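(* Let $X$ be an $\mathbb R^d$-valued Gaussian process on $[0,T]$ satisfying the standing assumptions listed in the context, with $H\in(1/4,1)$. Let $n\in\mathbb N$, $\gamma_1,\dots,\gamma_n\in\{1,\dots,d\}$ and $0\le s\le t\le T$. Then $$\mathbb E\big[\mathcal S(X)^{\gamma_1,\dots,\gamma_n}_{st}\big]=\sum_{P\in\mathcal P^n_0}P^{\gamma_1,\dots,\gamma_n}_{st}.$$
   Context: **Standing assumptions on $X$.** $X:\Omega\times[0,T]\to\mathbb R^d$ is the canonical process on $\Omega=C([0,T],\mathbb R^d)$ under a probability measure making it a centred continuous Gaussian process with $X_0=0$ and i.i.d. components. Write $X_{st}=X_t-X_s$, and let $R(s,t)=\mathbb E[X^1_sX^1_t]$ be the common scalar covariance function; $R^{\alpha\beta}=\mathbf 1_{\alpha=\beta}R$. The variance function is $R(t):=R(t,t)$, with derivative $R'(t)$. Put $R(\Delta(s,t),\Delta(u,v))=\mathbb E[X^1_{st}X^1_{uv}]$. It is assumed that: (i) $X$ admits a natural geometric rough path lift, obtained as the limit of the lifts of piecewise linear approximations of $X$ in $p$-variation for some $p\ge1$, and the Cameron–Martin space of $X$ embeds continuously in the continuous paths of finite $q$-variation for some $q$ with $1/p+1/q>1$; (ii) non-degeneracy: if $f:[0,T]\to\mathbb R^d$ is smooth and $\sum_\gamma\int_0^Tf^\gamma\,dh^\gamma=0$ for all $h$ in the Cameron–Martin space, then $f=0$; (iii) the sample paths are a.s. $H$-Hölder, or $K$-Hölder for all $K<H$; (iv) $R(\cdot,\cdot)$ is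 continuous on $[0,T]^2$ and $C^2$ on $\{0<s<t<T\}$, and $R(\cdot)$ is $C^1$ on $(0,T)$; (v) there is a constant $C$ with $|\partial_{12}R(s,t)|\le C(t-s)^{2H-2}$ for $0<s<t<T$; $|\tfrac12R'(t)-\partial_2R(s,t)|\le C|t-s|^{2H-1}$ for $s\in[0,T]$, $t\in(0,T)$, $s\ne t$ (the partial derivative existing there); $|R'(t)|\le Ct^{2H-1}$ for $t\in(0,T)$; and $R(\Delta(s,t),\Delta(s,t))\le C(t-s)^{2H}$ for $0\le s\le t\le T$. **Signature.** $\mathcal S(X)^{\gamma_1,\dots,\gamma_n}_{st}$ is the $L^2$-limit of the iterated Stieltjes integrals $\int_{s<u_1<\dots<u_n<t}dY^{\gamma_1}_{u_1}\cdots dY^{\gamma_n}_{u_n}$ of piecewise linear approximations $Y$ of $X$ along partitions with vanishing mesh ($=1$ for $n=0$). **Pairings and $P_{st}$.** $\mathcal P^n_0$ is the set of all partitions of $\{1,\dots,n\}$ into two-element sets (empty for $n$ odd; for $n=0$ it contains only the empty partition, whose associated value is $1$). A pair $\{i,j\}\in P$ is consecutive if $|i-j|=1$. Let $I_P$ be obtained from $\{1,\dots,n\}$ by removing the smaller element $h$ of each consecutive pair $\{h,h+1\}\in P$. With the convention $u_0:=s$, $$P^{\gamma_1,\dots,\gamma_n}_{st}=\int\prod_{\substack{\{i,j\}\in P\\ i<j,\ j-i>1}}\partial_{12}R^{\gamma_i\gamma_j}(u_i,u_j)\,du_i\,du_j\prod_{\{h,h+1\}\in P}\Big[\tfrac12(R^{\gamma_h\gamma_{h+1}})'(u_{h+1})-\partial_2R^{\gamma_h\gamma_{h+1}}(u_{h-1},u_{h+1})\Big]du_{h+1},$$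 a real number, where the (absolutely convergent) integral is over all $(u_i)_{i\in I_P}$ strictly increasing in $i$ with values in $(s,t)$. *)

theory Defs
  imports "HOL-Probability.Probability"
begin

subsection \<open>Partitions, piecewise linear interpolation, variation\<close>

definition is_partition :: "real \<Rightarrow> real list \<Rightarrow> bool" where
  "is_partition T D \<longleftrightarrow> D \<noteq> [] \<and> sorted_wrt (<) D \<and> hd D = 0 \<and> last D = T"

definition mesh :: "real list \<Rightarrow> real" where
  "mesh D = Max ((\<lambda>i. D ! Suc i - D ! i) ` {..<length D - 1})"

definition vanishing_mesh :: "real \<Rightarrow> real list filter" where
  "vanishing_mesh T = inf (filtercomap mesh (nhds 0)) (principal {D. is_partition T D})"

text \<open>At a partition point \<open>t\<close> one has \<open>a = b = t\<close>, and the quotient below is \<open>0 / 0 = 0\<close>.\<close>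

definition pl_interp :: "real list \<Rightarrow> (real \<Rightarrow> 'a::real_vector) \<Rightarrow> real \<Rightarrow> 'a" where
  "pl_interp D x t =
     (let a = Max {r \<in> set D. r \<le> t}; b = Min {r \<in> set D. t \<le> r}
      in x a + ((t - a) / (b - a)) *\<^sub>R (x b - x a))"

definition pvar :: "real \<Rightarrow> real \<Rightarrow> (real \<Rightarrow> real \<Rightarrow> real) \<Rightarrow> ennreal" where
  "pvar p T F =
     (SUP D \<in> {D. is_partition T D}.
        ennreal ((\<Sum>i<length D - 1. \<bar>F (D ! i) (D ! Suc i)\<bar> powr p) powr (1 / p)))"

definition holder_path :: "real \<Rightarrow> real \<Rightarrow> (real \<Rightarrow> 'a::real_normed_vector) \<Rightarrow> bool" where
  "holder_path K T x \<longleftrightarrow>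
     (\<exists>C. \<forall>s\<in>{0..T}. \<forall>t\<in>{0..T}. norm (x t - x s) \<le> C * \<bar>t - s\<bar> powr K)"


subsection \<open>Riemann--Stieltjes integrals and iterated integrals\<close>

definition has_RS_integral ::
  "(real \<Rightarrow> real) \<Rightarrow> (real \<Rightarrow> real) \<Rightarrow> real \<Rightarrow> real \<Rightarrow> real \<Rightarrow> bool" where
  "has_RS_integral f g a b I \<longleftrightarrow>
     (\<forall>\<epsilon>>0. \<exists>\<delta>>0. \<forall>p. p tagged_division_of {a..b} \<and> (\<lambda>x. ball x \<delta>) fine p \<longrightarrow>
        \<bar>(\<Sum>(x, K)\<in>p. f x * (g (Sup K) - g (Inf K))) - I\<bar> < \<epsilon>)"

definition RS_integral ::
  "(real \<Rightarrow> real) \<Rightarrow> (real \<Rightarrow> real) \<Rightarrow> real \<Rightarrow> real \<Rightarrow> real" where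
  "RS_integral f g a b = (THE I. has_RS_integral f g a b I)"

text \<open>
  \<open>iter_int Y \<gamma> s n t\<close> is the integral of \<open>dY\<^bsup>\<gamma> 1\<^esup>(u\<^sub>1) \<dots> dY\<^bsup>\<gamma> n\<^esup>(u\<^sub>n)\<close> over
  \<open>s < u\<^sub>1 < \<dots> < u\<^sub>n < t\<close>, with \<open>u\<^sub>n\<close> the outermost variable.
\<close>

primrec iter_int ::
  "(real \<Rightarrow> real ^ 'd) \<Rightarrow> (nat \<Rightarrow> 'd) \<Rightarrow> real \<Rightarrow> nat \<Rightarrow> real \<Rightarrow> real" where
  "iter_int Y \<gamma> s 0 = (\<lambda>t. 1)"
| "iter_int Y \<gamma> s (Suc n) = (\<lambda>t. RS_integral (iter_int Y \<gamma> s n) (\<lambda>u. Y u $ \<gamma> (Suc n)) s t)"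


subsection \<open>Partial derivatives\<close>

definition pd1 :: "(real \<Rightarrow> real \<Rightarrow> real) \<Rightarrow> real \<Rightarrow> real \<Rightarrow> real" where
  "pd1 f s t = deriv (\<lambda>x. f x t) s"

definition pd2 :: "(real \<Rightarrow> real \<Rightarrow> real) \<Rightarrow> real \<Rightarrow> real \<Rightarrow> real" where
  "pd2 f s t = deriv (\<lambda>y. f s y) t"

definition pd12 :: "(real \<Rightarrow> real \<Rightarrow> real) \<Rightarrow> real \<Rightarrow> real \<Rightarrow> real" where
  "pd12 f = pd1 (pd2 f)"

text \<open>The following two notions are meant for open \<open>U\<close>.\<close>

definition C1_on_plane :: "(real \<times> real) set \<Rightarrow> (real \<Rightarrow> real \<Rightarrow> real) \<Rightarrow> bool" where
  "C1_on_plane U f \<longleftrightarrow>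
     (\<forall>(s, t)\<in>U. (\<lambda>x. f x t) differentiable (at s) \<and> (\<lambda>y. f s y) differentiable (at t)) \<and>
     continuous_on U (\<lambda>(s, t). pd1 f s t) \<and> continuous_on U (\<lambda>(s, t). pd2 f s t)"

definition C2_on_plane :: "(real \<times> real) set \<Rightarrow> (real \<Rightarrow> real \<Rightarrow> real) \<Rightarrow> bool" where
  "C2_on_plane U f \<longleftrightarrow> C1_on_plane U f \<and> C1_on_plane U (pd1 f) \<and> C1_on_plane U (pd2 f)"

text \<open>Smoothness on the closed interval, with one-sided derivatives at the end points.\<close>

definition smooth_on_interval :: "real \<Rightarrow> (real \<Rightarrow> 'a::real_normed_vector) \<Rightarrow> bool" where
  "smooth_on_interval T f \<longleftrightarrow>
     (\<exists>F :: nat \<Rightarrow> real \<Rightarrow> 'a. F 0 = f \<and>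
        (\<forall>k. \<forall>t\<in>{0..T}. (F k has_vector_derivative F (Suc k) t) (at t within {0..T})))"


subsection \<open>The canonical Gaussian process\<close>

text \<open>
  Paths are represented by their extensional representatives on \<open>{0..T}\<close>; the trace of the product
  \<open>\<sigma>\<close>-algebra is generated by the evaluations, hence is the Borel \<open>\<sigma>\<close>-algebra of the uniform norm.
  The canonical process is \<open>X\<^sub>t \<omega> = \<omega> t\<close>.
\<close>

definition path_space :: "real \<Rightarrow> (real \<Rightarrow> real ^ 'd) measure" where
  "path_space T =
     restrict_space (PiM {0..T} (\<lambda>_. borel)) {\<omega>. continuous_on {0..T} \<omega>}"

definition centred_gaussian :: "'w measure \<Rightarrow> ('w \<Rightarrow> real) \<Rightarrow> bool" where
  "centred_gaussian M Z \<longleftrightarrow>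
     Z \<in> borel_measurable M \<and>
     ((AE \<omega> in M. Z \<omega> = 0) \<or>
      (\<exists>\<sigma>>0. distributed M lborel Z (\<lambda>x. ennreal (normal_density 0 \<sigma> x))))"

definition centred_gaussian_process :: "(real \<Rightarrow> real ^ 'd) measure \<Rightarrow> real \<Rightarrow> bool" where
  "centred_gaussian_process M T \<longleftrightarrow>
     (\<forall>J (a :: real \<Rightarrow> real ^ 'd). finite J \<and> J \<subseteq> {0..T} \<longrightarrow>
        centred_gaussian M (\<lambda>\<omega>. \<Sum>t\<in>J. a t \<bullet> \<omega> t))"

text \<open>The \<open>L\<^sup>2\<close>-closure of the linear span of the coordinates \<open>X\<^sup>\<alpha>\<^sub>t\<close>.\<close>

definition first_chaos ::
  "(real \<Rightarrow> real ^ 'd) measure \<Rightarrow> real \<Rightarrow> ((real \<Rightarrow> real ^ 'd) \<Rightarrow> real) set" where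
  "first_chaos M T =
     {Z \<in> borel_measurable M. \<forall>\<epsilon>>0. \<exists>J (a :: real \<Rightarrow> real ^ 'd). finite J \<and> J \<subseteq> {0..T} \<and>
        (\<integral>\<^sup>+\<omega>. ennreal ((Z \<omega> - (\<Sum>t\<in>J. a t \<bullet> \<omega> t))\<^sup>2) \<partial>M) < ennreal \<epsilon>}"

text \<open>
  The Cameron--Martin space consists of the paths \<open>t \<mapsto> E[Z X\<^sub>t]\<close>, \<open>Z\<close> in the first chaos, and the
  Cameron--Martin norm of such a path is the \<open>L\<^sup>2\<close>-norm of \<open>Z\<close>.
\<close>

definition cm_path ::
  "(real \<Rightarrow> real ^ 'd) measure \<Rightarrow> ((real \<Rightarrow> real ^ 'd) \<Rightarrow> real) \<Rightarrow> real \<Rightarrow> real ^ 'd" where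
  "cm_path M Z t = (\<chi> \<alpha>. LINT \<omega>|M. Z \<omega> * \<omega> t $ \<alpha>)"

definition cm_space ::
  "(real \<Rightarrow> real ^ 'd) measure \<Rightarrow> real \<Rightarrow> (real \<Rightarrow> real ^ 'd) set" where
  "cm_space M T = cm_path M ` first_chaos M T"

definition cm_embeds_qvar :: "(real \<Rightarrow> real ^ 'd) measure \<Rightarrow> real \<Rightarrow> real \<Rightarrow> bool" where
  "cm_embeds_qvar M T q \<longleftrightarrow>
     (\<exists>C. \<forall>Z\<in>first_chaos M T.
        continuous_on {0..T} (cm_path M Z) \<and>
        pvar q T (\<lambda>s t. norm (cm_path M Z t - cm_path M Z s))
          \<le> ennreal (C * sqrt (LINT \<omega>|M. (Z \<omega>)\<^sup>2)))"

text \<open>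
  \<open>XX k \<gamma> s t\<close> is the component along the word \<open>\<gamma> 1, \<dots>, \<gamma> k\<close> of level \<open>k\<close> of the lift. Convergence
  is in probability, in the (inhomogeneous) \<open>p\<close>-variation distance on levels \<open>1, \<dots>, \<lfloor>p\<rfloor>\<close>, written
  componentwise. A limit of this kind is almost surely a \<open>p\<close>-variation limit of lifts of piecewise
  linear paths (along a subsequence), i.e. a geometric rough path. Continuity of \<open>XX\<close> for every
  \<open>\<omega>\<close> makes the variation distances below measurable.
\<close>

definition natural_lift ::
  "(real \<Rightarrow> real ^ 'd) measure \<Rightarrow> real \<Rightarrow> real \<Rightarrow>
   (nat \<Rightarrow> (nat \<Rightarrow> 'd) \<Rightarrow> real \<Rightarrow> real \<Rightarrow> (real \<Rightarrow> real ^ 'd) \<Rightarrow> real) \<Rightarrow> bool" where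
  "natural_lift M T p XX \<longleftrightarrow>
     (\<forall>k\<in>{1..nat \<lfloor>p\<rfloor>}. \<forall>\<gamma>\<in>{1..k} \<rightarrow>\<^sub>E UNIV.
        (\<forall>s t. 0 \<le> s \<and> s \<le> t \<and> t \<le> T \<longrightarrow> XX k \<gamma> s t \<in> borel_measurable M) \<and>
        (\<forall>\<omega>\<in>space M. continuous_on {(s, t). 0 \<le> s \<and> s \<le> t \<and> t \<le> T} (\<lambda>(s, t). XX k \<gamma> s t \<omega>)) \<and>
        (\<forall>\<epsilon>>0. ((\<lambda>D. measure M {\<omega> \<in> space M.
              ennreal \<epsilon> < pvar (p / real k) T
                 (\<lambda>s t. iter_int (pl_interp D \<omega>) \<gamma> s k t - XX k \<gamma> s t \<omega>)})
            \<longlongrightarrow> 0) (vanishing_mesh T))) \<and>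
     (\<forall>\<gamma>\<in>{1..1} \<rightarrow>\<^sub>E UNIV. AE \<omega> in M. \<forall>s t. 0 \<le> s \<and> s \<le> t \<and> t \<le> T \<longrightarrow>
        XX 1 \<gamma> s t \<omega> = \<omega> t $ \<gamma> 1 - \<omega> s $ \<gamma> 1)"

definition nondegenerate :: "(real \<Rightarrow> real ^ 'd) measure \<Rightarrow> real \<Rightarrow> bool" where
  "nondegenerate M T \<longleftrightarrow>
     (\<forall>f :: real \<Rightarrow> real ^ 'd. smooth_on_interval T f \<and>
        (\<forall>h\<in>cm_space M T. (\<Sum>\<alpha>\<in>UNIV. RS_integral (\<lambda>u. f u $ \<alpha>) (\<lambda>u. h u $ \<alpha>) 0 T) = 0)
        \<longrightarrow> (\<forall>t\<in>{0..T}. f t = 0))"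

locale gaussian_setting = prob_space M
  for M :: "(real \<Rightarrow> real ^ 'd) measure" +
  fixes T H :: real and R :: "real \<Rightarrow> real \<Rightarrow> real"
  assumes T_pos: "0 < T"
    and canonical: "sets M = sets (path_space T)"
    and gaussian: "centred_gaussian_process M T"
    and start: "AE \<omega> in M. \<omega> 0 = 0"
    and components_indep:
      "indep_vars (\<lambda>_. PiM {0..T} (\<lambda>_. borel)) (\<lambda>\<alpha> \<omega>. \<lambda>t\<in>{0..T}. \<omega> t $ \<alpha>) (UNIV :: 'd set)"
    and components_ident:
      "\<And>\<alpha> \<beta>. distr M (PiM {0..T} (\<lambda>_. borel)) (\<lambda>\<omega>. \<lambda>t\<in>{0..T}. \<omega> t $ \<alpha>) =
              distr M (PiM {0..T} (\<lambda>_. borel)) (\<lambda>\<omega>. \<lambda>t\<in>{0..T}. \<omega> t $ \<beta>)"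
    and covariance:
      "\<And>\<alpha> s t. s \<in> {0..T} \<Longrightarrow> t \<in> {0..T} \<Longrightarrow> (LINT \<omega>|M. \<omega> s $ \<alpha> * \<omega> t $ \<alpha>) = R s t"
    and rough_lift:
      "\<exists>p\<ge>1. (\<exists>XX. natural_lift M T p XX) \<and> (\<exists>q\<ge>1. 1 / p + 1 / q > 1 \<and> cm_embeds_qvar M T q)"
    and nondegenerate: "nondegenerate M T"
    and holder:
      "(AE \<omega> in M. holder_path H T \<omega>) \<or> (\<forall>K. 0 < K \<and> K < H \<longrightarrow> (AE \<omega> in M. holder_path K T \<omega>))"
    and R_continuous: "continuous_on ({0..T} \<times> {0..T}) (\<lambda>(s, t). R s t)"
    and R_C2: "C2_on_plane {(s, t). 0 < s \<and> s < t \<and> t < T} R"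
    and variance_C1: "(\<lambda>t. R t t) C1_differentiable_on {0<..<T}"
    and pd2_exists:
      "\<And>s t. s \<in> {0..T} \<Longrightarrow> t \<in> {0<..<T} \<Longrightarrow> s \<noteq> t \<Longrightarrow> (\<lambda>v. R s v) differentiable (at t)"
    and bounds:
      "\<exists>C. (\<forall>s t. 0 < s \<and> s < t \<and> t < T \<longrightarrow> \<bar>pd12 R s t\<bar> \<le> C * (t - s) powr (2 * H - 2)) \<and>
           (\<forall>s\<in>{0..T}. \<forall>t\<in>{0<..<T}. s \<noteq> t \<longrightarrow>
              \<bar>1 / 2 * deriv (\<lambda>v. R v v) t - pd2 R s t\<bar> \<le> C * \<bar>t - s\<bar> powr (2 * H - 1)) \<and>
           (\<forall>t\<in>{0<..<T}. \<bar>deriv (\<lambda>v. R v v) t\<bar> \<le> C * t powr (2 * H - 1)) \<and>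
           (\<forall>s t \<alpha>. 0 \<le> s \<and> s \<le> t \<and> t \<le> T \<longrightarrow>
              (LINT \<omega>|M. (\<omega> t $ \<alpha> - \<omega> s $ \<alpha>) * (\<omega> t $ \<alpha> - \<omega> s $ \<alpha>)) \<le> C * (t - s) powr (2 * H))"



subsection \<open>Signature and pairings\<close>

definition is_signature ::
  "(real \<Rightarrow> real ^ 'd) measure \<Rightarrow> real \<Rightarrow> nat \<Rightarrow> (nat \<Rightarrow> 'd) \<Rightarrow> real \<Rightarrow> real \<Rightarrow>
   ((real \<Rightarrow> real ^ 'd) \<Rightarrow> real) \<Rightarrow> bool" where
  "is_signature M T n \<gamma> s t S \<longleftrightarrow>
     S \<in> borel_measurable M \<and> integrable M (\<lambda>\<omega>. (S \<omega>)\<^sup>2) \<and>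
     ((\<lambda>D. \<integral>\<^sup>+\<omega>. ennreal ((iter_int (pl_interp D \<omega>) \<gamma> s n t - S \<omega>)\<^sup>2) \<partial>M) \<longlongrightarrow> 0)
       (vanishing_mesh T)"

definition pairings :: "nat \<Rightarrow> nat set set set" where
  "pairings n = {P. partition_on {1..n} P \<and> (\<forall>B\<in>P. card B = 2)}"

definition kept_indices :: "nat \<Rightarrow> nat set set \<Rightarrow> nat set" where
  "kept_indices n P = {1..n} - {h. {h, Suc h} \<in> P}"

definition cov_matrix :: "(real \<Rightarrow> real \<Rightarrow> real) \<Rightarrow> 'd \<Rightarrow> 'd \<Rightarrow> real \<Rightarrow> real \<Rightarrow> real" where
  "cov_matrix R \<alpha> \<beta> s t = of_bool (\<alpha> = \<beta>) * R s t"

text \<open>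
  In the integrand \<open>u 0\<close> is read as \<open>s\<close>. If \<open>{h, h + 1} \<in> P\<close> then both \<open>h + 1\<close> and, for \<open>h > 1\<close>,
  \<open>h - 1\<close> are kept indices.
\<close>

definition pairing_integrand ::
  "(real \<Rightarrow> real \<Rightarrow> real) \<Rightarrow> (nat \<Rightarrow> 'd) \<Rightarrow> nat set set \<Rightarrow> (nat \<Rightarrow> real) \<Rightarrow> real" where
  "pairing_integrand R \<gamma> P u =
     (\<Prod>(i, j) \<in> {(i, j). {i, j} \<in> P \<and> i < j \<and> j - i > 1}.
        pd12 (cov_matrix R (\<gamma> i) (\<gamma> j)) (u i) (u j)) *
     (\<Prod>h \<in> {h. {h, Suc h} \<in> P}.
        1 / 2 * deriv (\<lambda>v. cov_matrix R (\<gamma> h) (\<gamma> (Suc h)) v v) (u (Suc h))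
        - pd2 (cov_matrix R (\<gamma> h) (\<gamma> (Suc h))) (u (h - 1)) (u (Suc h)))"

definition pairing_integral ::
  "(real \<Rightarrow> real \<Rightarrow> real) \<Rightarrow> nat \<Rightarrow> (nat \<Rightarrow> 'd) \<Rightarrow> real \<Rightarrow> real \<Rightarrow> nat set set \<Rightarrow> real" where
  "pairing_integral R n \<gamma> s t P =
     (LINT u : {u \<in> kept_indices n P \<rightarrow>\<^sub>E {s<..<t}. strict_mono_on (kept_indices n P) u}
        | PiM (kept_indices n P) (\<lambda>_. lborel).
        pairing_integrand R \<gamma> P (u(0 := s)))"

end

theory Submission
  imports Defs "HOL-Real_Asymp.Real_Asymp"
begin

text \<open>
  Lowering \<open>H\<close> one may assume \<open>1/4 < H < 1/2\<close>. For the interpolation of the path along the uniform grid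
  with \<open>N + 1\<close> cells on \<open>[s, t]\<close>, Wick's formula turns the expected iterated integral into a sum over
  pairings of integrals, over the simplex, of products of rectangular covariance increments
  \<open>rhoN N u v\<close>, which tend to \<open>pd12 R u v\<close> and are of order \<open>(v - u) powr (2 * H - 2)\<close>. This order is not
  integrable across a consecutive pair, so there the smaller variable is integrated out first; the
  result \<open>gN N a v\<close> is the drift of the limit formula up to \<open>o(1)\<close> and an oscillating term of size
  \<open>h powr (2 * H - 1)\<close> with mean zero on every cell. The oscillation is integrated against functions with
  Lipschitz constant of order \<open>h powr (2 * H - 1)\<close> at the mesh scale \<open>h\<close>, so it contributes
  \<open>h powr (4 * H - 1)\<close>, which vanishes as \<open>H > 1/4\<close>. Chains of consecutive pairs are therefore integrated
  out one after another, from the right, and dominated convergence applies to the remaining pairs.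
\<close>

section \<open>Wick's formula\<close>

text \<open>The signature is an \<open>L^2\<close> limit over all partitions of vanishing mesh, so a
  single convenient sequence decides its expectation. Equal cells are convenient because the
  covariance of two increments of equal length is controlled by the variance bound alone. Besides
  the oscillation there is a second obstacle. A pair that is not consecutive becomes a pair of
  neighbours once everything between its elements has been integrated out, as {1, 4} does around {2,
  3}; its factor of order \<open>2 * H - 2\<close> is then not integrable across the gap. So the
  inner chain has to keep its own size, the power \<open>2 * H\<close> of the gap, which is what the
  flags \<open>fl\<close> record. For the other pairs the singularity is shared between two gaps,
  with exponents \<alpha> and \<beta>, \<alpha> + \<beta> = 2 - 2H. No gap is used more than twice,
  and what is needed is \<alpha> < 1 and 2\<beta> < 1. Such numbers exist exactly when H > 1/4, the
  same threshold that makes 4H - 1 positive and 2 - 4H less than 1.\<close>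

definition pair_partitions :: "'a set \<Rightarrow> 'a set set set" where
  "pair_partitions A = {P. partition_on A P \<and> (\<forall>B\<in>P. card B = 2)}"

lemma finite_pair_partitions: "finite A \<Longrightarrow> finite (pair_partitions A)"
  by (rule finite_subset[of _ "Pow (Pow A)"]) (auto simp: pair_partitions_def partition_on_def)

lemma pair_partitions_empty: "pair_partitions {} = {{}}"
  by (auto simp: pair_partitions_def partition_on_def)

text \<open>The block of \<open>a\<close> is fixed by the partner \<open>b\<close>, and deleting it
  leaves a pairing of the rest. This recursion is why pairings of arbitrary sets are considered:
  removing \<open>b\<close> destroys the form \<open>{1..n}\<close>.\<close>

lemma pair_partitions_insert:
  assumes "a \<notin> A"
  shows "pair_partitions (insert a A) = (\<Union>b\<in>A. insert {a, b} ` pair_partitions (A - {b}))"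
proof (intro equalityI subsetI)
  fix P assume P: "P \<in> pair_partitions (insert a A)"
  then obtain B where B: "B \<in> P" "a \<in> B" and part: "partition_on (insert a A) P"
    and card2: "\<forall>B\<in>P. card B = 2"
    by (auto simp: pair_partitions_def partition_on_def)
  obtain b where b: "B = {a, b}" "a \<noteq> b"
  proof -
    obtain x y where "B = {x, y}" "x \<noteq> y" using B card2 by (meson card_2_iff)
    with B(2) that[of x] that[of y] show thesis by (auto simp: insert_commute)
  qed
  have "b \<in> A" using B b part by (auto simp: partition_on_def)
  have disj: "disjnt B (\<Union>(P - {B}))"
    using part B by (auto simp: partition_on_def disjoint_def disjnt_def)
  have "\<Union>(P - {B}) = insert a A - B"
  proof -
    have "\<Union>P = B \<union> \<Union>(P - {B})" using B(1) by blast
    then show ?thesis using part disj unfolding partition_on_def disjnt_def by blast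
  qed
  then have "P - {B} \<in> pair_partitions (A - {b})"
    using part card2 b assms by (auto simp: pair_partitions_def partition_on_def disjoint_def)
  then have "P \<in> insert {a, b} ` pair_partitions (A - {b})"
    using b B by (intro image_eqI[of _ _ "P - {B}"]) auto
  then show "P \<in> (\<Union>b\<in>A. insert {a, b} ` pair_partitions (A - {b}))"
    using \<open>b \<in> A\<close> by blast
next
  fix P assume "P \<in> (\<Union>b\<in>A. insert {a, b} ` pair_partitions (A - {b}))"
  then obtain b P' where b: "b \<in> A" and P': "P' \<in> pair_partitions (A - {b})" "P = insert {a, b} P'"
    by blast
  have ab: "a \<noteq> b" using b assms by auto
  have U: "\<Union>P' = A - {b}" using P' by (auto simp: pair_partitions_def partition_on_def)
  have "disjnt {a, b} X" if "X \<in> P'" for X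
    using U that assms by (auto simp: disjnt_def)
  then show "P \<in> pair_partitions (insert a A)"
    using P' U b ab unfolding pair_partitions_def partition_on_def
    by (auto simp: disjoint_def disjnt_def)
qed

text \<open>Each of the \<open>card A - 1\<close> possible partners of one element leaves a set with
  two elements fewer. The closed form is that of the even moments of the standard normal law, and
  this coincidence is what ties pairings to Gaussian moments in \<open>wick\<close>.\<close>

lemma card_pair_partitions:
  "finite A \<Longrightarrow> real (card (pair_partitions A)) =
     (if even (card A) then fact (card A) / (2 ^ (card A div 2) * fact (card A div 2)) else 0)"
proof (induction "card A" arbitrary: A rule: less_induct)
  case less
  show ?case
  proof (cases "A = {}")
    case True
    then show ?thesis by (simp add: pair_partitions_empty)
  next
    case False
    then obtain a A' where A: "A = insert a A'" "a \<notin> A'" by (meson Set.set_insert all_not_in_conv)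
    then have fin: "finite A'" using less by auto
    define c :: real where "c = (if odd (card A') then
        fact (card A' - 1) / (2 ^ ((card A' - 1) div 2) * fact ((card A' - 1) div 2)) else 0)"
    have IH: "real (card (pair_partitions (A' - {b}))) = c" if "b \<in> A'" for b
    proof -
      have "card (A' - {b}) < card A" using A fin
        by (simp add: card_Diff_singleton_if less_Suc_eq_le)
      moreover have "card A' > 0" using fin that card_gt_0_iff by blast
      ultimately show ?thesis
        using less.hyps[of "A' - {b}"] fin that by (auto simp: c_def card_Diff_singleton)
    qed
    have inj: "inj_on (insert {a, b}) (pair_partitions (A' - {b}))" if "b \<in> A'" for b
    proof (rule inj_onI)
      fix P Q assume "P \<in> pair_partitions (A' - {b})" "Q \<in> pair_partitions (A' - {b})"
        "insert {a, b} P = insert {a, b} Q"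
      moreover from this(1,2) have "{a, b} \<notin> P" "{a, b} \<notin> Q"
        using A by (auto simp: pair_partitions_def partition_on_def)
      ultimately show "P = Q" by (metis insert_ident)
    qed
    have disj: "insert {a, b} ` pair_partitions (A' - {b}) \<inter>
       insert {a, b'} ` pair_partitions (A' - {b'}) = {}" if "b \<in> A'" "b' \<in> A'" "b \<noteq> b'" for b b'
    proof (rule ccontr)
      assume "\<not> ?thesis"
      then obtain P P' where P: "P \<in> pair_partitions (A' - {b})" "insert {a, b} P = insert {a, b'} P'"
        by blast
      then have "{a, b'} \<in> insert {a, b} P" by simp
      moreover have "{a, b'} \<noteq> {a, b}" using that A by (auto simp: doubleton_eq_iff)
      ultimately have "{a, b'} \<in> P" by simp
      then show False using P(1) A by (auto simp: pair_partitions_def partition_on_def)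
    qed
    have "card (pair_partitions A) = (\<Sum>b\<in>A'. card (insert {a, b} ` pair_partitions (A' - {b})))"
      unfolding A(1) pair_partitions_insert[OF A(2)]
      using fin disj by (intro card_UN_disjoint) (auto intro!: finite_pair_partitions)
    also have "\<dots> = (\<Sum>b\<in>A'. card (pair_partitions (A' - {b})))"
      using inj by (intro sum.cong refl card_image) auto
    finally have eq: "real (card (pair_partitions A)) = card A' * c"
      using IH by simp
    show ?thesis
    proof (cases "odd (card A')")
      case True
      then obtain m where m: "card A' = Suc (2 * m)" by (auto elim: oddE)
      have "card A = Suc (Suc (2 * m))" using A fin m by simp
      then show ?thesis
        unfolding eq c_def using m by (simp add: field_simps del: of_nat_Suc) (simp add: field_simps)
    next
      case False
      then show ?thesis unfolding eq c_def using A fin by simp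
    qed
  qed
qed

lemma pair_partitions_card_eq:
  assumes "finite A" "P \<in> pair_partitions A"
  shows "card A = 2 * card P"
proof -
  have "card (\<Union>P) = sum card P"
    using assms
    by (intro card_Union_disjoint)
       (auto simp: pair_partitions_def partition_on_def disjoint_def pairwise_def disjnt_def
             intro: finite_subset)
  also have "\<dots> = 2 * card P" using assms by (simp add: pair_partitions_def)
  finally show ?thesis using assms by (simp add: pair_partitions_def partition_on_def)
qed

text \<open>The coefficient is written exactly as in \<open>card_pair_partitions\<close>. A variable
  that vanishes almost surely obeys the same formula, both sides being 0 for positive
  \<open>k\<close>.\<close>

lemma centred_gaussian_power:
  assumes "prob_space M" "centred_gaussian M Y"
  shows "integrable M (\<lambda>\<omega>. Y \<omega> ^ k)"
    and "(LINT \<omega>|M. Y \<omega> ^ k) =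
      (if even k then fact k / (2 ^ (k div 2) * fact (k div 2)) else 0) *
        (LINT \<omega>|M. (Y \<omega>)\<^sup>2) ^ (k div 2)"
proof -
  interpret prob_space M by fact
  have [measurable]: "Y \<in> borel_measurable M" using assms(2) by (simp add: centred_gaussian_def)
  consider "AE \<omega> in M. Y \<omega> = 0" |
    \<sigma> where "\<sigma> > 0" "distributed M lborel Y (\<lambda>x. ennreal (normal_density 0 \<sigma> x))"
    using assms(2) by (auto simp: centred_gaussian_def)
  then have "integrable M (\<lambda>\<omega>. Y \<omega> ^ k) \<and> (LINT \<omega>|M. Y \<omega> ^ k) =
      (if even k then fact k / (2 ^ (k div 2) * fact (k div 2)) else 0) *
        (LINT \<omega>|M. (Y \<omega>)\<^sup>2) ^ (k div 2)"
  proof cases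
    case 1
    have z: "AE \<omega> in M. Y \<omega> ^ j = 0 ^ j" for j using 1 by eventually_elim simp
    have "integrable M (\<lambda>\<omega>. Y \<omega> ^ k) = integrable M (\<lambda>\<omega>. 0 ^ k :: real)"
      using z[of k] by (intro integrable_cong_AE) auto
    then have int: "integrable M (\<lambda>\<omega>. Y \<omega> ^ k)" by simp
    have v: "(LINT \<omega>|M. Y \<omega> ^ j) = 0 ^ j" for j
    proof -
      have "(LINT \<omega>|M. Y \<omega> ^ j) = (LINT \<omega>|M. 0 ^ j)"
        using z[of j] by (intro integral_cong_AE) auto
      then show ?thesis by (simp add: prob_space)
    qed
    show ?thesis
    proof (cases "k = 0")
      case False
      show ?thesis
      proof (cases "even k")
        case True
        then have "k div 2 \<noteq> 0" using False by auto
        then show ?thesis using int False v[of 2] by (simp add: v zero_power)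
      qed (use False int in \<open>simp add: v zero_power\<close>)
    qed (use int prob_space in \<open>simp add: v\<close>)
  next
    case 2
    note d = 2(2)
    have "integrable lborel (\<lambda>x. normal_density 0 \<sigma> x * (x - 0) ^ k)"
      using 2(1) by (rule integrable_normal_moment)
    then have int: "integrable M (\<lambda>\<omega>. Y \<omega> ^ k)"
      by (subst distributed_integrable[OF d, of "\<lambda>x. x ^ k", symmetric]) simp_all
    have v: "(LINT \<omega>|M. Y \<omega> ^ j) = (LINT x|lborel. normal_density 0 \<sigma> x * (x - 0) ^ j)" for j
      by (subst distributed_integral[OF d, of "\<lambda>x. x ^ j", symmetric]) simp_all
    have v2: "(LINT \<omega>|M. (Y \<omega>)\<^sup>2) = \<sigma>\<^sup>2"
      unfolding v using integral_normal_moment_even[OF 2(1), of 0 1] by (simp add: fact_numeral)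
    show ?thesis
    proof (cases "even k")
      case True
      then obtain m where m: "k = 2 * m" by (auto elim: evenE)
      show ?thesis using int unfolding v2 v m
        using integral_normal_moment_even[OF 2(1), of 0 m] by (simp add: field_simps power_divide)
    next
      case False
      then obtain m where m: "k = 2 * m + 1" by (auto elim: oddE)
      show ?thesis using int unfolding v2 v m
        using integral_normal_moment_odd[OF 2(1), of 0 m] by simp
    qed
  qed
  then show "integrable M (\<lambda>\<omega>. Y \<omega> ^ k)"
    and "(LINT \<omega>|M. Y \<omega> ^ k) =
      (if even k then fact k / (2 ^ (k div 2) * fact (k div 2)) else 0) *
        (LINT \<omega>|M. (Y \<omega>)\<^sup>2) ^ (k div 2)" by auto
qed

text \<open>Inclusion-exclusion over the image of \<open>f\<close>: the signs cancel unless the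
  image is all of \<open>A\<close>, and a surjection of a finite set onto itself is a bijection.
  With \<Psi> a product this is the polarisation identity.\<close>

lemma sum_PiE_inclusion_exclusion:
  fixes \<Psi> :: "('a \<Rightarrow> 'a) \<Rightarrow> real"
  assumes "finite A"
  shows "(\<Sum>S\<in>Pow A. (- 1) ^ (card A + card S) * (\<Sum>f\<in>A \<rightarrow>\<^sub>E S. \<Psi> f)) =
    (\<Sum>f\<in>{f \<in> A \<rightarrow>\<^sub>E A. bij_betw f A A}. \<Psi> f)"
proof -
  have finA: "finite (A \<rightarrow>\<^sub>E A)" using assms by (intro finite_PiE) auto
  \<comment> \<open>An alternating sum over all sets between \<open>B\<close> and \<open>A\<close>;
    it vanishes as soon as there is a free element.\<close>
  have alt: "(\<Sum>S\<in>Pow A. if B \<subseteq> S then (- 1) ^ (card A + card S) else 0) = (of_bool (B = A) :: real)"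
    if "B \<subseteq> A" for B
  proof (cases "B = A")
    case True
    have "(\<Sum>S\<in>Pow A. if A \<subseteq> S then (- 1) ^ (card A + card S) else 0 :: real) =
        (\<Sum>S\<in>{A}. (- 1) ^ (card A + card S))"
      using assms by (intro sum.mono_neutral_cong_right) auto
    then show ?thesis using True by (simp flip: mult_2)
  next
    case False
    have "(\<Sum>S\<in>Pow A. if B \<subseteq> S then (- 1) ^ (card A + card S) else 0 :: real) =
       (\<Sum>S | S \<subseteq> A \<and> B \<subseteq> S. (- 1) ^ (card A + card S))"
      using assms by (intro sum.mono_neutral_cong_right) auto
    also have "\<dots> = (- 1) ^ card A * (\<Sum>S | S \<subseteq> A \<and> B \<subseteq> S. (- 1) ^ card S)"
      by (simp add: power_add sum_distrib_left)
    also have "(\<Sum>S | S \<subseteq> A \<and> B \<subseteq> S. (- 1) ^ card S) = (0::real)"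
      using card_subsupersets_even_odd[of A B] assms that False
      by (intro sum_alternating_cancels) (auto simp: Collect_conj_eq conj_ac psubset_eq)
    finally show ?thesis using False by simp
  qed
  have "(\<Sum>S\<in>Pow A. (- 1) ^ (card A + card S) * (\<Sum>f\<in>A \<rightarrow>\<^sub>E S. \<Psi> f)) =
     (\<Sum>S\<in>Pow A. \<Sum>f\<in>A \<rightarrow>\<^sub>E A. (if f ` A \<subseteq> S then (- 1) ^ (card A + card S) else 0) * \<Psi> f)"
    unfolding sum_distrib_left
  proof (rule sum.cong[OF refl], rule sum.mono_neutral_cong_left)
    fix S assume S: "S \<in> Pow A"
    show "finite (A \<rightarrow>\<^sub>E A)" by (rule finA)
    show "(A \<rightarrow>\<^sub>E S) \<subseteq> (A \<rightarrow>\<^sub>E A)" using S by (intro PiE_mono) auto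
    show "\<forall>f\<in>(A \<rightarrow>\<^sub>E A) - (A \<rightarrow>\<^sub>E S). (if f ` A \<subseteq> S then (- 1) ^ (card A + card S) else 0) * \<Psi> f = 0"
      by (auto simp: PiE_iff)
    show "(- 1) ^ (card A + card S) * \<Psi> f = (if f ` A \<subseteq> S then (- 1) ^ (card A + card S) else 0) * \<Psi> f"
      if "f \<in> A \<rightarrow>\<^sub>E S" for f
    proof -
      have "f ` A \<subseteq> S" using that by (auto simp: PiE_iff)
      then show ?thesis by simp
    qed
  qed
  also have "\<dots> = (\<Sum>f\<in>A \<rightarrow>\<^sub>E A. \<Sum>S\<in>Pow A. (if f ` A \<subseteq> S then (- 1) ^ (card A + card S) else 0) * \<Psi> f)"
    by (rule sum.swap)
  also have "\<dots> = (\<Sum>f\<in>A \<rightarrow>\<^sub>E A. of_bool (f ` A = A) * \<Psi> f)"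
  proof (intro sum.cong refl)
    fix f assume "f \<in> A \<rightarrow>\<^sub>E A"
    then have "f ` A \<subseteq> A" by auto
    then show "(\<Sum>S\<in>Pow A. (if f ` A \<subseteq> S then (- 1) ^ (card A + card S) else 0) * \<Psi> f) =
        of_bool (f ` A = A) * \<Psi> f"
      using alt[of "f ` A"] by (simp only: sum_distrib_right[symmetric])
  qed
  also have "\<dots> = (\<Sum>f\<in>{f \<in> A \<rightarrow>\<^sub>E A. bij_betw f A A}. \<Psi> f)"
  proof (intro sum.mono_neutral_cong_right ballI)
    have iff: "bij_betw f A A \<longleftrightarrow> f ` A = A" for f
      using eq_card_imp_inj_on[OF assms, of f] unfolding bij_betw_def by force
    show "of_bool (f ` A = A) * \<Psi> f = 0" if "f \<in> (A \<rightarrow>\<^sub>E A) - {f \<in> A \<rightarrow>\<^sub>E A. bij_betw f A A}" for f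
      using that iff[of f] by simp
    show "of_bool (f ` A = A) * \<Psi> f = \<Psi> f" if "f \<in> {f \<in> A \<rightarrow>\<^sub>E A. bij_betw f A A}" for f
      using that iff[of f] by simp
  qed (use finA in auto)
  finally show ?thesis .
qed

text \<open>Maps chosen separately on the blocks glue to one map on \<open>A\<close>. The assumption
  \<open>cong\<close> says that \<open>c f B\<close> sees only the restriction of \<open>f\<close>
  to \<open>B\<close>, so gluing does not change it.\<close>

lemma prod_sum_PiE_partition:
  fixes c :: "('a \<Rightarrow> 'b) \<Rightarrow> 'a set \<Rightarrow> real"
  assumes "finite A" "partition_on A P" "finite S"
    and cong: "\<And>f g B. B \<in> P \<Longrightarrow> (\<And>x. x \<in> B \<Longrightarrow> f x = g x) \<Longrightarrow> c f B = c g B"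
  shows "(\<Prod>B\<in>P. \<Sum>g\<in>B \<rightarrow>\<^sub>E S. c g B) = (\<Sum>f\<in>A \<rightarrow>\<^sub>E S. \<Prod>B\<in>P. c f B)"
proof -
  have finP: "finite P"
    using assms by (intro finite_subset[of P "Pow A"]) (auto simp: partition_on_def)
  have sub: "B \<subseteq> A" if "B \<in> P" for B using that assms by (auto simp: partition_on_def)
  have the: "(THE B. B \<in> P \<and> x \<in> B) = B" if "B \<in> P" "x \<in> B" for x B
    using assms(2) that by (intro the_equality) (auto simp: partition_on_def disjoint_def)
  have ex: "\<exists>B\<in>P. x \<in> B" if "x \<in> A" for x using that assms by (auto simp: partition_on_def)
  have "(\<Prod>B\<in>P. \<Sum>g\<in>B \<rightarrow>\<^sub>E S. c g B) = (\<Sum>G\<in>Pi\<^sub>E P (\<lambda>B. B \<rightarrow>\<^sub>E S). \<Prod>B\<in>P. c (G B) B)"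
    using finP assms(1,3) finite_subset[OF sub assms(1)] by (intro prod_sum_PiE finite_PiE) auto
  also have "\<dots> = (\<Sum>f\<in>A \<rightarrow>\<^sub>E S. \<Prod>B\<in>P. c f B)"
  proof (rule sum.reindex_bij_witness[where
        i = "\<lambda>f. \<lambda>B\<in>P. restrict f B" and j = "\<lambda>G. \<lambda>x\<in>A. G (THE B. B \<in> P \<and> x \<in> B) x"])
    fix G assume G: "G \<in> Pi\<^sub>E P (\<lambda>B. B \<rightarrow>\<^sub>E S)"
    have val: "(\<lambda>x\<in>A. G (THE B. B \<in> P \<and> x \<in> B) x) x = G B x" if "B \<in> P" "x \<in> B" for B x
      using that the sub by auto
    show "(\<lambda>B\<in>P. restrict (\<lambda>x\<in>A. G (THE B. B \<in> P \<and> x \<in> B) x) B) = G"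
    proof (rule ext)
      fix B show "(\<lambda>B\<in>P. restrict (\<lambda>x\<in>A. G (THE B. B \<in> P \<and> x \<in> B) x) B) B = G B"
      proof (cases "B \<in> P")
        case True
        then have "G B \<in> B \<rightarrow>\<^sub>E S" using G by auto
        then show ?thesis
          using True val[OF True] by (auto simp: fun_eq_iff restrict_def PiE_def extensional_def)
      qed (use G in \<open>auto simp: PiE_def extensional_def\<close>)
    qed
    show "(\<lambda>x\<in>A. G (THE B. B \<in> P \<and> x \<in> B) x) \<in> A \<rightarrow>\<^sub>E S"
    proof (intro PiE_I)
      fix x assume "x \<in> A"
      then obtain B where "B \<in> P" "x \<in> B" using ex by auto
      then show "(\<lambda>x\<in>A. G (THE B. B \<in> P \<and> x \<in> B) x) x \<in> S"
        using val G by (auto simp: PiE_def Pi_def)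
    qed auto
    show "(\<Prod>B\<in>P. c (\<lambda>x\<in>A. G (THE B. B \<in> P \<and> x \<in> B) x) B) = (\<Prod>B\<in>P. c (G B) B)"
      using val by (intro prod.cong refl cong) auto
  next
    fix f assume f: "f \<in> A \<rightarrow>\<^sub>E S"
    show "(\<lambda>B\<in>P. restrict f B) \<in> Pi\<^sub>E P (\<lambda>B. B \<rightarrow>\<^sub>E S)"
      using f sub by (auto simp: PiE_def Pi_def)
    show "(\<lambda>x\<in>A. (\<lambda>B\<in>P. restrict f B) (THE B. B \<in> P \<and> x \<in> B) x) = f"
    proof (rule ext)
      fix x show "(\<lambda>x\<in>A. (\<lambda>B\<in>P. restrict f B) (THE B. B \<in> P \<and> x \<in> B) x) x = f x"
      proof (cases "x \<in> A")
        case True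
        then obtain B where "B \<in> P" "x \<in> B" using ex by auto
        then show ?thesis using True the by auto
      qed (use f in \<open>auto simp: PiE_def extensional_def\<close>)
    qed
  qed
  finally show ?thesis .
qed

text \<open>Taking images under \<open>f\<close> maps the finite set of pairings injectively into
  itself, hence permutes it.\<close>

lemma sum_pair_partitions_image:
  assumes "finite A" "bij_betw f A A"
  shows "(\<Sum>P\<in>pair_partitions A. \<Prod>B\<in>P. c (f ` B)) = (\<Sum>P\<in>pair_partitions A. \<Prod>B\<in>P. (c B :: real))"
proof -
  have inj: "inj_on f A" and im: "f ` A = A" using assms by (auto simp: bij_betw_def)
  have inj2: "inj_on ((`) f) (Pow A)" using inj by (rule inj_on_image_Pow)
  have pp: "(`) f ` P \<in> pair_partitions A" if "P \<in> pair_partitions A" for P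
  proof -
    have P: "\<Union>P = A" "disjoint P" "{} \<notin> P" "\<And>B. B \<in> P \<Longrightarrow> card B = 2"
      using that by (auto simp: pair_partitions_def partition_on_def)
    have "f ` B \<inter> f ` B' = {}" if "B \<in> P" "B' \<in> P" "f ` B \<noteq> f ` B'" for B B'
    proof -
      have "B \<noteq> B'" using that by blast
      then have "B \<inter> B' = {}" using that(1,2) P(2) unfolding disjoint_def by blast
      moreover have "B \<subseteq> A" "B' \<subseteq> A" using that(1,2) P(1) by blast+
      ultimately show ?thesis using inj_on_image_Int[OF inj, of B B'] by simp
    qed
    moreover have "card (f ` B) = 2" if "B \<in> P" for B
      using P that inj by (subst card_image) (auto intro: inj_on_subset)
    moreover have "\<Union>((`) f ` P) = A" using im P(1) by (metis image_Union)
    ultimately show ?thesis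
      using P(3) unfolding pair_partitions_def partition_on_def disjoint_def by auto
  qed
  have inj3: "inj_on ((`) ((`) f)) (pair_partitions A)"
    by (rule inj_on_subset[OF inj_on_image_Pow[OF inj2]])
       (auto simp: pair_partitions_def partition_on_def)
  have im3: "(`) ((`) f) ` pair_partitions A = pair_partitions A"
    using pp inj3 finite_pair_partitions[OF assms(1)] by (intro endo_inj_surj) auto
  have "(\<Sum>P\<in>pair_partitions A. \<Prod>B\<in>P. c B) = (\<Sum>P\<in>pair_partitions A. \<Prod>B\<in>(`) f ` P. c B)"
    by (subst im3[symmetric], subst sum.reindex[OF inj3]) simp
  also have "\<dots> = (\<Sum>P\<in>pair_partitions A. \<Prod>B\<in>P. c (f ` B))"
  proof (intro sum.cong refl)
    fix P assume "P \<in> pair_partitions A"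
    then have "inj_on ((`) f) P"
      by (intro inj_on_subset[OF inj2]) (auto simp: pair_partitions_def partition_on_def)
    then show "(\<Prod>B\<in>(`) f ` P. c B) = (\<Prod>B\<in>P. c (f ` B))" by (subst prod.reindex) auto
  qed
  finally show ?thesis ..
qed

text \<open>Polarisation: the product of the \<open>Z i\<close> is, up to the number of bijections,
  an alternating sum of powers of the partial sums over \<open>S\<close>. Those sums are Gaussian,
  so their moments are known, and the same alternating sum applied to the moments keeps only the
  permutations, over which the sum over pairings is constant.\<close>

theorem wick:
  fixes Z :: "'i \<Rightarrow> 'w \<Rightarrow> real"
  assumes "prob_space M" "finite A"
    and gauss: "\<And>a. centred_gaussian M (\<lambda>\<omega>. \<Sum>i\<in>A. a i * Z i \<omega>)"
  shows "integrable M (\<lambda>\<omega>. \<Prod>i\<in>A. Z i \<omega>)"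
    and "(LINT \<omega>|M. (\<Prod>i\<in>A. Z i \<omega>)) = (\<Sum>P\<in>pair_partitions A. \<Prod>B\<in>P. (LINT \<omega>|M. (\<Prod>i\<in>B. Z i \<omega>)))"
proof -
  interpret prob_space M by fact
  define n where "n = card A"
  \<comment> \<open>The factorial of \<open>n\<close>; it occurs on both sides and is cancelled, for
    which positivity is enough.\<close>
  define K :: real where "K = card {f \<in> A \<rightarrow>\<^sub>E A. bij_betw f A A}"
  have "(\<lambda>x\<in>A. x) \<in> {f \<in> A \<rightarrow>\<^sub>E A. bij_betw f A A}" by (auto simp: bij_betw_def inj_on_def)
  moreover have fin_bij: "finite {f \<in> A \<rightarrow>\<^sub>E A. bij_betw f A A}"
    using assms(2) by (intro finite_Collect_conjI disjI1) (simp add: finite_PiE)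
  ultimately have "0 < card {f \<in> A \<rightarrow>\<^sub>E A. bij_betw f A A}" unfolding card_gt_0_iff by blast
  then have K: "K > 0" unfolding K_def by simp
  have gS: "centred_gaussian M (\<lambda>\<omega>. \<Sum>i\<in>S. Z i \<omega>)" if "S \<subseteq> A" for S
  proof -
    have "(\<lambda>\<omega>. \<Sum>i\<in>S. Z i \<omega>) = (\<lambda>\<omega>. \<Sum>i\<in>A. of_bool (i \<in> S) * Z i \<omega>)"
      using that assms(2) by (auto intro!: sum.mono_neutral_cong_left)
    then show ?thesis using gauss[of "\<lambda>i. of_bool (i \<in> S)"] by simp
  qed
  have gZ: "centred_gaussian M (Z i)" if "i \<in> A" for i
    using gS[of "{i}"] that by simp
  have [measurable]: "Z i \<in> borel_measurable M" if "i \<in> A" for i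
    using gZ[OF that] by (simp add: centred_gaussian_def)
  have int2: "integrable M (\<lambda>\<omega>. Z i \<omega> * Z j \<omega>)" if "i \<in> A" "j \<in> A" for i j
  proof (rule Bochner_Integration.integrable_bound)
    show "integrable M (\<lambda>\<omega>. (Z i \<omega>)\<^sup>2 + (Z j \<omega>)\<^sup>2)"
      using that assms(1) by (intro Bochner_Integration.integrable_add centred_gaussian_power gZ)
    show "AE \<omega> in M. norm (Z i \<omega> * Z j \<omega>) \<le> norm ((Z i \<omega>)\<^sup>2 + (Z j \<omega>)\<^sup>2)"
    proof (rule AE_I2)
      fix \<omega>
      have "2 * (\<bar>Z i \<omega>\<bar> * \<bar>Z j \<omega>\<bar>) \<le> (Z i \<omega>)\<^sup>2 + (Z j \<omega>)\<^sup>2"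
        using sum_squares_bound[of "\<bar>Z i \<omega>\<bar>" "\<bar>Z j \<omega>\<bar>"] by simp
      moreover have "\<bar>Z i \<omega>\<bar> * \<bar>Z j \<omega>\<bar> \<ge> 0" by simp
      ultimately have "\<bar>Z i \<omega>\<bar> * \<bar>Z j \<omega>\<bar> \<le> (Z i \<omega>)\<^sup>2 + (Z j \<omega>)\<^sup>2" by linarith
      then show "norm (Z i \<omega> * Z j \<omega>) \<le> norm ((Z i \<omega>)\<^sup>2 + (Z j \<omega>)\<^sup>2)"
        by (simp add: abs_mult)
    qed
  qed (use that in measurable)
  define c :: "('i \<Rightarrow> 'i) \<Rightarrow> 'i set \<Rightarrow> real" where "c = (\<lambda>f B. LINT \<omega>|M. (\<Prod>x\<in>B. Z (f x) \<omega>))"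
  have pw: "(\<Sum>i\<in>S. Z i \<omega>) ^ card B = (\<Sum>f\<in>B \<rightarrow>\<^sub>E S. \<Prod>x\<in>B. Z (f x) \<omega>)"
    if "S \<subseteq> A" "finite B" for S \<omega> and B :: "'i set"
  proof -
    have "(\<Sum>i\<in>S. Z i \<omega>) ^ card B = (\<Prod>x\<in>B. \<Sum>i\<in>S. Z i \<omega>)" by simp
    also have "\<dots> = (\<Sum>f\<in>B \<rightarrow>\<^sub>E S. \<Prod>x\<in>B. Z (f x) \<omega>)"
      using that assms(2) by (intro prod_sum_PiE) (auto intro: finite_subset)
    finally show ?thesis .
  qed
  have polar: "(\<Sum>S\<in>Pow A. (- 1) ^ (card A + card S) * (\<Sum>i\<in>S. Z i \<omega>) ^ n) = K * (\<Prod>i\<in>A. Z i \<omega>)" for \<omega>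
  proof -
    have "(\<Sum>S\<in>Pow A. (- 1) ^ (card A + card S) * (\<Sum>i\<in>S. Z i \<omega>) ^ n) =
      (\<Sum>S\<in>Pow A. (- 1) ^ (card A + card S) * (\<Sum>f\<in>A \<rightarrow>\<^sub>E S. \<Prod>x\<in>A. Z (f x) \<omega>))"
      using assms(2) by (intro sum.cong refl) (simp add: n_def pw)
    also have "\<dots> = (\<Sum>f\<in>{f \<in> A \<rightarrow>\<^sub>E A. bij_betw f A A}. \<Prod>x\<in>A. Z (f x) \<omega>)"
      by (rule sum_PiE_inclusion_exclusion[OF assms(2)])
    also have "\<dots> = (\<Sum>f\<in>{f \<in> A \<rightarrow>\<^sub>E A. bij_betw f A A}. \<Prod>x\<in>A. Z x \<omega>)"
      by (intro sum.cong refl) (auto intro: prod.reindex_bij_betw)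
    finally show ?thesis by (simp add: K_def)
  qed
  have intS: "integrable M (\<lambda>\<omega>. \<Sum>S\<in>Pow A. (- 1) ^ (card A + card S) * (\<Sum>i\<in>S. Z i \<omega>) ^ n)"
    using gS centred_gaussian_power(1)[OF assms(1)]
    by (intro Bochner_Integration.integrable_sum integrable_mult_right) auto
  have "integrable M (\<lambda>\<omega>. K * (\<Prod>i\<in>A. Z i \<omega>))" using intS unfolding polar .
  then show "integrable M (\<lambda>\<omega>. \<Prod>i\<in>A. Z i \<omega>)" using K by simp
  \<comment> \<open>The moment is the number of pairings times a power of one variance. Spreading
    that power over the blocks of each pairing makes it multilinear in the covariances, the form on
    which the alternating sum over \<open>S\<close> can act.\<close>
  have second: "(LINT \<omega>|M. (\<Sum>i\<in>S. Z i \<omega>) ^ n) =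
      (\<Sum>P\<in>pair_partitions A. \<Sum>f\<in>A \<rightarrow>\<^sub>E S. \<Prod>B\<in>P. c f B)" if "S \<subseteq> A" for S
  proof -
    have cB: "(LINT \<omega>|M. (\<Sum>i\<in>S. Z i \<omega>)\<^sup>2) = (\<Sum>g\<in>B \<rightarrow>\<^sub>E S. c g B)" if B: "card B = 2" for B :: "'i set"
    proof -
      obtain i j where ij: "B = {i, j}" "i \<noteq> j" using B by (auto simp: card_2_iff)
      have fin: "finite B" unfolding ij by simp
      have "(LINT \<omega>|M. (\<Sum>i\<in>S. Z i \<omega>)\<^sup>2) = (LINT \<omega>|M. (\<Sum>f\<in>B \<rightarrow>\<^sub>E S. \<Prod>x\<in>B. Z (f x) \<omega>))"
        using pw[OF \<open>S \<subseteq> A\<close> fin] B by simp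
      also have "\<dots> = (\<Sum>f\<in>B \<rightarrow>\<^sub>E S. c f B)"
        unfolding c_def
      proof (intro Bochner_Integration.integral_sum)
        fix f assume "f \<in> B \<rightarrow>\<^sub>E S"
        then have "f i \<in> A" "f j \<in> A" using \<open>S \<subseteq> A\<close> by (auto simp: ij)
        then show "integrable M (\<lambda>\<omega>. \<Prod>x\<in>B. Z (f x) \<omega>)" using int2 ij by simp
      qed
      finally show ?thesis .
    qed
    have "(LINT \<omega>|M. (\<Sum>i\<in>S. Z i \<omega>) ^ n) =
       real (card (pair_partitions A)) * (LINT \<omega>|M. (\<Sum>i\<in>S. Z i \<omega>)\<^sup>2) ^ (n div 2)"
      unfolding n_def card_pair_partitions[OF assms(2)]
      by (rule centred_gaussian_power(2)[OF assms(1) gS[OF that]])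
    also have "\<dots> = (\<Sum>P\<in>pair_partitions A. (LINT \<omega>|M. (\<Sum>i\<in>S. Z i \<omega>)\<^sup>2) ^ (n div 2))" by simp
    also have "\<dots> = (\<Sum>P\<in>pair_partitions A. \<Sum>f\<in>A \<rightarrow>\<^sub>E S. \<Prod>B\<in>P. c f B)"
    proof (intro sum.cong refl)
      fix P assume P: "P \<in> pair_partitions A"
      have "n div 2 = card P" using pair_partitions_card_eq[OF assms(2) P] by (simp add: n_def)
      then have "(LINT \<omega>|M. (\<Sum>i\<in>S. Z i \<omega>)\<^sup>2) ^ (n div 2) = (\<Prod>B\<in>P. (LINT \<omega>|M. (\<Sum>i\<in>S. Z i \<omega>)\<^sup>2))"
        by simp
      also have "\<dots> = (\<Prod>B\<in>P. \<Sum>g\<in>B \<rightarrow>\<^sub>E S. c g B)"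
        using P by (intro prod.cong refl cB) (auto simp: pair_partitions_def)
      also have "\<dots> = (\<Sum>f\<in>A \<rightarrow>\<^sub>E S. \<Prod>B\<in>P. c f B)"
        using P assms(2) that
        by (intro prod_sum_PiE_partition) (auto simp: pair_partitions_def c_def intro: finite_subset)
      finally show "(LINT \<omega>|M. (\<Sum>i\<in>S. Z i \<omega>)\<^sup>2) ^ (n div 2) = (\<Sum>f\<in>A \<rightarrow>\<^sub>E S. \<Prod>B\<in>P. c f B)" .
    qed
    finally show ?thesis .
  qed
  have "K * (LINT \<omega>|M. (\<Prod>i\<in>A. Z i \<omega>)) =
     (\<Sum>S\<in>Pow A. (- 1) ^ (card A + card S) * (LINT \<omega>|M. (\<Sum>i\<in>S. Z i \<omega>) ^ n))"
  proof -
    have "K * (LINT \<omega>|M. (\<Prod>i\<in>A. Z i \<omega>)) = (LINT \<omega>|M. K * (\<Prod>i\<in>A. Z i \<omega>))" by simp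
    also have "\<dots> = (LINT \<omega>|M. (\<Sum>S\<in>Pow A. (- 1) ^ (card A + card S) * (\<Sum>i\<in>S. Z i \<omega>) ^ n))"
      unfolding polar ..
    also have "\<dots> = (\<Sum>S\<in>Pow A. LINT \<omega>|M. (- 1) ^ (card A + card S) * (\<Sum>i\<in>S. Z i \<omega>) ^ n)"
      using gS centred_gaussian_power(1)[OF assms(1)]
      by (intro Bochner_Integration.integral_sum integrable_mult_right) auto
    finally show ?thesis by simp
  qed
  also have "\<dots> = (\<Sum>S\<in>Pow A. (- 1) ^ (card A + card S) *
      (\<Sum>f\<in>A \<rightarrow>\<^sub>E S. \<Sum>P\<in>pair_partitions A. \<Prod>B\<in>P. c f B))"
    by (intro sum.cong refl arg_cong2[where f = "(*)"]) (subst second, auto intro: sum.swap)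
  also have "\<dots> = (\<Sum>f\<in>{f \<in> A \<rightarrow>\<^sub>E A. bij_betw f A A}. \<Sum>P\<in>pair_partitions A. \<Prod>B\<in>P. c f B)"
    by (rule sum_PiE_inclusion_exclusion[OF assms(2)])
  also have "\<dots> = (\<Sum>f\<in>{f \<in> A \<rightarrow>\<^sub>E A. bij_betw f A A}. \<Sum>P\<in>pair_partitions A. \<Prod>B\<in>P. c id B)"
  proof (rule sum.cong[OF refl])
    fix f assume f: "f \<in> {f \<in> A \<rightarrow>\<^sub>E A. bij_betw f A A}"
    have "c f B = c id (f ` B)" if "B \<in> P" "P \<in> pair_partitions A" for B P
    proof -
      have "inj_on f B" using f that
        by (auto simp: bij_betw_def pair_partitions_def partition_on_def intro: inj_on_subset)
      then show ?thesis by (simp add: c_def prod.reindex)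
    qed
    then have "(\<Sum>P\<in>pair_partitions A. \<Prod>B\<in>P. c f B) = (\<Sum>P\<in>pair_partitions A. \<Prod>B\<in>P. c id (f ` B))"
      by (intro sum.cong prod.cong refl) auto
    also have "\<dots> = (\<Sum>P\<in>pair_partitions A. \<Prod>B\<in>P. c id B)"
      using f assms(2) by (intro sum_pair_partitions_image) auto
    finally show "(\<Sum>P\<in>pair_partitions A. \<Prod>B\<in>P. c f B) = (\<Sum>P\<in>pair_partitions A. \<Prod>B\<in>P. c id B)" .
  qed
  finally have "K * (LINT \<omega>|M. (\<Prod>i\<in>A. Z i \<omega>)) = K * (\<Sum>P\<in>pair_partitions A. \<Prod>B\<in>P. c id B)"
    by (simp add: K_def)
  then show "(LINT \<omega>|M. (\<Prod>i\<in>A. Z i \<omega>)) = (\<Sum>P\<in>pair_partitions A. \<Prod>B\<in>P. (LINT \<omega>|M. (\<Prod>i\<in>B. Z i \<omega>)))"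
    using K by (simp add: c_def)
qed

section \<open>Integrals over ordered simplices\<close>

text \<open>The end points are stored at the positions \<open>0\<close> and \<open>n + 1\<close>.
  Order and range of the variables then become one monotonicity condition, and position
  \<open>0\<close> supplies the value \<open>s\<close> which the drift of a first consecutive pair
  reads.\<close>

definition ext_pts :: "real \<Rightarrow> real \<Rightarrow> nat \<Rightarrow> (nat \<Rightarrow> real) \<Rightarrow> nat \<Rightarrow> real" where
  "ext_pts s t n u = u(0 := s, Suc n := t)"

text \<open>Only coordinates in \<open>I\<close> are constrained, while \<open>n\<close> stays
  fixed: the same notion serves every index set that arises as variables are integrated out.\<close>

definition osimplex :: "real \<Rightarrow> real \<Rightarrow> nat \<Rightarrow> nat set \<Rightarrow> (nat \<Rightarrow> real) set" where
  "osimplex s t n I = {u. strict_mono_on (insert 0 (insert (Suc n) I)) (ext_pts s t n u)}"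

lemma strict_mono_on_Ball: "strict_mono_on J f \<longleftrightarrow> (\<forall>i\<in>J. \<forall>j\<in>J. i < j \<longrightarrow> f i < f j)"
  by (auto simp: strict_mono_on_def)

lemma ext_pts_simps [simp]:
  "ext_pts s t n u 0 = s"
  "ext_pts s t n u (Suc n) = t"
  "i \<noteq> 0 \<Longrightarrow> i \<noteq> Suc n \<Longrightarrow> ext_pts s t n u i = u i"
  "k \<noteq> 0 \<Longrightarrow> k \<noteq> Suc n \<Longrightarrow> ext_pts s t n (u(k := x)) = (ext_pts s t n u)(k := x)"
  by (auto simp: ext_pts_def)

lemma measurable_ext_pts:
  assumes "I \<subseteq> {1..n}" "i \<in> insert 0 (insert (Suc n) I)"
  shows "(\<lambda>u. ext_pts s t n u i) \<in> borel_measurable (PiM I (\<lambda>_. lborel))"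
proof -
  consider "i = 0" | "i = Suc n" | "i \<in> I" "i \<noteq> 0" "i \<noteq> Suc n" using assms by auto
  then show ?thesis
  proof cases
    case 3
    then have "(\<lambda>u. u i) \<in> measurable (PiM I (\<lambda>_. lborel)) (lborel :: real measure)"
      by (intro measurable_component_singleton)
    then show ?thesis using 3 by simp
  qed simp_all
qed

lemma simplexD:
  assumes "u \<in> osimplex s t n I" "i \<in> insert 0 (insert (Suc n) I)" "j \<in> insert 0 (insert (Suc n) I)" "i < j"
  shows "ext_pts s t n u i < ext_pts s t n u j"
  by (rule strict_mono_onD[OF assms(1)[unfolded osimplex_def mem_Collect_eq] assms(2-4)])

lemma simplex_bounds:
  assumes "u \<in> osimplex s t n I" "i \<in> insert 0 (insert (Suc n) I)" "I \<subseteq> {1..n}"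
  shows "s \<le> ext_pts s t n u i" "ext_pts s t n u i \<le> t" "i \<noteq> 0 \<Longrightarrow> s < ext_pts s t n u i"
    "i \<noteq> Suc n \<Longrightarrow> ext_pts s t n u i < t"
proof -
  have 1: "i \<noteq> 0 \<Longrightarrow> s < ext_pts s t n u i" using simplexD[OF assms(1), of 0 i] assms by auto
  have 2: "ext_pts s t n u i < t" if "i \<noteq> Suc n"
  proof -
    have "i < Suc n" using assms that by auto
    then show ?thesis using simplexD[OF assms(1), of i "Suc n"] assms by auto
  qed
  show "i \<noteq> 0 \<Longrightarrow> s < ext_pts s t n u i" "i \<noteq> Suc n \<Longrightarrow> ext_pts s t n u i < t"
    by (fact 1, fact 2)
  show "s \<le> ext_pts s t n u i" using 1 by (cases "i = 0") auto
  show "ext_pts s t n u i \<le> t" using 2 by (cases "i = Suc n") auto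
qed

text \<open>The link to the domain in \<open>pairing_integral\<close>. Extensionality must be
  assumed because \<open>osimplex\<close> ignores the coordinates outside \<open>I\<close>.\<close>

lemma simplex_space_iff:
  assumes "I \<subseteq> {1..n}" "s < t" "u \<in> extensional I"
  shows "u \<in> osimplex s t n I \<longleftrightarrow> u \<in> (I \<rightarrow>\<^sub>E {s<..<t}) \<and> strict_mono_on I u"
proof
  assume u: "u \<in> osimplex s t n I"
  have "u i \<in> {s<..<t}" if "i \<in> I" for i
  proof -
    have "i \<noteq> 0" "i \<noteq> Suc n" using that assms by auto
    then show ?thesis using simplex_bounds(3,4)[OF u, of i] that assms by simp
  qed
  moreover have "u i < u j" if "i \<in> I" "j \<in> I" "i < j" for i j
  proof -
    have "i \<noteq> 0" "i \<noteq> Suc n" "j \<noteq> 0" "j \<noteq> Suc n" using that assms by auto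
    then show ?thesis using simplexD[OF u, of i j] that by simp
  qed
  ultimately show "u \<in> (I \<rightarrow>\<^sub>E {s<..<t}) \<and> strict_mono_on I u"
    using assms by (simp add: PiE_def strict_mono_on_Ball)
next
  assume u: "u \<in> (I \<rightarrow>\<^sub>E {s<..<t}) \<and> strict_mono_on I u"
  show "u \<in> osimplex s t n I"
    unfolding osimplex_def mem_Collect_eq
  proof (rule strict_mono_onI)
    fix i j assume ij: "i \<in> insert 0 (insert (Suc n) I)" "j \<in> insert 0 (insert (Suc n) I)" "i < j"
    have v: "ext_pts s t n u q \<in> {s<..<t}" "ext_pts s t n u q = u q" if "q \<in> I" for q
    proof -
      have "q \<noteq> 0" "q \<noteq> Suc n" using that assms by auto
      then show "ext_pts s t n u q \<in> {s<..<t}" "ext_pts s t n u q = u q" using u that by auto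
    qed
    consider "i = 0" "j = Suc n" | "i = 0" "j \<in> I" | "i \<in> I" "j = Suc n" | "i \<in> I" "j \<in> I"
      using ij assms by auto
    then show "ext_pts s t n u i < ext_pts s t n u j"
      using assms v[of i] v[of j] strict_mono_onD[of I u i j] u ij by cases auto
  qed
qed

lemma pred_simplex:
  assumes "I \<subseteq> {1..n}"
  shows "{u \<in> space (PiM I (\<lambda>_. lborel)). u \<in> osimplex s t n I} \<in> sets (PiM I (\<lambda>_. lborel))"
proof -
  define J where "J = insert 0 (insert (Suc n) I)"
  define N where "N = PiM I (\<lambda>_. lborel :: real measure)"
  have fin: "finite J" "J \<noteq> {}" using assms finite_subset by (auto simp: J_def)
  have less: "{u \<in> space N. i < j \<longrightarrow> ext_pts s t n u i < ext_pts s t n u j} \<in> sets N"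
    if "i \<in> J" "j \<in> J" for i j
  proof -
    have "{u \<in> space N. ext_pts s t n u i < ext_pts s t n u j} \<in> sets N"
      using that unfolding N_def J_def
      by (intro borel_measurable_less measurable_ext_pts[OF assms])
    then show ?thesis by (cases "i < j") simp_all
  qed
  have "{u \<in> space N. \<forall>j\<in>J. i < j \<longrightarrow> ext_pts s t n u i < ext_pts s t n u j} \<in> sets N"
    if "i \<in> J" for i
    by (rule sets.sets_Collect_finite_All'[OF less[OF that] fin])
  then have "{u \<in> space N. \<forall>i\<in>J. \<forall>j\<in>J. i < j \<longrightarrow> ext_pts s t n u i < ext_pts s t n u j} \<in> sets N"
    by (rule sets.sets_Collect_finite_All'[OF _ fin])
  then show ?thesis
    by (simp only: osimplex_def mem_Collect_eq strict_mono_on_Ball J_def N_def)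
qed

lemma borel_measurable_indicator_simplex:
  assumes "I \<subseteq> {1..n}"
  shows "(\<lambda>u. indicator (osimplex s t n I) u :: real) \<in> borel_measurable (PiM I (\<lambda>_. lborel))"
    and "(\<lambda>u. indicator (osimplex s t n I) u :: ennreal) \<in> borel_measurable (PiM I (\<lambda>_. lborel))"
  using borel_measurable_indicator'[OF pred_simplex[OF assms], of s t]
  by simp_all

text \<open>Only the neighbours \<open>a\<close> and \<open>b\<close> of \<open>k\<close> restrict
  the new coordinate, the remaining inequalities following by transitivity. Hence integrating out
  one variable is an integral over an interval between two other variables.\<close>

lemma simplex_upd:
  assumes k: "k \<in> {1..n}" and I: "I \<subseteq> {1..n}"
    and a: "a \<in> insert 0 I" "a < k" "\<And>i. i \<in> I \<Longrightarrow> i < k \<Longrightarrow> i \<le> a"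
    and b: "b \<in> insert (Suc n) I" "k < b" "\<And>i. i \<in> I \<Longrightarrow> k < i \<Longrightarrow> b \<le> i"
    and kI: "k \<notin> I"
  shows "u(k := x) \<in> osimplex s t n (insert k I) \<longleftrightarrow>
    u \<in> osimplex s t n I \<and> ext_pts s t n u a < x \<and> x < ext_pts s t n u b"
proof -
  have k0: "k \<noteq> 0" "k \<noteq> Suc n" using k by auto
  have ba: "b \<noteq> k" "a \<noteq> k" using a b by auto
  let ?v = "ext_pts s t n u"
  let ?J = "insert 0 (insert (Suc n) I)"
  show ?thesis
  proof
    assume L: "u(k := x) \<in> osimplex s t n (insert k I)"
    have "?v i < ?v j" if "i \<in> ?J" "j \<in> ?J" "i < j" for i j
    proof -
      have "i \<noteq> k" "j \<noteq> k" using that kI k by auto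
      then show ?thesis using simplexD[OF L, of i j] that k0 by auto
    qed
    then have "u \<in> osimplex s t n I" by (simp only: osimplex_def mem_Collect_eq strict_mono_on_Ball) blast
    moreover have "?v a < x" using simplexD[OF L, of a k] a k0 ba by auto
    moreover have "x < ?v b" using simplexD[OF L, of k b] b k0 ba by auto
    ultimately show "u \<in> osimplex s t n I \<and> ?v a < x \<and> x < ?v b" by blast
  next
    assume R: "u \<in> osimplex s t n I \<and> ?v a < x \<and> x < ?v b"
    have up: "?v b \<le> ?v j" if "j \<in> ?J" "k < j" for j
    proof -
      have "b \<le> j" using b that k I by auto
      then show ?thesis using R simplexD[of u s t n I b j] that b by (cases "b = j") auto
    qed
    have low: "?v i \<le> ?v a" if "i \<in> ?J" "i < k" for i
    proof -
      have "i \<le> a" using a that k by auto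
      then show ?thesis using R simplexD[of u s t n I i a] that a by (cases "i = a") auto
    qed
    show "u(k := x) \<in> osimplex s t n (insert k I)"
      unfolding osimplex_def mem_Collect_eq
    proof (rule strict_mono_onI)
      fix i j assume ij: "i \<in> insert 0 (insert (Suc n) (insert k I))"
        "j \<in> insert 0 (insert (Suc n) (insert k I))" "i < j"
      show "ext_pts s t n (u(k := x)) i < ext_pts s t n (u(k := x)) j"
        using ij k0 up[of j] low[of i] R simplexD[of u s t n I i j] by auto
    qed
  qed
qed

lemma product_sigma_finite_lborel: "product_sigma_finite (\<lambda>_::nat. lborel :: real measure)"
  by (simp add: product_sigma_finite_def sigma_finite_lborel)

lemma nn_integral_simplex_insert:
  assumes k: "k \<in> {1..n}" and I: "I \<subseteq> {1..n}"
    and a: "a \<in> insert 0 I" "a < k" "\<And>i. i \<in> I \<Longrightarrow> i < k \<Longrightarrow> i \<le> a"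
    and b: "b \<in> insert (Suc n) I" "k < b" "\<And>i. i \<in> I \<Longrightarrow> k < i \<Longrightarrow> b \<le> i"
    and kI: "k \<notin> I"
    and f: "f \<in> borel_measurable (PiM (insert k I) (\<lambda>_. lborel))"
  shows "(\<integral>\<^sup>+u. f u * indicator (osimplex s t n (insert k I)) u \<partial>PiM (insert k I) (\<lambda>_. lborel)) =
    (\<integral>\<^sup>+u. (\<integral>\<^sup>+x. f (u(k := x)) * indicator {ext_pts s t n u a<..<ext_pts s t n u b} x \<partial>lborel) *
       indicator (osimplex s t n I) u \<partial>PiM I (\<lambda>_. lborel))"
proof -
  interpret product_sigma_finite "\<lambda>_::nat. lborel :: real measure" by (rule product_sigma_finite_lborel)
  have fin: "finite I" using I finite_subset by blast
  have kI': "insert k I \<subseteq> {1..n}" using k I by auto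
  have "(\<integral>\<^sup>+u. f u * indicator (osimplex s t n (insert k I)) u \<partial>PiM (insert k I) (\<lambda>_. lborel)) =
    (\<integral>\<^sup>+u. (\<integral>\<^sup>+x. f (u(k := x)) * indicator (osimplex s t n (insert k I)) (u(k := x)) \<partial>lborel)
       \<partial>PiM I (\<lambda>_. lborel))"
    using fin kI f borel_measurable_indicator_simplex(2)[OF kI', of s t]
    by (intro product_nn_integral_insert) (auto intro!: borel_measurable_times_ennreal)
  also have "\<dots> = (\<integral>\<^sup>+u. (\<integral>\<^sup>+x. f (u(k := x)) * indicator {ext_pts s t n u a<..<ext_pts s t n u b} x \<partial>lborel) *
       indicator (osimplex s t n I) u \<partial>PiM I (\<lambda>_. lborel))"
  proof (intro nn_integral_cong)
    fix u
    show "(\<integral>\<^sup>+x. f (u(k := x)) * indicator (osimplex s t n (insert k I)) (u(k := x)) \<partial>lborel) =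
      (\<integral>\<^sup>+x. f (u(k := x)) * indicator {ext_pts s t n u a<..<ext_pts s t n u b} x \<partial>lborel) *
       indicator (osimplex s t n I) u"
      by (cases "u \<in> osimplex s t n I")
         (auto simp: indicator_def simplex_upd[OF k I a b kI] intro!: nn_integral_cong)
  qed
  finally show ?thesis .
qed

lemma integral_simplex_insert:
  fixes f :: "(nat \<Rightarrow> real) \<Rightarrow> real"
  assumes k: "k \<in> {1..n}" and I: "I \<subseteq> {1..n}"
    and a: "a \<in> insert 0 I" "a < k" "\<And>i. i \<in> I \<Longrightarrow> i < k \<Longrightarrow> i \<le> a"
    and b: "b \<in> insert (Suc n) I" "k < b" "\<And>i. i \<in> I \<Longrightarrow> k < i \<Longrightarrow> b \<le> i"
    and kI: "k \<notin> I"
    and f: "integrable (PiM (insert k I) (\<lambda>_. lborel)) (\<lambda>u. indicator (osimplex s t n (insert k I)) u * f u)"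
  shows "(LINT u|PiM (insert k I) (\<lambda>_. lborel). indicator (osimplex s t n (insert k I)) u * f u) =
    (LINT u|PiM I (\<lambda>_. lborel). indicator (osimplex s t n I) u *
      (LINT x|lborel. indicator {ext_pts s t n u a<..<ext_pts s t n u b} x * f (u(k := x))))"
proof -
  interpret product_sigma_finite "\<lambda>_::nat. lborel :: real measure" by (rule product_sigma_finite_lborel)
  have fin: "finite I" using I finite_subset by blast
  show ?thesis
    unfolding product_integral_insert[OF fin kI f]
  proof (intro Bochner_Integration.integral_cong refl)
    fix u
    show "(LINT x|lborel. indicator (osimplex s t n (insert k I)) (u(k := x)) * f (u(k := x))) =
      indicator (osimplex s t n I) u *
      (LINT x|lborel. indicator {ext_pts s t n u a<..<ext_pts s t n u b} x * f (u(k := x)))"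
      by (cases "u \<in> osimplex s t n I")
         (auto simp: indicator_def simplex_upd[OF k I a b kI] intro!: Bochner_Integration.integral_cong)
  qed
qed

lemma integrable_simplex_bounded:
  fixes f :: "(nat \<Rightarrow> real) \<Rightarrow> real"
  assumes I: "I \<subseteq> {1..n}" and f: "f \<in> borel_measurable (PiM I (\<lambda>_. lborel))"
    and C: "\<And>u. u \<in> osimplex s t n I \<Longrightarrow> \<bar>f u\<bar> \<le> C"
  shows "integrable (PiM I (\<lambda>_. lborel)) (\<lambda>u. indicator (osimplex s t n I) u * f u)"
proof -
  interpret product_sigma_finite "\<lambda>_::nat. lborel :: real measure" by (rule product_sigma_finite_lborel)
  have fin: "finite I" using I finite_subset by blast
  have "emeasure (PiM I (\<lambda>_. lborel)) (PiE I (\<lambda>_. {s..t})) = (\<Prod>i\<in>I. emeasure lborel {s..t})"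
    using fin by (intro emeasure_PiM) auto
  also have "\<dots> < \<infinity>" using fin by (simp add: emeasure_lborel_Icc_eq power_less_top_ennreal)
  finally have em: "emeasure (PiM I (\<lambda>_. lborel)) (PiE I (\<lambda>_. {s..t})) < \<infinity>" .
  have "integrable (PiM I (\<lambda>_. lborel)) (\<lambda>u. C * indicator (PiE I (\<lambda>_. {s..t})) u)"
    using em fin by (intro integrable_mult_right integrable_real_indicator sets_PiM_I_finite) auto
  then show ?thesis
  proof (rule Bochner_Integration.integrable_bound)
    show "(\<lambda>u. indicator (osimplex s t n I) u * f u) \<in> borel_measurable (PiM I (\<lambda>_. lborel))"
      using borel_measurable_indicator_simplex(1)[OF I] f by (intro borel_measurable_times)
    show "AE u in PiM I (\<lambda>_. lborel). norm (indicator (osimplex s t n I) u * f u) \<le>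
        norm (C * indicator (PiE I (\<lambda>_. {s..t})) u)"
    proof (rule AE_I2)
      fix u assume "u \<in> space (PiM I (\<lambda>_. lborel :: real measure))"
      then have e: "u \<in> extensional I" by (auto simp: space_PiM PiE_def)
      show "norm (indicator (osimplex s t n I) u * f u) \<le> norm (C * indicator (PiE I (\<lambda>_. {s..t})) u)"
      proof (cases "u \<in> osimplex s t n I")
        case True
        have "u i \<in> {s..t}" if "i \<in> I" for i
        proof -
          have "i \<noteq> 0" "i \<noteq> Suc n" using that I by auto
          then show ?thesis using simplex_bounds(1,2)[OF True, of i] that I by simp
        qed
        then have "u \<in> PiE I (\<lambda>_. {s..t})" using e by (auto simp: PiE_def)
        then show ?thesis using True C[OF True] by simp
      qed simp
    qed
  qed
qed

section \<open>Iterated integrals of piecewise linear paths\<close>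

lemma has_RS_integral_unique:
  assumes I: "has_RS_integral f g a b I" and J: "has_RS_integral f g a b J"
  shows "I = J"
proof (rule ccontr)
  assume "I \<noteq> J"
  define e where "e = \<bar>I - J\<bar> / 2"
  have e: "e > 0" using \<open>I \<noteq> J\<close> by (simp add: e_def)
  obtain d1 where d1: "d1 > 0" "\<And>p. p tagged_division_of {a..b} \<Longrightarrow> (\<lambda>x. ball x d1) fine p \<Longrightarrow>
     \<bar>(\<Sum>(x, K)\<in>p. f x * (g (Sup K) - g (Inf K))) - I\<bar> < e"
    using I e unfolding has_RS_integral_def by meson
  obtain d2 where d2: "d2 > 0" "\<And>p. p tagged_division_of {a..b} \<Longrightarrow> (\<lambda>x. ball x d2) fine p \<Longrightarrow>
     \<bar>(\<Sum>(x, K)\<in>p. f x * (g (Sup K) - g (Inf K))) - J\<bar> < e"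
    using J e unfolding has_RS_integral_def by meson
  have "gauge (\<lambda>x. ball x (min d1 d2) :: real set)" using d1 d2 by (intro gauge_ball) auto
  then obtain p where p: "p tagged_division_of {a..b}" "(\<lambda>x. ball x (min d1 d2)) fine p"
    using fine_division_exists_real by blast
  have "(\<lambda>x. ball x d1) fine p" "(\<lambda>x. ball x d2) fine p"
    using p(2) by (fastforce simp: fine_def)+
  then have "\<bar>(\<Sum>(x, K)\<in>p. f x * (g (Sup K) - g (Inf K))) - I\<bar> < e"
    "\<bar>(\<Sum>(x, K)\<in>p. f x * (g (Sup K) - g (Inf K))) - J\<bar> < e" using d1 d2 p by blast+
  then show False by (simp add: e_def abs_if split: if_splits)
qed

lemma RS_integral_eqI: "has_RS_integral f g a b I \<Longrightarrow> RS_integral f g a b = I"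
  unfolding RS_integral_def by (rule the_equality) (auto intro: has_RS_integral_unique)

lemma has_RS_integral_refl: "has_RS_integral f g a a 0"
proof -
  have "(\<Sum>(x, K)\<in>p. f x * (g (Sup K) - g (Inf K))) = 0" if "p tagged_division_of {a..a}" for p
  proof (intro sum.neutral ballI)
    fix z assume "z \<in> p"
    then obtain x K where z: "z = (x, K)" "(x, K) \<in> p" by (cases z) auto
    then have "x \<in> K" "K \<subseteq> {a..a}" using that by (auto dest: tagged_division_ofD)
    then have "K = {a}" by auto
    then show "(case z of (x, K) \<Rightarrow> f x * (g (Sup K) - g (Inf K))) = 0" using z by simp
  qed
  then show ?thesis unfolding has_RS_integral_def by (auto intro: exI[of _ 1])
qed

text \<open>On a fine division each summand differs from the integral over its interval by the
  oscillation of \<open>f\<close> there times \<open>L\<close> times the length. Boundedness of the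
  density is all that the argument asks of it, so piecewise constant slopes are covered.\<close>

lemma has_RS_integral_density:
  assumes "a \<le> b" and f: "continuous_on {a..b} f"
    and g: "\<And>x y. a \<le> x \<Longrightarrow> x \<le> y \<Longrightarrow> y \<le> b \<Longrightarrow> (g' has_integral (g y - g x)) {x..y}"
    and L: "\<And>x. \<bar>g' x\<bar> \<le> L"
    and fg: "(\<lambda>x. f x * g' x) integrable_on {a..b}"
  shows "has_RS_integral f g a b (integral {a..b} (\<lambda>x. f x * g' x))"
  unfolding has_RS_integral_def
proof (intro allI impI)
  fix e :: real assume "e > 0"
  \<comment> \<open>The two added units make the denominator positive and the final inequality
    strict, also for \<open>L = 0\<close> or \<open>a = b\<close>.\<close>
  define e' where "e' = e / ((\<bar>L\<bar> + 1) * (b - a + 1))"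
  have pos: "(\<bar>L\<bar> + 1) * (b - a + 1) > 0" using \<open>a \<le> b\<close> by (intro mult_pos_pos) auto
  then have e': "e' > 0" using \<open>e > 0\<close> by (simp add: e'_def)
  have "uniformly_continuous_on {a..b} f" using f by (simp add: compact_uniformly_continuous)
  then obtain d where d: "d > 0" "\<And>x y. x \<in> {a..b} \<Longrightarrow> y \<in> {a..b} \<Longrightarrow> dist y x < d \<Longrightarrow> dist (f y) (f x) < e'"
    using e' unfolding uniformly_continuous_on_def by meson
  show "\<exists>\<delta>>0. \<forall>p. p tagged_division_of {a..b} \<and> (\<lambda>x. ball x \<delta>) fine p \<longrightarrow>
        \<bar>(\<Sum>(x, K)\<in>p. f x * (g (Sup K) - g (Inf K))) - integral {a..b} (\<lambda>x. f x * g' x)\<bar> < e"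
  proof (intro exI[of _ d] conjI allI impI)
    fix p assume "p tagged_division_of {a..b} \<and> (\<lambda>x. ball x d) fine p"
    then have p: "p tagged_division_of {a..b}" and fine: "(\<lambda>x. ball x d) fine p" by auto
    have pc: "p tagged_division_of cbox a b" using p by simp
    have split: "integral {a..b} (\<lambda>x. f x * g' x) = (\<Sum>(x, K)\<in>p. integral K (\<lambda>x. f x * g' x))"
      using integral_combine_tagged_division_topdown[of "\<lambda>x. f x * g' x" a b p] fg pc by simp
    have each: "\<bar>f x * (g (Sup K) - g (Inf K)) - integral K (\<lambda>x. f x * g' x)\<bar> \<le> e' * \<bar>L\<bar> * measure lborel K"
      if xK: "(x, K) \<in> p" for x K
    proof -
      obtain c e where K: "K = {c..e}" using tagged_division_ofD(4)[OF p xK] by (auto simp: box_real)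
      have x: "x \<in> K" and sub: "K \<subseteq> {a..b}" using tagged_division_ofD(2,3)[OF p xK] by auto
      then have ce: "c \<le> e" "a \<le> c" "e \<le> b" using K by auto
      have ball: "K \<subseteq> ball x d" using fine xK by (auto simp: fine_def)
      have hg: "(g' has_integral (g e - g c)) {c..e}" using g ce by auto
      have i1: "((\<lambda>y. f x * g' y) has_integral f x * (g e - g c)) {c..e}"
        using hg by (rule has_integral_mult_right)
      have i2: "((\<lambda>y. f y * g' y) has_integral integral {c..e} (\<lambda>x. f x * g' x)) {c..e}"
        using fg sub K by (intro integrable_integral) (auto intro: integrable_on_subinterval)
      have "((\<lambda>y. f x * g' y - f y * g' y) has_integral
         (f x * (g e - g c) - integral {c..e} (\<lambda>x. f x * g' x))) (cbox c e)"
        using has_integral_diff[OF i1 i2] by simp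
      then have "norm (f x * (g e - g c) - integral {c..e} (\<lambda>x. f x * g' x)) \<le> (e' * \<bar>L\<bar>) * measure lborel (cbox c e)"
      proof (rule has_integral_bound[rotated])
        fix y assume y: "y \<in> cbox c e"
        then have "dist (f x) (f y) < e'" using d(2)[of y x] ball x sub K by (auto simp: subset_eq)
        then have "\<bar>f x - f y\<bar> \<le> e'" by (simp add: dist_real_def)
        moreover have "\<bar>g' y\<bar> \<le> \<bar>L\<bar>" using L[of y] by linarith
        ultimately have "\<bar>f x - f y\<bar> * \<bar>g' y\<bar> \<le> e' * \<bar>L\<bar>" by (intro mult_mono) auto
        then show "norm (f x * g' y - f y * g' y) \<le> e' * \<bar>L\<bar>"
          by (simp add: left_diff_distrib[symmetric] abs_mult)
      qed (use e' in simp)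
      then show ?thesis using K ce by simp
    qed
    have finp: "finite p" using p by blast
    have "\<bar>(\<Sum>(x, K)\<in>p. f x * (g (Sup K) - g (Inf K))) - integral {a..b} (\<lambda>x. f x * g' x)\<bar> =
      \<bar>\<Sum>(x, K)\<in>p. f x * (g (Sup K) - g (Inf K)) - integral K (\<lambda>x. f x * g' x)\<bar>"
      unfolding split by (simp add: sum_subtractf[symmetric] case_prod_unfold)
    also have "\<dots> \<le> (\<Sum>(x, K)\<in>p. e' * \<bar>L\<bar> * measure lborel K)"
      by (rule order_trans[OF sum_abs], rule sum_mono) (use each in auto)
    also have "\<dots> = e' * \<bar>L\<bar> * (\<Sum>(x, K)\<in>p. measure lborel K)"
      by (simp add: sum_distrib_left case_prod_unfold)
    also have "(\<Sum>(x, K)\<in>p. measure lborel K) = b - a"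
      using additive_content_tagged_division[OF pc] \<open>a \<le> b\<close> by simp
    also have "e' * \<bar>L\<bar> * (b - a) < e"
    proof -
      have "\<bar>L\<bar> * (b - a) < (\<bar>L\<bar> + 1) * (b - a + 1)"
        using \<open>a \<le> b\<close> by (simp add: algebra_simps add_strict_increasing2 mult_nonneg_nonneg add.commute)
      then have "e' * (\<bar>L\<bar> * (b - a)) < e' * ((\<bar>L\<bar> + 1) * (b - a + 1))" using e' by simp
      also have "\<dots> = e" unfolding e'_def using pos by (metis nonzero_eq_divide_eq less_irrefl times_divide_eq_left)
      finally show ?thesis by (simp add: mult.assoc)
    qed
    finally show "\<bar>(\<Sum>(x, K)\<in>p. f x * (g (Sup K) - g (Inf K))) - integral {a..b} (\<lambda>x. f x * g' x)\<bar> < e" .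
  qed (fact d)
qed

text \<open>Fubini with the inserted coordinate outermost, as needed for iterated integrals whose
  last variable is the outer one.\<close>

lemma (in product_sigma_finite) product_integral_insert_rev:
  fixes f :: "_ \<Rightarrow> real"
  assumes I: "finite I" "i \<notin> I"
    and f: "integrable (Pi\<^sub>M (insert i I) M) f"
  shows "integral\<^sup>L (Pi\<^sub>M (insert i I) M) f = (\<integral>y. (\<integral>x. f (x(i := y)) \<partial>Pi\<^sub>M I M) \<partial>M i)"
proof -
  have "integral\<^sup>L (Pi\<^sub>M ({i} \<union> I) M) f =
     (\<integral>y. (\<integral>x. f (merge {i} I (y, x)) \<partial>Pi\<^sub>M I M) \<partial>Pi\<^sub>M {i} M)"
    using f I by (intro product_integral_fold) auto
  also have "\<dots> = (\<integral>y. (\<integral>x. f (x(i := y i)) \<partial>Pi\<^sub>M I M) \<partial>Pi\<^sub>M {i} M)"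
  proof (intro Bochner_Integration.integral_cong refl arg_cong[where f = f] ext)
    fix y x :: "'i \<Rightarrow> 'a" and j assume "x \<in> space (Pi\<^sub>M I M)"
    then show "merge {i} I (y, x) j = (x(i := y i)) j"
      by (auto simp: merge_def space_PiM PiE_def extensional_def)
  qed
  also have "\<dots> = (\<integral>y. (\<integral>x. f (x(i := y)) \<partial>Pi\<^sub>M I M) \<partial>M i)"
  proof (rule product_integral_singleton)
    interpret I: finite_product_sigma_finite M I by standard (fact I)
    have [measurable]: "f \<in> borel_measurable (Pi\<^sub>M (insert i I) M)" using f by auto
    have "(\<lambda>p. (snd p)(i := fst p)) \<in> measurable (M i \<Otimes>\<^sub>M Pi\<^sub>M I M) (Pi\<^sub>M (insert i I) M)"
      by (rule measurable_fun_upd[where J = I]) auto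
    then have "(\<lambda>p. f ((snd p)(i := fst p))) \<in> borel_measurable (M i \<Otimes>\<^sub>M Pi\<^sub>M I M)"
      by measurable
    then show "(\<lambda>y. \<integral>x. f (x(i := y)) \<partial>Pi\<^sub>M I M) \<in> borel_measurable (M i)"
      by (intro I.borel_measurable_lebesgue_integral) (simp add: case_prod_beta)
  qed
  finally show ?thesis by simp
qed

lemma set_integrable_continuous_times:
  fixes f :: "real \<Rightarrow> real"
  assumes "continuous_on {a..b} f" "g \<in> borel_measurable borel" "\<And>x. \<bar>g x\<bar> \<le> L"
  shows "set_integrable lborel {a..b} (\<lambda>x. f x * g x)"
proof -
  have "bounded (f ` {a..b})" using assms(1) by (intro compact_imp_bounded compact_continuous_image) auto
  then obtain B where B: "\<And>x. x \<in> {a..b} \<Longrightarrow> \<bar>f x\<bar> \<le> B"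
    unfolding bounded_iff by (metis image_eqI real_norm_def)
  have m: "(\<lambda>x. indicator {a..b} x *\<^sub>R f x) \<in> borel_measurable borel"
    using assms(1) by (intro borel_measurable_continuous_on_indicator) auto
  have "integrable lborel (\<lambda>x. (B * L) * indicator {a..b} x)"
    by (intro integrable_mult_right integrable_real_indicator) (auto simp: emeasure_lborel_Icc_eq)
  then show ?thesis
    unfolding set_integrable_def
  proof (rule Bochner_Integration.integrable_bound)
    have "(\<lambda>x. (indicator {a..b} x *\<^sub>R f x) * g x) \<in> borel_measurable borel"
      using m assms(2) by (rule borel_measurable_times)
    then show "(\<lambda>x. indicator {a..b} x *\<^sub>R (f x * g x)) \<in> borel_measurable lborel"
      by (simp add: mult.assoc)
    show "AE x in lborel. norm (indicator {a..b} x *\<^sub>R (f x * g x)) \<le> norm (B * L * indicator {a..b} x)"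
    proof (rule AE_I2)
      fix x
      show "norm (indicator {a..b} x *\<^sub>R (f x * g x)) \<le> norm (B * L * indicator {a..b} x)"
      proof (cases "x \<in> {a..b}")
        case True
        then have "\<bar>f x\<bar> * \<bar>g x\<bar> \<le> B * L" using B[of x] assms(3)[of x] by (intro mult_mono) auto
        then show ?thesis using True abs_ge_self[of "B * L"] by (simp add: abs_mult)
      qed simp
    qed
  qed
qed

primrec nested_int :: "(nat \<Rightarrow> real \<Rightarrow> real) \<Rightarrow> real \<Rightarrow> nat \<Rightarrow> real \<Rightarrow> real" where
  "nested_int y s 0 = (\<lambda>u. 1)"
| "nested_int y s (Suc n) = (\<lambda>u. integral {s..u} (\<lambda>v. nested_int y s n v * y (Suc n) v))"

lemma continuous_on_nested_int:
  assumes "\<And>i. y i \<in> borel_measurable borel" "\<And>i x. \<bar>y i x\<bar> \<le> L"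
  shows "continuous_on {s..t} (nested_int y s n)"
proof (induction n)
  case (Suc n)
  have "(\<lambda>v. nested_int y s n v * y (Suc n) v) integrable_on {s..t}"
    using set_integrable_continuous_times[OF Suc assms] by (rule set_borel_integral_eq_integral(1))
  then show ?case by (simp add: indefinite_integral_continuous_1)
qed simp

lemma iter_int_eq_nested_int:
  fixes Y :: "real \<Rightarrow> real ^ 'd" and y :: "'d \<Rightarrow> real \<Rightarrow> real"
  assumes "\<And>\<alpha>. y \<alpha> \<in> borel_measurable borel" "\<And>\<alpha> x. \<bar>y \<alpha> x\<bar> \<le> L"
    and dens: "\<And>\<alpha> a b. s \<le> a \<Longrightarrow> a \<le> b \<Longrightarrow> b \<le> t \<Longrightarrow> (y \<alpha> has_integral (Y b $ \<alpha> - Y a $ \<alpha>)) {a..b}"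
    and "s \<le> u" "u \<le> t"
  shows "iter_int Y \<gamma> s n u = nested_int (\<lambda>i. y (\<gamma> i)) s n u"
  using assms(4,5)
proof (induction n arbitrary: u)
  case (Suc n)
  let ?V = "nested_int (\<lambda>i. y (\<gamma> i)) s n"
  have cont: "continuous_on {s..u} ?V" using assms(1,2) by (intro continuous_on_nested_int)
  have cont': "continuous_on {s..u} (iter_int Y \<gamma> s n)"
    using cont by (rule continuous_on_eq) (use Suc in auto)
  have "has_RS_integral (iter_int Y \<gamma> s n) (\<lambda>u. Y u $ \<gamma> (Suc n)) s u
     (integral {s..u} (\<lambda>v. iter_int Y \<gamma> s n v * y (\<gamma> (Suc n)) v))"
    using set_integrable_continuous_times[OF cont' assms(1,2)] Suc.prems assms(2) dens cont'
    by (intro has_RS_integral_density set_borel_integral_eq_integral(1)) auto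
  then have "iter_int Y \<gamma> s (Suc n) u = integral {s..u} (\<lambda>v. iter_int Y \<gamma> s n v * y (\<gamma> (Suc n)) v)"
    by (simp add: RS_integral_eqI)
  also have "\<dots> = integral {s..u} (\<lambda>v. ?V v * y (\<gamma> (Suc n)) v)"
    using Suc by (intro Henstock_Kurzweil_Integration.integral_cong) auto
  finally show ?case by simp
qed simp

lemma osimplex_Suc_iff:
  "x(Suc n := v) \<in> osimplex s u (Suc n) {1..Suc n} \<longleftrightarrow> x \<in> osimplex s v n {1..n} \<and> v < u"
proof -
  let ?A = "insert 0 (insert (Suc n) {1..n})"
  let ?f = "ext_pts s u (Suc n) (x(Suc n := v))" and ?g = "ext_pts s v n x"
  have A: "insert 0 (insert (Suc (Suc n)) {1..Suc n}) = insert (Suc (Suc n)) ?A" by auto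
  have eq: "?f i = ?g i" if "i \<in> ?A" for i using that by (auto simp: ext_pts_def)
  have top: "?f (Suc (Suc n)) = u" "?f (Suc n) = v" by (auto simp: ext_pts_def)
  have le: "i < Suc (Suc n)" if "i \<in> ?A" for i using that by auto
  show ?thesis
    unfolding osimplex_def mem_Collect_eq A
  proof
    assume L: "strict_mono_on (insert (Suc (Suc n)) ?A) ?f"
    have "strict_mono_on ?A ?g"
    proof (rule strict_mono_onI)
      fix i j assume "i \<in> ?A" "j \<in> ?A" "i < j"
      then show "?g i < ?g j" using strict_mono_onD[OF L, of i j] eq by simp
    qed
    moreover have "v < u" using strict_mono_onD[OF L, of "Suc n" "Suc (Suc n)"] top by simp
    ultimately show "strict_mono_on ?A ?g \<and> v < u" by blast
  next
    assume R: "strict_mono_on ?A ?g \<and> v < u"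
    have lev: "?g i \<le> v" if "i \<in> ?A" for i
    proof (cases "i = Suc n")
      case False
      then have "i < Suc n" using that by auto
      then show ?thesis using strict_mono_onD[of ?A ?g i "Suc n"] R that by simp
    qed simp
    show "strict_mono_on (insert (Suc (Suc n)) ?A) ?f"
    proof (rule strict_mono_onI)
      fix i j assume ij: "i \<in> insert (Suc (Suc n)) ?A" "j \<in> insert (Suc (Suc n)) ?A" "i < j"
      have iA: "i \<in> ?A" using ij le[of j] by (cases "i = Suc (Suc n)") auto
      show "?f i < ?f j"
      proof (cases "j = Suc (Suc n)")
        case True
        then show ?thesis using eq[OF iA] lev[OF iA] top R by simp
      next
        case False
        then have "j \<in> ?A" using ij by auto
        then show ?thesis using eq iA strict_mono_onD[of ?A ?g i j] R ij by simp
      qed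
    qed
  qed
qed

lemma nested_int_eq_simplex:
  assumes meas: "\<And>i. y i \<in> borel_measurable borel" and bd: "\<And>i x. \<bar>y i x\<bar> \<le> L" and "s < u"
  shows "nested_int y s n u = (LINT x|PiM {1..n} (\<lambda>_. lborel).
      indicator (osimplex s u n {1..n}) x * (\<Prod>i\<in>{1..n}. y i (x i)))"
  using \<open>s < u\<close>
proof (induction n arbitrary: u)
  case 0
  have "x \<in> osimplex s u 0 {}" for x
    using 0 by (auto simp: osimplex_def strict_mono_on_Ball)
  then show ?case by (simp add: PiM_empty lebesgue_integral_count_space_finite)
next
  case (Suc n)
  interpret product_sigma_finite "\<lambda>_::nat. lborel :: real measure" by (rule product_sigma_finite_lborel)
  have L: "L \<ge> 0" using bd[of 0 0] by linarith
  have ins: "{1..Suc n} = insert (Suc n) {1..n}" by auto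
  let ?J = "\<lambda>n u. LINT x|PiM {1..n} (\<lambda>_. lborel). indicator (osimplex s u n {1..n}) x * (\<Prod>i\<in>{1..n}. y i (x i))"
  have int: "integrable (PiM {1..Suc n} (\<lambda>_. lborel))
      (\<lambda>x. indicator (osimplex s u (Suc n) {1..Suc n}) x * (\<Prod>i\<in>{1..Suc n}. y i (x i)))"
  proof (rule integrable_simplex_bounded)
    show "(\<lambda>x. \<Prod>i\<in>{1..Suc n}. y i (x i)) \<in> borel_measurable (PiM {1..Suc n} (\<lambda>_. lborel))"
    proof (rule borel_measurable_prod)
      fix i assume "i \<in> {1..Suc n}"
      then have "(\<lambda>x. x i) \<in> measurable (PiM {1..Suc n} (\<lambda>_. lborel)) (lborel :: real measure)"
        by (intro measurable_component_singleton)
      then show "(\<lambda>x. y i (x i)) \<in> borel_measurable (PiM {1..Suc n} (\<lambda>_. lborel))"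
        using measurable_compose[OF _ meas[of i]] by simp
    qed
    show "\<bar>\<Prod>i\<in>{1..Suc n}. y i (x i)\<bar> \<le> (\<Prod>i\<in>{1..Suc n}. L)" for x
      unfolding abs_prod using bd by (intro prod_mono) auto
  qed auto
  have "?J (Suc n) u = (LINT v|lborel. LINT x|PiM {1..n} (\<lambda>_. lborel).
     indicator (osimplex s u (Suc n) {1..Suc n}) (x(Suc n := v)) * (\<Prod>i\<in>{1..Suc n}. y i ((x(Suc n := v)) i)))"
    using int unfolding ins by (intro product_integral_insert_rev) auto
  also have "\<dots> = (LINT v|lborel. indicator {s<..<u} v *\<^sub>R (nested_int y s n v * y (Suc n) v))"
  proof (intro Bochner_Integration.integral_cong refl)
    fix v :: real
    have pr: "(\<Prod>i\<in>{1..Suc n}. y i ((x(Suc n := v)) i)) = y (Suc n) v * (\<Prod>i\<in>{1..n}. y i (x i))" for x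
      unfolding ins by (subst prod.insert) (auto intro!: prod.cong)
    \<comment> \<open>For \<open>v\<close> below \<open>s\<close> the inner simplex is empty, which
      cuts the outer integral down to the interval from \<open>s\<close> to
      \<open>u\<close>.\<close>
    have em: "osimplex s v n {1..n} = {}" if "v \<le> s"
      using that by (auto simp: osimplex_def dest: strict_mono_onD[of _ _ 0 "Suc n"])
    have "(LINT x|PiM {1..n} (\<lambda>_. lborel). indicator (osimplex s u (Suc n) {1..Suc n}) (x(Suc n := v)) *
        (\<Prod>i\<in>{1..Suc n}. y i ((x(Suc n := v)) i))) =
      (LINT x|PiM {1..n} (\<lambda>_. lborel). (indicator {s<..<u} v * y (Suc n) v) *
         (indicator (osimplex s v n {1..n}) x * (\<Prod>i\<in>{1..n}. y i (x i))))"
      unfolding pr using em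
      by (intro Bochner_Integration.integral_cong refl)
         (auto simp: osimplex_Suc_iff indicator_def not_less simp del: One_nat_def)
    also have "\<dots> = (indicator {s<..<u} v * y (Suc n) v) * ?J n v" by simp
    also have "\<dots> = indicator {s<..<u} v *\<^sub>R (nested_int y s n v * y (Suc n) v)"
      using Suc.IH[of v] by (auto simp: indicator_def)
    finally show "(LINT x|PiM {1..n} (\<lambda>_. lborel). indicator (osimplex s u (Suc n) {1..Suc n}) (x(Suc n := v)) *
        (\<Prod>i\<in>{1..Suc n}. y i ((x(Suc n := v)) i))) =
        indicator {s<..<u} v *\<^sub>R (nested_int y s n v * y (Suc n) v)" .
  qed
  also have "\<dots> = integral {s<..<u} (\<lambda>v. nested_int y s n v * y (Suc n) v)"
  proof -
    have "set_integrable lborel {s..u} (\<lambda>v. nested_int y s n v * y (Suc n) v)"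
      using continuous_on_nested_int[of y L s u n] meas bd by (intro set_integrable_continuous_times) auto
    then have "set_integrable lborel {s<..<u} (\<lambda>v. nested_int y s n v * y (Suc n) v)"
      by (rule set_integrable_subset) auto
    from set_borel_integral_eq_integral(2)[OF this] show ?thesis
      by (simp add: set_lebesgue_integral_def)
  qed
  finally show ?case by (simp add: integral_open_interval_real)
qed

section \<open>Interpolation and slopes on the uniform grid of \<open>[s, t]\<close>\<close>

locale interval =
  fixes s t :: real
  assumes st: "s < t"
begin

definition h :: "nat \<Rightarrow> real" where "h N = (t - s) / real (Suc N)"

definition node :: "nat \<Rightarrow> nat \<Rightarrow> real" where "node N k = s + real k * h N"

text \<open>The last cell is closed on the right, so that \<open>cell N t = N\<close>.\<close>

definition cell :: "nat \<Rightarrow> real \<Rightarrow> nat" where "cell N u = min N (nat \<lfloor>(u - s) / h N\<rfloor>)"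

definition pl :: "nat \<Rightarrow> (real \<Rightarrow> real) \<Rightarrow> real \<Rightarrow> real" where
  "pl N x u = x (node N (cell N u)) +
     (u - node N (cell N u)) / h N * (x (node N (Suc (cell N u))) - x (node N (cell N u)))"

definition slope :: "nat \<Rightarrow> (real \<Rightarrow> real) \<Rightarrow> real \<Rightarrow> real" where
  "slope N x u = (x (node N (Suc (cell N u))) - x (node N (cell N u))) / h N"

lemma h_pos: "h N > 0" using st by (simp add: h_def)

lemma node_0 [simp]: "node N 0 = s" and node_last [simp]: "node N (Suc N) = t"
  using st by (simp_all add: node_def h_def del: of_nat_Suc)

lemma node_Suc: "node N (Suc k) = node N k + h N" by (simp add: node_def algebra_simps)

lemma node_mono: "k \<le> l \<Longrightarrow> node N k \<le> node N l"
  using h_pos[of N] by (simp add: node_def mult_right_mono)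

lemma node_less: "k < l \<Longrightarrow> node N k < node N l"
  using h_pos[of N] by (simp add: node_def)

lemma node_bounds: "k \<le> Suc N \<Longrightarrow> s \<le> node N k" "k \<le> Suc N \<Longrightarrow> node N k \<le> t"
  using node_mono[of 0 k N] node_mono[of k "Suc N" N] by auto

lemma cell_le: "cell N u \<le> N" by (simp add: cell_def)

lemma cell_eqI:
  assumes "k \<le> N" "node N k \<le> u" "u < node N (Suc k)"
  shows "cell N u = k"
proof -
  have "real k \<le> (u - s) / h N" "(u - s) / h N < real k + 1"
    using assms h_pos[of N] by (auto simp: node_def field_simps)
  then have "\<lfloor>(u - s) / h N\<rfloor> = int k" by (simp add: floor_eq_iff)
  then show ?thesis using assms(1) by (simp add: cell_def)
qed

lemma cell_exists:
  assumes "s \<le> u" "u < t"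
  obtains k where "k \<le> N" "node N k \<le> u" "u < node N (Suc k)" "cell N u = k"
proof -
  define k where "k = nat \<lfloor>(u - s) / h N\<rfloor>"
  have nn: "0 \<le> (u - s) / h N" using assms h_pos[of N] by simp
  have "real k \<le> (u - s) / h N" "(u - s) / h N < real k + 1" unfolding k_def using nn by linarith+
  then have k: "node N k \<le> u" "u < node N (Suc k)"
    using h_pos[of N] by (auto simp: node_def field_simps)
  have "k \<le> N"
  proof (rule ccontr)
    assume "\<not> k \<le> N"
    then have "t \<le> node N k" using node_mono[of "Suc N" k N] by simp
    then show False using k assms by simp
  qed
  then show ?thesis using k cell_eqI that by blast
qed

lemma cell_last: "cell N t = N"
proof -
  have "(t - s) / h N = real (Suc N)" using st by (simp add: h_def del: of_nat_Suc)
  then have "nat \<lfloor>(t - s) / h N\<rfloor> = Suc N" by (simp only: floor_of_nat nat_int)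
  then show ?thesis by (simp add: cell_def)
qed

lemma cell_bounds:
  assumes "s \<le> u" "u \<le> t"
  shows "node N (cell N u) \<le> u" "u \<le> node N (Suc (cell N u))"
    "u < t \<Longrightarrow> u < node N (Suc (cell N u))"
proof -
  have "node N (cell N u) \<le> u \<and> u \<le> node N (Suc (cell N u)) \<and>
    (u < t \<longrightarrow> u < node N (Suc (cell N u)))"
  proof (cases "u = t")
    case True
    then show ?thesis using node_bounds[of N N] by (simp add: cell_last)
  next
    case False
    then have "u < t" using assms by simp
    with assms(1) show ?thesis by (rule cell_exists[of u N]) simp
  qed
  then show "node N (cell N u) \<le> u" "u \<le> node N (Suc (cell N u))"
    "u < t \<Longrightarrow> u < node N (Suc (cell N u))" by auto
qed

lemma cell_mono: "u \<le> v \<Longrightarrow> cell N u \<le> cell N v"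
proof -
  assume "u \<le> v"
  then have "(u - s) / h N \<le> (v - s) / h N" using h_pos[of N] by (intro divide_right_mono) auto
  then have "nat \<lfloor>(u - s) / h N\<rfloor> \<le> nat \<lfloor>(v - s) / h N\<rfloor>" by (intro nat_mono floor_mono)
  then show ?thesis by (auto simp: cell_def)
qed

lemma measurable_cell [measurable]: "cell N \<in> measurable borel (count_space UNIV)"
proof -
  have "(\<lambda>u. \<lfloor>(u - s) / h N\<rfloor>) \<in> measurable borel (count_space UNIV)"
    by (rule measurable_compose[OF _ measurable_real_floor]) simp
  then have "(\<lambda>u. min N (nat \<lfloor>(u - s) / h N\<rfloor>)) \<in> measurable borel (count_space UNIV)"
    by (rule measurable_compose) simp
  then show ?thesis by (simp add: cell_def[abs_def])
qed

text \<open>At the right end of a cell other than the last, \<open>cell\<close> already returns the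
  next index. Both affine formulas give the nodal value there, so cells may be treated as
  closed.\<close>

lemma pl_closed_cell:
  assumes k: "k \<le> N" and "node N k \<le> u" "u \<le> node N (Suc k)"
  shows "pl N x u = x (node N k) + (u - node N k) / h N * (x (node N (Suc k)) - x (node N k))"
proof (cases "u < node N (Suc k)")
  case True
  then show ?thesis using cell_eqI[OF k assms(2)] by (simp add: pl_def)
next
  case False
  then have u: "u = node N (Suc k)" using assms by simp
  show ?thesis
  proof (cases "k = N")
    case True
    then have "u = t" using u by simp
    then show ?thesis using True by (simp add: pl_def cell_last)
  next
    case False
    then have "Suc k \<le> N" using k by simp
    then have "cell N u = Suc k" using u h_pos[of N] by (intro cell_eqI) (auto simp: node_Suc[of N "Suc k"])
    then show ?thesis using u h_pos[of N] by (simp add: pl_def node_Suc[of N k])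
  qed
qed

lemma pl_node: "k \<le> Suc N \<Longrightarrow> pl N x (node N k) = x (node N k)"
proof (cases k)
  case 0
  then show ?thesis using pl_closed_cell[of 0 N "node N 0" x] node_mono[of 0 "Suc 0" N] by simp
next
  case (Suc j)
  assume "k \<le> Suc N"
  then show ?thesis using Suc pl_closed_cell[of j N "node N k" x] node_mono[of j k N] h_pos[of N]
    by (simp add: node_Suc)
qed

lemma slope_has_integral_cell:
  assumes "k \<le> N" "node N k \<le> a" "a \<le> b" "b \<le> node N (Suc k)"
  shows "(slope N x has_integral (pl N x b - pl N x a)) {a..b}"
proof -
  let ?c = "(x (node N (Suc k)) - x (node N k)) / h N"
  have "((\<lambda>_. ?c) has_integral (b - a) *\<^sub>R ?c) {a..b}"
    using has_integral_const_real[of ?c a b] assms by simp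
  then have "(slope N x has_integral (b - a) *\<^sub>R ?c) {a..b}"
  proof (rule has_integral_spike[of "{b}", rotated 2])
    fix u assume "u \<in> {a..b} - {b}"
    then have "cell N u = k" using assms by (intro cell_eqI) auto
    then show "slope N x u = ?c" by (simp add: slope_def)
  qed auto
  moreover have "(b - a) *\<^sub>R ?c = pl N x b - pl N x a"
    using assms h_pos[of N] by (simp add: pl_closed_cell[OF assms(1)] field_simps)
  ultimately show ?thesis by simp
qed

lemma slope_has_integral_from_start:
  assumes "k \<le> Suc N" "s \<le> b" "b \<le> node N k"
  shows "(slope N x has_integral (pl N x b - pl N x s)) {s..b}"
  using assms
proof (induction k arbitrary: b)
  case 0
  then have "b = s" by simp
  then show ?case using has_integral_refl(2)[of "slope N x" s] by simp
next
  case (Suc k)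
  show ?case
  proof (cases "b \<le> node N k")
    case True
    then show ?thesis using Suc by auto
  next
    case False
    have 1: "(slope N x has_integral (pl N x (node N k) - pl N x s)) {s..node N k}"
      using Suc.prems(1) node_bounds(1)[of k N] by (intro Suc.IH) simp_all
    have 2: "(slope N x has_integral (pl N x b - pl N x (node N k))) {node N k..b}"
      using Suc.prems False by (intro slope_has_integral_cell[of k]) simp_all
    have "s \<le> node N k" "node N k \<le> b" using node_bounds[of k N] Suc.prems False by simp_all
    from has_integral_combine[OF this 1 2] show ?thesis by simp
  qed
qed

lemma slope_has_integral:
  assumes "s \<le> a" "a \<le> b" "b \<le> t"
  shows "(slope N x has_integral (pl N x b - pl N x a)) {a..b}"
proof -
  have A: "(slope N x has_integral (pl N x a - pl N x s)) {s..a}"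
    and B: "(slope N x has_integral (pl N x b - pl N x s)) {s..b}"
    using slope_has_integral_from_start[of "Suc N" N a] slope_has_integral_from_start[of "Suc N" N b] assms
    by simp_all
  have "slope N x integrable_on {a..b}"
    by (rule integrable_on_subinterval[OF has_integral_integrable[OF B]]) (use assms in auto)
  then have C: "(slope N x has_integral integral {a..b} (slope N x)) {a..b}"
    by (rule integrable_integral)
  have "integral {a..b} (slope N x) + (pl N x a - pl N x s) = pl N x b - pl N x s"
    using has_integral_unique[OF has_integral_combine[OF assms(1,2) A C] B] by simp
  then have "integral {a..b} (slope N x) = pl N x b - pl N x a" by linarith
  then show ?thesis using C by simp
qed

text \<open>Separates the time variable, entering through indicators of cells, from the path,
  entering through finitely many increments. Expectation and integration over the simplex can then
  be exchanged by linearity.\<close>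

lemma slope_sum: "slope N x u =
    (\<Sum>k\<le>N. of_bool (cell N u = k) * ((x (node N (Suc k)) - x (node N k)) / h N))"
proof -
  have "(\<Sum>k\<le>N. of_bool (cell N u = k) * ((x (node N (Suc k)) - x (node N k)) / h N)) =
     (\<Sum>k\<in>{cell N u}. (x (node N (Suc k)) - x (node N k)) / h N)"
    using cell_le by (intro sum.mono_neutral_cong_right) auto
  then show ?thesis by (simp add: slope_def)
qed

lemma measurable_slope: "slope N x \<in> borel_measurable borel"
proof -
  have "(\<lambda>u. (\<lambda>k. (x (node N (Suc k)) - x (node N k)) / h N) (cell N u)) \<in> borel_measurable borel"
    by (rule measurable_compose[OF measurable_cell]) simp
  then show ?thesis by (simp add: slope_def[abs_def])
qed

lemma slope_bound: "\<bar>slope N x u\<bar> \<le> (\<Sum>k\<le>N. \<bar>(x (node N (Suc k)) - x (node N k)) / h N\<bar>)"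
proof -
  have "\<bar>slope N x u\<bar> = \<bar>(x (node N (Suc (cell N u))) - x (node N (cell N u))) / h N\<bar>"
    by (simp add: slope_def)
  also have "\<dots> \<le> (\<Sum>k\<le>N. \<bar>(x (node N (Suc k)) - x (node N k)) / h N\<bar>)"
    using cell_le by (intro member_le_sum) auto
  finally show ?thesis .
qed

end

section \<open>Covariance increments on a uniform grid\<close>

text \<open>For exponents between -2 and 0, underestimating a length by a factor \<open>c\<close>
  costs at most the square of \<open>c\<close>. It is applied with \<open>c = 3\<close>, the origin
  of every 9 below.\<close>

lemma powr_scale_bound:
  fixes x y c e :: real
  assumes "0 < x" "x \<le> c * y" "1 \<le> c" "-2 \<le> e" "e \<le> 0"
  shows "y powr e \<le> c\<^sup>2 * x powr e"
proof -
  have y: "x / c \<le> y" "0 < x / c" using assms by (auto simp: field_simps)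
  then have "y powr e \<le> (x / c) powr e" using assms by (intro powr_mono2') auto
  also have "\<dots> = c powr (- e) * x powr e" using assms by (simp add: powr_divide powr_minus_divide)
  also have "c powr (- e) \<le> c powr 2" using assms by (intro powr_mono) auto
  also have "c powr 2 = c\<^sup>2" using assms by simp
  finally show ?thesis by (simp add: mult_right_mono)
qed

text \<open>Made for mean value points: the evaluation points are unknown, but they lie within the
  mesh of the limit point, and continuity there suffices.\<close>

lemma tendsto_of_nearby_values:
  fixes F :: "real \<Rightarrow> real \<Rightarrow> real"
  assumes cont: "isCont (\<lambda>p. F (fst p) (snd p)) (u, v)" and d: "d \<longlonglongrightarrow> 0"
    and ev: "\<forall>\<^sub>F N in sequentially. \<exists>\<xi> \<eta>. \<bar>\<xi> - u\<bar> \<le> d N \<and> \<bar>\<eta> - v\<bar> \<le> d N \<and> f N = F \<xi> \<eta>"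
  shows "f \<longlonglongrightarrow> F u v"
proof (rule tendstoI)
  fix e :: real assume "e > 0"
  then obtain r where r: "r > 0" "\<And>p. dist p (u, v) < r \<Longrightarrow> dist (F (fst p) (snd p)) (F u v) < e"
    using cont unfolding continuous_at_eps_delta by (metis fst_conv snd_conv)
  have "\<forall>\<^sub>F N in sequentially. d N < r / 2"
    using order_tendstoD(2)[OF d, of "r / 2"] r(1) by simp
  then show "\<forall>\<^sub>F N in sequentially. dist (f N) (F u v) < e"
    using ev
  proof eventually_elim
    case (elim N)
    then obtain \<xi> \<eta> where *: "\<bar>\<xi> - u\<bar> \<le> d N" "\<bar>\<eta> - v\<bar> \<le> d N" "f N = F \<xi> \<eta>" by blast
    have "dist (\<xi>, \<eta>) (u, v) \<le> \<bar>\<xi> - u\<bar> + \<bar>\<eta> - v\<bar>"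
      using sqrt_sum_squares_le_sum_abs[of "\<xi> - u" "\<eta> - v"] by (simp add: dist_prod_def dist_real_def)
    then have "dist (\<xi>, \<eta>) (u, v) < r" using * elim(1) by linarith
    then show ?case using r(2)[of "(\<xi>, \<eta>)"] * by simp
  qed
qed

text \<open>The analytic properties of the covariance, with \<open>H\<close> already lowered so that
  \<open>2 * H - 1\<close> is negative. \<open>R_incr\<close> concerns intervals of equal length,
  such as the cells of a uniform grid, and includes the case of coinciding or overlapping
  intervals.\<close>

locale cov_bounds = interval s t for s t :: real +
  fixes R :: "real \<Rightarrow> real \<Rightarrow> real" and T H C :: real
  assumes H: "1 / 4 < H" "H < 1 / 2" and C: "0 \<le> C"
    and s0: "0 \<le> s" and tT: "t \<le> T"
    and R_cont: "continuous_on ({0..T} \<times> {0..T}) (\<lambda>(x, y). R x y)"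
    and R_sym: "\<And>x y. x \<in> {0..T} \<Longrightarrow> y \<in> {0..T} \<Longrightarrow> R x y = R y x"
    and R_zero: "\<And>y. y \<in> {0..T} \<Longrightarrow> R 0 y = 0"
    and R_incr: "\<And>a b c d. 0 \<le> a \<Longrightarrow> a \<le> b \<Longrightarrow> b \<le> T \<Longrightarrow> 0 \<le> c \<Longrightarrow> c \<le> d \<Longrightarrow> d \<le> T \<Longrightarrow> b - a = d - c \<Longrightarrow>
      \<bar>R b d - R b c - R a d + R a c\<bar> \<le> C * (b - a) powr (2 * H)"
    and pd2_diff: "\<And>x y. x \<in> {0..T} \<Longrightarrow> y \<in> {0<..<T} \<Longrightarrow> x \<noteq> y \<Longrightarrow> (\<lambda>v. R x v) differentiable (at y)"
    and pd2_cont: "continuous_on {(x, y). 0 < x \<and> x < y \<and> y < T} (\<lambda>(x, y). pd2 R x y)"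
    and pd12_diff: "\<And>x y. 0 < x \<Longrightarrow> x < y \<Longrightarrow> y < T \<Longrightarrow> (\<lambda>x. pd2 R x y) differentiable (at x)"
    and pd12_cont: "continuous_on {(x, y). 0 < x \<and> x < y \<and> y < T} (\<lambda>(x, y). pd12 R x y)"
    and var_diff: "\<And>y. y \<in> {0<..<T} \<Longrightarrow> (\<lambda>v. R v v) differentiable (at y)"
    and dvar_cont: "continuous_on {0<..<T} (deriv (\<lambda>v. R v v))"
    and pd12_bound: "\<And>x y. 0 < x \<Longrightarrow> x < y \<Longrightarrow> y < T \<Longrightarrow> \<bar>pd12 R x y\<bar> \<le> C * (y - x) powr (2 * H - 2)"
    and drift_bound: "\<And>x y. 0 \<le> x \<Longrightarrow> x < y \<Longrightarrow> y < T \<Longrightarrow>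
      \<bar>1 / 2 * deriv (\<lambda>v. R v v) y - pd2 R x y\<bar> \<le> C * (y - x) powr (2 * H - 1)"
begin

lemma T_pos: "0 < T" using st s0 tT by linarith

lemma open_triangle: "open {(x, y). 0 < x \<and> x < y \<and> y < (T::real)}"
proof -
  have "{(x, y). 0 < x \<and> x < y \<and> y < T} =
     {p. 0 < fst p} \<inter> {p. fst p < snd p} \<inter> {p. snd p < T}" by auto
  then show ?thesis
    by (simp only:) (intro open_Int open_Collect_less continuous_intros)
qed

lemma R_tendsto:
  assumes "a \<longlonglongrightarrow> x" "b \<longlonglongrightarrow> y" "\<And>k. a k \<in> {0..T}" "\<And>k. b k \<in> {0..T}" "x \<in> {0..T}" "y \<in> {0..T}"
  shows "(\<lambda>k::nat. R (a k) (b k)) \<longlonglongrightarrow> R x y"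
  using continuous_on_tendsto_compose[OF R_cont tendsto_Pair[OF assms(1,2)]] assms(3-) by simp

lemma isCont_pd12: "0 < x \<Longrightarrow> x < y \<Longrightarrow> y < T \<Longrightarrow> isCont (\<lambda>p. pd12 R (fst p) (snd p)) (x, y)"
  using continuous_on_interior[OF pd12_cont, of "(x, y)"] open_triangle
  by (simp add: interior_open case_prod_unfold)

definition drift :: "real \<Rightarrow> real \<Rightarrow> real" where
  "drift x y = 1 / 2 * deriv (\<lambda>v. R v v) y - pd2 R x y"

lemma isCont_dvar: "0 < y \<Longrightarrow> y < T \<Longrightarrow> isCont (deriv (\<lambda>v. R v v)) y"
  using continuous_on_interior[OF dvar_cont, of y] by (simp add: interior_open)

lemma isCont_drift: "0 < x \<Longrightarrow> x < y \<Longrightarrow> y < T \<Longrightarrow> isCont (\<lambda>p. drift (fst p) (snd p)) (x, y)"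
proof -
  assume *: "0 < x" "x < y" "y < T"
  have 1: "isCont (\<lambda>p. pd2 R (fst p) (snd p)) (x, y)"
    using continuous_on_interior[OF pd2_cont, of "(x, y)"] open_triangle *
    by (simp add: interior_open case_prod_unfold)
  have 2: "isCont (\<lambda>p. deriv (\<lambda>v. R v v) (snd p)) (x, y)"
    by (rule isCont_o2[where f = snd]) (use * isCont_dvar[of y] in \<open>auto intro!: continuous_intros\<close>)
  show ?thesis unfolding drift_def by (intro continuous_intros 1 2)
qed

text \<open>The point \<open>x = 0\<close> lies outside the open triangle on which
  \<open>isCont_drift\<close> holds; there \<open>R 0\<close> vanishes identically and so does its
  derivative.\<close>

lemma drift_zero: "0 < y \<Longrightarrow> y < T \<Longrightarrow> drift 0 y = 1 / 2 * deriv (\<lambda>v. R v v) y"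
proof -
  assume *: "0 < y" "y < T"
  have "((\<lambda>v. R 0 v) has_real_derivative 0) (at y)"
    by (rule has_field_derivative_transform_within_open[of "\<lambda>_. 0" 0 y "{0<..<T}"])
       (use * R_zero in auto)
  then show ?thesis by (simp add: drift_def pd2_def DERIV_imp_deriv)
qed

text \<open>The covariance of the increments over \<open>[a, b]\<close> and \<open>[c, d]\<close> of
  one component.\<close>

definition rect :: "real \<Rightarrow> real \<Rightarrow> real \<Rightarrow> real \<Rightarrow> real" where
  "rect a b c d = R b d - R b c - R a d + R a c"

text \<open>The mean value theorem twice: in the second argument for the difference of the sections
  at \<open>b\<close> and \<open>a\<close>, then in the first argument for
  \<open>pd2 R\<close>.\<close>

lemma rect_mean_value:
  assumes "0 < a" "a < b" "b < c" "c < d" "d < T"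
  shows "\<exists>\<xi>\<in>{a<..<b}. \<exists>\<eta>\<in>{c<..<d}. rect a b c d = (b - a) * (d - c) * pd12 R \<xi> \<eta>"
proof -
  have D: "((\<lambda>v. R x v) has_real_derivative pd2 R x y) (at y)" if "x \<in> {a, b}" "c \<le> y" "y \<le> d" for x y
    using pd2_diff[of x y] that assms unfolding pd2_def
    by (subst DERIV_deriv_iff_real_differentiable) auto
  obtain \<eta> where \<eta>: "c < \<eta>" "\<eta> < d"
    "(R b d - R a d) - (R b c - R a c) = (d - c) * (pd2 R b \<eta> - pd2 R a \<eta>)"
    using MVT2[of c d "\<lambda>y. R b y - R a y" "\<lambda>y. pd2 R b y - pd2 R a y"] D assms
    by (auto intro!: DERIV_diff)
  have D2: "((\<lambda>x. pd2 R x \<eta>) has_real_derivative pd12 R x \<eta>) (at x)" if "a \<le> x" "x \<le> b" for x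
    using pd12_diff[of x \<eta>] that assms \<eta> unfolding pd12_def pd1_def
    by (subst DERIV_deriv_iff_real_differentiable) auto
  obtain \<xi> where \<xi>: "a < \<xi>" "\<xi> < b" "pd2 R b \<eta> - pd2 R a \<eta> = (b - a) * pd12 R \<xi> \<eta>"
    using MVT2[of a b "\<lambda>x. pd2 R x \<eta>" "\<lambda>x. pd12 R x \<eta>"] D2 assms by auto
  have "rect a b c d = (b - a) * (d - c) * pd12 R \<xi> \<eta>"
    using \<eta>(3) \<xi>(3) by (simp add: rect_def algebra_simps)
  then show ?thesis using \<xi> \<eta> by (intro bexI[of _ \<xi>] bexI[of _ \<eta>]) auto
qed

lemma rect_bound_interior:
  assumes "0 < a" "a < b" "b < c" "c < d" "d < T"
  shows "\<bar>rect a b c d\<bar> \<le> (b - a) * (d - c) * (C * (c - b) powr (2 * H - 2))"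
proof -
  obtain \<xi> \<eta> where *: "a < \<xi>" "\<xi> < b" "c < \<eta>" "\<eta> < d" "rect a b c d = (b - a) * (d - c) * pd12 R \<xi> \<eta>"
    using rect_mean_value[OF assms] by auto
  have "\<bar>pd12 R \<xi> \<eta>\<bar> \<le> C * (\<eta> - \<xi>) powr (2 * H - 2)" using * assms by (intro pd12_bound) auto
  also have "\<dots> \<le> C * (c - b) powr (2 * H - 2)"
    using * assms C H by (intro mult_left_mono powr_mono2') auto
  finally show ?thesis using * assms by (simp add: abs_mult mult_left_mono)
qed

text \<open>The derivative bounds are available only inside the open triangle. Rectangles touching
  \<open>0\<close> or \<open>T\<close> are reached from inside, by continuity of
  \<open>R\<close>.\<close>

lemma rect_bound:
  assumes "0 \<le> a" "a < b" "b < c" "c < d" "d \<le> T"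
  shows "\<bar>rect a b c d\<bar> \<le> (b - a) * (d - c) * (C * (c - b) powr (2 * H - 2))"
proof -
  define a' where "a' k = a + (b - a) * (1 / (real k + 2))" for k :: nat
  define d' where "d' k = d - (d - c) * (1 / (real k + 2))" for k :: nat
  have lim: "(\<lambda>k. 1 / (real k + 2)) \<longlonglongrightarrow> 0" by real_asymp
  have fr: "0 < 1 / (real k + 2)" "1 / (real k + 2) < 1" for k by auto
  have a': "a < a' k" "a' k < b" for k
    using mult_strict_left_mono[OF fr(2), of "b - a" k] mult_pos_pos[OF _ fr(1), of "b - a" k] assms
    by (simp_all add: a'_def)
  have d': "d' k < d" "c < d' k" for k
    using mult_strict_left_mono[OF fr(2), of "d - c" k] mult_pos_pos[OF _ fr(1), of "d - c" k] assms
    by (simp_all add: d'_def)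
  have la: "a' \<longlonglongrightarrow> a" unfolding a'_def using tendsto_add[OF tendsto_const tendsto_mult[OF tendsto_const lim]] by simp
  have ld: "d' \<longlonglongrightarrow> d" unfolding d'_def using tendsto_diff[OF tendsto_const tendsto_mult[OF tendsto_const lim]] by simp
  have in1: "a' k \<in> {0..T}" "d' k \<in> {0..T}" for k using a'[of k] d'[of k] assms by auto
  have lim': "(\<lambda>k. \<bar>rect (a' k) b c (d' k)\<bar>) \<longlonglongrightarrow> \<bar>rect a b c d\<bar>"
    unfolding rect_def using assms in1
    by (intro tendsto_rabs tendsto_add tendsto_diff R_tendsto la ld tendsto_const) auto
  moreover have "\<bar>rect (a' k) b c (d' k)\<bar> \<le> (b - a) * (d - c) * (C * (c - b) powr (2 * H - 2))" for k
  proof -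
    have "\<bar>rect (a' k) b c (d' k)\<bar> \<le> (b - a' k) * (d' k - c) * (C * (c - b) powr (2 * H - 2))"
      using a'[of k] d'[of k] assms by (intro rect_bound_interior) auto
    also have "\<dots> \<le> (b - a) * (d - c) * (C * (c - b) powr (2 * H - 2))"
      using a'[of k] d'[of k] assms C by (intro mult_right_mono mult_mono) auto
    finally show ?thesis .
  qed
  ultimately show ?thesis by (intro LIMSEQ_le_const2[OF lim']) auto
qed

text \<open>The covariance of the slopes, at times \<open>u\<close> and \<open>v\<close>, of one
  component of the interpolated path; the discrete counterpart of \<open>pd12 R\<close>.\<close>

definition rhoN :: "nat \<Rightarrow> real \<Rightarrow> real \<Rightarrow> real" where
  "rhoN N u v = slope N (\<lambda>x. slope N (R x) v) u"

lemma rhoN_rect: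
  "rhoN N u v = rect (node N (cell N u)) (node N (Suc (cell N u)))
     (node N (cell N v)) (node N (Suc (cell N v))) / (h N)\<^sup>2"
  using less_imp_neq[OF h_pos, of N] by (simp add: rhoN_def slope_def rect_def power2_eq_square field_simps)

lemma cell_nodes: "0 \<le> node N (cell N u)" "node N (Suc (cell N u)) \<le> T"
  "node N (cell N u) \<le> T" "0 \<le> node N (Suc (cell N u))"
  using node_bounds[of "cell N u" N] node_bounds[of "Suc (cell N u)" N] cell_le[of N u] s0 tT by auto

lemma rect_cells_le: "\<bar>rect (node N (cell N u)) (node N (Suc (cell N u)))
     (node N (cell N v)) (node N (Suc (cell N v)))\<bar> \<le> C * h N powr (2 * H)"
  using R_incr[of "node N (cell N u)" "node N (Suc (cell N u))" "node N (cell N v)" "node N (Suc (cell N v))"]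
    cell_nodes[of N u] cell_nodes[of N v] h_pos[of N]
  by (simp add: node_Suc rect_def)

lemma powr_diff_nat: "x > 0 \<Longrightarrow> x powr a / x\<^sup>2 = x powr (a - 2)" "x > 0 \<Longrightarrow> x powr a / x = x powr (a - 1)"
  for x a :: real by (simp_all add: powr_diff)

lemma rhoN_le_mesh: "\<bar>rhoN N u v\<bar> \<le> C * h N powr (2 * H - 2)"
proof -
  have "\<bar>rhoN N u v\<bar> \<le> C * h N powr (2 * H) / (h N)\<^sup>2"
    unfolding rhoN_rect abs_divide using rect_cells_le[of N u v] h_pos[of N] by (simp add: divide_right_mono)
  also have "\<dots> = C * h N powr (2 * H - 2)" 
    unfolding powr_diff_nat(1)[OF h_pos, of N "2 * H", symmetric] by simp
  finally show ?thesis .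
qed

text \<open>If the cells coincide or touch, \<open>v - u\<close> is of order \<open>h N\<close> and
  the mesh bound is enough. Otherwise the cells are \<open>(j + 1) * h N\<close> apart while
  \<open>v - u\<close> is at most \<open>(j + 3) * h N\<close>, so the gap is at least a third of
  \<open>v - u\<close> and \<open>rect_bound\<close> applies.\<close>

lemma rhoN_le:
  assumes "s \<le> u" "u < v" "v < t"
  shows "\<bar>rhoN N u v\<bar> \<le> 9 * C * (v - u) powr (2 * H - 2)"
proof -
  obtain k where k: "node N k \<le> u" "u < node N (Suc k)" "cell N u = k" "k \<le> N"
    using assms cell_exists[of u N] by auto
  obtain l where l: "node N l \<le> v" "v < node N (Suc l)" "cell N v = l" "l \<le> N"
    using assms cell_exists[of v N] by auto
  have kl: "k \<le> l" using cell_mono[of u v N] assms k l by auto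
  show ?thesis
  proof (cases "l \<le> Suc k")
    case True
    then have "node N (Suc l) \<le> node N (Suc (Suc k))" by (intro node_mono) auto
    then have "v - u \<le> 3 * h N" using k l h_pos[of N] by (simp add: node_Suc)
    then have "h N powr (2 * H - 2) \<le> 3\<^sup>2 * (v - u) powr (2 * H - 2)"
      using assms H by (intro powr_scale_bound) auto
    then have "C * h N powr (2 * H - 2) \<le> C * (9 * (v - u) powr (2 * H - 2))"
      using C by (intro mult_left_mono) auto
    then show ?thesis using rhoN_le_mesh[of N u v] by simp
  next
    case False
    then have "Suc (Suc k) \<le> l" by simp
    then obtain j where j: "l = Suc (Suc k) + j" using le_Suc_ex by blast
    have gap: "node N l - node N (Suc k) = (real j + 1) * h N" by (simp add: j node_def algebra_simps)
    have lt: "node N (Suc k) < node N l" using False by (intro node_less) auto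
    have b: "\<bar>rect (node N k) (node N (Suc k)) (node N l) (node N (Suc l))\<bar> \<le>
       h N * h N * (C * (node N l - node N (Suc k)) powr (2 * H - 2))"
      using rect_bound[of "node N k" "node N (Suc k)" "node N l" "node N (Suc l)"] lt
        cell_nodes[of N u] cell_nodes[of N v] k l h_pos[of N] by (simp add: node_Suc)
    have "v - u \<le> node N (Suc l) - node N k" using k l by simp
    also have "\<dots> = (real j + 3) * h N" by (simp add: j node_def algebra_simps)
    also have "\<dots> \<le> 3 * ((real j + 1) * h N)" using h_pos[of N] by (simp add: algebra_simps)
    finally have "v - u \<le> 3 * (node N l - node N (Suc k))" unfolding gap .
    then have p: "(node N l - node N (Suc k)) powr (2 * H - 2) \<le> 3\<^sup>2 * (v - u) powr (2 * H - 2)"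
      using assms H by (intro powr_scale_bound) auto
    have "\<bar>rhoN N u v\<bar> \<le> C * (node N l - node N (Suc k)) powr (2 * H - 2)"
      using b h_pos[of N] k l by (simp add: rhoN_rect power2_eq_square divide_le_eq mult_ac)
    also have "\<dots> \<le> C * (3\<^sup>2 * (v - u) powr (2 * H - 2))" using C p by (rule mult_left_mono[rotated])
    finally show ?thesis by simp
  qed
qed

lemma h_tendsto: "h \<longlonglongrightarrow> 0"
proof -
  have "(\<lambda>N. (t - s) / real (Suc N)) \<longlonglongrightarrow> 0" by real_asymp
  then show ?thesis by (simp add: h_def[abs_def])
qed

lemma eventually_h_less: "0 < e \<Longrightarrow> \<forall>\<^sub>F N in sequentially. h N < e"
  using order_tendstoD(2)[OF h_tendsto] .

lemma rhoN_tendsto: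
  assumes "s < u" "u < v" "v < t"
  shows "(\<lambda>N. rhoN N u v) \<longlonglongrightarrow> pd12 R u v"
proof (rule tendsto_of_nearby_values[where F = "pd12 R", OF _ h_tendsto])
  show "isCont (\<lambda>p. pd12 R (fst p) (snd p)) (u, v)" using assms s0 tT by (intro isCont_pd12) auto
  have "\<forall>\<^sub>F N in sequentially. h N < u - s" "\<forall>\<^sub>F N in sequentially. h N < (v - u) / 2"
    "\<forall>\<^sub>F N in sequentially. h N < t - v" using assms by (intro eventually_h_less; simp)+
  then show "\<forall>\<^sub>F N in sequentially. \<exists>\<xi> \<eta>. \<bar>\<xi> - u\<bar> \<le> h N \<and> \<bar>\<eta> - v\<bar> \<le> h N \<and> rhoN N u v = pd12 R \<xi> \<eta>"
  proof eventually_elim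
    case (elim N)
    obtain k where k: "node N k \<le> u" "u < node N (Suc k)" "cell N u = k" "k \<le> N"
      using assms cell_exists[of u N] by auto
    obtain l where l: "node N l \<le> v" "v < node N (Suc l)" "cell N v = l" "l \<le> N"
      using assms cell_exists[of v N] by auto
    \<comment> \<open>The three conditions on the mesh keep the cell of \<open>u\<close> away from
      \<open>s\<close>, the two cells apart, and the cell of \<open>v\<close> below
      \<open>t\<close>, so that the rectangle lies in the open triangle.\<close>
    have "\<exists>\<xi>\<in>{node N k<..<node N (Suc k)}. \<exists>\<eta>\<in>{node N l<..<node N (Suc l)}.
       rect (node N k) (node N (Suc k)) (node N l) (node N (Suc l)) =
       (node N (Suc k) - node N k) * (node N (Suc l) - node N l) * pd12 R \<xi> \<eta>"
      using k l elim assms s0 tT h_pos[of N] by (intro rect_mean_value) (auto simp: node_Suc)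
    then obtain \<xi> \<eta> where *: "\<xi> \<in> {node N k<..<node N (Suc k)}" "\<eta> \<in> {node N l<..<node N (Suc l)}"
      "rect (node N k) (node N (Suc k)) (node N l) (node N (Suc l)) = h N * h N * pd12 R \<xi> \<eta>"
      by (auto simp: node_Suc)
    have "rhoN N u v = pd12 R \<xi> \<eta>" using * k l h_pos[of N] by (simp add: rhoN_rect power2_eq_square)
    moreover have "\<bar>\<xi> - u\<bar> \<le> h N" "\<bar>\<eta> - v\<bar> \<le> h N" using * k l by (auto simp: node_Suc)
    ultimately show ?case by blast
  qed
qed

text \<open>In closed form, the integral of \<open>rhoN N u v\<close> over \<open>u\<close> from
  \<open>a\<close> to \<open>v\<close>: what remains of a consecutive pair after its smaller
  variable has been integrated out. Between different cells it does not converge pointwise, because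
  its value depends on the relative position of \<open>v\<close> in its cell.\<close>

definition gN :: "nat \<Rightarrow> real \<Rightarrow> real \<Rightarrow> real" where
  "gN N a v = pl N (\<lambda>x. slope N (R x) v) v - pl N (\<lambda>x. slope N (R x) v) a"

lemma rhoN_has_integral:
  assumes "s \<le> a" "a \<le> b" "b \<le> t"
  shows "((\<lambda>u. rhoN N u v) has_integral
     (pl N (\<lambda>x. slope N (R x) v) b - pl N (\<lambda>x. slope N (R x) v) a)) {a..b}"
  unfolding rhoN_def by (rule slope_has_integral[OF assms])

text \<open>\<open>fluct\<close> has mean zero on every cell; it is the part of \<open>gN\<close> that does not converge pointwise.\<close>

definition fluct :: "nat \<Rightarrow> real \<Rightarrow> real" where
  "fluct N v = ((v - node N (cell N v)) / h N - 1 / 2) *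
     (rect (node N (cell N v)) (node N (Suc (cell N v))) (node N (cell N v)) (node N (Suc (cell N v))) / h N)"

text \<open>Within one cell nothing is subtracted: there \<open>gN\<close> is explicit, bounded by
  the mesh power, and relevant only on an interval of length at most \<open>h N\<close>.\<close>

definition gmain :: "nat \<Rightarrow> real \<Rightarrow> real \<Rightarrow> real" where
  "gmain N a v = gN N a v - (if cell N a = cell N v then 0 else fluct N v)"

text \<open>The difference quotient over cell \<open>l\<close> of the function with value
  \<open>R y y / 2 - R x y\<close> at \<open>y\<close>, whose derivative is
  \<open>drift x\<close>.\<close>

definition wgt :: "nat \<Rightarrow> nat \<Rightarrow> real \<Rightarrow> real" where
  "wgt N l x = ((R (node N (Suc l)) (node N (Suc l)) - R (node N l) (node N l)) / 2
     - (R x (node N (Suc l)) - R x (node N l))) / h N"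

text \<open>Subtracting \<open>fluct\<close> replaces the relative position of \<open>v\<close> in
  its cell by 1/2, that is, by the average over the two ends of the cell; symmetry of
  \<open>R\<close> turns this average into half the increment of the variance. What remains
  interpolates \<open>wgt\<close> linearly in \<open>a\<close>.\<close>

lemma gmain_eq:
  assumes "cell N a \<noteq> cell N v"
  shows "gmain N a v = wgt N (cell N v) (node N (cell N a)) +
    (a - node N (cell N a)) / h N *
      (wgt N (cell N v) (node N (Suc (cell N a))) - wgt N (cell N v) (node N (cell N a)))"
proof -
  define x where "x = node N (cell N v)"
  define y where "y = node N (Suc (cell N v))"
  define p where "p = node N (cell N a)"
  define q where "q = node N (Suc (cell N a))"
  define \<theta> where "\<theta> = (v - x) / h N"
  define \<eta> where "\<eta> = (a - p) / h N"
  have sym: "R y x = R x y" using cell_nodes[of N v] by (auto simp: x_def y_def intro: R_sym)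
  have hp: "h N \<noteq> 0" using h_pos[of N] by simp
  show ?thesis
    using assms unfolding gmain_def gN_def fluct_def wgt_def pl_def slope_def rect_def
    unfolding x_def[symmetric] y_def[symmetric] p_def[symmetric] q_def[symmetric]
      \<theta>_def[symmetric] \<eta>_def[symmetric] sym
    using hp by (simp add: field_simps)
qed

lemma wgt_mean_value:
  assumes "0 \<le> x" "x < node N l" "l \<le> N"
  shows "\<exists>\<xi>. node N l < \<xi> \<and> \<xi> < node N (Suc l) \<and> wgt N l x = drift x \<xi>"
proof -
  let ?a = "node N l" and ?b = "node N (Suc l)"
  have ab: "?a < ?b" "0 \<le> ?a" "?b \<le> T" "0 < ?a"
    using node_less[of l "Suc l" N] node_bounds[of l N] node_bounds[of "Suc l" N] assms s0 tT by auto
  let ?f = "\<lambda>y. 1 / 2 * R y y - R x y"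
  have cont: "continuous_on {?a..?b} ?f"
  proof (intro continuous_intros)
    have "continuous_on {?a..?b} (\<lambda>y. (\<lambda>(x, y). R x y) (y, y))"
      by (rule continuous_on_compose2[OF R_cont]) (use ab in \<open>auto intro!: continuous_intros\<close>)
    then show "continuous_on {?a..?b} (\<lambda>y. R y y)" by simp
    have "continuous_on {?a..?b} (\<lambda>y. (\<lambda>(x, y). R x y) (x, y))"
      by (rule continuous_on_compose2[OF R_cont]) (use ab assms in \<open>auto intro!: continuous_intros\<close>)
    then show "continuous_on {?a..?b} (\<lambda>y. R x y)" by simp
  qed
  have D: "(?f has_real_derivative drift x y) (at y)" if "?a < y" "y < ?b" for y
  proof -
    have "((\<lambda>v. R v v) has_real_derivative deriv (\<lambda>v. R v v) y) (at y)"
      using var_diff[of y] that ab by (subst DERIV_deriv_iff_real_differentiable) auto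
    moreover have "((\<lambda>v. R x v) has_real_derivative pd2 R x y) (at y)"
      using pd2_diff[of x y] that ab assms unfolding pd2_def
      by (subst DERIV_deriv_iff_real_differentiable) auto
    ultimately show ?thesis unfolding drift_def by (intro DERIV_diff DERIV_cmult)
  qed
  then have "?f differentiable (at y)" if "?a < y" "y < ?b" for y
    using that real_differentiable_def by blast
  then obtain l' z where z: "?a < z" "z < ?b" "(?f has_real_derivative l') (at z)" "?f ?b - ?f ?a = (?b - ?a) * l'"
    using MVT[OF ab(1) cont] by blast
  have "l' = drift x z" using DERIV_unique[OF z(3) D] z by blast
  then have "wgt N l x = drift x z"
    using z(4) h_pos[of N] by (simp add: wgt_def node_Suc field_simps)
  then show ?thesis using z by blast
qed

lemma drift_le: "0 \<le> x \<Longrightarrow> x < y \<Longrightarrow> y < T \<Longrightarrow> \<bar>drift x y\<bar> \<le> C * (y - x) powr (2 * H - 1)"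
  using drift_bound by (simp add: drift_def)

lemma wgt_le:
  assumes "0 \<le> x" "x < node N l" "l \<le> N"
  shows "\<bar>wgt N l x\<bar> \<le> C * (node N l - x) powr (2 * H - 1)"
proof -
  obtain \<xi> where \<xi>: "node N l < \<xi>" "\<xi> < node N (Suc l)" "wgt N l x = drift x \<xi>"
    using wgt_mean_value[OF assms] by blast
  have "node N (Suc l) \<le> T" using node_bounds[of "Suc l" N] assms tT by auto
  then have "\<bar>wgt N l x\<bar> \<le> C * (\<xi> - x) powr (2 * H - 1)" using \<xi> assms by (auto intro: drift_le)
  also have "\<dots> \<le> C * (node N l - x) powr (2 * H - 1)"
    using \<xi> assms C H by (intro mult_left_mono powr_mono2') auto
  finally show ?thesis .
qed

lemma rect_same_cell_le: "\<bar>rect (node N (cell N v)) (node N (Suc (cell N v)))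
    (node N (cell N v)) (node N (Suc (cell N v))) / h N\<bar> \<le> C * h N powr (2 * H - 1)"
proof -
  have "\<bar>rect (node N (cell N v)) (node N (Suc (cell N v))) (node N (cell N v)) (node N (Suc (cell N v)))\<bar> / h N
      \<le> C * h N powr (2 * H) / h N"
    using rect_cells_le[of N v v] h_pos[of N] by (intro divide_right_mono) auto
  also have "\<dots> = C * h N powr (2 * H - 1)"
    unfolding powr_diff_nat(2)[OF h_pos, of N "2 * H", symmetric] by simp
  finally show ?thesis using h_pos[of N] by simp
qed

lemma fluct_le:
  assumes "s \<le> v" "v \<le> t"
  shows "\<bar>fluct N v\<bar> \<le> C * h N powr (2 * H - 1)"
proof -
  have "0 \<le> (v - node N (cell N v)) / h N" "(v - node N (cell N v)) / h N \<le> 1"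
    using cell_bounds[OF assms, of N] h_pos[of N] by (auto simp: node_Suc)
  then have "\<bar>(v - node N (cell N v)) / h N - 1 / 2\<bar> \<le> 1" by linarith
  then have "\<bar>fluct N v\<bar> \<le> 1 * (C * h N powr (2 * H - 1))"
    unfolding fluct_def abs_mult using rect_same_cell_le[of N v] by (intro mult_mono) auto
  then show ?thesis by simp
qed

text \<open>One length \<open>y\<close> serves both estimates that follow:
  \<open>h N \<le> y\<close> yields the mesh bound, and \<open>v - a \<le> 3 * y\<close> the
  singular one.\<close>

lemma gmain_aux:
  assumes "s \<le> a" "a < v" "v < t"
  shows "\<exists>y\<ge>h N. v - a \<le> 3 * y \<and> \<bar>gmain N a v\<bar> \<le> C * y powr (2 * H - 1)"
proof -
  define k where "k = cell N a"
  define l where "l = cell N v"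
  have k: "node N k \<le> a" "a < node N (Suc k)" "k \<le> N"
    using cell_bounds[of a N] cell_le[of N a] assms by (auto simp: k_def)
  have l: "node N l \<le> v" "v < node N (Suc l)" "l \<le> N"
    using cell_bounds[of v N] cell_le[of N v] assms by (auto simp: l_def)
  have kl: "k \<le> l" using cell_mono[of a v N] assms by (auto simp: k_def l_def)
  have n0: "0 \<le> node N k" "0 \<le> node N (Suc k)" using cell_nodes[of N a] by (auto simp: k_def)
  have hp: "0 < h N" by (rule h_pos)
  define \<theta> where "\<theta> = (a - node N k) / h N"
  have \<theta>: "0 \<le> \<theta>" "\<theta> \<le> 1" using k hp by (auto simp: \<theta>_def node_Suc)
  \<comment> \<open>Between different cells \<open>gmain\<close> is a convex combination of two
    values of \<open>wgt\<close>.\<close>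
  have conv: "\<bar>gmain N a v\<bar> \<le> B"
    if "k \<noteq> l" "\<bar>wgt N l (node N k)\<bar> \<le> B" "\<bar>wgt N l (node N (Suc k))\<bar> \<le> B" for B
  proof -
    have "gmain N a v = (1 - \<theta>) * wgt N l (node N k) + \<theta> * wgt N l (node N (Suc k))"
      using gmain_eq[of N a v] that(1) by (simp add: k_def l_def \<theta>_def algebra_simps)
    also have "\<bar>\<dots>\<bar> \<le> (1 - \<theta>) * \<bar>wgt N l (node N k)\<bar> + \<theta> * \<bar>wgt N l (node N (Suc k))\<bar>"
      using abs_triangle_ineq[of "(1 - \<theta>) * wgt N l (node N k)" "\<theta> * wgt N l (node N (Suc k))"] \<theta>
      by (simp add: abs_mult)
    also have "\<dots> \<le> (1 - \<theta>) * B + \<theta> * B" using that \<theta> by (intro add_mono mult_left_mono) auto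
    finally show ?thesis by (simp add: algebra_simps)
  qed
  consider "k = l" | "l = Suc k" | j where "l = Suc (Suc k) + j"
    using kl le_iff_add[of "Suc (Suc k)" l] by fastforce
  then show ?thesis
  proof cases
    case 1
    let ?q = "rect (node N l) (node N (Suc l)) (node N l) (node N (Suc l)) / h N"
    have "gmain N a v = (v - a) / h N * ?q"
      using 1 hp unfolding gmain_def gN_def pl_def slope_def rect_def k_def l_def
      by (simp add: field_simps)
    moreover have va: "0 \<le> (v - a) / h N" "(v - a) / h N \<le> 1" using 1 k l assms hp by (auto simp: node_Suc)
    moreover have "\<bar>?q\<bar> \<le> C * h N powr (2 * H - 1)" using rect_same_cell_le[of N v] by (simp add: l_def)
    ultimately have "\<bar>gmain N a v\<bar> \<le> 1 * (C * h N powr (2 * H - 1))"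
      unfolding abs_mult by (simp only: abs_mult) (intro mult_mono; simp)
    moreover have "v - a \<le> 3 * h N" using va hp by (simp add: divide_le_eq)
    ultimately show ?thesis by (intro exI[of _ "h N"]) auto
  next
    case 2
    have w1: "\<bar>wgt N l (node N k)\<bar> \<le> C * h N powr (2 * H - 1)"
      using wgt_le[of "node N k" N l] n0 l hp 2 by (simp add: node_Suc)
    \<comment> \<open>At the node shared by touching cells \<open>wgt_mean_value\<close> does not
      apply. By symmetry of \<open>R\<close> the value there is half the variance of the increment
      over the cell, divided by the mesh.\<close>
    have "wgt N l (node N l) = rect (node N l) (node N (Suc l)) (node N l) (node N (Suc l)) / h N / 2"
    proof -
      have "R (node N (Suc l)) (node N l) = R (node N l) (node N (Suc l))"
        using cell_nodes[of N v] by (intro R_sym) (auto simp: l_def)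
      then show ?thesis by (simp add: wgt_def rect_def field_simps)
    qed
    then have "\<bar>wgt N l (node N l)\<bar> =
        \<bar>rect (node N l) (node N (Suc l)) (node N l) (node N (Suc l)) / h N\<bar> / 2"
      by (simp only: abs_divide abs_numeral)
    also have "\<dots> \<le> \<bar>rect (node N l) (node N (Suc l)) (node N l) (node N (Suc l)) / h N\<bar>"
      using abs_ge_zero field_sum_of_halves le_add_same_cancel1 by (metis divide_nonneg_pos zero_less_numeral)
    also have "\<dots> \<le> C * h N powr (2 * H - 1)" using rect_same_cell_le[of N v] unfolding l_def .
    finally have w2: "\<bar>wgt N l (node N (Suc k))\<bar> \<le> C * h N powr (2 * H - 1)" using 2 by simp
    have "v - a \<le> 3 * h N" using k l 2 hp by (simp add: node_Suc)
    then show ?thesis using conv[OF _ w1 w2] 2 by (intro exI[of _ "h N"]) auto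
  next
    case 3
    define y where "y = node N l - node N (Suc k)"
    have y: "y = (real j + 1) * h N" by (simp add: y_def 3 node_def algebra_simps)
    have yh: "h N \<le> y" using hp by (simp add: y algebra_simps)
    have w2: "\<bar>wgt N l (node N (Suc k))\<bar> \<le> C * y powr (2 * H - 1)"
      unfolding y_def using node_less[of "Suc k" l N] 3 n0 l by (intro wgt_le) auto
    have "\<bar>wgt N l (node N k)\<bar> \<le> C * (node N l - node N k) powr (2 * H - 1)"
      using node_less[of k l N] 3 n0 l by (intro wgt_le) auto
    also have "\<dots> \<le> C * y powr (2 * H - 1)"
      using yh hp C H by (intro mult_left_mono powr_mono2') (auto simp: y_def node_Suc)
    finally have w1: "\<bar>wgt N l (node N k)\<bar> \<le> C * y powr (2 * H - 1)" .
    have "v - a \<le> node N (Suc l) - node N k" using k l by simp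
    also have "\<dots> = (real j + 3) * h N" by (simp add: 3 node_def algebra_simps)
    also have "\<dots> \<le> 3 * y" using hp by (simp add: y algebra_simps)
    finally show ?thesis using conv[OF _ w1 w2] 3 yh by (intro exI[of _ y]) auto
  qed
qed

lemma gmain_le_mesh:
  assumes "s \<le> a" "a < v" "v < t"
  shows "\<bar>gmain N a v\<bar> \<le> C * h N powr (2 * H - 1)"
proof -
  obtain y where y: "y \<ge> h N" "\<bar>gmain N a v\<bar> \<le> C * y powr (2 * H - 1)" using gmain_aux[OF assms] by blast
  have "C * y powr (2 * H - 1) \<le> C * h N powr (2 * H - 1)"
    using y h_pos[of N] H C by (intro mult_left_mono powr_mono2') auto
  then show ?thesis using y by linarith
qed

lemma gmain_le:
  assumes "s \<le> a" "a < v" "v < t"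
  shows "\<bar>gmain N a v\<bar> \<le> 9 * C * (v - a) powr (2 * H - 1)"
proof -
  obtain y where y: "y \<ge> h N" "v - a \<le> 3 * y" "\<bar>gmain N a v\<bar> \<le> C * y powr (2 * H - 1)"
    using gmain_aux[OF assms] by blast
  have "y powr (2 * H - 1) \<le> 3\<^sup>2 * (v - a) powr (2 * H - 1)"
    using y assms H by (intro powr_scale_bound) auto
  then have "C * y powr (2 * H - 1) \<le> C * (9 * (v - a) powr (2 * H - 1))"
    using C by (intro mult_left_mono) auto
  then show ?thesis using y by simp
qed

lemma gN_le_mesh:
  assumes "s \<le> a" "a < v" "v < t"
  shows "\<bar>gN N a v\<bar> \<le> 2 * C * h N powr (2 * H - 1)"
  using gmain_le_mesh[OF assms, of N] fluct_le[of v N] assms C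
  by (auto simp: gmain_def split: if_splits)

text \<open>Both values of \<open>wgt\<close> that \<open>gmain\<close> interpolates are values of
  \<open>drift\<close> at points within the mesh of \<open>(a, v)\<close>. Continuity of
  \<open>drift\<close> requires a positive first argument, so \<open>a = 0\<close> is treated
  separately.\<close>

lemma gmain_tendsto:
  assumes "s \<le> a" "a < v" "v < t"
  shows "(\<lambda>N. gmain N a v) \<longlonglongrightarrow> drift a v"
proof -
  define k where "k N = cell N a" for N
  define l where "l N = cell N v" for N
  have k: "node N (k N) \<le> a" "a < node N (Suc (k N))" "k N \<le> N" for N
    using cell_bounds[of a N] cell_le[of N a] assms by (auto simp: k_def)
  have l: "node N (l N) \<le> v" "v < node N (Suc (l N))" "l N \<le> N" for N
    using cell_bounds[of v N] cell_le[of N v] assms by (auto simp: l_def)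
  have n0: "0 \<le> node N (k N)" for N using cell_nodes[of N a] by (auto simp: k_def)
  define \<theta> where "\<theta> N = (a - node N (k N)) / h N" for N
  have \<theta>: "0 \<le> \<theta> N" "\<theta> N \<le> 1" for N
    using k[of N] h_pos[of N] by (auto simp: \<theta>_def node_Suc)
  have ev_sep: "\<forall>\<^sub>F N in sequentially. h N < (v - a) / 2"
    using assms by (intro eventually_h_less) auto
  have near: "\<exists>\<xi>. \<bar>\<xi> - v\<bar> \<le> h N \<and> wgt N (l N) x = drift x \<xi>"
    if x: "h N < (v - a) / 2" "0 \<le> x" "x \<le> a + h N" for N x
  proof -
    have "x < node N (l N)" using x l[of N] by (simp add: node_Suc)
    then obtain \<xi> where "node N (l N) < \<xi>" "\<xi> < node N (Suc (l N))" "wgt N (l N) x = drift x \<xi>"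
      using wgt_mean_value[of x N "l N"] x(2) l(3)[of N] by blast
    then show ?thesis using l[of N] by (intro exI[of _ \<xi>]) (auto simp: node_Suc)
  qed
  show ?thesis
  proof (cases "a = 0")
    case False
    then have a: "0 < a" using assms s0 by simp
    have iso: "isCont (\<lambda>p. drift (fst p) (snd p)) (a, v)"
      using a assms tT by (intro isCont_drift) auto
    have w1: "(\<lambda>N. wgt N (l N) (node N (k N))) \<longlonglongrightarrow> drift a v"
    proof (rule tendsto_of_nearby_values[OF iso h_tendsto])
      from ev_sep show "\<forall>\<^sub>F N in sequentially. \<exists>\<xi> \<eta>. \<bar>\<xi> - a\<bar> \<le> h N \<and> \<bar>\<eta> - v\<bar> \<le> h N \<and>
          wgt N (l N) (node N (k N)) = drift \<xi> \<eta>"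
      proof eventually_elim
      case (elim N)
      have "0 \<le> node N (k N)" "node N (k N) \<le> a + h N" "\<bar>node N (k N) - a\<bar> \<le> h N"
        using k[of N] n0[of N] h_pos[of N] by (auto simp: node_Suc)
      then show ?case using near[OF elim, of "node N (k N)"] by blast
      qed
    qed
    have w2: "(\<lambda>N. wgt N (l N) (node N (Suc (k N)))) \<longlonglongrightarrow> drift a v"
    proof (rule tendsto_of_nearby_values[OF iso h_tendsto])
      from ev_sep show "\<forall>\<^sub>F N in sequentially. \<exists>\<xi> \<eta>. \<bar>\<xi> - a\<bar> \<le> h N \<and> \<bar>\<eta> - v\<bar> \<le> h N \<and>
          wgt N (l N) (node N (Suc (k N))) = drift \<xi> \<eta>"
      proof eventually_elim
      case (elim N)
      have "0 \<le> node N (Suc (k N))" "node N (Suc (k N)) \<le> a + h N" "\<bar>node N (Suc (k N)) - a\<bar> \<le> h N"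
        using k[of N] n0[of N] h_pos[of N] by (auto simp: node_Suc)
      then show ?case using near[OF elim, of "node N (Suc (k N))"] by blast
      qed
    qed
    have "(\<lambda>N. \<theta> N * (wgt N (l N) (node N (Suc (k N))) - wgt N (l N) (node N (k N)))) \<longlonglongrightarrow> 0"
    proof (rule Lim_null_comparison)
      show "\<forall>\<^sub>F N in sequentially. norm (\<theta> N * (wgt N (l N) (node N (Suc (k N))) - wgt N (l N) (node N (k N))))
          \<le> \<bar>wgt N (l N) (node N (Suc (k N))) - wgt N (l N) (node N (k N))\<bar>"
        unfolding real_norm_def abs_mult
        using \<theta> by (intro always_eventually allI mult_left_le_one_le) simp_all
      show "(\<lambda>N. \<bar>wgt N (l N) (node N (Suc (k N))) - wgt N (l N) (node N (k N))\<bar>) \<longlonglongrightarrow> 0"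
        using tendsto_rabs[OF tendsto_diff[OF w2 w1]] by simp
    qed
    from tendsto_add[OF w1 this]
    have "(\<lambda>N. wgt N (l N) (node N (k N)) +
        \<theta> N * (wgt N (l N) (node N (Suc (k N))) - wgt N (l N) (node N (k N)))) \<longlonglongrightarrow> drift a v"
      by simp
    then show ?thesis
    proof (rule Lim_transform_eventually)
      show "\<forall>\<^sub>F N in sequentially. wgt N (l N) (node N (k N)) +
        \<theta> N * (wgt N (l N) (node N (Suc (k N))) - wgt N (l N) (node N (k N))) = gmain N a v"
        using ev_sep
      proof eventually_elim
        case (elim N)
        have "node N (Suc (k N)) < node N (l N)" using elim k[of N] l[of N] by (simp add: node_Suc)
        then have "k N \<noteq> l N" using node_mono[of "l N" "Suc (k N)" N] by auto
        then show ?case using gmain_eq[of N a v] by (simp add: k_def l_def \<theta>_def)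
      qed
    qed
  next
    case True
    \<comment> \<open>Here \<open>a = s = 0\<close> is a node of every grid, so the interpolation
      reduces to \<open>wgt\<close> at \<open>0\<close>, and \<open>drift 0\<close> is half the
      derivative of the variance, continuous in the second argument.\<close>
    then have sa: "s = 0" using assms s0 by simp
    have k0: "k N = 0" for N
      unfolding k_def using node_0[of N] node_Suc[of N 0] True sa h_pos[of N]
      by (intro cell_eqI) linarith+
    have na: "node N (cell N a) = a" for N
      using k0[of N] node_0[of N] sa True unfolding k_def by (metis (no_types))
    have iso: "isCont (\<lambda>p. (\<lambda>x y. 1 / 2 * deriv (\<lambda>v. R v v) y) (fst p) (snd p)) (0::real, v)"
    proof -
      have "isCont (\<lambda>p. deriv (\<lambda>v. R v v) (snd p)) (0::real, v)"
        by (rule isCont_o2[where f = snd]) (use True assms tT isCont_dvar[of v] in \<open>auto intro!: continuous_intros\<close>)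
      then show ?thesis by (intro continuous_intros)
    qed
    have "\<forall>\<^sub>F N in sequentially. h N < t - v" using assms by (intro eventually_h_less) auto
    have "(\<lambda>N. gmain N a v) \<longlonglongrightarrow> (\<lambda>x y. 1 / 2 * deriv (\<lambda>v. R v v) y) (0::real) v"
    proof (intro tendsto_of_nearby_values[OF iso h_tendsto])
      from ev_sep \<open>\<forall>\<^sub>F N in sequentially. h N < t - v\<close>
      show "\<forall>\<^sub>F N in sequentially. \<exists>\<xi> \<eta>. \<bar>\<xi> - (0::real)\<bar> \<le> h N \<and> \<bar>\<eta> - v\<bar> \<le> h N \<and>
          gmain N a v = (\<lambda>x y. 1 / 2 * deriv (\<lambda>v. R v v) y) \<xi> \<eta>"
      proof eventually_elim
      case (elim N)
      obtain \<xi> where \<xi>: "\<bar>\<xi> - v\<bar> \<le> h N" "wgt N (l N) 0 = drift 0 \<xi>"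
        using near[OF elim(1), of 0] True h_pos[of N] by auto
      have "v - \<xi> \<le> h N" "\<xi> - v \<le> h N" using \<xi>(1) by (simp_all add: abs_le_iff)
      then have "0 < \<xi>" "\<xi> < T"
        using elim(1) h_pos[of N] True assms(2,3) tT elim by (simp_all add: field_simps)
      then have d: "drift 0 \<xi> = 1 / 2 * deriv (\<lambda>v. R v v) \<xi>" by (rule drift_zero)
      have "node N (Suc (k N)) < node N (l N)" using elim k[of N] l[of N] by (simp add: node_Suc)
      then have "k N \<noteq> l N" using node_mono[of "l N" "Suc (k N)" N] by auto
      then have "gmain N a v = wgt N (l N) 0"
        using gmain_eq[of N a v] na[of N] True by (simp add: k_def l_def)
      then show ?case using \<xi> d h_pos[of N] by (intro exI[of _ 0] exI[of _ \<xi>]) auto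
      qed
    qed
    moreover have "drift a v = 1 / 2 * deriv (\<lambda>v. R v v) v"
      unfolding True by (rule drift_zero) (use True assms tT in auto)
    ultimately show ?thesis by (simp only:)
  qed
qed

end

section \<open>Integrating out consecutive pairs\<close>

lemma nn_integral_powr_Ioo:
  fixes a b e :: real
  assumes "a \<le> b" "-1 < e"
  shows "(\<integral>\<^sup>+v. ennreal (indicator {a<..<b} v * (v - a) powr e) \<partial>lborel) = ennreal ((b - a) powr (e + 1) / (e + 1))"
proof -
  have "((\<lambda>x. x powr e) has_integral ((b - a) powr (e + 1) / (e + 1))) {0..b - a}"
    using assms by (intro has_integral_powr_from_0) auto
  then have "((\<lambda>x. x powr e) has_integral ((b - a) powr (e + 1) / (e + 1))) {0<..<b - a}"
    by (simp add: has_integral_Icc_iff_Ioo)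
  then have "((\<lambda>x. if x \<in> {0<..<b - a} then x powr e else 0) has_integral ((b - a) powr (e + 1) / (e + 1))) UNIV"
    by (simp only: has_integral_restrict_UNIV)
  moreover have "(\<lambda>x. if x \<in> {0<..<b - a} then x powr e else 0) = (\<lambda>x. indicator {0<..<b - a} x * x powr e)"
    by (auto simp: indicator_def)
  ultimately have "(\<integral>\<^sup>+x. ennreal (indicator {0<..<b - a} x * x powr e) \<partial>lborel) =
      ennreal ((b - a) powr (e + 1) / (e + 1))"
    by (intro nn_integral_has_integral_lborel) auto
  then show ?thesis
    using nn_integral_real_affine[of "\<lambda>v. ennreal (indicator {a<..<b} v * (v - a) powr e)" 1 a]
    by (simp add: indicator_def if_distrib[of "\<lambda>x. x * _"] cong: if_cong) (simp add: algebra_simps)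
qed

lemma has_bochner_integral_powr_Ioo:
  fixes a b e :: real
  assumes "a \<le> b" "-1 < e"
  shows "has_bochner_integral lborel (\<lambda>v. indicator {a<..<b} v * (v - a) powr e) ((b - a) powr (e + 1) / (e + 1))"
  using nn_integral_powr_Ioo[OF assms] assms
  by (intro has_bochner_integral_nn_integral) (auto simp: ennreal_mult')

lemma set_integrable_bounded:
  fixes f :: "real \<Rightarrow> real"
  assumes [measurable]: "f \<in> borel_measurable borel" and B: "\<And>x. x \<in> {a..b} \<Longrightarrow> \<bar>f x\<bar> \<le> B"
  shows "set_integrable lborel {a..b} f"
  unfolding set_integrable_def
proof (rule Bochner_Integration.integrable_bound)
  show "integrable lborel (\<lambda>x. B * indicator {a..b} x)"
    by (intro integrable_mult_right integrable_real_indicator) (auto simp: emeasure_lborel_Icc_eq)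
  show "AE x in lborel. norm (indicator {a..b} x *\<^sub>R f x) \<le> norm (B * indicator {a..b} x)"
  proof (rule AE_I2)
    fix x show "norm (indicator {a..b} x *\<^sub>R f x) \<le> norm (B * indicator {a..b} x)"
      using B[of x] by (cases "x \<in> {a..b}") auto
  qed
qed simp

lemma integral_Ioo_eq_HK:
  fixes f :: "real \<Rightarrow> real"
  assumes "f \<in> borel_measurable borel" "\<And>x. x \<in> {a..b} \<Longrightarrow> \<bar>f x\<bar> \<le> B"
  shows "(LINT x|lborel. indicator {a<..<b} x * f x) = integral {a..b} f"
proof -
  have "set_integrable lborel {a<..<b} f"
    using set_integrable_bounded[OF assms] by (rule set_integrable_subset) auto
  from set_borel_integral_eq_integral(2)[OF this] show ?thesis
    by (simp add: set_lebesgue_integral_def integral_open_interval_real)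
qed

lemma integrable_indicator_Ioo_bounded:
  fixes f :: "real \<Rightarrow> real"
  assumes [measurable]: "f \<in> borel_measurable borel" and B: "\<And>x. x \<in> {a<..<b} \<Longrightarrow> \<bar>f x\<bar> \<le> B"
  shows "integrable lborel (\<lambda>x. indicator {a<..<b} x * f x)"
    and "a \<le> b \<Longrightarrow> \<bar>LINT x|lborel. indicator {a<..<b} x * f x\<bar> \<le> B * (b - a)"
proof -
  have dom: "integrable lborel (\<lambda>x. B * indicator {a<..<b} x)"
    by (intro integrable_mult_right integrable_real_indicator) (cases "a \<le> b"; auto)+
  have le: "norm (indicator {a<..<b} x * f x) \<le> B * indicator {a<..<b} x" for x
    using B[of x] by (cases "x \<in> {a<..<b}") auto
  show int: "integrable lborel (\<lambda>x. indicator {a<..<b} x * f x)"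
    by (rule Bochner_Integration.integrable_bound[OF dom])
       (use le in \<open>auto intro: order_trans[OF _ abs_ge_self]\<close>)
  assume "a \<le> b"
  have "\<bar>LINT x|lborel. indicator {a<..<b} x * f x\<bar> \<le> (LINT x|lborel. B * indicator {a<..<b} x)"
    using Bochner_Integration.integral_norm_bound_integral[OF int dom] le by simp
  also have "\<dots> = B * (b - a)" using \<open>a \<le> b\<close> by simp
  finally show "\<bar>LINT x|lborel. indicator {a<..<b} x * f x\<bar> \<le> B * (b - a)" .
qed

section \<open>The oscillating term and the chains of consecutive pairs\<close>

context cov_bounds
begin

lemma measurable_cell_pair:
  fixes f :: "nat \<Rightarrow> nat \<Rightarrow> real \<times> real \<Rightarrow> real"
  assumes "\<And>k l. f k l \<in> borel_measurable (borel \<Otimes>\<^sub>M borel)"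
  shows "(\<lambda>p. f (cell N (fst p)) (cell N (snd p)) p) \<in> borel_measurable (borel \<Otimes>\<^sub>M borel)"
proof -
  have 1: "(\<lambda>p::real \<times> real. cell N (fst p)) \<in> measurable (borel \<Otimes>\<^sub>M borel) (count_space UNIV)"
    and 2: "(\<lambda>p::real \<times> real. cell N (snd p)) \<in> measurable (borel \<Otimes>\<^sub>M borel) (count_space UNIV)"
    by measurable
  show ?thesis
    by (rule measurable_compose_countable[OF _ 1], rule measurable_compose_countable[OF _ 2]) (rule assms)
qed

lemma measurable_gN: "(\<lambda>p. gN N (fst p) (snd p)) \<in> borel_measurable (borel \<Otimes>\<^sub>M borel)"
proof -
  define F where "F l x = (R x (node N (Suc l)) - R x (node N l)) / h N" for l x
  have "(\<lambda>p. (\<lambda>k l p. (F l (node N l) + (snd p - node N l) / h N * (F l (node N (Suc l)) - F l (node N l))) -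
      (F l (node N k) + (fst p - node N k) / h N * (F l (node N (Suc k)) - F l (node N k))))
      (cell N (fst p)) (cell N (snd p)) p) \<in> borel_measurable (borel \<Otimes>\<^sub>M borel)"
    by (rule measurable_cell_pair) measurable
  then show ?thesis by (simp add: gN_def pl_def slope_def F_def)
qed

lemma measurable_rhoN: "(\<lambda>p. rhoN N (fst p) (snd p)) \<in> borel_measurable (borel \<Otimes>\<^sub>M borel)"
proof -
  have "(\<lambda>p. rect (node N (cell N (fst p))) (node N (Suc (cell N (fst p)))) (node N (cell N (snd p)))
      (node N (Suc (cell N (snd p)))) / (h N)\<^sup>2) \<in> borel_measurable (borel \<Otimes>\<^sub>M borel)"
    by (rule measurable_cell_pair[where f = "\<lambda>k l p. rect (node N k) (node N (Suc k)) (node N l) (node N (Suc l)) / (h N)\<^sup>2"])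
       simp
  then show ?thesis by (simp add: rhoN_rect)
qed

lemma measurable_fluct [measurable]: "fluct N \<in> borel_measurable borel"
proof -
  have "(\<lambda>p. (\<lambda>k l p. ((fst p - node N k) / h N - 1 / 2) *
      (rect (node N k) (node N (Suc k)) (node N k) (node N (Suc k)) / h N))
      (cell N (fst p)) (cell N (snd p)) p) \<in> borel_measurable (borel \<Otimes>\<^sub>M (borel :: real measure))"
    by (rule measurable_cell_pair) measurable
  then have "(\<lambda>p. fluct N (fst p)) \<in> borel_measurable (borel \<Otimes>\<^sub>M (borel :: real measure))"
    by (simp add: fluct_def)
  from measurable_compose[OF _ this, of "\<lambda>x. (x, 0)" borel] show ?thesis by simp
qed

lemma measurable_gmain: "(\<lambda>p. gmain N (fst p) (snd p)) \<in> borel_measurable (borel \<Otimes>\<^sub>M borel)"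
proof -
  have "(\<lambda>p. if cell N (fst p) = cell N (snd p) then 0 else fluct N (snd p)) \<in> borel_measurable (borel \<Otimes>\<^sub>M borel)"
    by (rule measurable_cell_pair[where f = "\<lambda>k l p. if k = l then 0 else fluct N (snd p)"]) measurable
  then show ?thesis unfolding gmain_def by (intro borel_measurable_diff measurable_gN)
qed

lemma measurable_gN2 [measurable (raw)]:
  "f \<in> borel_measurable M \<Longrightarrow> g \<in> borel_measurable M \<Longrightarrow> (\<lambda>x. gN N (f x) (g x)) \<in> borel_measurable M"
  using measurable_compose[OF measurable_Pair measurable_gN, of f M g] by simp

lemma measurable_rhoN2 [measurable (raw)]:
  "f \<in> borel_measurable M \<Longrightarrow> g \<in> borel_measurable M \<Longrightarrow> (\<lambda>x. rhoN N (f x) (g x)) \<in> borel_measurable M"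
  using measurable_compose[OF measurable_Pair measurable_rhoN, of f M g] by simp

lemma measurable_gmain2 [measurable (raw)]:
  "f \<in> borel_measurable M \<Longrightarrow> g \<in> borel_measurable M \<Longrightarrow> (\<lambda>x. gmain N (f x) (g x)) \<in> borel_measurable M"
  using measurable_compose[OF measurable_Pair measurable_gmain, of f M g] by simp

lemma fluct_cell_integral:
  assumes "k \<le> N"
  shows "(fluct N has_integral 0) {node N k..node N (Suc k)}"
proof -
  let ?q = "rect (node N k) (node N (Suc k)) (node N k) (node N (Suc k)) / h N"
  let ?P = "\<lambda>v. ((v - node N k)\<^sup>2 / (2 * h N) - v / 2) * ?q"
  have "((\<lambda>v. ((v - node N k) / h N - 1 / 2) * ?q) has_integral (?P (node N (Suc k)) - ?P (node N k)))
      {node N k..node N (Suc k)}"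
  proof (rule fundamental_theorem_of_calculus)
    fix v
    have "(?P has_real_derivative ((v - node N k) / h N - 1 / 2) * ?q) (at v within {node N k..node N (Suc k)})"
      using h_pos[of N] by (auto intro!: derivative_eq_intros simp: power2_eq_square field_simps)
    then show "(?P has_vector_derivative ((v - node N k) / h N - 1 / 2) * ?q) (at v within {node N k..node N (Suc k)})"
      by (simp add: has_real_derivative_iff_has_vector_derivative)
  qed (simp add: node_mono)
  then have "(fluct N has_integral (?P (node N (Suc k)) - ?P (node N k))) {node N k..node N (Suc k)}"
  proof (rule has_integral_spike[of "{node N (Suc k)}", rotated 2])
    fix v assume "v \<in> {node N k..node N (Suc k)} - {node N (Suc k)}"
    then have "cell N v = k" using assms by (intro cell_eqI) auto
    then show "fluct N v = ((v - node N k) / h N - 1 / 2) * ?q" by (simp add: fluct_def)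
  qed auto
  moreover have "?P (node N (Suc k)) - ?P (node N k) = 0"
    using h_pos[of N] by (simp add: node_Suc power2_eq_square field_simps)
  ultimately show ?thesis by simp
qed

text \<open>On a complete cell the value of \<Psi> at the left node may be subtracted, as
  \<open>fluct\<close> has mean zero; what is left is the variation of \<Psi> over the cell, at most
  \<open>L * h N\<close>. The incomplete last cell is bounded crudely and gives the term
  \<open>B * h N\<close>.\<close>

lemma fluct_weighted_bound:
  fixes \<Psi> :: "real \<Rightarrow> real"
  assumes k0: "k0 \<le> Suc N" and b: "node N k0 \<le> b" "b \<le> t"
    and [measurable]: "\<Psi> \<in> borel_measurable borel"
    and B: "\<And>v. v \<in> {node N k0..b} \<Longrightarrow> \<bar>\<Psi> v\<bar> \<le> B"
    and L: "\<And>v w. node N k0 \<le> v \<Longrightarrow> v \<le> w \<Longrightarrow> w \<le> b \<Longrightarrow> \<bar>\<Psi> w - \<Psi> v\<bar> \<le> L * (w - v)"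
    and L0: "0 \<le> L"
  shows "\<bar>LINT v|lborel. indicator {node N k0<..<b} v * (fluct N v * \<Psi> v)\<bar> \<le>
    C * h N powr (2 * H - 1) * (L * h N * (b - node N k0) + B * h N)"
proof -
  define A where "A = C * h N powr (2 * H - 1)"
  have A0: "0 \<le> A" using C by (simp add: A_def)
  have B0: "0 \<le> B" using B[of b] b by force
  have c: "s \<le> node N k0" using node_bounds[OF k0] by simp
  have hp: "0 < h N" by (rule h_pos)
  have fl: "\<bar>fluct N v\<bar> \<le> A" if "node N k0 \<le> v" "v \<le> b" for v
    using fluct_le[of v N] that b c by (simp add: A_def)
  have bd: "\<bar>fluct N v * \<Psi> v\<bar> \<le> A * B" if "v \<in> {node N k0..b}" for v
    unfolding abs_mult using fl[of v] B[OF that] that A0 by (intro mult_mono) auto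
  have int: "(\<lambda>v. fluct N v * \<Psi> v) integrable_on {x..y}" if "node N k0 \<le> x" "y \<le> b" for x y
    using that by (intro set_borel_integral_eq_integral(1) set_integrable_bounded[where B = "A * B"] bd) auto
  have step: "\<bar>integral {node N k..node N (Suc k)} (\<lambda>v. fluct N v * \<Psi> v)\<bar> \<le> A * (L * h N) * h N"
    if k: "k0 \<le> k" "k \<le> N" "node N (Suc k) \<le> b" for k
  proof -
    have n: "node N k0 \<le> node N k" using k by (intro node_mono)
    have hi: "((\<lambda>v. fluct N v * \<Psi> v - fluct N v * \<Psi> (node N k)) has_integral
        integral {node N k..node N (Suc k)} (\<lambda>v. fluct N v * \<Psi> v) - 0 * \<Psi> (node N k)) {node N k..node N (Suc k)}"
      using int[of "node N k" "node N (Suc k)"] n k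
      by (intro has_integral_diff has_integral_mult_left fluct_cell_integral integrable_integral) auto
    have "norm (integral {node N k..node N (Suc k)} (\<lambda>v. fluct N v * \<Psi> v) - 0 * \<Psi> (node N k)) \<le>
       (A * (L * h N)) * measure lborel (cbox (node N k) (node N (Suc k)))"
    proof (rule has_integral_bound)
      show "0 \<le> A * (L * h N)" using A0 L0 hp by simp
      show "((\<lambda>v. fluct N v * \<Psi> v - fluct N v * \<Psi> (node N k)) has_integral
        integral {node N k..node N (Suc k)} (\<lambda>v. fluct N v * \<Psi> v) - 0 * \<Psi> (node N k)) (cbox (node N k) (node N (Suc k)))"
        using hi by simp
      fix v assume v: "v \<in> cbox (node N k) (node N (Suc k))"
      have "\<bar>\<Psi> v - \<Psi> (node N k)\<bar> \<le> L * (v - node N k)" using v n k by (intro L) auto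
      also have "\<dots> \<le> L * h N" using v L0 by (intro mult_left_mono) (auto simp: node_Suc)
      finally have "\<bar>fluct N v\<bar> * \<bar>\<Psi> v - \<Psi> (node N k)\<bar> \<le> A * (L * h N)"
        using fl[of v] v n k A0 by (intro mult_mono) auto
      then show "norm (fluct N v * \<Psi> v - fluct N v * \<Psi> (node N k)) \<le> A * (L * h N)"
        by (simp add: right_diff_distrib[symmetric] abs_mult)
    qed
    then show ?thesis using hp by (simp add: node_Suc)
  qed
  have cells: "\<bar>integral {node N k0..node N k} (\<lambda>v. fluct N v * \<Psi> v)\<bar> \<le> A * (L * h N) * (node N k - node N k0)"
    if "k0 \<le> k" "k \<le> Suc N" "node N k \<le> b" for k
    using that
  proof (induction k rule: dec_induct)
    case base
    then show ?case by simp
  next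
    case (step k)
    have le: "node N k \<le> node N (Suc k)" "node N k0 \<le> node N k" using step by (auto intro: node_mono)
    have "integral {node N k0..node N (Suc k)} (\<lambda>v. fluct N v * \<Psi> v) =
      integral {node N k0..node N k} (\<lambda>v. fluct N v * \<Psi> v) + integral {node N k..node N (Suc k)} (\<lambda>v. fluct N v * \<Psi> v)"
      using le step int[of "node N k0" "node N (Suc k)"]
      by (intro Henstock_Kurzweil_Integration.integral_combine[symmetric]) auto
    moreover have "\<bar>integral {node N k0..node N k} (\<lambda>v. fluct N v * \<Psi> v)\<bar> \<le> A * (L * h N) * (node N k - node N k0)"
      using step le by simp
    moreover have "\<bar>integral {node N k..node N (Suc k)} (\<lambda>v. fluct N v * \<Psi> v)\<bar> \<le> A * (L * h N) * h N"
      using step by (intro \<open>\<And>k. k0 \<le> k \<Longrightarrow> k \<le> N \<Longrightarrow> node N (Suc k) \<le> b \<Longrightarrow> _\<close>) auto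
    moreover have "A * (L * h N) * (node N (Suc k) - node N k0) =
        A * (L * h N) * (node N k - node N k0) + A * (L * h N) * h N"
      by (simp add: node_Suc algebra_simps)
    ultimately show ?case by linarith
  qed
  define l where "l = cell N b"
  have l: "node N l \<le> b" "b \<le> node N (Suc l)" "l \<le> N"
    using cell_bounds[of b N] cell_le[of N b] b c by (auto simp: l_def)
  \<comment> \<open>The maximum matters only if \<open>k0 = Suc N\<close>: then
    \<open>b = t\<close>, to which \<open>cell\<close> assigns the index \<open>N\<close>.\<close>
  define m where "m = max k0 l"
  have m: "k0 \<le> m" "m \<le> Suc N" "node N m \<le> b" "b \<le> node N (Suc m)" "node N k0 \<le> node N m"
  proof -
    show "k0 \<le> m" "m \<le> Suc N" "node N m \<le> b" using k0 l b by (auto simp: m_def max_def)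
    show "b \<le> node N (Suc m)" using l node_mono[of "Suc l" "Suc m" N] by (simp add: m_def)
    show "node N k0 \<le> node N m" by (intro node_mono) (simp add: m_def)
  qed
  have last: "\<bar>integral {node N m..b} (\<lambda>v. fluct N v * \<Psi> v)\<bar> \<le> A * B * h N"
  proof -
    have "norm (integral (cbox (node N m) b) (\<lambda>v. fluct N v * \<Psi> v)) \<le> (A * B) * measure lborel (cbox (node N m) b)"
      using m int[of "node N m" b] bd mult_nonneg_nonneg[OF A0 B0]
      by (intro integrable_bound) auto
    also have "\<dots> \<le> A * B * h N"
      using m mult_nonneg_nonneg[OF A0 B0] by (intro mult_left_mono) (auto simp: node_Suc)
    finally show ?thesis by simp
  qed
  have "(LINT v|lborel. indicator {node N k0<..<b} v * (fluct N v * \<Psi> v)) =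
      integral {node N k0..b} (\<lambda>v. fluct N v * \<Psi> v)"
    by (intro integral_Ioo_eq_HK[where B = "A * B"] bd) auto
  also have "\<dots> = integral {node N k0..node N m} (\<lambda>v. fluct N v * \<Psi> v) + integral {node N m..b} (\<lambda>v. fluct N v * \<Psi> v)"
    using m int[of "node N k0" b]
    by (intro Henstock_Kurzweil_Integration.integral_combine[symmetric]) auto
  also have "\<bar>\<dots>\<bar> \<le> A * (L * h N) * (node N m - node N k0) + A * B * h N"
    using cells[of m] m last by linarith
  also have "\<dots> \<le> A * (L * h N) * (b - node N k0) + A * B * h N"
    using m A0 L0 hp by (intro add_right_mono mult_left_mono) auto
  finally show ?thesis by (simp add: A_def algebra_simps)
qed

text \<open>Integrates out the larger variable \<open>v\<close> of a consecutive pair whose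
  neighbours are \<open>a\<close> and \<open>b\<close>; \<open>F\<close> is the factor already
  accumulated between \<open>v\<close> and \<open>b\<close>. Iteration collapses a run of adjacent
  consecutive pairs into one function of the ends of a gap.\<close>

definition chainN :: "nat \<Rightarrow> (real \<Rightarrow> real \<Rightarrow> real) \<Rightarrow> real \<Rightarrow> real \<Rightarrow> real" where
  "chainN N F a b = (LINT v|lborel. indicator {a<..<b} v * (gN N a v * F v b))"

definition chain :: "(real \<Rightarrow> real \<Rightarrow> real) \<Rightarrow> real \<Rightarrow> real \<Rightarrow> real" where
  "chain F a b = (LINT v|lborel. indicator {a<..<b} v * (drift a v * F v b))"

text \<open>With \<open>str\<close> set this is the order of magnitude of a collapsed chain, which
  offsets the singularity of a pair that has become adjacent around it.\<close>

definition gap_weight :: "bool \<Rightarrow> real \<Rightarrow> real \<Rightarrow> real" where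
  "gap_weight str a b = (if str then (b - a) powr (2 * H) else 1)"

text \<open>The class is chosen to be stable under \<open>chainN\<close>. A Lipschitz constant of
  order \<open>h N powr (2 * H - 1)\<close> in the lower point is what integration against
  \<open>gN\<close> produces, and also what the oscillation tolerates. The bounds include
  \<open>a = b\<close>, while convergence is required only for \<open>a < b\<close>.\<close>

definition admissible :: "bool \<Rightarrow> (nat \<Rightarrow> real \<Rightarrow> real \<Rightarrow> real) \<Rightarrow> (real \<Rightarrow> real \<Rightarrow> real) \<Rightarrow> bool" where
  "admissible str F Fl \<longleftrightarrow>
    (\<forall>N. (\<lambda>p. F N (fst p) (snd p)) \<in> borel_measurable (borel \<Otimes>\<^sub>M borel)) \<and>
    (\<exists>B\<ge>0. (\<forall>N a b. s \<le> a \<longrightarrow> a \<le> b \<longrightarrow> b \<le> t \<longrightarrow> \<bar>F N a b\<bar> \<le> B * gap_weight str a b) \<and>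
      (\<forall>N a a' b. s \<le> a \<longrightarrow> a \<le> a' \<longrightarrow> a' \<le> b \<longrightarrow> b \<le> t \<longrightarrow>
         \<bar>F N a' b - F N a b\<bar> \<le> B * h N powr (2 * H - 1) * (a' - a))) \<and>
    (\<forall>a b. s \<le> a \<longrightarrow> a < b \<longrightarrow> b \<le> t \<longrightarrow> (\<lambda>N. F N a b) \<longlonglongrightarrow> Fl a b)"

lemma admissible_const: "admissible False (\<lambda>_ _ _. 1) (\<lambda>_ _. 1)"
  unfolding admissible_def gap_weight_def by (auto intro!: exI[of _ 1])

lemma gap_weight_le: "s \<le> a \<Longrightarrow> a \<le> b \<Longrightarrow> b \<le> t \<Longrightarrow> gap_weight str a b \<le> 1 + (t - s) powr (2 * H)"
  using H powr_mono2[of "2 * H" "b - a" "t - s"] by (auto simp: gap_weight_def)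

text \<open>The increment of \<open>gN\<close> in its lower point is an integral of
  \<open>rhoN\<close> over \<open>[a, a']\<close>. Within distance \<open>h N\<close> of
  \<open>a'\<close> the mesh bound for \<open>rhoN\<close> contributes
  \<open>h N powr (2 * H - 1)\<close>; beyond, the integral of the power \<open>2 * H - 2\<close>
  from \<open>h N\<close> upwards is at most \<open>h N powr (2 * H - 1) / (1 - 2 * H)\<close>,
  where \<open>H < 1 / 2\<close> enters.\<close>

lemma gN_diff_integral:
  fixes \<Psi> :: "real \<Rightarrow> real"
  assumes ab: "s \<le> a" "a \<le> a'" "a' \<le> b" "b \<le> t"
    and [measurable]: "\<Psi> \<in> borel_measurable borel"
    and B: "\<And>v. v \<in> {a'..b} \<Longrightarrow> \<bar>\<Psi> v\<bar> \<le> B"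
  shows "\<bar>LINT v|lborel. indicator {a'<..<b} v * ((gN N a' v - gN N a v) * \<Psi> v)\<bar> \<le>
    C * (1 + 9 / (1 - 2 * H)) * h N powr (2 * H - 1) * B * (a' - a)"
proof -
  have hp: "0 < h N" by (rule h_pos)
  have B0: "0 \<le> B" using B[of b] ab by force
  have incr: "\<bar>gN N a' v - gN N a v\<bar> \<le> K * (a' - a)"
    if K: "0 \<le> K" "\<And>u. a \<le> u \<Longrightarrow> u \<le> a' \<Longrightarrow> \<bar>rhoN N u v\<bar> \<le> K" and v: "a' < v" "v < b" for K v
  proof -
    let ?f = "\<lambda>x. slope N (R x) v"
    have "((\<lambda>u. rhoN N u v) has_integral (pl N ?f a' - pl N ?f a)) (cbox a a')"
      using rhoN_has_integral[of a a' N v] ab by simp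
    then have "norm (pl N ?f a' - pl N ?f a) \<le> K * measure lborel (cbox a a')"
      by (rule has_integral_bound[OF K(1)]) (use K in auto)
    moreover have "gN N a' v - gN N a v = - (pl N ?f a' - pl N ?f a)" by (simp add: gN_def)
    ultimately show ?thesis using ab by simp
  qed
  let ?G = "\<lambda>v. (gN N a' v - gN N a v) * \<Psi> v"
  have b1: "\<bar>?G v\<bar> \<le> C * h N powr (2 * H - 2) * (a' - a) * B" if "v \<in> {a'<..<b}" for v
    unfolding abs_mult
    using incr[of "C * h N powr (2 * H - 2)" v] rhoN_le_mesh[of N] B[of v] that C ab B0
    by (intro mult_mono) auto
  have int: "integrable lborel (\<lambda>v. indicator {x<..<y} v * ?G v)" if "a' \<le> x" "y \<le> b" for x y
    using that by (intro integrable_indicator_Ioo_bounded[where B = "C * h N powr (2 * H - 2) * (a' - a) * B"] b1) auto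
  \<comment> \<open>The distance at which the singular bound for \<open>rhoN\<close> takes over from
    the mesh bound.\<close>
  define c where "c = min b (a' + h N)"
  have c: "a' \<le> c" "c \<le> b" "c \<le> a' + h N" using ab hp by (auto simp: c_def)
  have first: "\<bar>LINT v|lborel. indicator {a'<..<c} v * ?G v\<bar> \<le> C * h N powr (2 * H - 1) * B * (a' - a)"
  proof -
    have "\<bar>LINT v|lborel. indicator {a'<..<c} v * ?G v\<bar> \<le> C * h N powr (2 * H - 2) * (a' - a) * B * (c - a')"
      using c by (intro integrable_indicator_Ioo_bounded(2) b1) auto
    also have "\<dots> \<le> C * h N powr (2 * H - 2) * (a' - a) * B * h N"
      using c C B0 ab by (intro mult_left_mono mult_nonneg_nonneg) auto
    also have "\<dots> = C * (h N powr (2 * H - 2) * h N) * B * (a' - a)" by simp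
    also have "h N powr (2 * H - 2) * h N = h N powr (2 * H - 1)"
      using hp powr_add[of "h N" "2 * H - 2" 1] by simp
    finally show ?thesis .
  qed
  have second: "\<bar>LINT v|lborel. indicator {c<..<b} v * ?G v\<bar> \<le> 9 * C / (1 - 2 * H) * h N powr (2 * H - 1) * B * (a' - a)"
  proof (cases "c = b")
    case True
    then show ?thesis using C B0 ab H by simp
  next
    case False
    then have ca: "c = a' + h N" by (simp add: c_def min_def split: if_splits)
    define K where "K = 9 * C * B * (a' - a)"
    have K0: "0 \<le> K" using C B0 ab by (simp add: K_def)
    let ?P = "\<lambda>v. (v - a') powr (2 * H - 1) / (2 * H - 1)"
    have "((\<lambda>v. (v - a') powr (2 * H - 2)) has_integral (?P b - ?P c)) {c..b}"
    proof (rule fundamental_theorem_of_calculus)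
      fix v assume "v \<in> {c..b}"
      then have "0 < v - a'" using ca hp by auto
      then have "(?P has_real_derivative (v - a') powr (2 * H - 2)) (at v within {c..b})"
        using H by (auto intro!: derivative_eq_intros)
      then show "(?P has_vector_derivative (v - a') powr (2 * H - 2)) (at v within {c..b})"
        by (simp add: has_real_derivative_iff_has_vector_derivative)
    qed (rule c)
    then have hi: "((\<lambda>v. K * (v - a') powr (2 * H - 2)) has_integral K * (?P b - ?P c)) {c..b}"
      by (rule has_integral_mult_right)
    have bd2: "\<bar>?G v\<bar> \<le> K * (v - a') powr (2 * H - 2)" if "v \<in> {c<..<b}" for v
    proof -
      have va: "a' < v" "v < b" using that c by auto
      have rho: "\<bar>rhoN N u v\<bar> \<le> 9 * C * (v - a') powr (2 * H - 2)" if "a \<le> u" "u \<le> a'" for u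
      proof -
        have "\<bar>rhoN N u v\<bar> \<le> 9 * C * (v - u) powr (2 * H - 2)"
          using that va ab by (intro rhoN_le) auto
        also have "\<dots> \<le> 9 * C * (v - a') powr (2 * H - 2)"
          using that va C H by (intro mult_left_mono powr_mono2') auto
        finally show ?thesis .
      qed
      have "\<bar>gN N a' v - gN N a v\<bar> \<le> 9 * C * (v - a') powr (2 * H - 2) * (a' - a)"
        using rho va C by (intro incr) auto
      then have "\<bar>?G v\<bar> \<le> (9 * C * (v - a') powr (2 * H - 2) * (a' - a)) * B"
        unfolding abs_mult using B[of v] va B0 C ab by (intro mult_mono) auto
      then show ?thesis by (simp add: K_def algebra_simps)
    qed
    have meas: "?G \<in> borel_measurable borel" by measurable
    have b1': "\<bar>indicator {c<..<b} v * ?G v\<bar> \<le> C * h N powr (2 * H - 2) * (a' - a) * B" if "v \<in> {c..b}" for v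
      using b1[of v] c C B0 ab by (cases "v \<in> {c<..<b}") auto
    have "(LINT v|lborel. indicator {c<..<b} v * ?G v) = (LINT v|lborel. indicator {c<..<b} v * (indicator {c<..<b} v * ?G v))"
      by (intro Bochner_Integration.integral_cong) (auto simp: indicator_def)
    also have "\<dots> = integral {c..b} (\<lambda>v. indicator {c<..<b} v * ?G v)"
      by (intro integral_Ioo_eq_HK[OF _ b1']) measurable
    finally have eq: "(LINT v|lborel. indicator {c<..<b} v * ?G v) = integral {c..b} (\<lambda>v. indicator {c<..<b} v * ?G v)" .
    have "norm (integral {c..b} (\<lambda>v. indicator {c<..<b} v * ?G v)) \<le> integral {c..b} (\<lambda>v. K * (v - a') powr (2 * H - 2))"
    proof (rule Henstock_Kurzweil_Integration.integral_norm_bound_integral)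
      show "(\<lambda>v. indicator {c<..<b} v * ?G v) integrable_on {c..b}"
        by (intro set_borel_integral_eq_integral(1) set_integrable_bounded[OF _ b1']) measurable
      show "(\<lambda>v. K * (v - a') powr (2 * H - 2)) integrable_on {c..b}"
        using hi by (rule has_integral_integrable)
      fix v assume "v \<in> {c..b}"
      show "norm (indicator {c<..<b} v * ?G v) \<le> K * (v - a') powr (2 * H - 2)"
        using bd2[of v] K0 by (cases "v \<in> {c<..<b}") auto
    qed
    also have "\<dots> = K * (?P b - ?P c)" using hi by (rule integral_unique)
    also have "\<dots> \<le> K * (- ?P c)"
      using H K0 by (intro mult_left_mono) (auto simp: divide_le_0_iff)
    also have "- ?P c = h N powr (2 * H - 1) / (1 - 2 * H)"
      using H by (simp add: ca field_simps)
    also have "K * (h N powr (2 * H - 1) / (1 - 2 * H)) = 9 * C / (1 - 2 * H) * h N powr (2 * H - 1) * B * (a' - a)"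
      unfolding K_def by (simp only: times_divide_eq_left times_divide_eq_right mult_ac)
    finally show ?thesis unfolding eq by (simp only: real_norm_def)
  qed
  have "(LINT v|lborel. indicator {a'<..<b} v * ?G v) =
     (LINT v|lborel. indicator {a'<..<c} v * ?G v + indicator {c<..<b} v * ?G v)"
  proof (rule integral_cong_AE)
    show "AE v in lborel. indicator {a'<..<b} v * ?G v = indicator {a'<..<c} v * ?G v + indicator {c<..<b} v * ?G v"
      using AE_lborel_singleton[of c] by eventually_elim (use c in \<open>auto simp: indicator_def\<close>)
  qed measurable
  also have "\<dots> = (LINT v|lborel. indicator {a'<..<c} v * ?G v) + (LINT v|lborel. indicator {c<..<b} v * ?G v)"
    using c by (intro Bochner_Integration.integral_add int) auto
  finally have "\<bar>LINT v|lborel. indicator {a'<..<b} v * ?G v\<bar> \<le>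
     C * h N powr (2 * H - 1) * B * (a' - a) + 9 * C / (1 - 2 * H) * h N powr (2 * H - 1) * B * (a' - a)"
    using first second by linarith
  also have "\<dots> = C * (1 + 9 / (1 - 2 * H)) * h N powr (2 * H - 1) * B * (a' - a)"
    by (simp add: algebra_simps)
  finally show ?thesis .
qed

lemma admissibleD:
  assumes "admissible str F Fl"
  shows "(\<lambda>p. F N (fst p) (snd p)) \<in> borel_measurable (borel \<Otimes>\<^sub>M borel)"
    and "\<exists>B\<ge>0. \<forall>N a b. s \<le> a \<longrightarrow> a \<le> b \<longrightarrow> b \<le> t \<longrightarrow> \<bar>F N a b\<bar> \<le> B * gap_weight str a b"
    and "s \<le> a \<Longrightarrow> a < b \<Longrightarrow> b \<le> t \<Longrightarrow> (\<lambda>N. F N a b) \<longlonglongrightarrow> Fl a b"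
  using assms unfolding admissible_def by blast+

lemma admissible_uniform:
  assumes "admissible str F Fl"
  obtains B where "0 \<le> B" "\<And>N a b. s \<le> a \<Longrightarrow> a \<le> b \<Longrightarrow> b \<le> t \<Longrightarrow> \<bar>F N a b\<bar> \<le> B"
    "\<And>N a a' b. s \<le> a \<Longrightarrow> a \<le> a' \<Longrightarrow> a' \<le> b \<Longrightarrow> b \<le> t \<Longrightarrow>
       \<bar>F N a' b - F N a b\<bar> \<le> B * h N powr (2 * H - 1) * (a' - a)"
proof -
  obtain B where B: "0 \<le> B"
    "\<And>N a b. s \<le> a \<Longrightarrow> a \<le> b \<Longrightarrow> b \<le> t \<Longrightarrow> \<bar>F N a b\<bar> \<le> B * gap_weight str a b"
    "\<And>N a a' b. s \<le> a \<Longrightarrow> a \<le> a' \<Longrightarrow> a' \<le> b \<Longrightarrow> b \<le> t \<Longrightarrow>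
       \<bar>F N a' b - F N a b\<bar> \<le> B * h N powr (2 * H - 1) * (a' - a)"
    using assms unfolding admissible_def by blast
  define W where "W = 1 + (t - s) powr (2 * H)"
  have W: "1 \<le> W" by (simp add: W_def)
  have BW: "B \<le> B * W" using mult_left_mono[OF W B(1)] by simp
  show thesis
  proof (rule that[of "B * W"])
    show "0 \<le> B * W" using B W by simp
    fix N a a' b assume *: "s \<le> a" "a \<le> a'" "a' \<le> b" "b \<le> t"
    have "\<bar>F N a' b - F N a b\<bar> \<le> B * h N powr (2 * H - 1) * (a' - a)" using B(3) * .
    also have "\<dots> \<le> (B * W) * h N powr (2 * H - 1) * (a' - a)"
      using BW * by (intro mult_right_mono) auto
    finally show "\<bar>F N a' b - F N a b\<bar> \<le> (B * W) * h N powr (2 * H - 1) * (a' - a)" .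
  next
    fix N a b assume *: "s \<le> a" "a \<le> b" "b \<le> t"
    have "\<bar>F N a b\<bar> \<le> B * gap_weight str a b" using B(2) * .
    also have "\<dots> \<le> B * W" using gap_weight_le[OF *] B(1) by (intro mult_left_mono) (auto simp: W_def)
    finally show "\<bar>F N a b\<bar> \<le> B * W" .
  qed
qed

lemma measurable_admissible2:
  assumes "admissible str F Fl" "f \<in> borel_measurable M" "g \<in> borel_measurable M"
  shows "(\<lambda>x. F N (f x) (g x)) \<in> borel_measurable M"
  using measurable_compose[OF measurable_Pair admissibleD(1)[OF assms(1)], of f M g N] assms by simp

text \<open>Apart from one point, \<open>gN\<close> and \<open>gmain\<close> agree on the cell of
  \<open>a\<close> and differ by \<open>fluct\<close> from the next node on; that node lies below
  \<open>b\<close> since \<open>h N < b - a\<close>. Sup norm of \<open>fluct\<close>, Lipschitz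
  constant of \<open>F\<close> and cell length multiply to \<open>h N powr (4 * H - 1)\<close>, and
  the incomplete last cell gives \<open>h N powr (2 * H)\<close>.\<close>

lemma chainN_split:
  assumes F: "(\<lambda>v. F v b) \<in> borel_measurable borel"
    and ab: "s \<le> a" "h N < b - a" "b \<le> t"
    and B: "0 \<le> B" "\<And>v. a \<le> v \<Longrightarrow> v \<le> b \<Longrightarrow> \<bar>F v b\<bar> \<le> B"
    and L: "\<And>v w. a \<le> v \<Longrightarrow> v \<le> w \<Longrightarrow> w \<le> b \<Longrightarrow> \<bar>F w b - F v b\<bar> \<le> B * h N powr (2 * H - 1) * (w - v)"
  shows "\<bar>chainN N F a b - (LINT v|lborel. indicator {a<..<b} v * (gmain N a v * F v b))\<bar> \<le>
    C * B * (h N powr (4 * H - 1) * (b - a) + h N powr (2 * H))"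
proof -
  note F [measurable]
  have hp: "0 < h N" by (rule h_pos)
  have at: "a < t" using ab hp by linarith
  define c where "c = node N (Suc (cell N a))"
  have c: "a < c" "c \<le> a + h N" using cell_bounds[of a N] ab at by (auto simp: c_def node_Suc)
  have cb: "c < b" using c ab by linarith
  have same: "cell N v = cell N a" if "a < v" "v < c" for v
    using cell_bounds(1)[of a N] that ab at cell_le[of N a] by (intro cell_eqI) (auto simp: c_def)
  have diff: "cell N a \<noteq> cell N v" if "c \<le> v" "v < b" for v
  proof -
    have "v < node N (Suc (cell N v))" using that ab c at by (intro cell_bounds(3)) auto
    then show ?thesis using that by (auto simp: c_def)
  qed
  have g: "\<bar>gN N a v\<bar> \<le> 2 * C * h N powr (2 * H - 1)" "\<bar>gmain N a v\<bar> \<le> C * h N powr (2 * H - 1)"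
    if "a < v" "v < b" for v
    using that ab gN_le_mesh[of a v N] gmain_le_mesh[of a v N] by auto
  have "(LINT v|lborel. indicator {a<..<b} v * (gN N a v * F v b)) -
      (LINT v|lborel. indicator {a<..<b} v * (gmain N a v * F v b)) =
      (LINT v|lborel. indicator {a<..<b} v * (gN N a v * F v b) - indicator {a<..<b} v * (gmain N a v * F v b))"
  proof (rule Bochner_Integration.integral_diff[symmetric])
    show "integrable lborel (\<lambda>v. indicator {a<..<b} v * (gN N a v * F v b))"
      using g B C by (intro integrable_indicator_Ioo_bounded[where B = "2 * C * h N powr (2 * H - 1) * B"])
        (auto simp: abs_mult intro!: mult_mono)
    show "integrable lborel (\<lambda>v. indicator {a<..<b} v * (gmain N a v * F v b))"
      using g B C by (intro integrable_indicator_Ioo_bounded[where B = "C * h N powr (2 * H - 1) * B"])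
        (auto simp: abs_mult intro!: mult_mono)
  qed
  also have "\<dots> = (LINT v|lborel. indicator {c<..<b} v * (fluct N v * F v b))"
  proof (rule integral_cong_AE)
    show "AE v in lborel. indicator {a<..<b} v * (gN N a v * F v b) - indicator {a<..<b} v * (gmain N a v * F v b) =
        indicator {c<..<b} v * (fluct N v * F v b)"
      using AE_lborel_singleton[of c]
    proof eventually_elim
      case (elim v)
      consider "v \<notin> {a<..<b}" | "a < v" "v < c" "v < b" | "c < v" "v < b" using elim by force
      then show ?case
        using c same[of v] diff[of v] by cases (auto simp: gmain_def algebra_simps indicator_def)
    qed
  qed measurable
  finally have eq: "chainN N F a b - (LINT v|lborel. indicator {a<..<b} v * (gmain N a v * F v b)) =
     (LINT v|lborel. indicator {c<..<b} v * (fluct N v * F v b))" by (simp add: chainN_def)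
  have "\<bar>LINT v|lborel. indicator {c<..<b} v * (fluct N v * F v b)\<bar> \<le>
    C * h N powr (2 * H - 1) * (B * h N powr (2 * H - 1) * h N * (b - c) + B * h N)"
    unfolding c_def
  proof (rule fluct_weighted_bound)
    show "Suc (cell N a) \<le> Suc N" using cell_le by simp
    show "node N (Suc (cell N a)) \<le> b" using cb by (simp add: c_def)
    show "\<bar>F v b\<bar> \<le> B" if "v \<in> {node N (Suc (cell N a))..b}" for v
      using that c by (intro B) (auto simp: c_def)
    show "\<bar>F w b - F v b\<bar> \<le> B * h N powr (2 * H - 1) * (w - v)"
      if "node N (Suc (cell N a)) \<le> v" "v \<le> w" "w \<le> b" for v w
      using that c by (intro L) (auto simp: c_def)
    show "0 \<le> B * h N powr (2 * H - 1)" using B by simp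
  qed (use ab F in auto)
  also have "\<dots> = C * B * ((h N powr (2 * H - 1) * (h N powr (2 * H - 1) * h N)) * (b - c) + h N powr (2 * H - 1) * h N)"
    by (simp add: algebra_simps)
  also have "h N powr (2 * H - 1) * h N = h N powr (2 * H)"
    using hp powr_add[of "h N" "2 * H - 1" 1] by simp
  also have "h N powr (2 * H - 1) * h N powr (2 * H) = h N powr (4 * H - 1)"
    by (simp add: powr_add[symmetric])
  also have "C * B * (h N powr (4 * H - 1) * (b - c) + h N powr (2 * H)) \<le>
      C * B * (h N powr (4 * H - 1) * (b - a) + h N powr (2 * H))"
    using c B C by (intro mult_left_mono add_right_mono) auto
  finally show ?thesis unfolding eq .
qed

text \<open>For \<open>b - a\<close> at most the mesh, the mesh bound for \<open>gN\<close> times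
  \<open>b - a\<close> suffices. Otherwise \<open>gmain\<close> integrates to order
  \<open>2 * H\<close>, and the error terms of \<open>chainN_split\<close> are absorbed because the
  mesh is below \<open>b - a\<close> and their exponents are positive.\<close>

lemma admissible_chain_bound:
  assumes adm: "admissible str F Fl"
  shows "\<exists>B\<ge>0. \<forall>N a b. s \<le> a \<longrightarrow> a \<le> b \<longrightarrow> b \<le> t \<longrightarrow> \<bar>chainN N (F N) a b\<bar> \<le> B * (b - a) powr (2 * H)"
proof -
  obtain B where B: "0 \<le> B" "\<And>N a b. s \<le> a \<Longrightarrow> a \<le> b \<Longrightarrow> b \<le> t \<Longrightarrow> \<bar>F N a b\<bar> \<le> B"
    "\<And>N a a' b. s \<le> a \<Longrightarrow> a \<le> a' \<Longrightarrow> a' \<le> b \<Longrightarrow> b \<le> t \<Longrightarrow>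
       \<bar>F N a' b - F N a b\<bar> \<le> B * h N powr (2 * H - 1) * (a' - a)"
    by (rule admissible_uniform[OF adm]) (rule that; assumption)
  \<comment> \<open>The constant 9 of \<open>gmain_le\<close> and \<open>1 / (2 * H) \<le> 2\<close>
    give 18, the term \<open>h N powr (2 * H)\<close> one more, and the power of
    \<open>t - s\<close> comes from the term of order \<open>4 * H - 1\<close>; 20 is rounded up and
    also covers the short intervals.\<close>
  define K where "K = C * B * (20 + (t - s) powr (2 * H))"
  have K0: "0 \<le> K" using C B by (simp add: K_def)
  have meas: "(\<lambda>v. F N v b) \<in> borel_measurable borel" for N b
    by (rule measurable_admissible2[OF adm]) auto
  have "\<bar>chainN N (F N) a b\<bar> \<le> K * (b - a) powr (2 * H)" if ab: "s \<le> a" "a \<le> b" "b \<le> t" for N a b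
  proof (cases "b - a \<le> h N")
    case True
    have m: "(\<lambda>v. gN N a v * F N v b) \<in> borel_measurable borel" using meas by measurable
    have "\<bar>gN N a v * F N v b\<bar> \<le> 2 * C * h N powr (2 * H - 1) * B" if "v \<in> {a<..<b}" for v
      unfolding abs_mult using that ab B C gN_le_mesh[of a v N] by (intro mult_mono) auto
    then have "\<bar>chainN N (F N) a b\<bar> \<le> 2 * C * h N powr (2 * H - 1) * B * (b - a)"
      unfolding chainN_def using m ab by (intro integrable_indicator_Ioo_bounded(2)) auto
    also have "\<dots> = 2 * C * B * (h N powr (2 * H - 1) * (b - a))" by simp
    also have "\<dots> \<le> 2 * C * B * (b - a) powr (2 * H)"
    proof (cases "a = b")
      case False
      then have p: "0 < b - a" using ab by simp
      have "h N powr (2 * H - 1) * (b - a) \<le> (b - a) powr (2 * H - 1) * (b - a)"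
        using p True H by (intro mult_right_mono powr_mono2') auto
      also have "\<dots> = (b - a) powr (2 * H)" using p powr_add[of "b - a" "2 * H - 1" 1] by simp
      finally show ?thesis using C B by (intro mult_left_mono) auto
    qed simp
    also have "\<dots> \<le> K * (b - a) powr (2 * H)"
    proof (rule mult_right_mono)
      have "C * B * 2 \<le> C * B * (20 + (t - s) powr (2 * H))" using C B by (intro mult_left_mono) auto
      then show "2 * C * B \<le> K" by (simp add: K_def mult_ac)
    qed simp
    finally show ?thesis .
  next
    case False
    then have hab: "h N < b - a" by simp
    have p: "0 < b - a" using hab h_pos[of N] by linarith
    have "\<bar>LINT v|lborel. indicator {a<..<b} v * (gmain N a v * F N v b)\<bar> \<le>
       (LINT v|lborel. (9 * C * B) * (indicator {a<..<b} v * (v - a) powr (2 * H - 1)))"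
    proof -
      have hb: "has_bochner_integral lborel (\<lambda>v. indicator {a<..<b} v * (v - a) powr (2 * H - 1))
          ((b - a) powr (2 * H - 1 + 1) / (2 * H - 1 + 1))"
        using ab H by (intro has_bochner_integral_powr_Ioo) auto
      have m: "(\<lambda>v. gmain N a v * F N v b) \<in> borel_measurable borel" using meas by measurable
      have le: "norm (indicator {a<..<b} v * (gmain N a v * F N v b)) \<le>
          (9 * C * B) * (indicator {a<..<b} v * (v - a) powr (2 * H - 1))" for v
      proof (cases "v \<in> {a<..<b}")
        case True
        then have "\<bar>gmain N a v\<bar> * \<bar>F N v b\<bar> \<le> (9 * C * (v - a) powr (2 * H - 1)) * B"
          using ab B C gmain_le[of a v N] by (intro mult_mono) auto
        then show ?thesis using True by (simp add: abs_mult mult_ac)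
      qed simp
      have "norm (LINT v|lborel. indicator {a<..<b} v * (gmain N a v * F N v b)) \<le>
        (LINT v|lborel. (9 * C * B) * (indicator {a<..<b} v * (v - a) powr (2 * H - 1)))"
      proof (rule Bochner_Integration.integral_norm_bound_integral)
        show "integrable lborel (\<lambda>v. indicator {a<..<b} v * (gmain N a v * F N v b))"
        proof (rule integrable_indicator_Ioo_bounded(1)[OF m])
          fix v assume "v \<in> {a<..<b}"
          then show "\<bar>gmain N a v * F N v b\<bar> \<le> C * h N powr (2 * H - 1) * B"
            unfolding abs_mult using ab B C gmain_le_mesh[of a v N] by (intro mult_mono) auto
        qed
      qed (use hb le in \<open>auto simp: has_bochner_integral_iff\<close>)
      then show ?thesis by simp
    qed
    also have "\<dots> = (9 * C * B) * ((b - a) powr (2 * H) / (2 * H))"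
      using has_bochner_integral_integral_eq[OF has_bochner_integral_powr_Ioo[of a b "2 * H - 1"]] ab H
      by simp
    also have "\<dots> \<le> (9 * C * B) * (2 * (b - a) powr (2 * H))"
    proof (rule mult_left_mono)
      have "(b - a) powr (2 * H) / (2 * H) \<le> (b - a) powr (2 * H) / (1 / 2)"
        using H by (intro divide_left_mono) auto
      then show "(b - a) powr (2 * H) / (2 * H) \<le> 2 * (b - a) powr (2 * H)" by simp
    qed (use C B in auto)
    finally have m1: "\<bar>LINT v|lborel. indicator {a<..<b} v * (gmain N a v * F N v b)\<bar> \<le>
        C * B * (18 * (b - a) powr (2 * H))" by (simp add: mult_ac)
    have sp: "\<bar>chainN N (F N) a b - (LINT v|lborel. indicator {a<..<b} v * (gmain N a v * F N v b))\<bar> \<le>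
      C * B * (h N powr (4 * H - 1) * (b - a) + h N powr (2 * H))"
      using ab hab B by (intro chainN_split meas) auto
    have "h N powr (4 * H - 1) * (b - a) \<le> (b - a) powr (4 * H - 1) * (b - a)"
      using hab h_pos[of N] H p by (intro mult_right_mono powr_mono2) auto
    also have "\<dots> = (b - a) powr (2 * H) * (b - a) powr (2 * H)"
      using p powr_add[of "b - a" "4 * H - 1" 1] by (simp add: powr_add[symmetric])
    also have "\<dots> \<le> (t - s) powr (2 * H) * (b - a) powr (2 * H)"
      using ab H p by (intro mult_right_mono powr_mono2) auto
    finally have "h N powr (4 * H - 1) * (b - a) + h N powr (2 * H) \<le>
        (t - s) powr (2 * H) * (b - a) powr (2 * H) + (b - a) powr (2 * H)"
      using hab h_pos[of N] H by (intro add_mono powr_mono2) auto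
    then have "C * B * (h N powr (4 * H - 1) * (b - a) + h N powr (2 * H)) \<le>
        C * B * ((t - s) powr (2 * H) * (b - a) powr (2 * H) + (b - a) powr (2 * H))"
      using C B by (intro mult_left_mono) auto
    then have "\<bar>chainN N (F N) a b\<bar> \<le>
        C * B * (18 * (b - a) powr (2 * H)) + C * B * ((t - s) powr (2 * H) * (b - a) powr (2 * H) + (b - a) powr (2 * H))"
      using m1 sp by linarith
    also have "\<dots> = C * B * (19 + (t - s) powr (2 * H)) * (b - a) powr (2 * H)" by (simp add: algebra_simps)
    also have "\<dots> \<le> K * (b - a) powr (2 * H)"
      unfolding K_def using C B by (intro mult_right_mono mult_left_mono) auto
    finally show ?thesis .
  qed
  then show ?thesis using K0 by blast
qed

lemma measurable_chainN:
  assumes adm: "admissible str F Fl"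
  shows "(\<lambda>p. chainN N (F N) (fst p) (snd p)) \<in> borel_measurable (borel \<Otimes>\<^sub>M borel)"
proof -
  have [measurable]: "(\<lambda>q. F N (snd q) (snd (fst q))) \<in> borel_measurable ((borel \<Otimes>\<^sub>M borel) \<Otimes>\<^sub>M lborel)"
    by (rule measurable_admissible2[OF adm]) measurable
  have ind: "(\<lambda>q :: (real \<times> real) \<times> real. indicator {fst (fst q)<..<snd (fst q)} (snd q) :: real)
      \<in> borel_measurable ((borel \<Otimes>\<^sub>M borel) \<Otimes>\<^sub>M lborel)"
    unfolding greaterThanLessThan_iff indicator_def by measurable
  have "(\<lambda>q. indicator {fst (fst q)<..<snd (fst q)} (snd q) * (gN N (fst (fst q)) (snd q) * F N (snd q) (snd (fst q))))
      \<in> borel_measurable ((borel \<Otimes>\<^sub>M borel) \<Otimes>\<^sub>M lborel)"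
    by (intro borel_measurable_times ind measurable_gN2) measurable
  then show ?thesis
    unfolding chainN_def
    by (intro sigma_finite_measure.borel_measurable_lebesgue_integral[OF sigma_finite_lborel])
       (simp add: case_prod_beta)
qed

text \<open>Moving the lower end removes a piece of length \<open>a' - a\<close>, on which the mesh
  bound for \<open>gN\<close> applies, and changes \<open>gN\<close> on the rest, which
  \<open>gN_diff_integral\<close> controls. Both contributions have the order
  \<open>2 * H - 1\<close> that \<open>admissible\<close> demands, so the estimate reproduces itself
  along a chain.\<close>

lemma admissible_chain_Lipschitz:
  assumes adm: "admissible str F Fl"
  shows "\<exists>B\<ge>0. \<forall>N a a' b. s \<le> a \<longrightarrow> a \<le> a' \<longrightarrow> a' \<le> b \<longrightarrow> b \<le> t \<longrightarrow>
    \<bar>chainN N (F N) a' b - chainN N (F N) a b\<bar> \<le> B * h N powr (2 * H - 1) * (a' - a)"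
proof -
  obtain B where B: "0 \<le> B" "\<And>N a b. s \<le> a \<Longrightarrow> a \<le> b \<Longrightarrow> b \<le> t \<Longrightarrow> \<bar>F N a b\<bar> \<le> B"
    "\<And>N a a' b. s \<le> a \<Longrightarrow> a \<le> a' \<Longrightarrow> a' \<le> b \<Longrightarrow> b \<le> t \<Longrightarrow>
       \<bar>F N a' b - F N a b\<bar> \<le> B * h N powr (2 * H - 1) * (a' - a)"
    by (rule admissible_uniform[OF adm]) (rule that; assumption)
  define K where "K = C * (1 + 9 / (1 - 2 * H)) * B + 2 * C * B"
  have K0: "0 \<le> K" using C B H by (simp add: K_def)
  have meas [measurable]: "(\<lambda>v. F N v b) \<in> borel_measurable borel" for N b
    by (rule measurable_admissible2[OF adm]) auto
  have "\<bar>chainN N (F N) a' b - chainN N (F N) a b\<bar> \<le> K * h N powr (2 * H - 1) * (a' - a)"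
    if ab: "s \<le> a" "a \<le> a'" "a' \<le> b" "b \<le> t" for N a a' b
  proof -
    have g: "\<bar>gN N x v * F N v b\<bar> \<le> 2 * C * h N powr (2 * H - 1) * B" if "s \<le> x" "x < v" "v < b" for x v
      unfolding abs_mult using that ab B C gN_le_mesh[of x v N] by (intro mult_mono) auto
    have m: "(\<lambda>v. gN N x v * F N v b) \<in> borel_measurable borel" for x by measurable
    have int: "integrable lborel (\<lambda>v. indicator {y<..<z} v * (gN N x v * F N v b))"
      if "s \<le> x" "x \<le> y" "z \<le> b" for x y z
      using that g
      by (intro integrable_indicator_Ioo_bounded(1)[OF m, where B = "2 * C * h N powr (2 * H - 1) * B"]) auto
    have split: "chainN N (F N) a b = (LINT v|lborel. indicator {a<..<a'} v * (gN N a v * F N v b)) +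
        (LINT v|lborel. indicator {a'<..<b} v * (gN N a v * F N v b))"
    proof -
      have "chainN N (F N) a b = (LINT v|lborel. indicator {a<..<a'} v * (gN N a v * F N v b) +
         indicator {a'<..<b} v * (gN N a v * F N v b))"
        unfolding chainN_def
      proof (rule integral_cong_AE)
        show "AE v in lborel. indicator {a<..<b} v * (gN N a v * F N v b) =
            indicator {a<..<a'} v * (gN N a v * F N v b) + indicator {a'<..<b} v * (gN N a v * F N v b)"
          using AE_lborel_singleton[of a'] by eventually_elim (use ab in \<open>auto simp: indicator_def\<close>)
      qed measurable
      also have "\<dots> = (LINT v|lborel. indicator {a<..<a'} v * (gN N a v * F N v b)) +
        (LINT v|lborel. indicator {a'<..<b} v * (gN N a v * F N v b))"
        using ab by (intro Bochner_Integration.integral_add int) auto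
      finally show ?thesis .
    qed
    have d: "chainN N (F N) a' b - (LINT v|lborel. indicator {a'<..<b} v * (gN N a v * F N v b)) =
       (LINT v|lborel. indicator {a'<..<b} v * ((gN N a' v - gN N a v) * F N v b))"
    proof -
      have "(LINT v|lborel. indicator {a'<..<b} v * (gN N a' v * F N v b) - indicator {a'<..<b} v * (gN N a v * F N v b)) =
          chainN N (F N) a' b - (LINT v|lborel. indicator {a'<..<b} v * (gN N a v * F N v b))"
        unfolding chainN_def
        by (rule Bochner_Integration.integral_diff) (rule int; use ab in simp)+
      then show ?thesis by (simp add: algebra_simps)
    qed
    have 1: "\<bar>LINT v|lborel. indicator {a'<..<b} v * ((gN N a' v - gN N a v) * F N v b)\<bar> \<le>
        C * (1 + 9 / (1 - 2 * H)) * h N powr (2 * H - 1) * B * (a' - a)"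
      using ab B by (intro gN_diff_integral meas) auto
    have 2: "\<bar>LINT v|lborel. indicator {a<..<a'} v * (gN N a v * F N v b)\<bar> \<le>
        2 * C * h N powr (2 * H - 1) * B * (a' - a)"
      using ab g by (intro integrable_indicator_Ioo_bounded(2)[OF m]) auto
    have "\<bar>chainN N (F N) a' b - chainN N (F N) a b\<bar> \<le>
        C * (1 + 9 / (1 - 2 * H)) * h N powr (2 * H - 1) * B * (a' - a) + 2 * C * h N powr (2 * H - 1) * B * (a' - a)"
      using 1 2 d split by linarith
    then show ?thesis by (simp add: K_def algebra_simps)
  qed
  then show ?thesis using K0 by blast
qed

text \<open>Dominated convergence with the majorant \<open>(v - a) powr (2 * H - 1)\<close>,
  available for \<open>gmain\<close> but not for \<open>gN\<close>.\<close>

lemma gmain_integral_tendsto: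
  assumes adm: "admissible str F Fl" and ab: "s \<le> a" "a < b" "b \<le> t"
  shows "(\<lambda>N. LINT v|lborel. indicator {a<..<b} v * (gmain N a v * F N v b)) \<longlonglongrightarrow> chain Fl a b"
proof -
  obtain B where B: "0 \<le> B" "\<And>N a b. s \<le> a \<Longrightarrow> a \<le> b \<Longrightarrow> b \<le> t \<Longrightarrow> \<bar>F N a b\<bar> \<le> B"
    "\<And>N a a' b. s \<le> a \<Longrightarrow> a \<le> a' \<Longrightarrow> a' \<le> b \<Longrightarrow> b \<le> t \<Longrightarrow>
       \<bar>F N a' b - F N a b\<bar> \<le> B * h N powr (2 * H - 1) * (a' - a)"
    by (rule admissible_uniform[OF adm]) (rule that; assumption)
  have meas [measurable]: "(\<lambda>v. F N v b) \<in> borel_measurable borel" for N b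
    by (rule measurable_admissible2[OF adm]) auto
  have m: "(\<lambda>v. indicator {a<..<b} v * (gmain N a v * F N v b)) \<in> borel_measurable lborel" for N
    by measurable
  have lim: "(\<lambda>N. indicator {a<..<b} v * (gmain N a v * F N v b)) \<longlonglongrightarrow> indicator {a<..<b} v * (drift a v * Fl v b)" for v
  proof (cases "v \<in> {a<..<b}")
    case True
    then show ?thesis
      using ab gmain_tendsto[of a v] admissibleD(3)[OF adm, of v b]
      by (intro tendsto_mult tendsto_const) auto
  qed simp
  have "has_bochner_integral lborel (\<lambda>v. indicator {a<..<b} v * (v - a) powr (2 * H - 1))
          ((b - a) powr (2 * H - 1 + 1) / (2 * H - 1 + 1))"
    using ab H by (intro has_bochner_integral_powr_Ioo) auto
  then have dom: "integrable lborel (\<lambda>v. (9 * C * B) * (indicator {a<..<b} v * (v - a) powr (2 * H - 1)))"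
    by (auto simp: has_bochner_integral_iff)
  show ?thesis
    unfolding chain_def
  proof (rule integral_dominated_convergence[OF _ m dom])
    show "(\<lambda>v. indicator {a<..<b} v * (drift a v * Fl v b)) \<in> borel_measurable lborel"
      by (rule borel_measurable_LIMSEQ_real[OF lim m])
    show "AE v in lborel. norm (indicator {a<..<b} v * (gmain N a v * F N v b)) \<le>
          (9 * C * B) * (indicator {a<..<b} v * (v - a) powr (2 * H - 1))" for N
    proof (rule AE_I2)
      fix v
      show "norm (indicator {a<..<b} v * (gmain N a v * F N v b)) \<le>
          (9 * C * B) * (indicator {a<..<b} v * (v - a) powr (2 * H - 1))"
      proof (cases "v \<in> {a<..<b}")
        case True
        then have "\<bar>gmain N a v\<bar> * \<bar>F N v b\<bar> \<le> (9 * C * (v - a) powr (2 * H - 1)) * B"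
          using ab B C gmain_le[of a v N] by (intro mult_mono) auto
        then show ?thesis using True by (simp add: abs_mult mult_ac)
      qed simp
    qed
  qed (use lim in auto)
qed

text \<open>The induction step for chains. The limit is identified by comparing with
  \<open>gmain\<close>, the error of the comparison vanishing because \<open>4 * H - 1\<close> is
  positive; the flag becomes true whatever it was.\<close>

theorem admissible_chain:
  assumes adm: "admissible str F Fl"
  shows "admissible True (\<lambda>N. chainN N (F N)) (chain Fl)"
proof -
  obtain B1 where B1: "0 \<le> B1" "\<And>N a b. s \<le> a \<Longrightarrow> a \<le> b \<Longrightarrow> b \<le> t \<Longrightarrow>
      \<bar>chainN N (F N) a b\<bar> \<le> B1 * (b - a) powr (2 * H)"
    using admissible_chain_bound[OF adm] by blast
  obtain B2 where B2: "0 \<le> B2" "\<And>N a a' b. s \<le> a \<Longrightarrow> a \<le> a' \<Longrightarrow> a' \<le> b \<Longrightarrow> b \<le> t \<Longrightarrow>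
    \<bar>chainN N (F N) a' b - chainN N (F N) a b\<bar> \<le> B2 * h N powr (2 * H - 1) * (a' - a)"
    using admissible_chain_Lipschitz[OF adm] by blast
  have conv: "(\<lambda>N. chainN N (F N) a b) \<longlonglongrightarrow> chain Fl a b" if ab: "s \<le> a" "a < b" "b \<le> t" for a b
  proof -
    obtain B where B: "0 \<le> B" "\<And>N a b. s \<le> a \<Longrightarrow> a \<le> b \<Longrightarrow> b \<le> t \<Longrightarrow> \<bar>F N a b\<bar> \<le> B"
      "\<And>N a a' b. s \<le> a \<Longrightarrow> a \<le> a' \<Longrightarrow> a' \<le> b \<Longrightarrow> b \<le> t \<Longrightarrow>
         \<bar>F N a' b - F N a b\<bar> \<le> B * h N powr (2 * H - 1) * (a' - a)"
      by (rule admissible_uniform[OF adm]) (rule that; assumption)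
    have meas: "(\<lambda>v. F N v b) \<in> borel_measurable borel" for N
      by (rule measurable_admissible2[OF adm]) auto
    have p: "(\<lambda>N. h N powr e) \<longlonglongrightarrow> 0" if "0 < e" for e
      using tendsto_powr2[OF h_tendsto tendsto_const, of e] h_pos that
      by (auto intro!: always_eventually less_imp_le)
    have "(\<lambda>N. C * B * (h N powr (4 * H - 1) * (b - a) + h N powr (2 * H))) \<longlonglongrightarrow>
        C * B * (0 * (b - a) + 0)"
      using H by (intro tendsto_intros p) auto
    then have z: "(\<lambda>N. C * B * (h N powr (4 * H - 1) * (b - a) + h N powr (2 * H))) \<longlonglongrightarrow> 0" by simp
    have "(\<lambda>N. chainN N (F N) a b - (LINT v|lborel. indicator {a<..<b} v * (gmain N a v * F N v b))) \<longlonglongrightarrow> 0"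
    proof (rule Lim_null_comparison[OF _ z])
      have "\<forall>\<^sub>F N in sequentially. h N < b - a" using ab by (intro eventually_h_less) auto
      then show "\<forall>\<^sub>F N in sequentially. norm (chainN N (F N) a b -
          (LINT v|lborel. indicator {a<..<b} v * (gmain N a v * F N v b))) \<le>
          C * B * (h N powr (4 * H - 1) * (b - a) + h N powr (2 * H))"
      proof eventually_elim
        case (elim N)
        show ?case unfolding real_norm_def
          using ab elim B by (intro chainN_split meas) auto
      qed
    qed
    from tendsto_add[OF this gmain_integral_tendsto[OF adm ab]] show ?thesis by simp
  qed
  define B where "B = B1 + B2"
  have "\<bar>chainN N (F N) a b\<bar> \<le> B * gap_weight True a b" if "s \<le> a" "a \<le> b" "b \<le> t" for N a b
  proof -
    have "B1 * (b - a) powr (2 * H) \<le> B * gap_weight True a b"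
      using B2(1) by (simp add: B_def gap_weight_def mult_right_mono)
    then show ?thesis using B1(2)[OF that, of N] by linarith
  qed
  moreover have "\<bar>chainN N (F N) a' b - chainN N (F N) a b\<bar> \<le> B * h N powr (2 * H - 1) * (a' - a)"
    if "s \<le> a" "a \<le> a'" "a' \<le> b" "b \<le> t" for N a a' b
  proof -
    have "B2 * h N powr (2 * H - 1) * (a' - a) \<le> B * h N powr (2 * H - 1) * (a' - a)"
      using B1(1) that by (intro mult_right_mono) (auto simp: B_def)
    then show ?thesis using B2(2)[OF that, of N] by linarith
  qed
  moreover have "0 \<le> B" using B1 B2 by (simp add: B_def)
  ultimately show ?thesis
    unfolding admissible_def using measurable_chainN[OF adm] conv by blast
qed

end

section \<open>Domination of the non-consecutive pairs\<close>

definition prv :: "nat set \<Rightarrow> nat \<Rightarrow> nat" where "prv J q = Max {i \<in> insert 0 J. i < q}"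

lemma prv_props:
  assumes "finite J" "0 < q"
  shows "prv J q \<in> insert 0 J" "prv J q < q" "\<And>i. i \<in> J \<Longrightarrow> i < q \<Longrightarrow> i \<le> prv J q"
proof -
  have f: "finite {i \<in> insert 0 J. i < q}" "{i \<in> insert 0 J. i < q} \<noteq> {}" using assms by auto
  show "prv J q \<in> insert 0 J" "prv J q < q" using Max_in[OF f] by (auto simp: prv_def)
  fix i assume "i \<in> J" "i < q"
  then show "i \<le> prv J q" unfolding prv_def by (intro Max_ge f) auto
qed

lemma prv_eqI:
  assumes "finite J" "a \<in> insert 0 J" "a < q" "\<And>i. i \<in> J \<Longrightarrow> i < q \<Longrightarrow> i \<le> a"
  shows "prv J q = a"
proof (rule antisym)
  show "a \<le> prv J q" using prv_props[of J q] assms by (cases "a = 0") auto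
  show "prv J q \<le> a" using prv_props[of J q] assms by (cases "prv J q = 0") auto
qed

text \<open>For \<open>E\<close> the non-consecutive pairs of a pairing and \<open>Kc\<close> the larger elements of its
  consecutive pairs.\<close>

locale pair_struct =
  fixes n :: nat and E :: "(nat \<times> nat) set" and Kc :: "nat set"
  assumes E_range: "(i, j) \<in> E \<Longrightarrow> 1 \<le> i \<and> Suc i < j \<and> j \<le> n"
    and E_disj: "(i, j) \<in> E \<Longrightarrow> (i', j') \<in> E \<Longrightarrow> i = i' \<or> i = j' \<or> j = i' \<or> j = j' \<Longrightarrow> i = i' \<and> j = j'"
    and Kc_range: "k \<in> Kc \<Longrightarrow> 2 \<le> k \<and> k \<le> n"
    and Kc_disj: "k \<in> Kc \<Longrightarrow> k \<notin> fst ` E \<union> snd ` E \<and> k - 1 \<notin> fst ` E \<union> snd ` E"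
    and Kc_sep: "k \<in> Kc \<Longrightarrow> k - 1 \<notin> Kc"
    and cover: "i \<in> {1..n} \<Longrightarrow> i \<in> fst ` E \<union> snd ` E \<or> i \<in> Kc \<or> Suc i \<in> Kc"
begin

definition Q :: "nat set" where "Q = fst ` E \<union> snd ` E"

lemma Q_cases:
  assumes "q \<in> Q"
  obtains j where "(q, j) \<in> E" | i where "(i, q) \<in> E"
proof -
  consider "q \<in> fst ` E" | "q \<in> snd ` E" using assms unfolding Q_def by blast
  then show thesis
  proof cases
    case 1
    then obtain x where "x \<in> E" "q = fst x" by blast
    then show ?thesis using that(1)[of "snd x"] by simp
  next
    case 2
    then obtain x where "x \<in> E" "q = snd x" by blast
    then show ?thesis using that(2)[of "fst x"] by simp
  qed
qed

lemma Q_range: "Q \<subseteq> {1..n}"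
proof
  fix q assume "q \<in> Q"
  then show "q \<in> {1..n}"
  proof (cases rule: Q_cases)
    case (1 j)
    from E_range[OF this] show ?thesis by simp
  next
    case (2 i)
    from E_range[OF this] show ?thesis by simp
  qed
qed

lemma finite_Q: "finite Q" using Q_range finite_subset by blast

lemma finite_E: "finite E"
proof (rule finite_subset)
  show "E \<subseteq> {1..n} \<times> {1..n}"
  proof (intro subrelI)
    fix i j assume "(i, j) \<in> E"
    from E_range[OF this] show "(i, j) \<in> {1..n} \<times> {1..n}" by simp
  qed
qed simp

lemma E_fst: "(i, j) \<in> E \<Longrightarrow> i \<in> fst ` E" by (rule image_eqI[of _ _ "(i, j)"]) simp_all

lemma E_snd: "(i, j) \<in> E \<Longrightarrow> j \<in> snd ` E" by (rule image_eqI[of _ _ "(i, j)"]) simp_all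

lemma E_inQ: "(i, j) \<in> E \<Longrightarrow> i \<in> Q" "(i, j) \<in> E \<Longrightarrow> j \<in> Q"
  unfolding Q_def by (rule UnI1, erule E_fst) (rule UnI2, erule E_snd)

lemma E_less: "(i, j) \<in> E \<Longrightarrow> i < j" using E_range[of i j] by simp

lemma Q_pos: "q \<in> Q \<Longrightarrow> 0 < q" using Q_range by auto

text \<open>A gap of \<open>Q\<close> is named by its upper end. This gap lies between
  \<open>i\<close> and \<open>j\<close> and ends no later than the next left element; a pair that
  starts further right has its main gap strictly beyond that element, whence injectivity.\<close>

definition main_gap :: "nat \<times> nat \<Rightarrow> nat" where
  "main_gap = (\<lambda>(i, j). LEAST q. q \<in> Q \<and> i < q \<and> (q \<in> fst ` E \<or> q = j))"

text \<open>The gap directly above \<open>i\<close>. It is injective for the same reason, but may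
  coincide with the main gap.\<close>

definition next_gap :: "nat \<times> nat \<Rightarrow> nat" where
  "next_gap = (\<lambda>(i, j). LEAST q. q \<in> Q \<and> i < q)"

lemma main_props:
  assumes "(i, j) \<in> E"
  shows "main_gap (i, j) \<in> Q" "i < main_gap (i, j)" "main_gap (i, j) \<le> j" "main_gap (i, j) \<in> fst ` E \<or> main_gap (i, j) = j"
    "\<And>q. q \<in> fst ` E \<Longrightarrow> i < q \<Longrightarrow> main_gap (i, j) \<le> q"
proof -
  let ?P = "\<lambda>q. q \<in> Q \<and> i < q \<and> (q \<in> fst ` E \<or> q = j)"
  have eq: "main_gap (i, j) = (LEAST q. ?P q)" by (simp only: main_gap_def prod.case)
  have ex: "?P j" using E_inQ(2)[OF assms] E_less[OF assms] by (simp only: simp_thms)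
  have "?P (main_gap (i, j))" unfolding eq using ex by (rule LeastI)
  then show "main_gap (i, j) \<in> Q" "i < main_gap (i, j)" "main_gap (i, j) \<in> fst ` E \<or> main_gap (i, j) = j"
    by (simp_all only: simp_thms)
  show "main_gap (i, j) \<le> j" unfolding eq using ex by (rule Least_le)
  fix q assume "q \<in> fst ` E" "i < q"
  then have "?P q" unfolding Q_def by blast
  then show "main_gap (i, j) \<le> q" unfolding eq by (rule Least_le)
qed

lemma nxt_props:
  assumes "(i, j) \<in> E"
  shows "next_gap (i, j) \<in> Q" "i < next_gap (i, j)" "\<And>q. q \<in> Q \<Longrightarrow> i < q \<Longrightarrow> next_gap (i, j) \<le> q"
proof -
  let ?P = "\<lambda>q. q \<in> Q \<and> i < q"
  have eq: "next_gap (i, j) = (LEAST q. ?P q)" by (simp only: next_gap_def prod.case)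
  have ex: "?P j" using E_inQ(2)[OF assms] E_less[OF assms] by (simp only: simp_thms)
  have "?P (next_gap (i, j))" unfolding eq using ex by (rule LeastI)
  then show "next_gap (i, j) \<in> Q" "i < next_gap (i, j)" by (simp_all only: simp_thms)
  fix q assume "q \<in> Q" "i < q"
  then have "?P q" by (rule conjI)
  then show "next_gap (i, j) \<le> q" unfolding eq by (rule Least_le)
qed

lemma nxt_le: "(i, j) \<in> E \<Longrightarrow> next_gap (i, j) \<le> j"
  using nxt_props(3)[of i j j] E_inQ(2)[of i j] E_less[of i j] by simp

lemma main_less: "(i, j) \<in> E \<Longrightarrow> (i', j') \<in> E \<Longrightarrow> i < i' \<Longrightarrow> main_gap (i, j) < main_gap (i', j')"
  by (rule le_less_trans[OF main_props(5)[OF _ E_fst] main_props(2)])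

lemma inj_main: "inj_on main_gap E"
proof (rule inj_onI)
  fix x y assume xy: "x \<in> E" "y \<in> E" "main_gap x = main_gap y"
  obtain i j where x: "x = (i, j)" by (cases x)
  obtain i' j' where y: "y = (i', j')" by (cases y)
  note E = xy(1)[unfolded x] xy(2)[unfolded y] and eq = xy(3)[unfolded x y]
  have "\<not> i < i'" using main_less[OF E] eq by linarith
  moreover have "\<not> i' < i" using main_less[OF E(2,1)] eq by linarith
  ultimately have "i = i'" by linarith
  then show "x = y" unfolding x y using E_disj[OF E] by blast
qed

lemma nxt_less: "(i, j) \<in> E \<Longrightarrow> (i', j') \<in> E \<Longrightarrow> i < i' \<Longrightarrow> next_gap (i, j) < next_gap (i', j')"
  by (rule le_less_trans[OF nxt_props(3)[OF _ E_inQ(1)] nxt_props(2)])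

lemma inj_nxt: "inj_on next_gap E"
proof (rule inj_onI)
  fix x y assume xy: "x \<in> E" "y \<in> E" "next_gap x = next_gap y"
  obtain i j where x: "x = (i, j)" by (cases x)
  obtain i' j' where y: "y = (i', j')" by (cases y)
  note E = xy(1)[unfolded x] xy(2)[unfolded y] and eq = xy(3)[unfolded x y]
  have "\<not> i < i'" using nxt_less[OF E] eq by linarith
  moreover have "\<not> i' < i" using nxt_less[OF E(2,1)] eq by linarith
  ultimately have "i = i'" by linarith
  then show "x = y" unfolding x y using E_disj[OF E] by blast
qed

lemma inj_snd: "inj_on snd E"
proof (rule inj_onI)
  fix x y assume xy: "x \<in> E" "y \<in> E" "snd x = snd y"
  obtain i j where x: "x = (i, j)" by (cases x)
  obtain i' j' where y: "y = (i', j')" by (cases y)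
  note E = xy(1)[unfolded x] xy(2)[unfolded y] and eq = xy(3)[unfolded x y snd_conv]
  show "x = y" unfolding x y using E_disj[OF E] eq by blast
qed

text \<open>A pair needs a second gap for the rest of its exponent. It is the gap directly above
  \<open>i\<close>; if that is already the main gap, the pair belongs to \<open>E1\<close> and takes
  the gap directly below \<open>j\<close> instead.\<close>

definition E1 :: "(nat \<times> nat) set" where "E1 = {x \<in> E. next_gap x = main_gap x}"
definition E2 :: "(nat \<times> nat) set" where "E2 = {x \<in> E. next_gap x \<noteq> main_gap x}"

text \<open>If \<open>q\<close> is the next gap of a pair in \<open>E2\<close>, it is not a left
  element, since it would then also be the main gap. As a main gap it is therefore the right element
  of its pair. No left element lies between \<open>i\<close> and \<open>q\<close>, and no element at
  all between \<open>i'\<close> and \<open>q\<close>; hence the two pairs coincide, a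
  contradiction.\<close>

lemma main_not_nxt: "q \<in> main_gap ` E \<Longrightarrow> q \<notin> next_gap ` E2"
proof
  assume "q \<in> main_gap ` E"
  then obtain x where x: "x \<in> E" "q = main_gap x" by blast
  assume "q \<in> next_gap ` E2"
  then obtain y where y: "y \<in> E" "next_gap y \<noteq> main_gap y" "q = next_gap y" unfolding E2_def by blast
  obtain i j where xij: "x = (i, j)" by (cases x)
  obtain i' j' where yij: "y = (i', j')" by (cases y)
  note ij = x[unfolded xij] and ij' = y[unfolded yij]
  have ilt: "i < q" "i' < q" using main_props(2)[OF ij(1)] nxt_props(2)[OF ij'(1)] ij(2) ij'(3) by simp_all
  show False
  proof (cases "q \<in> fst ` E")
    case True
    have "main_gap (i', j') \<le> q" by (rule main_props(5)[OF ij'(1) True ilt(2)])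
    moreover have "next_gap (i', j') \<le> main_gap (i', j')"
      by (rule nxt_props(3)[OF ij'(1) main_props(1,2)[OF ij'(1)]])
    ultimately show False using ij'(2,3) by linarith
  next
    case False
    then have q: "q = j" using main_props(4)[OF ij(1)] ij(2) by simp
    have "i \<le> i'"
    proof (rule ccontr)
      assume "\<not> i \<le> i'"
      then have "i' < i" by simp
      then have "q \<le> i" using nxt_props(3)[OF ij'(1) E_inQ(1)[OF ij(1)]] ij'(3) by simp
      then show False using ilt by simp
    qed
    moreover have "\<not> i < i'"
    proof
      assume "i < i'"
      then have "q \<le> i'" using main_props(5)[OF ij(1) E_fst[OF ij'(1)]] ij(2) by simp
      then show False using ilt by simp
    qed
    ultimately have "i = i'" by simp
    moreover from this have "j = j'" using E_disj[OF ij(1) ij'(1)] by blast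
    ultimately have "main_gap (i', j') = q" using ij(2) by simp
    then show False using ij'(2,3) by simp
  qed
qed

text \<open>Such a \<open>q\<close> must be the right element of a pair with no element of
  \<open>Q\<close> in between. As the pair is not consecutive, \<open>q - 1\<close> is strictly
  inside it and belongs to a consecutive pair. This is the one case in which a gap receives the full
  exponent \<open>2 * H - 2\<close> of a pair, and its conclusion is what makes the gap
  flagged.\<close>

lemma main_snd_adjacent:
  assumes "q \<in> main_gap ` E" "q \<in> snd ` E1"
  shows "q - 1 \<notin> insert 0 Q"
proof -
  obtain x where x: "x \<in> E" "next_gap x = main_gap x" "q = snd x" using assms(2) unfolding E1_def by blast
  obtain y where y: "y \<in> E" "q = main_gap y" using assms(1) by blast
  obtain i j where xij: "x = (i, j)" by (cases x)
  obtain i' j' where yij: "y = (i', j')" by (cases y)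
  note ij = x[unfolded xij snd_conv] and ij' = y[unfolded yij]
  have iq: "Suc i < q" using E_range[OF ij(1)] ij(3) by simp
  have "q \<notin> fst ` E"
  proof
    assume "q \<in> fst ` E"
    then obtain z where z: "z \<in> E" "q = fst z" by blast
    obtain j'' where "z = (q, j'')" using z(2) by (cases z) simp
    then have "i = q" using E_disj[OF ij(1), of q j''] z(1) ij(3) by blast
    then show False using iq by simp
  qed
  then have "j' = q" using main_props(4)[OF ij'(1)] ij'(2) by simp
  then have "i = i'" "j = j'" using E_disj[OF ij(1) ij'(1)] ij(3) by blast+
  then have nx: "next_gap (i, j) = q" using ij(2) ij'(2) by simp
  have "q - 1 \<notin> Q"
  proof
    assume "q - 1 \<in> Q"
    then have "q \<le> q - 1" using nxt_props(3)[OF ij(1), of "q - 1"] iq nx by simp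
    then show False using iq by simp
  qed
  then show ?thesis using iq by simp
qed

end

section \<open>An integrable majorant in terms of gaps\<close>

locale pair_bounds = cov_bounds s t R T H C + pair_struct n E Kc
  for s t :: real and R :: "real \<Rightarrow> real \<Rightarrow> real" and T H C :: real
    and n :: nat and E :: "(nat \<times> nat) set" and Kc :: "nat set"
begin

abbreviation X :: "(nat \<Rightarrow> real) \<Rightarrow> nat \<Rightarrow> real" where "X u \<equiv> ext_pts s t n u"

text \<open>On bounded lengths an exponent may be made more singular at the cost of a constant; all
  gaps can then be given the same exponent.\<close>

lemma powr_neg_weaken:
  assumes "0 < y" "y \<le> t - s" "a \<le> b" "b \<le> a + 2"
  shows "y powr (- a) \<le> (1 + (t - s))\<^sup>2 * y powr (- b)"
proof -
  have "y powr (- a) = y powr (b - a) * y powr (- b)" by (simp add: powr_add[symmetric])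
  also have "y powr (b - a) \<le> (1 + (t - s)) powr (b - a)" using assms by (intro powr_mono2) auto
  also have "(1 + (t - s)) powr (b - a) \<le> (1 + (t - s)) powr 2" using assms st by (intro powr_mono) auto
  also have "(1 + (t - s)) powr 2 = (1 + (t - s))\<^sup>2" using st by simp
  finally show ?thesis by (simp add: mult_right_mono)
qed

text \<open>Each factor \<open>(X u j - X u i) powr (2 * H - 2)\<close> is split over two of the gaps between consecutive
  points of \<open>Q\<close>, in such a way that the exponent on every gap stays above \<open>-1\<close>; this is possible
  since \<open>H > 1 / 4\<close>.\<close>

lemma pairs_le_gaps:
  assumes fl: "\<And>q. q \<in> Q \<Longrightarrow> q - 1 \<notin> insert 0 Q \<Longrightarrow> fl q"
  shows "\<exists>K\<ge>0. \<forall>u\<in>osimplex s t n Q.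
    (\<Prod>(i, j)\<in>E. (X u j - X u i) powr (2 * H - 2)) *
    (\<Prod>q\<in>insert (Suc n) Q. gap_weight (fl q) (X u (prv Q q)) (X u q))
    \<le> K * (\<Prod>q\<in>Q. (X u q - X u (prv Q q)) powr (- (5 / 4 - H)))"
proof -
  define W where "W = 1 + (t - s) powr (2 * H)"
  define D where "D = (1 + (t - s))\<^sup>2"
  have W1: "1 \<le> W" by (simp add: W_def)
  have D1: "1 \<le> D" using st by (simp add: D_def)
  define M where "M = main_gap ` E"
  define J1 where "J1 = snd ` E1"
  define J2 where "J2 = next_gap ` E2"
  have sub: "M \<subseteq> Q" "J1 \<subseteq> Q" "J2 \<subseteq> Q"
  proof -
    have "main_gap x \<in> Q \<and> snd x \<in> Q \<and> next_gap x \<in> Q" if "x \<in> E" for x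
      using main_props(1)[of "fst x" "snd x"] nxt_props(1)[of "fst x" "snd x"] E_inQ(2)[of "fst x" "snd x"] that
      by simp
    then show "M \<subseteq> Q" "J1 \<subseteq> Q" "J2 \<subseteq> Q"
      unfolding M_def J1_def J2_def E1_def E2_def by blast+
  qed
  \<comment> \<open>Main gaps carry exponent \<alpha> and second gaps \<beta>. The constraints
    \<alpha> < 1 and 2\<beta> < 1 confine \<beta> to the interval from 1 - 2H to 1/2, nonempty since
    H > 1/4; 3/4 - H is its midpoint.\<close>
  define \<alpha> where "\<alpha> = 5 / 4 - H"
  define \<beta> where "\<beta> = 3 / 4 - H"
  have ab: "2 * H - 2 = - \<alpha> + - \<beta>" by (simp add: \<alpha>_def \<beta>_def)
  have pos: "0 < \<alpha>" "0 < \<beta>" using H by (auto simp: \<alpha>_def \<beta>_def)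
  show ?thesis
  proof (intro exI[of _ "W * (W * D) ^ card Q"] conjI ballI)
    show "0 \<le> W * (W * D) ^ card Q" using W1 D1 by simp
    fix u assume u: "u \<in> osimplex s t n Q"
    define y where "y q = X u q - X u (prv Q q)" for q
    have y: "0 < y q" "y q \<le> t - s" if "q \<in> Q" for q
    proof -
      note p = prv_props[OF finite_Q Q_pos[OF that]]
      have "X u (prv Q q) < X u q" using simplexD[OF u, of "prv Q q" q] p that by auto
      then show "0 < y q" by (simp add: y_def)
      have "s \<le> X u (prv Q q)" "X u q \<le> t"
        using simplex_bounds(1)[OF u _ Q_range, of "prv Q q"] simplex_bounds(2)[OF u _ Q_range, of q] p that by auto
      then show "y q \<le> t - s" by (simp add: y_def)
    qed
    have mono: "X u i \<le> X u j" if "i \<in> insert 0 Q" "j \<in> Q" "i \<le> j" for i j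
      using simplexD[OF u, of i j] that by (cases "i = j") auto
    have yle: "y q \<le> X u j - X u i" if "i \<in> Q" "j \<in> Q" "q \<in> Q" "i < q" "q \<le> j" for i j q
    proof -
      note p = prv_props[OF finite_Q Q_pos[OF that(3)]]
      have "X u q \<le> X u j" using mono that by auto
      moreover have "X u i \<le> X u (prv Q q)"
      proof -
        have ip: "i \<le> prv Q q" using p(3) that by auto
        then have "prv Q q \<in> Q" using p(1) that Q_pos by fastforce
        then show ?thesis using mono ip that by auto
      qed
      ultimately show ?thesis by (simp add: y_def)
    qed
    define sec where "sec x = (if x \<in> E1 then snd x else next_gap x)" for x
    \<comment> \<open>Both chosen gaps lie inside the interval of the pair, so negative powers of
      their lengths are the larger ones.\<close>
    have pair: "(X u j - X u i) powr (2 * H - 2) \<le> y (main_gap (i, j)) powr (- \<alpha>) * y (sec (i, j)) powr (- \<beta>)"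
      if ij: "(i, j) \<in> E" for i j
    proof -
      note Q = E_inQ[OF ij] E_less[OF ij]
      have m: "main_gap (i, j) \<in> Q" "y (main_gap (i, j)) \<le> X u j - X u i"
        using main_props(1-3)[OF ij] Q by (simp_all add: yle)
      have c: "sec (i, j) \<in> Q" "y (sec (i, j)) \<le> X u j - X u i"
        using nxt_props(1,2)[OF ij] nxt_le[OF ij] Q by (simp_all add: sec_def yle)
      have "(X u j - X u i) powr (2 * H - 2) = (X u j - X u i) powr (- \<alpha>) * (X u j - X u i) powr (- \<beta>)"
        unfolding ab by (rule powr_add)
      also have "\<dots> \<le> y (main_gap (i, j)) powr (- \<alpha>) * y (sec (i, j)) powr (- \<beta>)"
        using m c pos y by (intro mult_mono powr_mono2') auto
      finally show ?thesis .
    qed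
    have E12: "E = E1 \<union> E2" "E1 \<inter> E2 = {}" "finite E1" "finite E2" using finite_E by (auto simp: E1_def E2_def)
    have ind: "(\<Prod>q\<in>S. f q) = (\<Prod>q\<in>Q. if q \<in> S then f q else 1)" if "S \<subseteq> Q" for S and f :: "nat \<Rightarrow> real"
      using that finite_Q by (intro prod.mono_neutral_cong_left) auto
    have "(\<Prod>(i, j)\<in>E. (X u j - X u i) powr (2 * H - 2)) \<le> (\<Prod>x\<in>E. y (main_gap x) powr (- \<alpha>) * y (sec x) powr (- \<beta>))"
      using pair by (intro prod_mono) auto
    also have "\<dots> = (\<Prod>x\<in>E. y (main_gap x) powr (- \<alpha>)) * ((\<Prod>x\<in>E1. y (sec x) powr (- \<beta>)) * (\<Prod>x\<in>E2. y (sec x) powr (- \<beta>)))"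
      unfolding prod.distrib by (subst (2) E12(1), subst prod.union_disjoint) (use E12 in auto)
    also have "(\<Prod>x\<in>E. y (main_gap x) powr (- \<alpha>)) = (\<Prod>q\<in>M. y q powr (- \<alpha>))"
      unfolding M_def by (subst prod.reindex[OF inj_main]) simp
    also have "(\<Prod>x\<in>E1. y (sec x) powr (- \<beta>)) = (\<Prod>q\<in>J1. y q powr (- \<beta>))"
    proof -
      have "inj_on snd E1" using inj_snd by (rule inj_on_subset) (auto simp: E1_def)
      then show ?thesis unfolding J1_def by (subst prod.reindex) (auto simp: sec_def)
    qed
    also have "(\<Prod>x\<in>E2. y (sec x) powr (- \<beta>)) = (\<Prod>q\<in>J2. y q powr (- \<beta>))"
    proof -
      have "inj_on next_gap E2" using inj_nxt by (rule inj_on_subset) (auto simp: E2_def)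
      moreover have "sec x = next_gap x" if "x \<in> E2" for x using that E12(2) by (auto simp: sec_def)
      ultimately show ?thesis unfolding J2_def by (subst prod.reindex) auto
    qed
    finally have A: "(\<Prod>(i, j)\<in>E. (X u j - X u i) powr (2 * H - 2)) \<le>
       (\<Prod>q\<in>Q. (if q \<in> M then y q powr (- \<alpha>) else 1) *
          ((if q \<in> J1 then y q powr (- \<beta>) else 1) * (if q \<in> J2 then y q powr (- \<beta>) else 1)))"
      unfolding ind[OF sub(1)] ind[OF sub(2)] ind[OF sub(3)] by (simp add: prod.distrib)
    have gw0: "0 \<le> gap_weight b x z" for b x z by (simp add: gap_weight_def)
    have gwW: "gap_weight b (X u (prv Q q)) (X u q) \<le> W" if "q \<in> insert (Suc n) Q" for b q
    proof -
      have q0: "0 < q" using that Q_pos by auto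
      note p = prv_props[OF finite_Q q0]
      have "s \<le> X u (prv Q q)" using simplex_bounds(1)[OF u _ Q_range, of "prv Q q"] p by auto
      moreover have "X u q \<le> t" using simplex_bounds(2)[OF u _ Q_range, of q] that by auto
      moreover have "X u (prv Q q) < X u q" using simplexD[OF u, of "prv Q q" q] p that by auto
      ultimately show ?thesis unfolding W_def by (intro gap_weight_le) auto
    qed
    \<comment> \<open>Exponents collected by one gap: main and second for \<open>E1\<close>, at most
      2 - 4H after the gain 2H from the flag; main alone, \<alpha>; twice second, 2\<beta>; once
      second, \<beta>; or 0. None exceeds \<alpha>, because H > 1/4, and main together with
      \<open>J2\<close> is excluded by \<open>main_not_nxt\<close>.\<close>
    have each: "(if q \<in> M then y q powr (- \<alpha>) else 1) *
          ((if q \<in> J1 then y q powr (- \<beta>) else 1) * (if q \<in> J2 then y q powr (- \<beta>) else 1)) *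
          gap_weight (fl q) (X u (prv Q q)) (X u q) \<le> W * D * y q powr (- \<alpha>)" (is "?L * ?g \<le> _")
      if q: "q \<in> Q" for q
    proof -
      have key: "x * ?g \<le> W * D * y q powr (- \<alpha>)" if "x = y q powr (- a)" "a \<le> \<alpha>" "\<alpha> \<le> a + 2" for x a
      proof -
        have "x * ?g \<le> (D * y q powr (- \<alpha>)) * W"
          using that powr_neg_weaken[OF y(1,2)[OF q] that(2,3)] gw0 gwW[of q] q D1
          by (intro mult_mono) (auto simp: D_def)
        then show ?thesis by (simp add: mult_ac)
      qed
      have yq: "y q \<noteq> 0" using y[OF q] by simp
      show ?thesis
      proof (cases "q \<in> M")
        case True
        then have n2: "q \<notin> J2" using main_not_nxt by (simp add: M_def J2_def)
        show ?thesis
        proof (cases "q \<in> J1")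
          case True
          then have "fl q" using \<open>q \<in> M\<close> main_snd_adjacent fl q by (simp add: M_def J1_def)
          then have "?L * ?g = y q powr (- \<alpha>) * y q powr (- \<beta>) * y q powr (2 * H)"
            using True \<open>q \<in> M\<close> n2 by (simp add: gap_weight_def y_def)
          also have "\<dots> = y q powr (- (2 - 4 * H))"
            by (simp add: powr_add[symmetric] \<alpha>_def \<beta>_def)
          also have "\<dots> \<le> D * y q powr (- \<alpha>)"
            unfolding D_def using H y[OF q] by (intro powr_neg_weaken) (auto simp: \<alpha>_def)
          also have "\<dots> \<le> W * (D * y q powr (- \<alpha>))" 
            using mult_right_mono[OF W1, of "D * y q powr (- \<alpha>)"] D1 by simp
          finally show ?thesis by (simp add: mult_ac)
        next
          case False
          then show ?thesis using \<open>q \<in> M\<close> n2 by (intro key[of _ \<alpha>]) auto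
        qed
      next
        case False
        consider "q \<in> J1" "q \<in> J2" | "q \<in> J1" "q \<notin> J2" | "q \<notin> J1" "q \<in> J2" | "q \<notin> J1" "q \<notin> J2" by blast
        then show ?thesis
        proof cases
          case 1
          then show ?thesis using False H
            by (intro key[of _ "2 * \<beta>"]) (auto simp: powr_add[symmetric] \<alpha>_def \<beta>_def)
        next
          case 2
          then show ?thesis using False by (intro key[of _ \<beta>]) (auto simp: \<alpha>_def \<beta>_def)
        next
          case 3
          then show ?thesis using False by (intro key[of _ \<beta>]) (auto simp: \<alpha>_def \<beta>_def)
        next
          case 4
          then show ?thesis using False H yq by (intro key[of _ 0]) (auto simp: \<alpha>_def)
        qed
      qed
    qed
    let ?g = "\<lambda>q. gap_weight (fl q) (X u (prv Q q)) (X u q)"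
    \<comment> \<open>The topmost gap, below \<open>n + 1\<close>, belongs to no pair; it has no
      singular factor and costs only \<open>W\<close>.\<close>
    have nQ: "Suc n \<notin> Q" using Q_range by auto
    have "(\<Prod>(i, j)\<in>E. (X u j - X u i) powr (2 * H - 2)) * (\<Prod>q\<in>insert (Suc n) Q. ?g q) \<le>
      (\<Prod>q\<in>Q. (if q \<in> M then y q powr (- \<alpha>) else 1) *
          ((if q \<in> J1 then y q powr (- \<beta>) else 1) * (if q \<in> J2 then y q powr (- \<beta>) else 1))) *
      (\<Prod>q\<in>insert (Suc n) Q. ?g q)"
      using A gw0 by (intro mult_right_mono prod_nonneg) auto
    also have "\<dots> = ?g (Suc n) * (\<Prod>q\<in>Q. ((if q \<in> M then y q powr (- \<alpha>) else 1) *
          ((if q \<in> J1 then y q powr (- \<beta>) else 1) * (if q \<in> J2 then y q powr (- \<beta>) else 1))) * ?g q)"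
      using finite_Q nQ by (simp add: prod.distrib)
    also have "\<dots> \<le> W * (\<Prod>q\<in>Q. W * D * y q powr (- \<alpha>))"
      using each gwW[of "Suc n"] gw0 W1 by (intro mult_mono prod_mono prod_nonneg) auto
    also have "\<dots> = W * (W * D) ^ card Q * (\<Prod>q\<in>Q. y q powr (- \<alpha>))"
      by (simp add: prod.distrib power_mult_distrib)
    finally show "(\<Prod>(i, j)\<in>E. (X u j - X u i) powr (2 * H - 2)) * (\<Prod>q\<in>insert (Suc n) Q. ?g q) \<le>
      W * (W * D) ^ card Q * (\<Prod>q\<in>Q. (X u q - X u (prv Q q)) powr (- (5 / 4 - H)))"
      by (simp add: y_def \<alpha>_def)
  qed
qed

lemma measurable_prv_term:
  assumes "I \<subseteq> {1..n}" "q \<in> insert (Suc n) I"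
  shows "(\<lambda>u. X u (prv I q)) \<in> borel_measurable (PiM I (\<lambda>_. lborel))"
    "(\<lambda>u. X u q) \<in> borel_measurable (PiM I (\<lambda>_. lborel))"
proof -
  have "finite I" "0 < q" using assms finite_subset by auto
  then show "(\<lambda>u. X u (prv I q)) \<in> borel_measurable (PiM I (\<lambda>_. lborel))"
    using prv_props(1)[of I q] assms by (intro measurable_ext_pts) auto
  show "(\<lambda>u. X u q) \<in> borel_measurable (PiM I (\<lambda>_. lborel))"
    using assms by (intro measurable_ext_pts) auto
qed

text \<open>The largest variable is integrated out first: it occurs in a single gap factor, whose
  integral is bounded independently of the position of its predecessor.\<close>

lemma gaps_integrable:
  assumes "finite I" "I \<subseteq> {1..n}" and e: "0 < e" "e < 1"
  shows "(\<integral>\<^sup>+u. ennreal (\<Prod>q\<in>I. (X u q - X u (prv I q)) powr (- e)) * indicator (osimplex s t n I) u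
    \<partial>PiM I (\<lambda>_. lborel)) < \<infinity>"
  using assms(1,2)
proof (induction I rule: finite_linorder_max_induct)
  case empty
  have "indicator (osimplex s t n {}) u \<le> (1 :: ennreal)" for u by (auto simp: indicator_def)
  then have "(\<integral>\<^sup>+u. ennreal (\<Prod>q\<in>{}. (X u q - X u (prv {} q)) powr (- e)) * indicator (osimplex s t n {}) u
    \<partial>PiM {} (\<lambda>_. lborel)) \<le> (\<integral>\<^sup>+u. 1 \<partial>PiM {} (\<lambda>_::nat. lborel :: real measure))"
    by (intro nn_integral_mono) simp
  also have "\<dots> = 1" by (simp add: PiM_empty nn_integral_count_space_finite)
  finally show ?case by (rule le_less_trans) simp
next
  case (insert k I)
  have k: "k \<in> {1..n}" "I \<subseteq> {1..n}" "k \<notin> I" "finite I" using insert by auto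
  define a where "a = prv I k"
  have a: "a \<in> insert 0 I" "a < k" "\<And>i. i \<in> I \<Longrightarrow> i < k \<Longrightarrow> i \<le> a"
    using prv_props[of I k] k by (auto simp: a_def)
  have prv1: "prv (insert k I) q = prv I q" if "q \<in> I" for q
  proof -
    have "q < k" "0 < q" using that insert k by auto
    then show ?thesis using prv_props[of I q] k by (intro prv_eqI) auto
  qed
  have prvk: "prv (insert k I) k = a" using a k by (intro prv_eqI) auto
  have I1: "insert k I \<subseteq> {1..n}" using k by auto
  have meas: "(\<lambda>u. ennreal (\<Prod>q\<in>insert k I. (X u q - X u (prv (insert k I) q)) powr (- e)))
    \<in> borel_measurable (PiM (insert k I) (\<lambda>_. lborel))"
    by (intro measurable_compose[OF _ measurable_ennreal] borel_measurable_prod powr_real_measurable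
        borel_measurable_diff measurable_prv_term[OF I1] borel_measurable_const) auto
  let ?K = "ennreal ((t - s) powr (1 - e) / (1 - e))"
  have b: "Suc n \<in> insert (Suc n) I" "k < Suc n" "\<And>i. i \<in> I \<Longrightarrow> k < i \<Longrightarrow> Suc n \<le> i"
    using k insert by auto
  have "(\<integral>\<^sup>+u. ennreal (\<Prod>q\<in>insert k I. (X u q - X u (prv (insert k I) q)) powr (- e)) *
       indicator (osimplex s t n (insert k I)) u \<partial>PiM (insert k I) (\<lambda>_. lborel)) =
     (\<integral>\<^sup>+u. (\<integral>\<^sup>+x. ennreal (\<Prod>q\<in>insert k I. (X (u(k := x)) q - X (u(k := x)) (prv (insert k I) q)) powr (- e)) *
       indicator {X u a<..<X u (Suc n)} x \<partial>lborel) * indicator (osimplex s t n I) u \<partial>PiM I (\<lambda>_. lborel))"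
    by (rule nn_integral_simplex_insert[OF k(1,2) a b k(3) meas])
  also have "\<dots> \<le> (\<integral>\<^sup>+u. ?K * (ennreal (\<Prod>q\<in>I. (X u q - X u (prv I q)) powr (- e)) *
       indicator (osimplex s t n I) u) \<partial>PiM I (\<lambda>_. lborel))"
  proof (intro nn_integral_mono)
    fix u
    show "(\<integral>\<^sup>+x. ennreal (\<Prod>q\<in>insert k I. (X (u(k := x)) q - X (u(k := x)) (prv (insert k I) q)) powr (- e)) *
       indicator {X u a<..<X u (Suc n)} x \<partial>lborel) * indicator (osimplex s t n I) u \<le>
       ?K * (ennreal (\<Prod>q\<in>I. (X u q - X u (prv I q)) powr (- e)) * indicator (osimplex s t n I) u)"
    proof (cases "u \<in> osimplex s t n I")
      case True
      let ?P = "\<Prod>q\<in>I. (X u q - X u (prv I q)) powr (- e)"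
      have P0: "0 \<le> ?P" by (intro prod_nonneg) auto
      have X1: "X (u(k := x)) q = X u q" if "q \<in> insert 0 I" for q x
        using k that by auto
      have Xk: "X (u(k := x)) k = x" for x using k by auto
      have pr: "(\<Prod>q\<in>insert k I. (X (u(k := x)) q - X (u(k := x)) (prv (insert k I) q)) powr (- e)) =
          (x - X u a) powr (- e) * ?P" for x
      proof -
        have "(\<Prod>q\<in>I. (X (u(k := x)) q - X (u(k := x)) (prv (insert k I) q)) powr (- e)) = ?P"
        proof (intro prod.cong refl)
          fix q assume q: "q \<in> I"
          then have "prv I q \<in> insert 0 I" using prv_props(1)[of I q] k by auto
          then show "(X (u(k := x)) q - X (u(k := x)) (prv (insert k I) q)) powr (- e) =
             (X u q - X u (prv I q)) powr (- e)"
            using X1[of q x] X1[of "prv I q" x] q prv1[OF q] by simp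
        qed
        then show ?thesis using k a(2) X1[OF a(1), of x] by (simp add: prvk Xk)
      qed
      have at: "s \<le> X u a" "X u a < t"
        using simplex_bounds(1)[OF True _ k(2), of a] simplexD[OF True, of a "Suc n"] a b by auto
      have "(\<integral>\<^sup>+x. ennreal (\<Prod>q\<in>insert k I. (X (u(k := x)) q - X (u(k := x)) (prv (insert k I) q)) powr (- e)) *
         indicator {X u a<..<X u (Suc n)} x \<partial>lborel) =
         (\<integral>\<^sup>+x. ennreal ?P * ennreal (indicator {X u a<..<t} x * (x - X u a) powr (- e)) \<partial>lborel)"
        unfolding pr by (intro nn_integral_cong) (auto simp: indicator_def ennreal_mult' P0 mult.commute)
      also have "\<dots> = ennreal ?P * ennreal ((t - X u a) powr (- e + 1) / (- e + 1))"
        using at e by (subst nn_integral_cmult) (auto simp: nn_integral_powr_Ioo)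
      also have "\<dots> \<le> ennreal ?P * ?K"
        using at e by (intro mult_left_mono ennreal_leI) (auto intro!: divide_right_mono powr_mono2)
      finally show ?thesis using True by (simp add: mult.commute)
    qed simp
  qed
  also have "\<dots> = ?K * (\<integral>\<^sup>+u. ennreal (\<Prod>q\<in>I. (X u q - X u (prv I q)) powr (- e)) *
       indicator (osimplex s t n I) u \<partial>PiM I (\<lambda>_. lborel))"
    by (intro nn_integral_cmult borel_measurable_times_ennreal measurable_compose[OF _ measurable_ennreal]
        borel_measurable_prod powr_real_measurable borel_measurable_diff measurable_prv_term[OF k(2)]
        borel_measurable_const borel_measurable_indicator_simplex(2)[OF k(2)]) auto
  also have "\<dots> < \<infinity>"
    using insert.IH k by (auto simp: ennreal_mult_less_top)
  finally show ?case .
qed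

end

section \<open>Convergence of the integral of a pairing\<close>

context pair_bounds
begin

text \<open>In \<open>stage m\<close> the smaller elements of all consecutive pairs have been integrated out, and so have
  the larger ones from \<open>m\<close> upwards; the latter are collected in the factors \<open>\<Phi> q\<close> of \<open>weight\<close>.\<close>

definition stage :: "nat \<Rightarrow> nat set" where "stage m = Q \<union> {k \<in> Kc. k < m}"

definition weight :: "nat \<Rightarrow> (real \<Rightarrow> real \<Rightarrow> real) \<Rightarrow> (real \<Rightarrow> real \<Rightarrow> real) \<Rightarrow> (nat \<Rightarrow> real \<Rightarrow> real \<Rightarrow> real) \<Rightarrow>
    (nat \<Rightarrow> real) \<Rightarrow> real" where
  "weight m \<rho> g \<Phi> u = (\<Prod>(i, j)\<in>E. \<rho> (X u i) (X u j)) *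
     (\<Prod>k\<in>{k \<in> Kc. k < m}. g (X u (k - 2)) (X u k)) *
     (\<Prod>q\<in>insert (Suc n) Q. \<Phi> q (X u (prv (stage m) q)) (X u q))"

text \<open>\<open>fl q\<close> records that \<open>\<Phi> q\<close> is of order \<open>2 * H\<close> in the length of the gap below \<open>q\<close>; integrating out
  a consecutive pair directly below \<open>q\<close> makes it so.\<close>

definition flagged :: "nat \<Rightarrow> (nat \<Rightarrow> bool) \<Rightarrow> bool" where
  "flagged m fl \<longleftrightarrow> (\<forall>q\<in>Q. q - 1 \<notin> insert 0 (stage m) \<longrightarrow> fl q)"

lemma Kc_sub: "Kc \<subseteq> {1..n}"
proof
  fix k assume "k \<in> Kc"
  from Kc_range[OF this] show "k \<in> {1..n}" by simp
qed

lemma finite_Kc: "finite Kc" by (rule finite_subset[OF Kc_sub]) simp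

lemma Kc_notQ: "k \<in> Kc \<Longrightarrow> k \<notin> Q" "k \<in> Kc \<Longrightarrow> k - 1 \<notin> Q"
  using Kc_disj unfolding Q_def by blast+

lemma stage_sub: "stage m \<subseteq> {1..n}" unfolding stage_def using Q_range Kc_sub by blast

lemma finite_stage: "finite (stage m)" by (rule finite_subset[OF stage_sub]) simp

lemma Q_stage: "Q \<subseteq> stage m" unfolding stage_def by blast

lemma stage_0: "stage 0 = Q" by (simp add: stage_def)

text \<open>If \<open>k - 2\<close> were the smaller element of a consecutive pair, its partner
  \<open>k - 1\<close> would be in \<open>Kc\<close>, against \<open>Kc_sep\<close>. So the lower
  neighbour read by the drift is never an eliminated smaller variable.\<close>

lemma Kc_below: "k \<in> Kc \<Longrightarrow> k - 2 \<in> insert 0 (Q \<union> Kc)"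
proof -
  assume k: "k \<in> Kc"
  show ?thesis
  proof (cases "k - 2 = 0")
    case False
    then have r: "k - 2 \<in> {1..n}" "Suc (k - 2) = k - 1" using Kc_range[OF k] by auto
    then show ?thesis using cover[OF r(1)] Kc_sep[OF k] unfolding Q_def by auto
  qed simp
qed

lemma Kc_below_stage:
  assumes "k \<in> Kc" "k \<le> m"
  shows "k - 2 \<in> insert 0 (stage m)"
proof -
  have "k - 2 < m" using Kc_range[OF assms(1)] assms(2) by linarith
  then show ?thesis using Kc_below[OF assms(1)] unfolding stage_def by blast
qed

lemma stage_Suc:
  assumes "m \<in> Kc" shows "stage (Suc m) = insert m (stage m)" "m \<notin> stage m"
  using assms Kc_notQ(1)[OF assms] by (auto simp: stage_def less_Suc_eq)

lemma stage_Suc': "m \<notin> Kc \<Longrightarrow> stage (Suc m) = stage m" "m \<notin> Kc \<Longrightarrow> {k \<in> Kc. k < Suc m} = {k \<in> Kc. k < m}"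
  by (auto simp: stage_def less_Suc_eq)

lemma weight_Suc': "m \<notin> Kc \<Longrightarrow> weight (Suc m) = weight m"
  by (simp only: weight_def fun_eq_iff stage_Suc' simp_thms)

definition above :: "nat \<Rightarrow> nat" where "above m = Min {i \<in> insert (Suc n) (stage m). m < i}"

context
  fixes m assumes m: "m \<in> Kc"
begin

lemma m_range: "2 \<le> m" "m \<le> n" "m \<in> {1..n}" using Kc_range[OF m] by auto

lemma below: "m - 2 \<in> insert 0 (stage m)" "m - 2 < m" "\<And>i. i \<in> stage m \<Longrightarrow> i < m \<Longrightarrow> i \<le> m - 2"
proof -
  show "m - 2 \<in> insert 0 (stage m)" by (rule Kc_below_stage[OF m]) simp
  show "m - 2 < m" using m_range by simp
  fix i assume i: "i \<in> stage m" "i < m"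
  have "i \<noteq> m - 1" using i(1) Kc_notQ(2)[OF m] Kc_sep[OF m] unfolding stage_def by blast
  then show "i \<le> m - 2" using i(2) by linarith
qed

text \<open>All elements of \<open>Kc\<close> left in \<open>stage m\<close> lie below
  \<open>m\<close>, so the upper neighbour of \<open>m\<close> belongs to \<open>Q\<close> or is
  \<open>n + 1\<close>, exactly where the accumulated factors sit. This is why elimination runs from
  the right.\<close>

lemma above_props: "above m \<in> insert (Suc n) (stage m)" "m < above m"
  "\<And>i. i \<in> stage m \<Longrightarrow> m < i \<Longrightarrow> above m \<le> i" "above m \<in> insert (Suc n) Q"
proof -
  have fin: "finite {i \<in> insert (Suc n) (stage m). m < i}" using finite_stage by simp
  have ne: "{i \<in> insert (Suc n) (stage m). m < i} \<noteq> {}" using m_range by auto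
  have "above m \<in> {i \<in> insert (Suc n) (stage m). m < i}" unfolding above_def by (rule Min_in[OF fin ne])
  then show A: "above m \<in> insert (Suc n) (stage m)" "m < above m" by simp_all
  show "\<And>i. i \<in> stage m \<Longrightarrow> m < i \<Longrightarrow> above m \<le> i" unfolding above_def by (intro Min_le[OF fin]) simp
  show "above m \<in> insert (Suc n) Q" using A unfolding stage_def by auto
qed

lemma prv_above: "prv (stage (Suc m)) (above m) = m" "prv (stage m) (above m) = m - 2"
proof -
  show "prv (stage (Suc m)) (above m) = m"
  proof (rule prv_eqI[OF finite_stage])
    show "m \<in> insert 0 (stage (Suc m))" using stage_Suc[OF m] by simp
    show "m < above m" by (rule above_props(2))
    fix i assume "i \<in> stage (Suc m)" "i < above m"
    then show "i \<le> m" using above_props(3)[of i] stage_Suc[OF m] by (cases "i = m") (auto simp: not_less[symmetric])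
  qed
  show "prv (stage m) (above m) = m - 2"
  proof (rule prv_eqI[OF finite_stage below(1)])
    show "m - 2 < above m" using above_props(2) by simp
    fix i assume i: "i \<in> stage m" "i < above m"
    then have "\<not> m < i" using above_props(3)[of i] by auto
    moreover have "i \<noteq> m" using i stage_Suc(2)[OF m] by auto
    ultimately show "i \<le> m - 2" using below(3)[OF i(1)] by simp
  qed
qed

lemma prv_other:
  assumes q: "q \<in> insert (Suc n) Q" "q \<noteq> above m"
  shows "prv (stage (Suc m)) q = prv (stage m) q" "prv (stage m) q \<noteq> m" "q \<noteq> m"
proof -
  have q0: "0 < q" using q Q_pos by auto
  show qm: "q \<noteq> m" using q(1) Kc_notQ(1)[OF m] m_range by auto
  note p = prv_props[OF finite_stage[of m] q0]
  show "prv (stage m) q \<noteq> m"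
  proof
    assume "prv (stage m) q = m"
    then have "m \<in> insert 0 (stage m)" using p(1) by simp
    then show False using stage_Suc(2)[OF m] m_range by auto
  qed
  show "prv (stage (Suc m)) q = prv (stage m) q"
  proof (rule prv_eqI[OF finite_stage])
    show "prv (stage m) q \<in> insert 0 (stage (Suc m))" using p(1) stage_Suc(1)[OF m] by blast
    show "prv (stage m) q < q" by (rule p(2))
    fix i assume i: "i \<in> stage (Suc m)" "i < q"
    show "i \<le> prv (stage m) q"
    proof (cases "i = m")
      case True
      show ?thesis
      proof (cases "q = Suc n")
        case True
        have "above m \<noteq> Suc n" using True q(2) by simp
        then have ab: "above m \<in> stage m" using above_props(1) by blast
        then have "above m < q" using stage_sub True by fastforce
        then have "above m \<le> prv (stage m) q" using p(3)[OF ab] by simp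
        then show ?thesis using above_props(2) \<open>i = m\<close> by simp
      next
        case False
        then have "q \<in> stage m" using q(1) Q_stage by blast
        then have "above m \<le> q" using above_props(3) i \<open>i = m\<close> by blast
        then have lt: "above m < q" using q(2) by simp
        have "q \<le> n" using \<open>q \<in> stage m\<close> stage_sub by fastforce
        then have "above m \<in> stage m" using above_props(1) lt by auto
        then have "above m \<le> prv (stage m) q" using p(3) lt by blast
        then show ?thesis using above_props(2) \<open>i = m\<close> by simp
      qed
    next
      case False
      then have "i \<in> stage m" using i(1) stage_Suc(1)[OF m] by blast
      then show ?thesis using p(3) i(2) by blast
    qed
  qed
qed

text \<open>The part of the weight that does not contain coordinate \<open>m\<close>, hence a
  constant in the inner integral.\<close>

definition core :: "(real \<Rightarrow> real \<Rightarrow> real) \<Rightarrow> (real \<Rightarrow> real \<Rightarrow> real) \<Rightarrow> (nat \<Rightarrow> real \<Rightarrow> real \<Rightarrow> real) \<Rightarrow>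
    (nat \<Rightarrow> real) \<Rightarrow> real" where
  "core \<rho> g \<Phi> u = (\<Prod>(i, j)\<in>E. \<rho> (X u i) (X u j)) *
     (\<Prod>k\<in>{k \<in> Kc. k < m}. g (X u (k - 2)) (X u k)) *
     (\<Prod>q\<in>insert (Suc n) Q - {above m}. \<Phi> q (X u (prv (stage m) q)) (X u q))"

lemma X_upd: "X (u(m := x)) i = (if i = m then x else X u i)"
  using m_range by simp

lemma weight_upd: "weight (Suc m) \<rho> g \<Phi> (u(m := x)) =
    core \<rho> g \<Phi> u * (g (X u (m - 2)) x * \<Phi> (above m) x (X u (above m)))"
proof -
  have E: "(\<Prod>(i, j)\<in>E. \<rho> (X (u(m := x)) i) (X (u(m := x)) j)) = (\<Prod>(i, j)\<in>E. \<rho> (X u i) (X u j))"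
  proof (rule prod.cong[OF refl])
    fix p assume p: "p \<in> E"
    obtain i j where ij: "p = (i, j)" by (cases p)
    have "i \<noteq> m" "j \<noteq> m" using E_inQ[of i j] p Kc_notQ(1)[OF m] unfolding ij by blast+
    then show "(case p of (i, j) \<Rightarrow> \<rho> (X (u(m := x)) i) (X (u(m := x)) j)) = (case p of (i, j) \<Rightarrow> \<rho> (X u i) (X u j))"
      unfolding ij by (simp add: X_upd)
  qed
  have Ks: "{k \<in> Kc. k < Suc m} = insert m {k \<in> Kc. k < m}" using m by auto
  have K: "(\<Prod>k\<in>{k \<in> Kc. k < Suc m}. g (X (u(m := x)) (k - 2)) (X (u(m := x)) k)) =
      g (X u (m - 2)) x * (\<Prod>k\<in>{k \<in> Kc. k < m}. g (X u (k - 2)) (X u k))"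
  proof -
    have "(\<Prod>k\<in>{k \<in> Kc. k < m}. g (X (u(m := x)) (k - 2)) (X (u(m := x)) k)) =
        (\<Prod>k\<in>{k \<in> Kc. k < m}. g (X u (k - 2)) (X u k))"
      by (intro prod.cong refl) (auto simp: X_upd)
    moreover have "g (X (u(m := x)) (m - 2)) (X (u(m := x)) m) = g (X u (m - 2)) x"
      using below(2) by (simp add: X_upd)
    moreover have "finite {k \<in> Kc. k < m}" using finite_Kc by simp
    ultimately show ?thesis unfolding Ks by (subst prod.insert) simp_all
  qed
  have P: "(\<Prod>q\<in>insert (Suc n) Q. \<Phi> q (X (u(m := x)) (prv (stage (Suc m)) q)) (X (u(m := x)) q)) =
     \<Phi> (above m) x (X u (above m)) *
     (\<Prod>q\<in>insert (Suc n) Q - {above m}. \<Phi> q (X u (prv (stage m) q)) (X u q))"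
  proof -
    have fin: "finite (insert (Suc n) Q)" using finite_Q by simp
    have "(\<Prod>q\<in>insert (Suc n) Q - {above m}. \<Phi> q (X (u(m := x)) (prv (stage (Suc m)) q)) (X (u(m := x)) q)) =
        (\<Prod>q\<in>insert (Suc n) Q - {above m}. \<Phi> q (X u (prv (stage m) q)) (X u q))"
      by (intro prod.cong refl) (use prv_other in \<open>simp add: X_upd\<close>)
    moreover have "\<Phi> (above m) (X (u(m := x)) (prv (stage (Suc m)) (above m))) (X (u(m := x)) (above m)) =
       \<Phi> (above m) x (X u (above m))"
      using above_props(2) by (simp add: prv_above X_upd)
    ultimately show ?thesis
      by (subst prod.remove[OF fin above_props(4)]) simp
  qed
  show ?thesis unfolding weight_def E K P core_def by (simp only: mult_ac)
qed

lemma weight_core: "weight m \<rho> g (\<Phi>(above m := \<Psi>)) u =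
    core \<rho> g \<Phi> u * \<Psi> (X u (m - 2)) (X u (above m))"
proof -
  have fin: "finite (insert (Suc n) Q)" using finite_Q by simp
  have "(\<Prod>q\<in>insert (Suc n) Q. (\<Phi>(above m := \<Psi>)) q (X u (prv (stage m) q)) (X u q)) =
     \<Psi> (X u (m - 2)) (X u (above m)) *
     (\<Prod>q\<in>insert (Suc n) Q - {above m}. \<Phi> q (X u (prv (stage m) q)) (X u q))"
  proof (subst prod.remove[OF fin above_props(4)], rule arg_cong2[where f = "(*)"])
    show "(\<Phi>(above m := \<Psi>)) (above m) (X u (prv (stage m) (above m))) (X u (above m)) =
        \<Psi> (X u (m - 2)) (X u (above m))" by (simp add: prv_above)
  qed (auto intro: prod.cong)
  then show ?thesis unfolding weight_def core_def by (simp only: mult_ac)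
qed

text \<open>Removing \<open>m\<close> makes \<open>q - 1\<close> newly absent only for
  \<open>q = m + 1\<close>, and if that is in \<open>Q\<close> it is the upper neighbour of
  \<open>m\<close>, whose flag has just been set.\<close>

lemma flagged_step: "flagged (Suc m) fl \<Longrightarrow> flagged m (fl(above m := True))"
  unfolding flagged_def
proof (intro ballI impI)
  fix q assume fl: "\<forall>q\<in>Q. q - 1 \<notin> insert 0 (stage (Suc m)) \<longrightarrow> fl q" and q: "q \<in> Q" "q - 1 \<notin> insert 0 (stage m)"
  show "(fl(above m := True)) q"
  proof (cases "q = above m")
    case False
    have "q - 1 \<noteq> m"
    proof
      assume "q - 1 = m"
      then have qm: "q = Suc m" using m_range by simp
      have "q \<in> stage m" using q(1) Q_stage by blast
      then have "above m \<le> q" using above_props(3)[of q] qm by simp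
      then have "q = above m" using above_props(2) qm by simp
      then show False using False by simp
    qed
    then have "q - 1 \<notin> insert 0 (stage (Suc m))" using q(2) stage_Suc(1)[OF m] by auto
    then show ?thesis using fl q(1) False by simp
  qed simp
qed

end

lemma flagged_Suc': "m \<notin> Kc \<Longrightarrow> flagged (Suc m) fl \<longleftrightarrow> flagged m fl"
  by (simp add: flagged_def stage_Suc')

lemma X_stage_pair:
  assumes u: "u \<in> osimplex s t n (stage m)"
  shows "(i, j) \<in> E \<Longrightarrow> s < X u i \<and> X u i < X u j \<and> X u j < t"
    and "k \<in> Kc \<Longrightarrow> k < m \<Longrightarrow> s \<le> X u (k - 2) \<and> X u (k - 2) < X u k \<and> X u k < t"
    and "q \<in> insert (Suc n) Q \<Longrightarrow> s \<le> X u (prv (stage m) q) \<and> X u (prv (stage m) q) < X u q \<and> X u q \<le> t"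
proof -
  show "s < X u i \<and> X u i < X u j \<and> X u j < t" if ij: "(i, j) \<in> E"
  proof -
    have r: "i \<in> stage m" "j \<in> stage m" using E_inQ[OF ij] Q_stage by blast+
    have r2: "i \<noteq> 0" "j \<noteq> Suc n" using E_range[OF ij] by simp_all
    show ?thesis
      using simplex_bounds(3)[OF u _ stage_sub r2(1)] simplex_bounds(4)[OF u _ stage_sub r2(2)]
        simplexD[OF u _ _ E_less[OF ij]] r by blast
  qed
  show "s \<le> X u (k - 2) \<and> X u (k - 2) < X u k \<and> X u k < t" if k: "k \<in> Kc" "k < m"
  proof -
    have r: "k \<in> stage m" "k - 2 \<in> insert 0 (stage m)"
      using k Kc_below_stage[OF k(1), of m] by (auto simp: stage_def)
    have r2: "k \<noteq> Suc n" "k - 2 < k" using Kc_range[OF k(1)] by simp_all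
    show ?thesis
      using simplex_bounds(1)[OF u _ stage_sub] simplex_bounds(4)[OF u _ stage_sub r2(1)]
        simplexD[OF u _ _ r2(2)] r by blast
  qed
  show "s \<le> X u (prv (stage m) q) \<and> X u (prv (stage m) q) < X u q \<and> X u q \<le> t" if q: "q \<in> insert (Suc n) Q"
  proof -
    have "0 < q" using q Q_pos by auto
    note p = prv_props[OF finite_stage[of m] this]
    have q': "q \<in> insert 0 (insert (Suc n) (stage m))" "prv (stage m) q \<in> insert 0 (insert (Suc n) (stage m))"
      using q Q_stage[of m] p(1) by auto
    show ?thesis
      using simplex_bounds(1)[OF u q'(2) stage_sub] simplex_bounds(2)[OF u q'(1) stage_sub]
        simplexD[OF u q'(2,1) p(2)] by blast
  qed
qed

lemma measurable_binary:
  assumes "(\<lambda>p. F (fst p) (snd p)) \<in> borel_measurable (borel \<Otimes>\<^sub>M borel)"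
    "f \<in> borel_measurable M" "g \<in> borel_measurable M"
  shows "(\<lambda>x. F (f x) (g x) :: real) \<in> borel_measurable M"
  using measurable_compose[OF measurable_Pair assms(1), of f M g] assms by simp

lemma measurable_X: "i \<in> insert 0 (insert (Suc n) (stage m)) \<Longrightarrow> (\<lambda>u. X u i) \<in> borel_measurable (PiM (stage m) (\<lambda>_. lborel))"
  by (rule measurable_ext_pts[OF stage_sub])

lemma measurable_weight:
  assumes \<rho>: "(\<lambda>p. \<rho> (fst p) (snd p)) \<in> borel_measurable (borel \<Otimes>\<^sub>M borel)"
    and g: "(\<lambda>p. g (fst p) (snd p)) \<in> borel_measurable (borel \<Otimes>\<^sub>M borel)"
    and \<Phi>: "\<And>q. q \<in> insert (Suc n) Q \<Longrightarrow> (\<lambda>p. \<Phi> q (fst p) (snd p)) \<in> borel_measurable (borel \<Otimes>\<^sub>M borel)"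
  shows "weight m \<rho> g \<Phi> \<in> borel_measurable (PiM (stage m) (\<lambda>_. lborel))"
  unfolding weight_def
proof (intro borel_measurable_times borel_measurable_prod)
  fix p assume p: "p \<in> E"
  obtain i j where ij: "p = (i, j)" by (cases p)
  have "i \<in> stage m" "j \<in> stage m" using E_inQ[of i j] p Q_stage unfolding ij by blast+
  then show "(\<lambda>u. case p of (i, j) \<Rightarrow> \<rho> (X u i) (X u j)) \<in> borel_measurable (PiM (stage m) (\<lambda>_. lborel))"
    unfolding ij prod.case by (intro measurable_binary[OF \<rho>] measurable_X) auto
next
  fix k assume k: "k \<in> {k \<in> Kc. k < m}"
  then have "k \<in> stage m" "k - 2 \<in> insert 0 (stage m)" using Kc_below_stage[of k m] by (auto simp: stage_def)
  then show "(\<lambda>u. g (X u (k - 2)) (X u k)) \<in> borel_measurable (PiM (stage m) (\<lambda>_. lborel))"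
    by (intro measurable_binary[OF g] measurable_X) auto
next
  fix q assume q: "q \<in> insert (Suc n) Q"
  then have "0 < q" using Q_pos by auto
  note p = prv_props(1)[OF finite_stage[of m] this]
  show "(\<lambda>u. \<Phi> q (X u (prv (stage m) q)) (X u q)) \<in> borel_measurable (PiM (stage m) (\<lambda>_. lborel))"
  proof (intro measurable_binary[OF \<Phi>[OF q]] measurable_X)
    show "prv (stage m) q \<in> insert 0 (insert (Suc n) (stage m))" using p by auto
    show "q \<in> insert 0 (insert (Suc n) (stage m))" using q Q_stage[of m] by auto
  qed
qed

text \<open>The common majorant, up to constants: every factor is replaced by its singular power,
  and the accumulated factors by their orders of magnitude.\<close>

definition dom :: "nat \<Rightarrow> (nat \<Rightarrow> bool) \<Rightarrow> (nat \<Rightarrow> real) \<Rightarrow> real" where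
  "dom m fl = weight m (\<lambda>x y. (y - x) powr (2 * H - 2)) (\<lambda>x y. (y - x) powr (2 * H - 1)) (\<lambda>q. gap_weight (fl q))"

lemma measurable_gap_weight: "(\<lambda>p. gap_weight b (fst p) (snd p)) \<in> borel_measurable (borel \<Otimes>\<^sub>M borel)"
  unfolding gap_weight_def by (cases b) simp_all

lemma measurable_dom: "dom m fl \<in> borel_measurable (PiM (stage m) (\<lambda>_. lborel))"
  unfolding dom_def by (intro measurable_weight measurable_gap_weight) simp_all

lemma gap_weight_nonneg: "0 \<le> gap_weight b x y" by (simp add: gap_weight_def)

lemma dom_nonneg: "0 \<le> dom m fl u"
  unfolding dom_def weight_def by (intro mult_nonneg_nonneg prod_nonneg) (auto simp: gap_weight_nonneg)

text \<open>Integrating out \<open>m\<close> turns the power \<open>2 * H - 1\<close> into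
  \<open>2 * H\<close> of the enlarged gap, that is, into the flag at \<open>above m\<close>; the
  power gained there earlier is merely bounded. At stage 0 only the pairs in \<open>E\<close> are
  left, with the flags that \<open>pairs_le_gaps\<close> needs.\<close>

lemma dom_finite: "flagged m fl \<Longrightarrow>
    (\<integral>\<^sup>+u. ennreal (dom m fl u) * indicator (osimplex s t n (stage m)) u \<partial>PiM (stage m) (\<lambda>_. lborel)) < \<infinity>"
proof (induction m arbitrary: fl)
  case 0
  then have fl0: "fl q" if "q \<in> Q" "q - 1 \<notin> insert 0 Q" for q
    using that unfolding flagged_def stage_0 by blast
  have "\<exists>K\<ge>0. \<forall>u\<in>osimplex s t n Q.
    (\<Prod>(i, j)\<in>E. (X u j - X u i) powr (2 * H - 2)) *
    (\<Prod>q\<in>insert (Suc n) Q. gap_weight (fl q) (X u (prv Q q)) (X u q))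
    \<le> K * (\<Prod>q\<in>Q. (X u q - X u (prv Q q)) powr (- (5 / 4 - H)))"
    using fl0 by (rule pairs_le_gaps)
  then obtain K where K: "0 \<le> K" and K': "\<forall>u\<in>osimplex s t n Q.
    (\<Prod>(i, j)\<in>E. (X u j - X u i) powr (2 * H - 2)) *
    (\<Prod>q\<in>insert (Suc n) Q. gap_weight (fl q) (X u (prv Q q)) (X u q))
    \<le> K * (\<Prod>q\<in>Q. (X u q - X u (prv Q q)) powr (- (5 / 4 - H)))"
    by (elim exE conjE) (rule that)
  have "(\<integral>\<^sup>+u. ennreal (dom 0 fl u) * indicator (osimplex s t n Q) u \<partial>PiM Q (\<lambda>_. lborel)) \<le>
    (\<integral>\<^sup>+u. ennreal K * (ennreal (\<Prod>q\<in>Q. (X u q - X u (prv Q q)) powr (- (5 / 4 - H))) *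
       indicator (osimplex s t n Q) u) \<partial>PiM Q (\<lambda>_. lborel))"
  proof (intro nn_integral_mono)
    fix u
    show "ennreal (dom 0 fl u) * indicator (osimplex s t n Q) u \<le>
       ennreal K * (ennreal (\<Prod>q\<in>Q. (X u q - X u (prv Q q)) powr (- (5 / 4 - H))) *
       indicator (osimplex s t n Q) u)"
    proof (cases "u \<in> osimplex s t n Q")
      case True
      have "dom 0 fl u \<le> K * (\<Prod>q\<in>Q. (X u q - X u (prv Q q)) powr (- (5 / 4 - H)))"
        using bspec[OF K' True] by (simp add: dom_def weight_def stage_0)
      then show ?thesis using True K by (simp add: ennreal_mult'[symmetric] ennreal_leI)
    qed simp
  qed
  also have "\<dots> = ennreal K * (\<integral>\<^sup>+u. ennreal (\<Prod>q\<in>Q. (X u q - X u (prv Q q)) powr (- (5 / 4 - H))) *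
       indicator (osimplex s t n Q) u \<partial>PiM Q (\<lambda>_. lborel))"
    by (intro nn_integral_cmult borel_measurable_times_ennreal measurable_compose[OF _ measurable_ennreal]
        borel_measurable_prod powr_real_measurable borel_measurable_diff measurable_prv_term[OF Q_range]
        borel_measurable_const borel_measurable_indicator_simplex(2)[OF Q_range]) auto
  also have "\<dots> < \<infinity>"
    using gaps_integrable[OF finite_Q Q_range, of "5 / 4 - H"] H by (simp add: ennreal_mult_less_top)
  finally show ?case by (simp add: stage_0)
next
  case (Suc m)
  show ?case
  proof (cases "m \<in> Kc")
    case False
    then show ?thesis using Suc by (simp add: dom_def weight_Suc' stage_Suc' flagged_Suc')
  next
    case True
    note m = True
    define fl' where "fl' = fl(above m := True)"
    have fl': "flagged m fl'" unfolding fl'_def by (rule flagged_step[OF m Suc.prems])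
    \<comment> \<open>A bound for the old \<open>gap_weight\<close> times \<open>1 / (2 * H)\<close>
      from integrating the power \<open>2 * H - 1\<close>.\<close>
    define W where "W = (1 + (t - s) powr (2 * H)) / (2 * H)"
    have W0: "0 \<le> W" using H by (simp add: W_def)
    let ?a = "m - 2" and ?b = "above m"
    let ?core = "core m (\<lambda>x y. (y - x) powr (2 * H - 2)) (\<lambda>x y. (y - x) powr (2 * H - 1)) (\<lambda>q. gap_weight (fl q))"
    have core0: "0 \<le> ?core u" for u
      unfolding core_def[OF m] by (intro mult_nonneg_nonneg prod_nonneg) (auto simp: gap_weight_nonneg)
    have upd: "dom (Suc m) fl (u(m := x)) = ?core u * ((x - X u ?a) powr (2 * H - 1) * gap_weight (fl ?b) x (X u ?b))"
      for u x unfolding dom_def by (rule weight_upd[OF m])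
    have fl'_eq: "(\<lambda>q. gap_weight (fl' q)) = (\<lambda>q. gap_weight (fl q))(?b := gap_weight True)"
      by (auto simp: fl'_def)
    have cr: "dom m fl' u = ?core u * (X u ?b - X u ?a) powr (2 * H)" for u
      unfolding dom_def fl'_eq using weight_core[OF m] by (simp add: gap_weight_def)
    have "(\<integral>\<^sup>+u. ennreal (dom (Suc m) fl u) * indicator (osimplex s t n (insert m (stage m))) u
        \<partial>PiM (insert m (stage m)) (\<lambda>_. lborel)) =
      (\<integral>\<^sup>+u. (\<integral>\<^sup>+x. ennreal (dom (Suc m) fl (u(m := x))) * indicator {X u ?a<..<X u ?b} x \<partial>lborel) *
         indicator (osimplex s t n (stage m)) u \<partial>PiM (stage m) (\<lambda>_. lborel))"
      using measurable_dom[of "Suc m" fl] unfolding stage_Suc(1)[OF m]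
      by (intro nn_integral_simplex_insert[OF m_range(3)[OF m] stage_sub below[OF m] above_props(1-3)[OF m] stage_Suc(2)[OF m]]
          measurable_compose[OF _ measurable_ennreal])
    also have "\<dots> \<le> (\<integral>\<^sup>+u. ennreal W * (ennreal (dom m fl' u) * indicator (osimplex s t n (stage m)) u)
        \<partial>PiM (stage m) (\<lambda>_. lborel))"
    proof (intro nn_integral_mono)
      fix u
      show "(\<integral>\<^sup>+x. ennreal (dom (Suc m) fl (u(m := x))) * indicator {X u ?a<..<X u ?b} x \<partial>lborel) *
         indicator (osimplex s t n (stage m)) u \<le> ennreal W * (ennreal (dom m fl' u) * indicator (osimplex s t n (stage m)) u)"
      proof (cases "u \<in> osimplex s t n (stage m)")
        case True
        have ab: "s \<le> X u ?a" "X u ?a < X u ?b" "X u ?b \<le> t"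
          using X_stage_pair(3)[OF True above_props(4)[OF m]] by (simp_all add: prv_above[OF m])
        let ?w = "1 + (t - s) powr (2 * H)"
        have "(\<integral>\<^sup>+x. ennreal (dom (Suc m) fl (u(m := x))) * indicator {X u ?a<..<X u ?b} x \<partial>lborel) \<le>
          (\<integral>\<^sup>+x. ennreal (?core u * ?w) * ennreal (indicator {X u ?a<..<X u ?b} x * (x - X u ?a) powr (2 * H - 1)) \<partial>lborel)"
        proof (intro nn_integral_mono)
          fix x
          show "ennreal (dom (Suc m) fl (u(m := x))) * indicator {X u ?a<..<X u ?b} x \<le>
            ennreal (?core u * ?w) * ennreal (indicator {X u ?a<..<X u ?b} x * (x - X u ?a) powr (2 * H - 1))"
          proof (cases "x \<in> {X u ?a<..<X u ?b}")
            case True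
            then have "gap_weight (fl ?b) x (X u ?b) \<le> ?w" using ab by (intro gap_weight_le) auto
            then have "dom (Suc m) fl (u(m := x)) \<le> ?core u * ((x - X u ?a) powr (2 * H - 1) * ?w)"
              unfolding upd using core0 by (intro mult_left_mono) auto
            then have "dom (Suc m) fl (u(m := x)) \<le> (?core u * ?w) * (x - X u ?a) powr (2 * H - 1)"
              by (simp only: mult_ac)
            then show ?thesis using True core0[of u] by (simp add: ennreal_mult'[symmetric] ennreal_leI)
          qed simp
        qed
        also have "\<dots> = ennreal (?core u * ?w) * ennreal ((X u ?b - X u ?a) powr (2 * H) / (2 * H))"
          using ab H nn_integral_powr_Ioo[of "X u ?a" "X u ?b" "2 * H - 1"]
          by (subst nn_integral_cmult) auto
        also have "\<dots> = ennreal (W * dom m fl' u)"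
          using core0[of u] H by (subst ennreal_mult'[symmetric]) (auto simp: W_def cr field_simps)
        finally show ?thesis using True W0 by (simp add: ennreal_mult')
      qed simp
    qed
    also have "\<dots> = ennreal W * (\<integral>\<^sup>+u. ennreal (dom m fl' u) * indicator (osimplex s t n (stage m)) u
        \<partial>PiM (stage m) (\<lambda>_. lborel))"
      by (intro nn_integral_cmult borel_measurable_times_ennreal measurable_compose[OF measurable_dom measurable_ennreal]
          borel_measurable_indicator_simplex(2)[OF stage_sub])
    also have "\<dots> < \<infinity>" using Suc.IH[OF fl'] by (simp add: ennreal_mult_less_top)
    finally show ?thesis unfolding stage_Suc(1)[OF m] .
  qed
qed

end

section \<open>Dominated convergence and elimination of the consecutive pairs\<close>

context pair_bounds
begin

lemma prod_abs_le_const: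
  fixes f g :: "'b \<Rightarrow> real"
  assumes "\<And>x. x \<in> A \<Longrightarrow> \<bar>f x\<bar> \<le> c x * g x"
  shows "\<bar>\<Prod>x\<in>A. f x\<bar> \<le> (\<Prod>x\<in>A. c x) * (\<Prod>x\<in>A. g x)"
proof -
  have "\<bar>\<Prod>x\<in>A. f x\<bar> \<le> (\<Prod>x\<in>A. c x * g x)"
    unfolding abs_prod using assms by (intro prod_mono) auto
  then show ?thesis by (simp add: prod.distrib)
qed

lemma weight_abs_le:
  assumes \<rho>: "\<And>i j. (i, j) \<in> E \<Longrightarrow> \<bar>\<rho> (X u i) (X u j)\<bar> \<le> c1 * \<rho>' (X u i) (X u j)"
    and g: "\<And>k. k \<in> Kc \<Longrightarrow> k < m \<Longrightarrow> \<bar>g (X u (k - 2)) (X u k)\<bar> \<le> c2 * g' (X u (k - 2)) (X u k)"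
    and \<Phi>: "\<And>q. q \<in> insert (Suc n) Q \<Longrightarrow>
      \<bar>\<Phi> q (X u (prv (stage m) q)) (X u q)\<bar> \<le> B q * \<Phi>' q (X u (prv (stage m) q)) (X u q)"
  shows "\<bar>weight m \<rho> g \<Phi> u\<bar> \<le>
    (\<Prod>p\<in>E. c1) * (\<Prod>k\<in>{k \<in> Kc. k < m}. c2) * (\<Prod>q\<in>insert (Suc n) Q. B q) * weight m \<rho>' g' \<Phi>' u"
proof -
  have 1: "\<bar>\<Prod>(i, j)\<in>E. \<rho> (X u i) (X u j)\<bar> \<le> (\<Prod>p\<in>E. c1) * (\<Prod>(i, j)\<in>E. \<rho>' (X u i) (X u j))"
    by (rule prod_abs_le_const) (use \<rho> in auto)
  have 2: "\<bar>\<Prod>k\<in>{k \<in> Kc. k < m}. g (X u (k - 2)) (X u k)\<bar> \<le>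
      (\<Prod>k\<in>{k \<in> Kc. k < m}. c2) * (\<Prod>k\<in>{k \<in> Kc. k < m}. g' (X u (k - 2)) (X u k))"
    by (rule prod_abs_le_const) (use g in auto)
  have 3: "\<bar>\<Prod>q\<in>insert (Suc n) Q. \<Phi> q (X u (prv (stage m) q)) (X u q)\<bar> \<le>
      (\<Prod>q\<in>insert (Suc n) Q. B q) * (\<Prod>q\<in>insert (Suc n) Q. \<Phi>' q (X u (prv (stage m) q)) (X u q))"
    by (rule prod_abs_le_const) (use \<Phi> in blast)
  have "\<bar>weight m \<rho> g \<Phi> u\<bar> \<le>
    ((\<Prod>p\<in>E. c1) * (\<Prod>(i, j)\<in>E. \<rho>' (X u i) (X u j))) *
    ((\<Prod>k\<in>{k \<in> Kc. k < m}. c2) * (\<Prod>k\<in>{k \<in> Kc. k < m}. g' (X u (k - 2)) (X u k))) *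
    ((\<Prod>q\<in>insert (Suc n) Q. B q) * (\<Prod>q\<in>insert (Suc n) Q. \<Phi>' q (X u (prv (stage m) q)) (X u q)))"
    unfolding weight_def abs_mult
    using 1 2 3 by (intro mult_mono mult_nonneg_nonneg abs_ge_zero order_trans[OF abs_ge_zero 1]
        order_trans[OF abs_ge_zero 2] order_trans[OF abs_ge_zero 3])
  then show ?thesis unfolding weight_def by (simp only: mult_ac)
qed

context
  fixes m :: nat and fl :: "nat \<Rightarrow> bool" and \<Phi> :: "nat \<Rightarrow> nat \<Rightarrow> real \<Rightarrow> real \<Rightarrow> real"
    and \<Phi>l :: "nat \<Rightarrow> real \<Rightarrow> real \<Rightarrow> real"
  assumes adm: "\<And>q. q \<in> insert (Suc n) Q \<Longrightarrow> admissible (fl q) (\<Phi> q) (\<Phi>l q)"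
begin

lemma weight_dominated: "\<exists>B\<ge>0. \<forall>N. \<forall>u\<in>osimplex s t n (stage m).
    \<bar>weight m (rhoN N) (gmain N) (\<lambda>q. \<Phi> q N) u\<bar> \<le> B * dom m fl u"
proof -
  have "\<forall>q\<in>insert (Suc n) Q. \<exists>B\<ge>0. \<forall>N a b. s \<le> a \<longrightarrow> a \<le> b \<longrightarrow> b \<le> t \<longrightarrow>
      \<bar>\<Phi> q N a b\<bar> \<le> B * gap_weight (fl q) a b"
    using admissibleD(2)[OF adm] by blast
  then obtain B where B: "\<And>q. q \<in> insert (Suc n) Q \<Longrightarrow> 0 \<le> B q"
    "\<And>q N a b. q \<in> insert (Suc n) Q \<Longrightarrow> s \<le> a \<Longrightarrow> a \<le> b \<Longrightarrow> b \<le> t \<Longrightarrow> \<bar>\<Phi> q N a b\<bar> \<le> B q * gap_weight (fl q) a b"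
    by metis
  let ?B = "(\<Prod>p\<in>E. 9 * C) * (\<Prod>k\<in>{k \<in> Kc. k < m}. 9 * C) * (\<Prod>q\<in>insert (Suc n) Q. B q)"
  have B0: "0 \<le> ?B" using C B by (intro mult_nonneg_nonneg prod_nonneg) auto
  have "\<bar>weight m (rhoN N) (gmain N) (\<lambda>q. \<Phi> q N) u\<bar> \<le> ?B * dom m fl u"
    if u: "u \<in> osimplex s t n (stage m)" for N u
    unfolding dom_def
  proof (rule weight_abs_le)
    fix i j assume "(i, j) \<in> E"
    from X_stage_pair(1)[OF u this]
    show "\<bar>rhoN N (X u i) (X u j)\<bar> \<le> 9 * C * (X u j - X u i) powr (2 * H - 2)"
      by (intro rhoN_le) simp_all
  next
    fix k assume "k \<in> Kc" "k < m"
    from X_stage_pair(2)[OF u this]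
    show "\<bar>gmain N (X u (k - 2)) (X u k)\<bar> \<le> 9 * C * (X u k - X u (k - 2)) powr (2 * H - 1)"
      by (intro gmain_le) simp_all
  next
    fix q assume q: "q \<in> insert (Suc n) Q"
    from X_stage_pair(3)[OF u this]
    show "\<bar>\<Phi> q N (X u (prv (stage m) q)) (X u q)\<bar> \<le> B q * gap_weight (fl q) (X u (prv (stage m) q)) (X u q)"
      by (intro B(2)[OF q]) simp_all
  qed
  then show ?thesis using B0 by blast
qed

lemma weight_tendsto:
  assumes u: "u \<in> osimplex s t n (stage m)"
  shows "(\<lambda>N. weight m (rhoN N) (gmain N) (\<lambda>q. \<Phi> q N) u) \<longlonglongrightarrow> weight m (pd12 R) drift \<Phi>l u"
  unfolding weight_def
proof (intro tendsto_mult tendsto_prod)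
  fix p assume p: "p \<in> E"
  obtain i j where ij: "p = (i, j)" by (cases p)
  from X_stage_pair(1)[OF u p[unfolded ij]]
  show "(\<lambda>N. case p of (i, j) \<Rightarrow> rhoN N (X u i) (X u j)) \<longlonglongrightarrow> (case p of (i, j) \<Rightarrow> pd12 R (X u i) (X u j))"
    unfolding ij prod.case by (intro rhoN_tendsto) simp_all
next
  fix k assume "k \<in> {k \<in> Kc. k < m}"
  then have "k \<in> Kc" "k < m" by simp_all
  from X_stage_pair(2)[OF u this]
  show "(\<lambda>N. gmain N (X u (k - 2)) (X u k)) \<longlonglongrightarrow> drift (X u (k - 2)) (X u k)"
    by (intro gmain_tendsto) simp_all
next
  fix q assume q: "q \<in> insert (Suc n) Q"
  from X_stage_pair(3)[OF u this]
  show "(\<lambda>N. \<Phi> q N (X u (prv (stage m) q)) (X u q)) \<longlonglongrightarrow> \<Phi>l q (X u (prv (stage m) q)) (X u q)"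
    by (intro admissibleD(3)[OF adm[OF q]]) simp_all
qed

text \<open>With \<open>gmain\<close> instead of \<open>gN\<close> the weights converge pointwise
  under one majorant. The first claim provides the integrability of the limit that Fubini asks for
  at each stage; the second is applied at stage 0, where no drift factor is left.\<close>

lemma weight_dct:
  assumes fl: "flagged m fl"
  shows "integrable (PiM (stage m) (\<lambda>_. lborel)) (\<lambda>u. indicator (osimplex s t n (stage m)) u * weight m (pd12 R) drift \<Phi>l u)"
    and "(\<lambda>N. LINT u|PiM (stage m) (\<lambda>_. lborel). indicator (osimplex s t n (stage m)) u *
        weight m (rhoN N) (gmain N) (\<lambda>q. \<Phi> q N) u) \<longlonglongrightarrow>
      (LINT u|PiM (stage m) (\<lambda>_. lborel). indicator (osimplex s t n (stage m)) u * weight m (pd12 R) drift \<Phi>l u)"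
proof -
  let ?I = "\<lambda>u. indicator (osimplex s t n (stage m)) u :: real"
  let ?M = "PiM (stage m) (\<lambda>_. lborel :: real measure)"
  obtain B where B: "0 \<le> B" "\<And>N u. u \<in> osimplex s t n (stage m) \<Longrightarrow>
    \<bar>weight m (rhoN N) (gmain N) (\<lambda>q. \<Phi> q N) u\<bar> \<le> B * dom m fl u"
    using weight_dominated by blast
  have mI: "?I \<in> borel_measurable ?M" by (rule borel_measurable_indicator_simplex(1)[OF stage_sub])
  have md: "(\<lambda>u. ?I u * dom m fl u) \<in> borel_measurable ?M"
    using mI measurable_dom by (rule borel_measurable_times)
  have m: "(\<lambda>u. ?I u * weight m (rhoN N) (gmain N) (\<lambda>q. \<Phi> q N) u) \<in> borel_measurable ?M" for N
    using mI by (intro borel_measurable_times measurable_weight measurable_rhoN measurable_gmain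
        admissibleD(1)[OF adm])
  have lim: "(\<lambda>N. ?I u * weight m (rhoN N) (gmain N) (\<lambda>q. \<Phi> q N) u) \<longlonglongrightarrow> ?I u * weight m (pd12 R) drift \<Phi>l u" for u
  proof (cases "u \<in> osimplex s t n (stage m)")
    case True
    then show ?thesis by (intro tendsto_mult tendsto_const weight_tendsto)
  qed simp
  have ml: "(\<lambda>u. ?I u * weight m (pd12 R) drift \<Phi>l u) \<in> borel_measurable ?M"
    by (rule borel_measurable_LIMSEQ_real[OF lim m])
  have "integrable ?M (\<lambda>u. ?I u * dom m fl u)"
  proof (rule integrableI_bounded[OF md])
    have "(\<integral>\<^sup>+u. ennreal (norm (?I u * dom m fl u)) \<partial>?M) =
      (\<integral>\<^sup>+u. ennreal (dom m fl u) * indicator (osimplex s t n (stage m)) u \<partial>?M)"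
      by (intro nn_integral_cong) (auto simp: indicator_def dom_nonneg)
    then show "(\<integral>\<^sup>+u. ennreal (norm (?I u * dom m fl u)) \<partial>?M) < \<infinity>" using dom_finite[OF fl] by simp
  qed
  then have w: "integrable ?M (\<lambda>u. B * (?I u * dom m fl u))" by (rule integrable_mult_right)
  have bd: "AE u in ?M. norm (?I u * weight m (rhoN N) (gmain N) (\<lambda>q. \<Phi> q N) u) \<le> B * (?I u * dom m fl u)" for N
  proof (rule AE_I2)
    fix u
    show "norm (?I u * weight m (rhoN N) (gmain N) (\<lambda>q. \<Phi> q N) u) \<le> B * (?I u * dom m fl u)"
      using B(2)[of u N] by (cases "u \<in> osimplex s t n (stage m)") auto
  qed
  have AElim: "AE u in ?M. (\<lambda>N. ?I u * weight m (rhoN N) (gmain N) (\<lambda>q. \<Phi> q N) u) \<longlonglongrightarrow>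
      ?I u * weight m (pd12 R) drift \<Phi>l u"
    by (rule AE_I2) (rule lim)
  show "integrable ?M (\<lambda>u. ?I u * weight m (pd12 R) drift \<Phi>l u)"
    by (rule integrable_dominated_convergence[OF ml m w AElim bd])
  show "(\<lambda>N. LINT u|?M. ?I u * weight m (rhoN N) (gmain N) (\<lambda>q. \<Phi> q N) u) \<longlonglongrightarrow>
      (LINT u|?M. ?I u * weight m (pd12 R) drift \<Phi>l u)"
    by (rule integral_dominated_convergence[OF ml m w AElim bd])
qed

text \<open>For fixed \<open>N\<close> all factors are bounded, by mesh powers, so the singular
  majorant is avoided. This matters because \<open>gN\<close> has no bound by a power of
  \<open>v - a\<close> that is uniform in \<open>N\<close>.\<close>

lemma weight_integrable_N:
  "integrable (PiM (stage m) (\<lambda>_. lborel)) (\<lambda>u. indicator (osimplex s t n (stage m)) u *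
     weight m (rhoN N) (gN N) (\<lambda>q. \<Phi> q N) u)"
proof -
  have "\<forall>q\<in>insert (Suc n) Q. \<exists>B. \<forall>a b. s \<le> a \<longrightarrow> a \<le> b \<longrightarrow> b \<le> t \<longrightarrow> \<bar>\<Phi> q N a b\<bar> \<le> B"
  proof
    fix q assume "q \<in> insert (Suc n) Q"
    from admissible_uniform[OF adm[OF this]]
    show "\<exists>B. \<forall>a b. s \<le> a \<longrightarrow> a \<le> b \<longrightarrow> b \<le> t \<longrightarrow> \<bar>\<Phi> q N a b\<bar> \<le> B" by metis
  qed
  then obtain B where B: "\<And>q a b. q \<in> insert (Suc n) Q \<Longrightarrow> s \<le> a \<Longrightarrow> a \<le> b \<Longrightarrow> b \<le> t \<Longrightarrow> \<bar>\<Phi> q N a b\<bar> \<le> B q"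
    by metis
  \<comment> \<open>The last factor is a product of ones; evaluating it at the zero function makes
    the constant independent of \<open>u\<close>.\<close>
  define K where "K = (\<Prod>p\<in>E. C * h N powr (2 * H - 2)) * (\<Prod>k\<in>{k \<in> Kc. k < m}. 2 * C * h N powr (2 * H - 1)) *
      (\<Prod>q\<in>insert (Suc n) Q. B q) * weight m (\<lambda>_ _. 1) (\<lambda>_ _. 1) (\<lambda>_ _ _. 1) (\<lambda>_. 0)"
  show ?thesis
  proof (rule integrable_simplex_bounded[OF stage_sub])
    show "weight m (rhoN N) (gN N) (\<lambda>q. \<Phi> q N) \<in> borel_measurable (PiM (stage m) (\<lambda>_. lborel))"
      by (intro measurable_weight measurable_rhoN measurable_gN admissibleD(1)[OF adm])
    fix u assume u: "u \<in> osimplex s t n (stage m)"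
    have "\<bar>weight m (rhoN N) (gN N) (\<lambda>q. \<Phi> q N) u\<bar> \<le>
      (\<Prod>p\<in>E. C * h N powr (2 * H - 2)) * (\<Prod>k\<in>{k \<in> Kc. k < m}. 2 * C * h N powr (2 * H - 1)) *
      (\<Prod>q\<in>insert (Suc n) Q. B q) * weight m (\<lambda>_ _. 1) (\<lambda>_ _. 1) (\<lambda>_ _ _. 1) u"
    proof (rule weight_abs_le)
      show "\<bar>rhoN N (X u i) (X u j)\<bar> \<le> C * h N powr (2 * H - 2) * 1" for i j
        using rhoN_le_mesh by simp
    next
      fix k assume "k \<in> Kc" "k < m"
      from X_stage_pair(2)[OF u this]
      show "\<bar>gN N (X u (k - 2)) (X u k)\<bar> \<le> 2 * C * h N powr (2 * H - 1) * 1"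
        using gN_le_mesh[of "X u (k - 2)" "X u k" N] by simp
    next
      fix q assume q: "q \<in> insert (Suc n) Q"
      from X_stage_pair(3)[OF u this]
      show "\<bar>\<Phi> q N (X u (prv (stage m) q)) (X u q)\<bar> \<le> B q * 1"
        using B[OF q, of "X u (prv (stage m) q)" "X u q"] by simp
    qed
    also have "weight m (\<lambda>_ _. 1) (\<lambda>_ _. 1) (\<lambda>_ _ _. 1) u = weight m (\<lambda>_ _. 1) (\<lambda>_ _. 1) (\<lambda>_ _ _. 1) (\<lambda>_. 0)"
      unfolding weight_def ..
    finally show "\<bar>weight m (rhoN N) (gN N) (\<lambda>q. \<Phi> q N) u\<bar> \<le> K" unfolding K_def .
  qed
qed

end

text \<open>Stated for arbitrary \<rho>, \<open>g\<close> and \<Phi>, so that the approximating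
  integrals and the limit integral are peeled by the same rule.\<close>

lemma weight_peel:
  assumes m: "m \<in> Kc"
    and int: "integrable (PiM (stage (Suc m)) (\<lambda>_. lborel)) (\<lambda>u. indicator (osimplex s t n (stage (Suc m))) u *
      weight (Suc m) \<rho> g \<Phi> u)"
    and ch: "\<And>a b. ch a b = (LINT v|lborel. indicator {a<..<b} v * (g a v * \<Phi> (above m) v b))"
  shows "(LINT u|PiM (stage (Suc m)) (\<lambda>_. lborel). indicator (osimplex s t n (stage (Suc m))) u * weight (Suc m) \<rho> g \<Phi> u) =
    (LINT u|PiM (stage m) (\<lambda>_. lborel). indicator (osimplex s t n (stage m)) u * weight m \<rho> g (\<Phi>(above m := ch)) u)"
proof -
  have "(LINT u|PiM (stage (Suc m)) (\<lambda>_. lborel). indicator (osimplex s t n (stage (Suc m))) u * weight (Suc m) \<rho> g \<Phi> u) =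
    (LINT u|PiM (stage m) (\<lambda>_. lborel). indicator (osimplex s t n (stage m)) u *
      (LINT x|lborel. indicator {X u (m - 2)<..<X u (above m)} x * weight (Suc m) \<rho> g \<Phi> (u(m := x))))"
    using int unfolding stage_Suc(1)[OF m]
    by (intro integral_simplex_insert[OF m_range(3)[OF m] stage_sub below[OF m] above_props(1-3)[OF m] stage_Suc(2)[OF m]])
  also have "\<dots> = (LINT u|PiM (stage m) (\<lambda>_. lborel). indicator (osimplex s t n (stage m)) u * weight m \<rho> g (\<Phi>(above m := ch)) u)"
  proof (intro Bochner_Integration.integral_cong refl arg_cong2[where f = "(*)"])
    fix u
    have "(LINT x|lborel. indicator {X u (m - 2)<..<X u (above m)} x * weight (Suc m) \<rho> g \<Phi> (u(m := x))) =
      (LINT x|lborel. core m \<rho> g \<Phi> u * (indicator {X u (m - 2)<..<X u (above m)} x *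
         (g (X u (m - 2)) x * \<Phi> (above m) x (X u (above m)))))"
      unfolding weight_upd[OF m] by (simp only: mult_ac)
    also have "\<dots> = core m \<rho> g \<Phi> u * ch (X u (m - 2)) (X u (above m))" unfolding ch by simp
    finally show "(LINT x|lborel. indicator {X u (m - 2)<..<X u (above m)} x * weight (Suc m) \<rho> g \<Phi> (u(m := x))) =
      weight m \<rho> g (\<Phi>(above m := ch)) u" unfolding weight_core[OF m] .
  qed
  finally show ?thesis .
qed

text \<open>Induction on the stage. For \<open>m\<close> in \<open>Kc\<close> both sides are peeled
  simultaneously, the chain is moved into the factor at \<open>above m\<close>, and
  \<open>admissible_chain\<close> keeps the hypotheses. Thus the factors \<open>gN\<close> are never
  asked to converge pointwise; they disappear before dominated convergence is used.\<close>

theorem weight_converges: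
  assumes "flagged m fl" "\<And>q. q \<in> insert (Suc n) Q \<Longrightarrow> admissible (fl q) (\<Phi> q) (\<Phi>l q)"
  shows "(\<lambda>N. LINT u|PiM (stage m) (\<lambda>_. lborel). indicator (osimplex s t n (stage m)) u *
        weight m (rhoN N) (gN N) (\<lambda>q. \<Phi> q N) u) \<longlonglongrightarrow>
      (LINT u|PiM (stage m) (\<lambda>_. lborel). indicator (osimplex s t n (stage m)) u * weight m (pd12 R) drift \<Phi>l u)"
  using assms
proof (induction m arbitrary: fl \<Phi> \<Phi>l)
  case 0
  \<comment> \<open>No element of \<open>Kc\<close> lies below 0, so \<open>gN\<close> and
    \<open>gmain\<close> may be exchanged.\<close>
  have "weight 0 \<rho> g \<Psi> = weight 0 \<rho> g' \<Psi>" for \<rho> g g' \<Psi> by (simp add: weight_def fun_eq_iff)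
  then have eq: "weight 0 (rhoN N) (gN N) \<Psi> = weight 0 (rhoN N) (gmain N) \<Psi>" for N \<Psi> by blast
  show ?case unfolding eq by (rule weight_dct(2)[OF 0(2,1)])
next
  case (Suc m)
  show ?case
  proof (cases "m \<in> Kc")
    case False
    then have "flagged m fl" using Suc.prems(1) flagged_Suc' by blast
    then show ?thesis unfolding stage_Suc'(1)[OF False] weight_Suc'[OF False]
      using Suc.prems(2) by (rule Suc.IH)
  next
    case True
    note m = True
    define \<Psi> where "\<Psi> = \<Phi>(above m := (\<lambda>N. chainN N (\<Phi> (above m) N)))"
    define \<Psi>l where "\<Psi>l = \<Phi>l(above m := chain (\<Phi>l (above m)))"
    have adm': "admissible ((fl(above m := True)) q) (\<Psi> q) (\<Psi>l q)" if q: "q \<in> insert (Suc n) Q" for q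
    proof (cases "q = above m")
      case True
      then show ?thesis
        using admissible_chain[OF Suc.prems(2)[OF above_props(4)[OF m]]] by (simp add: \<Psi>_def \<Psi>l_def)
    next
      case False
      then show ?thesis using Suc.prems(2)[OF q] by (simp add: \<Psi>_def \<Psi>l_def)
    qed
    have \<Psi>_eq: "(\<lambda>q. \<Psi> q N) = (\<lambda>q. \<Phi> q N)(above m := chainN N (\<Phi> (above m) N))" for N
      by (auto simp: \<Psi>_def fun_eq_iff)
    have IH: "(\<lambda>N. LINT u|PiM (stage m) (\<lambda>_. lborel). indicator (osimplex s t n (stage m)) u *
        weight m (rhoN N) (gN N) (\<lambda>q. \<Psi> q N) u) \<longlonglongrightarrow>
      (LINT u|PiM (stage m) (\<lambda>_. lborel). indicator (osimplex s t n (stage m)) u * weight m (pd12 R) drift \<Psi>l u)"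
      using flagged_step[OF m Suc.prems(1)] adm' by (rule Suc.IH)
    have L: "(LINT u|PiM (stage (Suc m)) (\<lambda>_. lborel). indicator (osimplex s t n (stage (Suc m))) u *
        weight (Suc m) (rhoN N) (gN N) (\<lambda>q. \<Phi> q N) u) =
      (LINT u|PiM (stage m) (\<lambda>_. lborel). indicator (osimplex s t n (stage m)) u *
        weight m (rhoN N) (gN N) (\<lambda>q. \<Psi> q N) u)" for N
      unfolding \<Psi>_eq
      by (rule weight_peel[OF m weight_integrable_N[OF Suc.prems(2)]]) (simp_all add: chainN_def)
    have Rr: "(LINT u|PiM (stage (Suc m)) (\<lambda>_. lborel). indicator (osimplex s t n (stage (Suc m))) u *
        weight (Suc m) (pd12 R) drift \<Phi>l u) =
      (LINT u|PiM (stage m) (\<lambda>_. lborel). indicator (osimplex s t n (stage m)) u * weight m (pd12 R) drift \<Psi>l u)"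
      unfolding \<Psi>l_def
      by (rule weight_peel[OF m weight_dct(1)[OF Suc.prems(2,1)]]) (simp_all add: chain_def)
    show ?thesis unfolding L Rr by (rule IH)
  qed
qed

text \<open>The indices that remain after the smaller elements of the consecutive pairs with larger
  element in \<open>S\<close> have been integrated out.\<close>

definition removed :: "nat set \<Rightarrow> nat set" where "removed S = {1..n} - (\<lambda>k. k - 1) ` S"

text \<open>Interpolates between Wick's integrand, for empty \<open>S\<close>, and the integrand
  with \<open>gN\<close> at every consecutive pair, for \<open>S = Kc\<close>.\<close>

definition mixed :: "nat \<Rightarrow> nat set \<Rightarrow> (nat \<Rightarrow> real) \<Rightarrow> real" where
  "mixed N S u = (\<Prod>(i, j)\<in>E. rhoN N (X u i) (X u j)) *
     (\<Prod>k\<in>Kc - S. rhoN N (X u (k - 1)) (X u k)) * (\<Prod>k\<in>S. gN N (X u (k - 2)) (X u k))"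

lemma removed_sub: "removed S \<subseteq> {1..n}" by (simp add: removed_def)

lemma pred_Kc_inj: "k \<in> Kc \<Longrightarrow> k' \<in> Kc \<Longrightarrow> k - 1 = k' - 1 \<Longrightarrow> k = k'"
  using Kc_range[of k] Kc_range[of k'] by linarith

lemma mixed_indices:
  assumes S: "S \<subseteq> Kc"
  shows "q \<in> Q \<Longrightarrow> q \<in> removed S" "k \<in> Kc \<Longrightarrow> k \<in> removed S" "k \<in> Kc - S \<Longrightarrow> k - 1 \<in> removed S"
    "k \<in> Kc \<Longrightarrow> k - 2 \<in> insert 0 (removed S)"
proof -
  show "q \<in> removed S" if "q \<in> Q" for q
  proof -
    have "q \<notin> (\<lambda>k. k - 1) ` S" using that Kc_notQ(2) S by auto
    then show ?thesis using that Q_range unfolding removed_def by blast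
  qed
  show kr: "k \<in> removed S" if k: "k \<in> Kc" for k
  proof -
    have "k \<notin> (\<lambda>k. k - 1) ` S"
    proof
      assume "k \<in> (\<lambda>k. k - 1) ` S"
      then obtain k' where "k' \<in> S" "k = k' - 1" by blast
      then show False using Kc_sep[of k'] S k by auto
    qed
    then show ?thesis using k Kc_sub unfolding removed_def by blast
  qed
  show "k - 1 \<in> removed S" if k: "k \<in> Kc - S" for k
  proof -
    have "k - 1 \<notin> (\<lambda>k. k - 1) ` S"
    proof
      assume "k - 1 \<in> (\<lambda>k. k - 1) ` S"
      then obtain k' where "k' \<in> S" "k - 1 = k' - 1" by blast
      then show False using pred_Kc_inj[of k k'] S k by auto
    qed
    moreover have "k - 1 \<in> {1..n}" using Kc_range[of k] k by auto
    ultimately show ?thesis unfolding removed_def by blast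
  qed
  show "k - 2 \<in> insert 0 (removed S)" if k: "k \<in> Kc" for k
  proof (cases "k - 2 = 0")
    case False
    have "k - 2 \<notin> (\<lambda>k. k - 1) ` S"
    proof
      assume "k - 2 \<in> (\<lambda>k. k - 1) ` S"
      then obtain k' where k': "k' \<in> S" "k - 2 = k' - 1" by blast
      then have "k' = k - 1" using False by linarith
      then show False using k' S Kc_sep[OF k] by auto
    qed
    moreover have "k - 2 \<in> {1..n}" using Kc_range[OF k] False by auto
    ultimately show ?thesis unfolding removed_def by blast
  qed simp
qed

lemma measurable_X_removed: "i \<in> insert 0 (removed S) \<Longrightarrow> (\<lambda>u. X u i) \<in> borel_measurable (PiM (removed S) (\<lambda>_. lborel))"
  by (rule measurable_ext_pts[OF removed_sub]) auto

lemma measurable_mixed: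
  assumes S: "S \<subseteq> Kc"
  shows "mixed N S \<in> borel_measurable (PiM (removed S) (\<lambda>_. lborel))"
  unfolding mixed_def
proof (intro borel_measurable_times borel_measurable_prod)
  fix p assume p: "p \<in> E"
  obtain i j where ij: "p = (i, j)" by (cases p)
  show "(\<lambda>u. case p of (i, j) \<Rightarrow> rhoN N (X u i) (X u j)) \<in> borel_measurable (PiM (removed S) (\<lambda>_. lborel))"
    unfolding ij prod.case
    using mixed_indices(1)[OF S] E_inQ[of i j] p[unfolded ij]
    by (intro measurable_rhoN2 measurable_X_removed) auto
next
  fix k assume "k \<in> Kc - S"
  then show "(\<lambda>u. rhoN N (X u (k - 1)) (X u k)) \<in> borel_measurable (PiM (removed S) (\<lambda>_. lborel))"
    using mixed_indices(2,3)[OF S, of k] by (intro measurable_rhoN2 measurable_X_removed) auto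
next
  fix k assume "k \<in> S"
  then have "k \<in> Kc" using S by blast
  then show "(\<lambda>u. gN N (X u (k - 2)) (X u k)) \<in> borel_measurable (PiM (removed S) (\<lambda>_. lborel))"
    using mixed_indices(2,4)[OF S, of k] by (intro measurable_gN2 measurable_X_removed) auto
qed

lemma integrable_mixed:
  assumes S: "S \<subseteq> Kc"
  shows "integrable (PiM (removed S) (\<lambda>_. lborel)) (\<lambda>u. indicator (osimplex s t n (removed S)) u * mixed N S u)"
proof (rule integrable_simplex_bounded[OF removed_sub measurable_mixed[OF S]])
  fix u assume u: "u \<in> osimplex s t n (removed S)"
  let ?c = "C * h N powr (2 * H - 2)" and ?d = "2 * C * h N powr (2 * H - 1)"
  have 1: "\<bar>\<Prod>(i, j)\<in>E. rhoN N (X u i) (X u j)\<bar> \<le> (\<Prod>p\<in>E. ?c) * (\<Prod>p\<in>E. 1)"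
    by (rule prod_abs_le_const) (use rhoN_le_mesh in auto)
  have 2: "\<bar>\<Prod>k\<in>Kc - S. rhoN N (X u (k - 1)) (X u k)\<bar> \<le> (\<Prod>k\<in>Kc - S. ?c) * (\<Prod>k\<in>Kc - S. 1)"
    by (rule prod_abs_le_const) (use rhoN_le_mesh in auto)
  have 3: "\<bar>\<Prod>k\<in>S. gN N (X u (k - 2)) (X u k)\<bar> \<le> (\<Prod>k\<in>S. ?d) * (\<Prod>k\<in>S. 1)"
  proof (rule prod_abs_le_const)
    fix k assume "k \<in> S"
    then have k: "k \<in> Kc" using S by blast
    note i = mixed_indices(2,4)[OF S k]
    have r: "k - 2 < k" "k \<noteq> Suc n" using Kc_range[OF k] by auto
    have "s \<le> X u (k - 2)" "X u (k - 2) < X u k" "X u k < t"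
      using simplex_bounds(1)[OF u _ removed_sub, of "k - 2"] simplex_bounds(4)[OF u _ removed_sub r(2)]
        simplexD[OF u _ _ r(1)] i by auto
    then show "\<bar>gN N (X u (k - 2)) (X u k)\<bar> \<le> ?d * 1" using gN_le_mesh by simp
  qed
  show "\<bar>mixed N S u\<bar> \<le> ((\<Prod>p\<in>E. ?c) * (\<Prod>p\<in>E. 1)) * ((\<Prod>k\<in>Kc - S. ?c) * (\<Prod>k\<in>Kc - S. 1)) *
      ((\<Prod>k\<in>S. ?d) * (\<Prod>k\<in>S. 1))"
    unfolding mixed_def abs_mult
    using 1 2 3 by (intro mult_mono mult_nonneg_nonneg abs_ge_zero order_trans[OF abs_ge_zero 1]
        order_trans[OF abs_ge_zero 2] order_trans[OF abs_ge_zero 3])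
qed

lemma integral_rhoN_eq_gN:
  assumes "s \<le> a" "a < v" "v < t"
  shows "(LINT x|lborel. indicator {a<..<v} x * rhoN N x v) = gN N a v"
proof -
  have m: "(\<lambda>x. rhoN N x v) \<in> borel_measurable borel" by measurable
  have "(LINT x|lborel. indicator {a<..<v} x * rhoN N x v) = integral {a..v} (\<lambda>x. rhoN N x v)"
    by (rule integral_Ioo_eq_HK[OF m]) (rule rhoN_le_mesh)
  also have "\<dots> = gN N a v"
    unfolding gN_def using assms by (intro integral_unique rhoN_has_integral) auto
  finally show ?thesis .
qed

text \<open>The coordinate \<open>k - 1\<close> occurs only in the factor \<open>rhoN\<close> of its
  own pair and has the neighbours \<open>k - 2\<close> and \<open>k\<close>; integrating it between
  them yields \<open>gN\<close>. For fixed \<open>N\<close> everything is bounded, so no singularity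
  interferes.\<close>

lemma mixed_step:
  assumes S: "insert k S \<subseteq> Kc" "k \<notin> S" "finite S"
  shows "(LINT u|PiM (removed S) (\<lambda>_. lborel). indicator (osimplex s t n (removed S)) u * mixed N S u) =
    (LINT u|PiM (removed (insert k S)) (\<lambda>_. lborel). indicator (osimplex s t n (removed (insert k S))) u *
      mixed N (insert k S) u)"
proof -
  let ?I = "removed (insert k S)"
  let ?j = "k - 1"
  have k: "k \<in> Kc" and SK: "S \<subseteq> Kc" using S by auto
  note kr = Kc_range[OF k]
  have j: "?j \<in> {1..n}" "?j \<notin> ?I" "?j \<in> removed S"
    using kr mixed_indices(3)[OF SK, of k] k S(2) by (auto simp: removed_def)
  have ins: "removed S = insert ?j ?I" using j(3) by (auto simp: removed_def)
  note ix = mixed_indices[OF S(1)]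
  have a: "k - 2 \<in> insert 0 ?I" "k - 2 < ?j" "\<And>i. i \<in> ?I \<Longrightarrow> i < ?j \<Longrightarrow> i \<le> k - 2"
    using ix(4)[OF k] kr by auto
  have b: "k \<in> insert (Suc n) ?I" "?j < k" "\<And>i. i \<in> ?I \<Longrightarrow> ?j < i \<Longrightarrow> k \<le> i"
    using ix(2)[OF k] kr by auto
  have XU: "X (u(?j := x)) i = (if i = ?j then x else X u i)" for u x i
  proof -
    have "?j \<noteq> 0" "?j \<noteq> Suc n" using j(1) by auto
    from ext_pts_simps(4)[OF this] show ?thesis by simp
  qed
  define c where "c u = (\<Prod>(i, j)\<in>E. rhoN N (X u i) (X u j)) *
     (\<Prod>k\<in>Kc - insert k S. rhoN N (X u (k - 1)) (X u k)) * (\<Prod>k\<in>S. gN N (X u (k - 2)) (X u k))" for u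
  have upd: "mixed N S (u(?j := x)) = c u * rhoN N x (X u k)" for u x
  proof -
    have 1: "(\<Prod>(i, j)\<in>E. rhoN N (X (u(?j := x)) i) (X (u(?j := x)) j)) = (\<Prod>(i, j)\<in>E. rhoN N (X u i) (X u j))"
    proof (rule prod.cong[OF refl])
      fix p assume p: "p \<in> E"
      obtain i' j' where ij: "p = (i', j')" by (cases p)
      have "i' \<noteq> ?j" "j' \<noteq> ?j" using E_inQ[of i' j'] p Kc_notQ(2)[OF k] unfolding ij by metis+
      then show "(case p of (i, j) \<Rightarrow> rhoN N (X (u(?j := x)) i) (X (u(?j := x)) j)) =
          (case p of (i, j) \<Rightarrow> rhoN N (X u i) (X u j))"
        unfolding ij by (simp add: XU del: One_nat_def)
    qed
    have neq: "k' \<noteq> ?j" "k' - 2 \<noteq> ?j" if "k' \<in> Kc" for k'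
    proof -
      show "k' \<noteq> ?j" using Kc_sep[OF k] that by auto
      show "k' - 2 \<noteq> ?j"
      proof
        assume "k' - 2 = ?j"
        then have "k' - 1 = k" using kr by linarith
        then show False using Kc_sep[OF that] k by simp
      qed
    qed
    have Ks: "Kc - S = insert k (Kc - insert k S)" using k S(2) by auto
    have 2: "(\<Prod>k'\<in>Kc - S. rhoN N (X (u(?j := x)) (k' - 1)) (X (u(?j := x)) k')) =
        rhoN N x (X u k) * (\<Prod>k'\<in>Kc - insert k S. rhoN N (X u (k' - 1)) (X u k'))"
    proof -
      have "(\<Prod>k'\<in>Kc - insert k S. rhoN N (X (u(?j := x)) (k' - 1)) (X (u(?j := x)) k')) =
          (\<Prod>k'\<in>Kc - insert k S. rhoN N (X u (k' - 1)) (X u k'))"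
      proof (rule prod.cong[OF refl])
        fix k' assume k': "k' \<in> Kc - insert k S"
        then have "k' - 1 \<noteq> ?j" using pred_Kc_inj[of k' k] k by auto
        then show "rhoN N (X (u(?j := x)) (k' - 1)) (X (u(?j := x)) k') = rhoN N (X u (k' - 1)) (X u k')"
          using neq(1)[of k'] k' by (simp add: XU del: One_nat_def)
      qed
      moreover have "rhoN N (X (u(?j := x)) ?j) (X (u(?j := x)) k) = rhoN N x (X u k)"
        using b(2) by (simp add: XU del: One_nat_def)
      ultimately show ?thesis unfolding Ks using finite_Kc by (subst prod.insert) simp_all
    qed
    have 3: "(\<Prod>k'\<in>S. gN N (X (u(?j := x)) (k' - 2)) (X (u(?j := x)) k')) = (\<Prod>k'\<in>S. gN N (X u (k' - 2)) (X u k'))"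
    proof (rule prod.cong[OF refl])
      fix k' assume "k' \<in> S"
      then have "k' \<in> Kc" using SK by blast
      then show "gN N (X (u(?j := x)) (k' - 2)) (X (u(?j := x)) k') = gN N (X u (k' - 2)) (X u k')"
        by (simp only: XU neq if_False)
    qed
    show ?thesis unfolding mixed_def 1 2 3 c_def by (simp only: mult_ac)
  qed
  have new: "mixed N (insert k S) u = c u * gN N (X u (k - 2)) (X u k)" for u
    unfolding mixed_def c_def using S(2,3) by (simp add: mult_ac)
  have "(LINT u|PiM (removed S) (\<lambda>_. lborel). indicator (osimplex s t n (removed S)) u * mixed N S u) =
    (LINT u|PiM ?I (\<lambda>_. lborel). indicator (osimplex s t n ?I) u *
      (LINT x|lborel. indicator {X u (k - 2)<..<X u k} x * mixed N S (u(?j := x))))"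
    using integrable_mixed[OF SK, of N] unfolding ins
    by (intro integral_simplex_insert[OF j(1) removed_sub a b j(2)])
  also have "\<dots> = (LINT u|PiM ?I (\<lambda>_. lborel). indicator (osimplex s t n ?I) u * mixed N (insert k S) u)"
  proof (intro Bochner_Integration.integral_cong refl)
    fix u
    show "indicator (osimplex s t n ?I) u * (LINT x|lborel. indicator {X u (k - 2)<..<X u k} x * mixed N S (u(?j := x))) =
       indicator (osimplex s t n ?I) u * mixed N (insert k S) u"
    proof (cases "u \<in> osimplex s t n ?I")
      case True
      have r: "k - 2 < k" "k \<noteq> Suc n" using kr by auto
      have X: "s \<le> X u (k - 2)" "X u (k - 2) < X u k" "X u k < t"
        using simplex_bounds(1)[OF True _ removed_sub, of "k - 2"] simplex_bounds(4)[OF True _ removed_sub r(2)]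
          simplexD[OF True _ _ r(1)] ix(2,4)[OF k] by auto
      have "(LINT x|lborel. indicator {X u (k - 2)<..<X u k} x * mixed N S (u(?j := x))) =
         (LINT x|lborel. c u * (indicator {X u (k - 2)<..<X u k} x * rhoN N x (X u k)))"
        unfolding upd by (simp only: mult_ac)
      also have "\<dots> = mixed N (insert k S) u" unfolding new using integral_rhoN_eq_gN[OF X] by simp
      finally show ?thesis by simp
    qed simp
  qed
  finally show ?thesis .
qed

lemma mixed_eq:
  assumes "finite S" "S \<subseteq> Kc"
  shows "(LINT u|PiM {1..n} (\<lambda>_. lborel). indicator (osimplex s t n {1..n}) u * mixed N {} u) =
    (LINT u|PiM (removed S) (\<lambda>_. lborel). indicator (osimplex s t n (removed S)) u * mixed N S u)"
  using assms
proof (induction S rule: finite_induct)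
  case empty
  then show ?case by (simp add: removed_def)
next
  case (insert k S)
  then show ?case using mixed_step[of k S N] by simp
qed

lemma removed_Kc: "removed Kc = stage (Suc n)"
proof -
  have "{k \<in> Kc. k < Suc n} = Kc" using Kc_sub by auto
  then have st: "stage (Suc n) = Q \<union> Kc" by (simp add: stage_def)
  have "Q \<union> Kc \<subseteq> removed Kc" using mixed_indices(1,2)[of Kc] by blast
  moreover have "removed Kc \<subseteq> Q \<union> Kc"
  proof
    fix i assume i: "i \<in> removed Kc"
    have "Suc i \<notin> Kc"
    proof
      assume "Suc i \<in> Kc"
      then have "i \<in> (\<lambda>k. k - 1) ` Kc" by (intro image_eqI[of _ _ "Suc i"]) simp_all
      then show False using i by (simp add: removed_def)
    qed
    moreover have "i \<in> {1..n}" using i removed_sub by blast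
    ultimately show "i \<in> Q \<union> Kc" using cover[of i] unfolding Q_def by blast
  qed
  ultimately show ?thesis unfolding st by blast
qed

theorem pairing_limit:
  "(\<lambda>N. LINT u|PiM {1..n} (\<lambda>_. lborel). indicator (osimplex s t n {1..n}) u *
      ((\<Prod>(i, j)\<in>E. rhoN N (u i) (u j)) * (\<Prod>k\<in>Kc. rhoN N (u (k - 1)) (u k)))) \<longlonglongrightarrow>
    (LINT u|PiM (Q \<union> Kc) (\<lambda>_. lborel). indicator (osimplex s t n (Q \<union> Kc)) u *
      ((\<Prod>(i, j)\<in>E. pd12 R (u i) (u j)) * (\<Prod>k\<in>Kc. drift (X u (k - 2)) (u k))))"
proof -
  have Kn: "{k \<in> Kc. k < Suc n} = Kc" using Kc_sub by auto
  have st: "stage (Suc n) = Q \<union> Kc" by (simp add: stage_def Kn)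
  have XE: "(\<Prod>(i, j)\<in>E. f (X u i) (X u j)) = (\<Prod>(i, j)\<in>E. f (u i) (u j))" for f :: "real \<Rightarrow> real \<Rightarrow> real" and u
  proof (rule prod.cong[OF refl])
    fix p assume p: "p \<in> E"
    obtain i j where ij: "p = (i, j)" by (cases p)
    show "(case p of (i, j) \<Rightarrow> f (X u i) (X u j)) = (case p of (i, j) \<Rightarrow> f (u i) (u j))"
      using E_range[of i j] p unfolding ij by simp
  qed
  have XK: "X u k = u k" "X u (k - 1) = u (k - 1)" if "k \<in> Kc" for k u
  proof -
    have "k \<noteq> 0" "k \<noteq> Suc n" "k - 1 \<noteq> 0" "k - 1 \<noteq> Suc n" using Kc_range[OF that] by linarith+
    then show "X u k = u k" "X u (k - 1) = u (k - 1)" by simp_all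
  qed
  \<comment> \<open>The elimination starts without any flag: if \<open>q - 1\<close> is absent at
    this stage it is the smaller element of a consecutive pair, which forces \<open>q\<close> into
    \<open>Kc\<close> and out of \<open>Q\<close>.\<close>
  have fl: "flagged (Suc n) (\<lambda>_. False)"
    unfolding flagged_def st
  proof (intro ballI impI)
    fix q assume q: "q \<in> Q" "q - 1 \<notin> insert 0 (Q \<union> Kc)"
    have r: "q - 1 \<in> {1..n}" "Suc (q - 1) = q" using q Q_range by auto
    have "q \<in> Kc" using cover[OF r(1)] q(2) r(2) unfolding Q_def by auto
    then show False using Kc_notQ(1) q(1) by blast
  qed
  have lhs: "(LINT u|PiM {1..n} (\<lambda>_. lborel). indicator (osimplex s t n {1..n}) u *
      ((\<Prod>(i, j)\<in>E. rhoN N (u i) (u j)) * (\<Prod>k\<in>Kc. rhoN N (u (k - 1)) (u k)))) =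
    (LINT u|PiM (stage (Suc n)) (\<lambda>_. lborel). indicator (osimplex s t n (stage (Suc n))) u *
        weight (Suc n) (rhoN N) (gN N) (\<lambda>_ _ _. 1) u)" for N
  proof -
    have "mixed N {} u = (\<Prod>(i, j)\<in>E. rhoN N (u i) (u j)) * (\<Prod>k\<in>Kc. rhoN N (u (k - 1)) (u k))" for u
      unfolding mixed_def XE by (simp add: XK del: One_nat_def)
    moreover have "mixed N Kc u = weight (Suc n) (rhoN N) (gN N) (\<lambda>_ _ _. 1) u" for u
      unfolding mixed_def weight_def Kn by simp
    ultimately show ?thesis using mixed_eq[OF finite_Kc subset_refl, of N] by (simp add: removed_Kc)
  qed
  have rhs: "weight (Suc n) (pd12 R) drift (\<lambda>_ _ _. 1) u =
     (\<Prod>(i, j)\<in>E. pd12 R (u i) (u j)) * (\<Prod>k\<in>Kc. drift (X u (k - 2)) (u k))" for u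
    unfolding weight_def XE Kn by (simp add: XK)
  have "(\<lambda>N. LINT u|PiM (stage (Suc n)) (\<lambda>_. lborel). indicator (osimplex s t n (stage (Suc n))) u *
        weight (Suc n) (rhoN N) (gN N) (\<lambda>q. (\<lambda>_ _ _ _. 1) q N) u) \<longlonglongrightarrow>
      (LINT u|PiM (stage (Suc n)) (\<lambda>_. lborel). indicator (osimplex s t n (stage (Suc n))) u *
        weight (Suc n) (pd12 R) drift (\<lambda>_ _ _. 1) u)"
    by (rule weight_converges[OF fl]) (rule admissible_const)
  then show ?thesis unfolding lhs rhs st by simp
qed

end

section \<open>The uniform grid as a partition\<close>

context interval
begin

lemma pl_eq_at_nodes: "k \<le> Suc N \<Longrightarrow> u = node N k \<Longrightarrow> pl N x u = x u"
  using pl_node[of k N x] by simp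

end

text \<open>As a set it shrinks to one point for \<open>a = b\<close>, so that \<open>s = 0\<close>
  and \<open>t = T\<close> require no separate grid.\<close>

definition equidistant :: "nat \<Rightarrow> real \<Rightarrow> real \<Rightarrow> real set" where
  "equidistant N a b = (\<lambda>k. a + real k * ((b - a) / real (Suc N))) ` {..Suc N}"

lemma equidistant_props:
  assumes "a \<le> b"
  shows "finite (equidistant N a b)" "a \<in> equidistant N a b" "b \<in> equidistant N a b" "equidistant N a b \<subseteq> {a..b}"
proof -
  show "finite (equidistant N a b)" by (simp add: equidistant_def)
  show "a \<in> equidistant N a b" unfolding equidistant_def by (rule image_eqI[of _ _ 0]) auto
  show "b \<in> equidistant N a b" unfolding equidistant_def
    by (rule image_eqI[of _ _ "Suc N"]) (auto simp del: of_nat_Suc)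
  show "equidistant N a b \<subseteq> {a..b}"
  proof
    fix x assume "x \<in> equidistant N a b"
    then obtain k where k: "k \<le> Suc N" "x = a + real k * ((b - a) / real (Suc N))"
      by (auto simp: equidistant_def)
    have "real k * ((b - a) / real (Suc N)) \<le> real (Suc N) * ((b - a) / real (Suc N))"
      using k assms by (intro mult_right_mono) (auto simp del: of_nat_Suc)
    also have "\<dots> = b - a" by (simp del: of_nat_Suc)
    finally have "x \<le> b" using k by simp
    moreover have "0 \<le> real k * ((b - a) / real (Suc N))" using assms by simp
    ultimately show "x \<in> {a..b}" using k by simp
  qed
qed

lemma equidistant_next:
  assumes "a \<le> x" "x < b"
  shows "\<exists>y\<in>equidistant N a b. x < y \<and> y \<le> x + (b - a) / real (Suc N)"
proof -
  interpret interval a b by standard (use assms in linarith)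
  obtain k where k: "k \<le> N" "node N k \<le> x" "x < node N (Suc k)" using assms by (rule cell_exists)
  have "node N (Suc k) \<in> equidistant N a b"
    unfolding equidistant_def node_def h_def by (rule image_eqI[of _ _ "Suc k"]) (use k in auto)
  then show ?thesis using k unfolding node_Suc h_def by (intro bexI[of _ "node N k + (b - a) / real (Suc N)"]) auto
qed

text \<open>Both \<open>s\<close> and \<open>t\<close> are partition points, and the cells between
  them are equal. The outer parts serve only to make the mesh on all of \<open>[0, T]\<close>
  vanish.\<close>

definition grid_points :: "real \<Rightarrow> real \<Rightarrow> real \<Rightarrow> nat \<Rightarrow> real set" where
  "grid_points s t T N = equidistant N 0 s \<union> equidistant N s t \<union> equidistant N t T"

definition grid :: "real \<Rightarrow> real \<Rightarrow> real \<Rightarrow> nat \<Rightarrow> real list" where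
  "grid s t T N = sorted_list_of_set (grid_points s t T N)"

lemma grid_points_props:
  assumes "0 \<le> s" "s \<le> t" "t \<le> T"
  shows "finite (grid_points s t T N)" "0 \<in> grid_points s t T N" "T \<in> grid_points s t T N"
    "grid_points s t T N \<subseteq> {0..T}" "set (grid s t T N) = grid_points s t T N"
proof -
  note e = equidistant_props[OF assms(1), of N] equidistant_props[OF assms(2), of N] equidistant_props[OF assms(3), of N]
  show fin: "finite (grid_points s t T N)" using e by (simp add: grid_points_def)
  show "0 \<in> grid_points s t T N" "T \<in> grid_points s t T N" using e by (simp_all add: grid_points_def)
  have "{0..s} \<subseteq> {0..T}" "{s..t} \<subseteq> {0..T}" "{t..T} \<subseteq> {0..T}" using assms by auto
  then show "grid_points s t T N \<subseteq> {0..T}" using e(4,8,12) unfolding grid_points_def by blast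
  show "set (grid s t T N) = grid_points s t T N" using fin by (simp add: grid_def)
qed

lemma grid_points_next:
  assumes "0 \<le> s" "s \<le> t" "t \<le> T" "0 \<le> x" "x < T"
  shows "\<exists>y\<in>grid_points s t T N. x < y \<and> y \<le> x + T / real (Suc N)"
proof -
  have le: "(b - a) / real (Suc N) \<le> T / real (Suc N)" if "0 \<le> a" "b \<le> T" for a b
    using that by (intro divide_right_mono) auto
  consider "x < s" | "s \<le> x" "x < t" | "t \<le> x" by linarith
  then show ?thesis
  proof cases
    case 1
    obtain y where "y \<in> equidistant N 0 s" "x < y" "y \<le> x + (s - 0) / real (Suc N)"
      using equidistant_next[OF assms(4) 1] by blast
    moreover have "(s - 0) / real (Suc N) \<le> T / real (Suc N)" using assms by (intro le) auto
    ultimately show ?thesis unfolding grid_points_def by (intro bexI[of _ y]) auto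
  next
    case 2
    obtain y where "y \<in> equidistant N s t" "x < y" "y \<le> x + (t - s) / real (Suc N)"
      using equidistant_next[OF 2] by blast
    moreover have "(t - s) / real (Suc N) \<le> T / real (Suc N)" using assms by (intro le) auto
    ultimately show ?thesis unfolding grid_points_def by (intro bexI[of _ y]) auto
  next
    case 3
    obtain y where "y \<in> equidistant N t T" "x < y" "y \<le> x + (T - t) / real (Suc N)"
      using equidistant_next[OF 3 assms(5)] by blast
    moreover have "(T - t) / real (Suc N) \<le> T / real (Suc N)" using assms by (intro le) auto
    ultimately show ?thesis unfolding grid_points_def by (intro bexI[of _ y]) auto
  qed
qed

lemma grid_partition:
  assumes "0 \<le> s" "s \<le> t" "t \<le> T" "0 < T"
  shows "is_partition T (grid s t T N)" "0 \<le> mesh (grid s t T N)" "mesh (grid s t T N) \<le> T / real (Suc N)"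
proof -
  let ?D = "grid s t T N"
  note g = grid_points_props[OF assms(1-3), of N]
  have sorted: "sorted_wrt (<) ?D" unfolding grid_def by (rule strict_sorted_list_of_set)
  have ne: "?D \<noteq> []" using g(2,5) by auto
  have less: "?D ! i < ?D ! j" if "i < j" "j < length ?D" for i j
    using sorted_wrt_nth_less[OF sorted that] .
  have in01: "?D ! i \<in> {0..T}" if "i < length ?D" for i
    using that g(4,5) nth_mem by blast
  obtain i where i: "i < length ?D" "?D ! i = 0" using g(2,5) by (metis in_set_conv_nth)
  have i0: "i = 0"
  proof (rule ccontr)
    assume "i \<noteq> 0"
    then show False using less[of 0 i] in01[of 0] i ne by fastforce
  qed
  obtain j where j: "j < length ?D" "?D ! j = T" using g(3,5) by (metis in_set_conv_nth)
  have jl: "j = length ?D - 1"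
  proof (rule ccontr)
    assume "j \<noteq> length ?D - 1"
    then have "j < length ?D - 1" using j by simp
    moreover have "length ?D - 1 < length ?D" using j by simp
    ultimately show False using less[of j "length ?D - 1"] in01[of "length ?D - 1"] j by simp
  qed
  show "is_partition T ?D"
    unfolding is_partition_def using ne sorted i i0 j jl by (simp add: hd_conv_nth last_conv_nth)
  have len: "1 < length ?D"
  proof (rule ccontr)
    assume "\<not> 1 < length ?D"
    then have "j = i" using i0 jl by simp
    then show False using i j assms by simp
  qed
  let ?S = "(\<lambda>i. ?D ! Suc i - ?D ! i) ` {..<length ?D - 1}"
  have "0 \<in> {..<length ?D - 1}" using len by simp
  then have S: "finite ?S" "?S \<noteq> {}" by blast+
  have "0 \<le> x" if x: "x \<in> ?S" for x
  proof -
    obtain k where k: "k < length ?D - 1" "x = ?D ! Suc k - ?D ! k" using x by blast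
    have "Suc k < length ?D" using k(1) by linarith
    then show ?thesis using less[of k "Suc k"] k(2) by simp
  qed
  then show "0 \<le> mesh ?D" unfolding mesh_def using Max_in[OF S] by blast
  have "x \<le> T / real (Suc N)" if x: "x \<in> ?S" for x
  proof -
    obtain k where k: "k < length ?D - 1" "x = ?D ! Suc k - ?D ! k" using x by blast
    have k': "Suc k < length ?D" using k(1) by linarith
    have lt: "?D ! k < ?D ! Suc k" using less[of k "Suc k"] k' by simp
    have "?D ! Suc k \<le> T" "0 \<le> ?D ! k" using in01[of "Suc k"] in01[of k] k' by simp_all
    then obtain y where y: "y \<in> grid_points s t T N" "?D ! k < y" "y \<le> ?D ! k + T / real (Suc N)"
      using grid_points_next[OF assms(1-3), of "?D ! k" N] lt by auto
    then obtain l where l: "l < length ?D" "?D ! l = y" using g(5) by (metis in_set_conv_nth)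
    have "k < l"
    proof (rule ccontr)
      assume "\<not> k < l"
      then have "?D ! l \<le> ?D ! k" using less[of l k] k' by (cases "l = k") auto
      then show False using l y by simp
    qed
    then have "?D ! Suc k \<le> y" using less[of "Suc k" l] l by (cases "Suc k = l") auto
    then show ?thesis using y k by simp
  qed
  then show "mesh ?D \<le> T / real (Suc N)" unfolding mesh_def using Max_in[OF S] by blast
qed

lemma grid_vanishing:
  assumes "0 \<le> s" "s \<le> t" "t \<le> T" "0 < T"
  shows "filterlim (grid s t T) (vanishing_mesh T) sequentially"
  unfolding vanishing_mesh_def filterlim_inf filterlim_filtercomap_iff
proof
  have lim: "(\<lambda>N. T / real (Suc N)) \<longlonglongrightarrow> 0" by real_asymp
  have "(\<lambda>N. mesh (grid s t T N)) \<longlonglongrightarrow> 0"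
    by (rule tendsto_sandwich[OF _ _ tendsto_const lim]) (use grid_partition[OF assms] in \<open>auto intro!: always_eventually\<close>)
  then show "filterlim (mesh \<circ> grid s t T) (nhds 0) sequentially" by (simp add: comp_def)
  show "filterlim (grid s t T) (principal {D. is_partition T D}) sequentially"
    unfolding filterlim_principal using grid_partition[OF assms] by (auto intro!: always_eventually)
qed

context interval
begin

text \<open>Since \<open>s\<close> and \<open>t\<close> are grid points, the grid points nearest to
  a time in \<open>[s, t]\<close> are nodes of the inner uniform grid, and the interpolation is that
  of \<open>pl\<close>.\<close>

lemma pl_interp_grid:
  fixes x :: "real \<Rightarrow> real ^ 'd"
  assumes "0 \<le> s" "t \<le> T" and u: "s \<le> u" "u \<le> t"
  shows "pl_interp (grid s t T N) x u $ \<alpha> = pl N (\<lambda>r. x r $ \<alpha>) u"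
proof -
  have st': "s \<le> t" using st by simp
  note g = grid_points_props[OF assms(1) st' assms(2), of N]
  let ?G = "grid_points s t T N"
  have eqd: "equidistant N s t = node N ` {..Suc N}" by (simp add: equidistant_def node_def h_def)
  have G: "?G = equidistant N 0 s \<union> node N ` {..Suc N} \<union> equidistant N t T"
    by (simp add: grid_points_def eqd)
  have e: "equidistant N 0 s \<subseteq> {0..s}" "equidistant N t T \<subseteq> {t..T}"
    using equidistant_props(4)[of 0 s N] equidistant_props(4)[of t T N] assms by auto
  have nodeG: "node N k \<in> ?G" if "k \<le> Suc N" for k unfolding G using that by blast
  have cs: "r \<le> s \<or> (\<exists>k\<le>Suc N. r = node N k) \<or> t \<le> r" if "r \<in> ?G" for r
    using that e unfolding G by auto
  define k where "k = cell N u"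
  have k: "k \<le> N" "node N k \<le> u" "u \<le> node N (Suc k)"
    using cell_le[of N u] cell_bounds[OF u, of N] by (auto simp: k_def)
  let ?a = "Max {r \<in> ?G. r \<le> u}" and ?b = "Min {r \<in> ?G. u \<le> r}"
  have finG: "finite {r \<in> ?G. r \<le> u}" "finite {r \<in> ?G. u \<le> r}" using g(1) by auto
  have pli: "pl_interp (grid s t T N) x u = x ?a + ((u - ?a) / (?b - ?a)) *\<^sub>R (x ?b - x ?a)"
    unfolding pl_interp_def Let_def g(5) ..
  show ?thesis
  proof (cases "u \<in> ?G")
    case True
    have "?a = u" "?b = u" using True finG by (auto intro!: Max_eqI Min_eqI)
    then have 1: "pl_interp (grid s t T N) x u = x u" unfolding pli by simp
    obtain j where j: "j \<le> Suc N" "u = node N j"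
    proof -
      consider "u = s" | "\<exists>k\<le>Suc N. u = node N k" | "u = t" using cs[OF True] u by fastforce
      then show thesis
      proof cases
        case 1
        then show ?thesis using that[of 0] by simp
      next
        case 2
        then show ?thesis using that by blast
      next
        case 3
        then show ?thesis using that[of "Suc N"] by simp
      qed
    qed
    show ?thesis unfolding 1 pl_eq_at_nodes[OF j] ..
  next
    case False
    then have strict: "node N k < u" "u < node N (Suc k)"
      using k nodeG[of k] nodeG[of "Suc k"] by (auto simp: order_less_le)
    have st1: "s < u" "u < t" using strict node_bounds[of k N] node_bounds[of "Suc k" N] k by auto
    have a: "?a = node N k"
    proof (rule Max_eqI[OF finG(1)])
      show "node N k \<in> {r \<in> ?G. r \<le> u}" using nodeG[of k] k by simp
      fix r assume r: "r \<in> {r \<in> ?G. r \<le> u}"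
      consider "r \<le> s" | j where "j \<le> Suc N" "r = node N j" | "t \<le> r" using cs[of r] r by blast
      then show "r \<le> node N k"
      proof cases
        case 1
        then show ?thesis using node_bounds(1)[of k N] k by simp
      next
        case 2
        then have "node N j < node N (Suc k)" using r strict by simp
        then have "\<not> Suc k \<le> j" using node_mono[of "Suc k" j N] by linarith
        then show ?thesis using 2 node_mono[of j k N] by simp
      next
        case 3
        then show ?thesis using r st1 by simp
      qed
    qed
    have b: "?b = node N (Suc k)"
    proof (rule Min_eqI[OF finG(2)])
      show "node N (Suc k) \<in> {r \<in> ?G. u \<le> r}" using nodeG[of "Suc k"] k by simp
      fix r assume r: "r \<in> {r \<in> ?G. u \<le> r}"
      consider "r \<le> s" | j where "j \<le> Suc N" "r = node N j" | "t \<le> r" using cs[of r] r by blast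
      then show "node N (Suc k) \<le> r"
      proof cases
        case 1
        then show ?thesis using r st1 by simp
      next
        case 2
        then have "node N k < node N j" using r strict by simp
        then have "\<not> j \<le> k" using node_mono[of j k N] by linarith
        then show ?thesis using 2 node_mono[of "Suc k" j N] by simp
      next
        case 3
        then show ?thesis using node_bounds(2)[of "Suc k" N] k by simp
      qed
    qed
    show ?thesis unfolding pli a b pl_closed_cell[OF k(1,2,3)] by (simp add: node_Suc)
  qed
qed

end

text \<open>\<open>L^2\<close> convergence along one admissible sequence of partitions forces
  convergence of the means, because the square of a mean is at most the mean square.\<close>

lemma expectation_of_signature:
  assumes M: "prob_space M" and S: "is_signature M T n \<gamma> s t S"
    and D: "filterlim D (vanishing_mesh T) sequentially"
    and I: "\<And>N. integrable M (\<lambda>\<omega>. iter_int (pl_interp (D N) \<omega>) \<gamma> s n t)"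
    and L: "(\<lambda>N. LINT \<omega>|M. iter_int (pl_interp (D N) \<omega>) \<gamma> s n t) \<longlonglongrightarrow> L"
  shows "(LINT \<omega>|M. S \<omega>) = L"
proof -
  interpret prob_space M by fact
  define J where "J N \<omega> = iter_int (pl_interp (D N) \<omega>) \<gamma> s n t" for N \<omega>
  have Sm [measurable]: "S \<in> borel_measurable M" and S2: "integrable M (\<lambda>\<omega>. (S \<omega>)\<^sup>2)"
    and conv: "((\<lambda>D. \<integral>\<^sup>+\<omega>. ennreal ((iter_int (pl_interp D \<omega>) \<gamma> s n t - S \<omega>)\<^sup>2) \<partial>M) \<longlongrightarrow> 0) (vanishing_mesh T)"
    using S unfolding is_signature_def by auto
  have Ji: "integrable M (J N)" for N using I[of N] unfolding J_def .
  have Jm [measurable]: "J N \<in> borel_measurable M" for N using Ji by auto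
  have Si: "integrable M S"
  proof (rule Bochner_Integration.integrable_bound)
    show "integrable M (\<lambda>\<omega>. 1 + (S \<omega>)\<^sup>2)" using S2 by simp
    show "AE \<omega> in M. norm (S \<omega>) \<le> norm (1 + (S \<omega>)\<^sup>2)"
    proof (rule AE_I2)
      fix \<omega>
      have "2 * \<bar>S \<omega>\<bar> \<le> 1 + (S \<omega>)\<^sup>2" using sum_squares_bound[of 1 "\<bar>S \<omega>\<bar>"] by simp
      then show "norm (S \<omega>) \<le> norm (1 + (S \<omega>)\<^sup>2)" by (simp add: abs_if split: if_splits)
    qed
  qed simp
  have c: "(\<lambda>N. \<integral>\<^sup>+\<omega>. ennreal ((J N \<omega> - S \<omega>)\<^sup>2) \<partial>M) \<longlonglongrightarrow> 0"
    unfolding J_def by (rule filterlim_compose[OF conv D])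
  have diff: "(\<lambda>N. (LINT \<omega>|M. J N \<omega>) - (LINT \<omega>|M. S \<omega>)) \<longlonglongrightarrow> 0"
  proof (rule tendstoI)
    fix e :: real assume e: "e > 0"
    have "\<forall>\<^sub>F N in sequentially. (\<integral>\<^sup>+\<omega>. ennreal ((J N \<omega> - S \<omega>)\<^sup>2) \<partial>M) < ennreal (e\<^sup>2)"
      using order_tendstoD(2)[OF c, of "ennreal (e\<^sup>2)"] e by simp
    then show "\<forall>\<^sub>F N in sequentially. dist ((LINT \<omega>|M. J N \<omega>) - (LINT \<omega>|M. S \<omega>)) 0 < e"
    proof eventually_elim
      case (elim N)
      define Z where "Z \<omega> = J N \<omega> - S \<omega>" for \<omega>
      have Zm [measurable]: "Z \<in> borel_measurable M" unfolding Z_def by measurable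
      have Zi: "integrable M Z" unfolding Z_def using Ji Si by simp
      have fin: "(\<integral>\<^sup>+\<omega>. ennreal ((Z \<omega>)\<^sup>2) \<partial>M) < ennreal (e\<^sup>2)" using elim by (simp add: Z_def)
      have Z2: "integrable M (\<lambda>\<omega>. (Z \<omega>)\<^sup>2)"
      proof (rule integrableI_bounded)
        show "(\<integral>\<^sup>+\<omega>. ennreal (norm ((Z \<omega>)\<^sup>2)) \<partial>M) < \<infinity>" using less_trans[OF fin, of \<infinity>] by simp
      qed simp
      have "(LINT \<omega>|M. (Z \<omega>)\<^sup>2) < e\<^sup>2"
        using fin nn_integral_eq_integral[OF Z2] by (simp add: ennreal_less_iff)
      \<comment> \<open>Nonnegativity of the variance of \<open>Z\<close>.\<close>
      moreover have "(LINT \<omega>|M. Z \<omega>)\<^sup>2 \<le> (LINT \<omega>|M. (Z \<omega>)\<^sup>2)"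
        using variance_eq[OF Zi Z2] variance_positive[of Z] by simp
      ultimately have "(LINT \<omega>|M. Z \<omega>)\<^sup>2 < e\<^sup>2" by linarith
      then have "\<bar>LINT \<omega>|M. Z \<omega>\<bar> < e" using e power2_less_imp_less[of "\<bar>LINT \<omega>|M. Z \<omega>\<bar>" e] by simp
      moreover have "(LINT \<omega>|M. Z \<omega>) = (LINT \<omega>|M. J N \<omega>) - (LINT \<omega>|M. S \<omega>)"
        unfolding Z_def using Ji Si by (rule Bochner_Integration.integral_diff)
      ultimately show ?case by simp
    qed
  qed
  have "(\<lambda>N. (LINT \<omega>|M. J N \<omega>) - ((LINT \<omega>|M. J N \<omega>) - (LINT \<omega>|M. S \<omega>))) \<longlonglongrightarrow> L - 0"
    using L diff unfolding J_def by (rule tendsto_diff)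
  then have "(\<lambda>N. (LINT \<omega>|M. S \<omega>)) \<longlonglongrightarrow> L" by simp
  then show ?thesis using LIMSEQ_unique tendsto_const by blast
qed

section \<open>Pairings and Gaussian moments\<close>

lemma pairings_eq: "pairings n = pair_partitions {1..n}"
  by (simp add: pairings_def pair_partitions_def)

definition nc_pairs :: "nat set set \<Rightarrow> (nat \<times> nat) set" where
  "nc_pairs P = {(i, j). {i, j} \<in> P \<and> i < j \<and> j - i > 1}"

text \<open>A consecutive pair is recorded by its larger element, the variable that stays in the
  limit formula; \<open>h\<close> in the definition of the integrand corresponds to
  \<open>k - 1\<close>.\<close>

definition c_tops :: "nat set set \<Rightarrow> nat set" where
  "c_tops P = Suc ` {h. {h, Suc h} \<in> P}"

lemma pairing_block_eq:
  assumes P: "P \<in> pairings n" and "B \<in> P" "B' \<in> P" "x \<in> B" "x \<in> B'"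
  shows "B = B'"
proof (rule ccontr)
  assume ne: "B \<noteq> B'"
  have "disjoint P" using P by (simp add: pairings_def partition_on_def)
  from disjointD[OF this assms(2,3) ne] assms(4,5) show False by blast
qed

lemma pairing_unique:
  assumes "P \<in> pairings n" "{a, b} \<in> P" "{a, c} \<in> P" "a \<noteq> b"
  shows "b = c"
proof -
  have "{a, b} = {a, c}" by (rule pairing_block_eq[OF assms(1-3), of a]) simp_all
  then show ?thesis using assms(4) by (auto simp: doubleton_eq_iff)
qed

lemma pairing_range: "P \<in> pairings n \<Longrightarrow> B \<in> P \<Longrightarrow> B \<subseteq> {1..n}"
  unfolding pairings_def partition_on_def by blast

lemma pairing_partner:
  assumes P: "P \<in> pairings n" and i: "i \<in> {1..n}"
  obtains j where "{i, j} \<in> P" "i \<noteq> j"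
proof -
  obtain B where B: "B \<in> P" "i \<in> B" using P i unfolding pairings_def partition_on_def by blast
  then have "card B = 2" using P unfolding pairings_def by blast
  then obtain x y where xy: "B = {x, y}" "x \<noteq> y" by (meson card_2_iff)
  then consider "i = x" | "i = y" using B by blast
  then show thesis
  proof cases
    case 1
    then show ?thesis using that[of y] xy B by simp
  next
    case 2
    then show ?thesis using that[of x] xy B by (simp add: insert_commute)
  qed
qed

lemma nc_pairsD: "(i, j) \<in> nc_pairs P \<Longrightarrow> {i, j} \<in> P \<and> Suc i < j"
  unfolding nc_pairs_def by auto

lemma c_tops_iff: "k \<in> c_tops P \<longleftrightarrow> (\<exists>h. k = Suc h \<and> {h, Suc h} \<in> P)"
  unfolding c_tops_def by blast

lemma pair_struct_of_pairing:
  assumes P: "P \<in> pairings n"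
  shows "pair_struct n (nc_pairs P) (c_tops P)"
proof
  fix i j assume ij: "(i, j) \<in> nc_pairs P"
  note d = nc_pairsD[OF ij]
  then have "{i, j} \<subseteq> {1..n}" using pairing_range[OF P] by blast
  then show "1 \<le> i \<and> Suc i < j \<and> j \<le> n" using d by simp
next
  fix i j i' j' assume ij: "(i, j) \<in> nc_pairs P" and ij': "(i', j') \<in> nc_pairs P"
    and eq: "i = i' \<or> i = j' \<or> j = i' \<or> j = j'"
  note d = nc_pairsD[OF ij] nc_pairsD[OF ij']
  have ends: "{i, j} \<in> P" "{i', j'} \<in> P" using d by simp_all
  obtain x where "x \<in> {i, j}" "x \<in> {i', j'}"
    using eq that[of i] that[of j] by auto
  then have "{i, j} = {i', j'}" by (rule pairing_block_eq[OF P ends])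
  then show "i = i' \<and> j = j'" using d by (auto simp: doubleton_eq_iff)
next
  fix k assume "k \<in> c_tops P"
  then obtain h where h: "k = Suc h" "{h, Suc h} \<in> P" unfolding c_tops_iff by blast
  then have "{h, Suc h} \<subseteq> {1..n}" using pairing_range[OF P] by blast
  then show "2 \<le> k \<and> k \<le> n" using h by simp
next
  fix k assume "k \<in> c_tops P"
  then obtain h where h: "k = Suc h" "{h, Suc h} \<in> P" unfolding c_tops_iff by blast
  have no: "x \<noteq> i \<and> x \<noteq> j" if ij: "(i, j) \<in> nc_pairs P" and x: "x \<in> {h, Suc h}" for x i j
  proof -
    note d = nc_pairsD[OF ij]
    show ?thesis
    proof (rule ccontr)
      assume "\<not> ?thesis"
      then have "x \<in> {i, j}" by auto
      then have "{i, j} = {h, Suc h}" using pairing_block_eq[OF P _ h(2) _ x] d by simp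
      then show False using d by (auto simp: doubleton_eq_iff)
    qed
  qed
  have "x \<notin> fst ` nc_pairs P \<union> snd ` nc_pairs P" if "x \<in> {h, Suc h}" for x
  proof
    assume "x \<in> fst ` nc_pairs P \<union> snd ` nc_pairs P"
    then obtain i j where "(i, j) \<in> nc_pairs P" "x = i \<or> x = j" by auto
    with no[OF this(1) that] show False by simp
  qed
  then show "k \<notin> fst ` nc_pairs P \<union> snd ` nc_pairs P \<and> k - 1 \<notin> fst ` nc_pairs P \<union> snd ` nc_pairs P"
    using h(1) by simp
next
  fix k assume "k \<in> c_tops P"
  then obtain h where h: "k = Suc h" "{h, Suc h} \<in> P" unfolding c_tops_iff by blast
  show "k - 1 \<notin> c_tops P"
  proof
    assume "k - 1 \<in> c_tops P"
    then obtain h' where h': "h = Suc h'" "{h', Suc h'} \<in> P" unfolding c_tops_iff h(1) by auto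
    have "{h, h'} \<in> P" using h' by (simp add: insert_commute)
    from pairing_unique[OF P h(2) this] h' show False by simp
  qed
next
  fix i assume i: "i \<in> {1..n}"
  obtain j where j: "{i, j} \<in> P" "i \<noteq> j" using pairing_partner[OF P i] .
  have j': "{j, i} \<in> P" using j(1) by (simp add: insert_commute)
  consider "j = Suc i" | "i = Suc j" | "Suc i < j" | "Suc j < i" using j(2) by linarith
  then show "i \<in> fst ` nc_pairs P \<union> snd ` nc_pairs P \<or> i \<in> c_tops P \<or> Suc i \<in> c_tops P"
  proof cases
    case 1
    then show ?thesis using j(1) unfolding c_tops_iff by blast
  next
    case 2
    then show ?thesis using j' unfolding c_tops_iff by blast
  next
    case 3
    then have "(i, j) \<in> nc_pairs P" using j(1) by (simp add: nc_pairs_def)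
    then show ?thesis by (metis UnI1 fst_conv image_eqI)
  next
    case 4
    then have "(j, i) \<in> nc_pairs P" using j' by (simp add: nc_pairs_def)
    then show ?thesis by (metis UnI2 snd_conv image_eqI)
  qed
qed

lemma prod_pairing:
  fixes c :: "nat set \<Rightarrow> 'a::comm_monoid_mult"
  assumes P: "P \<in> pairings n"
  shows "(\<Prod>B\<in>P. c B) = (\<Prod>(i, j)\<in>nc_pairs P. c {i, j}) * (\<Prod>k\<in>c_tops P. c {k - 1, k})"
proof -
  interpret pair_struct n "nc_pairs P" "c_tops P" by (rule pair_struct_of_pairing[OF P])
  let ?f = "\<lambda>(i, j). {i, j} :: nat set" and ?g = "\<lambda>k. {k - 1, k} :: nat set"
  have finK: "finite (c_tops P)"
  proof (rule finite_subset)
    show "c_tops P \<subseteq> {1..n}"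
    proof
      fix k assume "k \<in> c_tops P"
      from Kc_range[OF this] show "k \<in> {1..n}" by simp
    qed
  qed simp
  have gP: "?g k \<in> P" if k: "k \<in> c_tops P" for k
  proof -
    obtain h where "k = Suc h" "{h, Suc h} \<in> P" using k unfolding c_tops_iff by (elim exE conjE)
    then show ?thesis by simp
  qed
  have fP: "?f p \<in> P" if p: "p \<in> nc_pairs P" for p
  proof (cases p)
    case (Pair i j)
    show ?thesis using nc_pairsD[of i j P] p unfolding Pair by simp
  qed
  have union: "P = ?f ` nc_pairs P \<union> ?g ` c_tops P"
  proof (intro equalityI subsetI)
    fix B assume B: "B \<in> P"
    then have "card B = 2" using P unfolding pairings_def by blast
    then obtain x y where xy: "B = {x, y}" "x \<noteq> y" by (meson card_2_iff)
    have main: "B \<in> ?f ` nc_pairs P \<union> ?g ` c_tops P" if ab: "B = {a, b}" "a < b" for a b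
    proof (cases "b = Suc a")
      case True
      then have "b \<in> c_tops P" using B ab unfolding c_tops_iff by blast
      moreover have "B = ?g b" using ab True by simp
      ultimately show ?thesis by blast
    next
      case False
      then have "(a, b) \<in> nc_pairs P" using B ab by (simp add: nc_pairs_def)
      then show ?thesis using ab(1) by (intro UnI1 image_eqI[of _ _ "(a, b)"]) simp_all
    qed
    show "B \<in> ?f ` nc_pairs P \<union> ?g ` c_tops P"
    proof (cases "x < y")
      case True
      then show ?thesis using main xy by blast
    next
      case False
      then show ?thesis using main[of y x] xy by (simp add: insert_commute)
    qed
  next
    fix B assume "B \<in> ?f ` nc_pairs P \<union> ?g ` c_tops P"
    then show "B \<in> P" using gP fP by blast
  qed
  have disj: "?f ` nc_pairs P \<inter> ?g ` c_tops P = {}"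
  proof (rule ccontr)
    assume "\<not> ?thesis"
    then obtain B where B: "B \<in> ?f ` nc_pairs P" "B \<in> ?g ` c_tops P" by (meson disjoint_iff)
    from B(1) obtain p where p1: "p \<in> nc_pairs P" "B = ?f p" by (rule imageE)
    from B(2) obtain k where k1: "k \<in> c_tops P" "B = ?g k" by (rule imageE)
    have pk: "p \<in> nc_pairs P" "k \<in> c_tops P" "?f p = ?g k" using p1 k1 by simp_all
    obtain i j where p: "p = (i, j)" by (cases p)
    have "Suc i < j" using nc_pairsD[of i j P] pk(1) p by blast
    moreover have "{i, j} = {k - 1, k}" using pk(3) p by simp
    ultimately show False by (auto simp: doubleton_eq_iff)
  qed
  have injf: "inj_on ?f (nc_pairs P)"
  proof (rule inj_onI)
    fix p q assume pq: "p \<in> nc_pairs P" "q \<in> nc_pairs P" "?f p = ?f q"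
    obtain i j where p: "p = (i, j)" by (cases p)
    obtain i' j' where q: "q = (i', j')" by (cases q)
    have "i < j" "i' < j'" using nc_pairsD[of i j P] nc_pairsD[of i' j' P] pq p q by auto
    moreover have "{i, j} = {i', j'}" using pq(3) p q by simp
    ultimately show "p = q" unfolding p q by (auto simp: doubleton_eq_iff)
  qed
  have injg: "inj_on ?g (c_tops P)"
  proof (rule inj_onI)
    fix k l assume kl: "k \<in> c_tops P" "l \<in> c_tops P" "?g k = ?g l"
    have "2 \<le> k" "2 \<le> l" using Kc_range kl by blast+
    then show "k = l" using kl(3) by (auto simp: doubleton_eq_iff)
  qed
  have "(\<Prod>B\<in>P. c B) = (\<Prod>B\<in>?f ` nc_pairs P. c B) * (\<Prod>B\<in>?g ` c_tops P. c B)"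
    by (subst union, rule prod.union_disjoint) (use finite_E finK disj in auto)
  also have "(\<Prod>B\<in>?f ` nc_pairs P. c B) = (\<Prod>(i, j)\<in>nc_pairs P. c {i, j})"
    by (subst prod.reindex[OF injf]) (simp add: case_prod_beta comp_def)
  also have "(\<Prod>B\<in>?g ` c_tops P. c B) = (\<Prod>k\<in>c_tops P. c {k - 1, k})"
    by (subst prod.reindex[OF injg]) simp
  finally show ?thesis .
qed

section \<open>Covariances of the coordinates and the bounds on \<open>R\<close>\<close>

context gaussian_setting
begin

text \<open>The times \<open>p i\<close> may coincide, whereas the assumption on the process has one
  vector for each time; terms with equal time are therefore collected, components becoming inner
  products with basis vectors.\<close>

lemma linear_gaussian:
  assumes "finite A" "\<And>i. i \<in> A \<Longrightarrow> p i \<in> {0..T}"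
  shows "centred_gaussian M (\<lambda>\<omega>. \<Sum>i\<in>A. c i * \<omega> (p i) $ \<gamma> i)"
proof -
  define a where "a r = (\<Sum>i\<in>{i \<in> A. p i = r}. c i *\<^sub>R axis (\<gamma> i) (1::real))" for r
  have "(\<Sum>r\<in>p ` A. a r \<bullet> \<omega> r) = (\<Sum>i\<in>A. c i * \<omega> (p i) $ \<gamma> i)" for \<omega> :: "real \<Rightarrow> real ^ 'd"
  proof -
    have "(\<Sum>i\<in>A. c i * \<omega> (p i) $ \<gamma> i) = (\<Sum>r\<in>p ` A. \<Sum>i\<in>{i \<in> A. p i = r}. c i * \<omega> (p i) $ \<gamma> i)"
      by (rule sum.image_gen[OF assms(1)])
    also have "\<dots> = (\<Sum>r\<in>p ` A. a r \<bullet> \<omega> r)"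
    proof (rule sum.cong[OF refl])
      fix r
      have "a r \<bullet> \<omega> r = (\<Sum>i\<in>{i \<in> A. p i = r}. c i * \<omega> r $ \<gamma> i)"
        unfolding a_def inner_sum_left by (simp add: inner_axis')
      also have "\<dots> = (\<Sum>i\<in>{i \<in> A. p i = r}. c i * \<omega> (p i) $ \<gamma> i)" by (rule sum.cong) auto
      finally show "(\<Sum>i\<in>{i \<in> A. p i = r}. c i * \<omega> (p i) $ \<gamma> i) = a r \<bullet> \<omega> r" ..
    qed
    finally show ?thesis ..
  qed
  moreover have "centred_gaussian M (\<lambda>\<omega>. \<Sum>r\<in>p ` A. a r \<bullet> \<omega> r)"
    using gaussian assms unfolding centred_gaussian_process_def by blast
  ultimately show ?thesis by simp
qed

lemma coordinate_gaussian: "x \<in> {0..T} \<Longrightarrow> centred_gaussian M (\<lambda>\<omega>. \<omega> x $ \<alpha>)"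
  using linear_gaussian[of "{()}" "\<lambda>_. x" "\<lambda>_. 1" "\<lambda>_. \<alpha>"] by simp

lemma coordinate_moments:
  assumes "x \<in> {0..T}"
  shows "(\<lambda>\<omega>. \<omega> x $ \<alpha>) \<in> borel_measurable M" "integrable M (\<lambda>\<omega>. \<omega> x $ \<alpha>)" "(LINT \<omega>|M. \<omega> x $ \<alpha>) = 0"
  using centred_gaussian_power[OF prob_space_axioms coordinate_gaussian[OF assms], of \<alpha> 1]
    coordinate_gaussian[OF assms, of \<alpha>] by (simp_all add: centred_gaussian_def)

text \<open>Wick's formula over the index type \<open>bool\<close>, which keeps the two factors
  apart even when they are the same variable.\<close>

lemma coordinate_product_integrable:
  assumes "x \<in> {0..T}" "y \<in> {0..T}"
  shows "integrable M (\<lambda>\<omega>. \<omega> x $ \<alpha> * \<omega> y $ \<beta>)"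
proof -
  have "integrable M (\<lambda>\<omega>. \<Prod>b\<in>UNIV. \<omega> (if b then x else y) $ (if b then \<alpha> else \<beta>))"
    by (rule wick(1)[OF prob_space_axioms]) (use assms in \<open>auto intro!: linear_gaussian\<close>)
  then show ?thesis by (simp add: UNIV_bool mult.commute)
qed

lemma coordinate_covariance:
  assumes "x \<in> {0..T}" "y \<in> {0..T}"
  shows "(LINT \<omega>|M. \<omega> x $ \<alpha> * \<omega> y $ \<beta>) = of_bool (\<alpha> = \<beta>) * R x y"
proof (cases "\<alpha> = \<beta>")
  case True
  then show ?thesis using covariance[OF assms] by simp
next
  case False
  \<comment> \<open>A time for each component, so that the two independent coordinates can be
    written as one indexed family.\<close>
  let ?p = "\<lambda>\<delta>. if \<delta> = \<alpha> then x else y"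
  have p: "?p \<delta> \<in> {0..T}" for \<delta> using assms by simp
  have "indep_vars (\<lambda>_. PiM {0..T} (\<lambda>_. borel)) (\<lambda>\<delta> \<omega>. \<lambda>r\<in>{0..T}. \<omega> r $ \<delta>) {\<alpha>, \<beta>}"
    by (rule indep_vars_subset[OF components_indep]) simp
  then have "indep_vars (\<lambda>_. borel) (\<lambda>\<delta> \<omega>. (\<lambda>f. f (?p \<delta>)) (\<lambda>r\<in>{0..T}. \<omega> r $ \<delta>)) {\<alpha>, \<beta>}"
    by (rule indep_vars_compose2) (use p in \<open>simp add: measurable_component_singleton\<close>)
  then have ind: "indep_vars (\<lambda>_. borel) (\<lambda>\<delta> \<omega>. \<omega> (?p \<delta>) $ \<delta>) {\<alpha>, \<beta>}"
    using p by (simp only: restrict_apply if_True)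
  have "(LINT \<omega>|M. (\<Prod>\<delta>\<in>{\<alpha>, \<beta>}. \<omega> (?p \<delta>) $ \<delta>)) = (\<Prod>\<delta>\<in>{\<alpha>, \<beta>}. LINT \<omega>|M. \<omega> (?p \<delta>) $ \<delta>)"
    by (rule indep_vars_lebesgue_integral[OF _ ind]) (use p coordinate_moments(2) in auto)
  also have "\<dots> = 0" using coordinate_moments(3)[OF assms(1)] by simp
  finally show ?thesis using False by simp
qed

lemma increment_covariance:
  assumes "a \<in> {0..T}" "b \<in> {0..T}" "c \<in> {0..T}" "d \<in> {0..T}"
  shows "(LINT \<omega>|M. (\<omega> b $ \<alpha> - \<omega> a $ \<alpha>) * (\<omega> d $ \<beta> - \<omega> c $ \<beta>)) =
      of_bool (\<alpha> = \<beta>) * (R b d - R b c - R a d + R a c)"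
    and "integrable M (\<lambda>\<omega>. (\<omega> b $ \<alpha> - \<omega> a $ \<alpha>) * (\<omega> d $ \<beta> - \<omega> c $ \<beta>))"
proof -
  have eq: "(\<omega> b $ \<alpha> - \<omega> a $ \<alpha>) * (\<omega> d $ \<beta> - \<omega> c $ \<beta>) =
     (\<omega> b $ \<alpha> * \<omega> d $ \<beta> - \<omega> b $ \<alpha> * \<omega> c $ \<beta>) - (\<omega> a $ \<alpha> * \<omega> d $ \<beta> - \<omega> a $ \<alpha> * \<omega> c $ \<beta>)" for \<omega> :: "real \<Rightarrow> real ^ 'd"
    by (simp add: algebra_simps)
  note i = coordinate_product_integrable
  show "integrable M (\<lambda>\<omega>. (\<omega> b $ \<alpha> - \<omega> a $ \<alpha>) * (\<omega> d $ \<beta> - \<omega> c $ \<beta>))"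
    unfolding eq using assms by (intro Bochner_Integration.integrable_diff i)
  have "(LINT \<omega>|M. (\<omega> b $ \<alpha> - \<omega> a $ \<alpha>) * (\<omega> d $ \<beta> - \<omega> c $ \<beta>)) =
    ((LINT \<omega>|M. \<omega> b $ \<alpha> * \<omega> d $ \<beta>) - (LINT \<omega>|M. \<omega> b $ \<alpha> * \<omega> c $ \<beta>)) -
    ((LINT \<omega>|M. \<omega> a $ \<alpha> * \<omega> d $ \<beta>) - (LINT \<omega>|M. \<omega> a $ \<alpha> * \<omega> c $ \<beta>))"
    unfolding eq using assms
    by (simp add: Bochner_Integration.integral_diff Bochner_Integration.integrable_diff i)
  then show "(LINT \<omega>|M. (\<omega> b $ \<alpha> - \<omega> a $ \<alpha>) * (\<omega> d $ \<beta> - \<omega> c $ \<beta>)) =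
      of_bool (\<alpha> = \<beta>) * (R b d - R b c - R a d + R a c)"
    using assms by (simp add: coordinate_covariance algebra_simps)
qed

lemma cov_bounds_exists:
  assumes H: "1 / 4 < H" and st: "0 \<le> s" "s < t" "t \<le> T"
  shows "\<exists>H' C. cov_bounds s t R T H' C"
proof -
  \<comment> \<open>For \<open>H\<close> at least 1/2 any value strictly between 1/4 and 1/2 serves;
    3/8 is the middle.\<close>
  define H' where "H' = (if H < 1 / 2 then H else 3 / 8)"
  have H': "1 / 4 < H'" "H' < 1 / 2" "H' \<le> H" using H by (auto simp: H'_def)
  obtain C where C: "\<And>x y. 0 < x \<Longrightarrow> x < y \<Longrightarrow> y < T \<Longrightarrow> \<bar>pd12 R x y\<bar> \<le> C * (y - x) powr (2 * H - 2)"
    "\<And>x y. x \<in> {0..T} \<Longrightarrow> y \<in> {0<..<T} \<Longrightarrow> x \<noteq> y \<Longrightarrow>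
       \<bar>1 / 2 * deriv (\<lambda>v. R v v) y - pd2 R x y\<bar> \<le> C * \<bar>y - x\<bar> powr (2 * H - 1)"
    "\<And>x y \<alpha>. 0 \<le> x \<Longrightarrow> x \<le> y \<Longrightarrow> y \<le> T \<Longrightarrow>
       (LINT \<omega>|M. (\<omega> y $ \<alpha> - \<omega> x $ \<alpha>) * (\<omega> y $ \<alpha> - \<omega> x $ \<alpha>)) \<le> C * (y - x) powr (2 * H)"
  proof -
    from bounds show thesis
    proof (elim exE conjE)
      fix C
      assume b1: "\<forall>x y. 0 < x \<and> x < y \<and> y < T \<longrightarrow> \<bar>pd12 R x y\<bar> \<le> C * (y - x) powr (2 * H - 2)"
        and b2: "\<forall>x\<in>{0..T}. \<forall>y\<in>{0<..<T}. x \<noteq> y \<longrightarrow>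
          \<bar>1 / 2 * deriv (\<lambda>v. R v v) y - pd2 R x y\<bar> \<le> C * \<bar>y - x\<bar> powr (2 * H - 1)"
        and b3: "\<forall>x y \<alpha>. 0 \<le> x \<and> x \<le> y \<and> y \<le> T \<longrightarrow>
          (LINT \<omega>|M. (\<omega> y $ \<alpha> - \<omega> x $ \<alpha>) * (\<omega> y $ \<alpha> - \<omega> x $ \<alpha>)) \<le> C * (y - x) powr (2 * H)"
      show thesis
      proof (rule that)
        show "\<bar>pd12 R x y\<bar> \<le> C * (y - x) powr (2 * H - 2)" if "0 < x" "x < y" "y < T" for x y
          by (rule b1[rule_format]) (intro conjI that)
        show "\<bar>1 / 2 * deriv (\<lambda>v. R v v) y - pd2 R x y\<bar> \<le> C * \<bar>y - x\<bar> powr (2 * H - 1)"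
          if "x \<in> {0..T}" "y \<in> {0<..<T}" "x \<noteq> y" for x y
          by (rule b2[rule_format, OF that])
        show "(LINT \<omega>|M. (\<omega> y $ \<alpha> - \<omega> x $ \<alpha>) * (\<omega> y $ \<alpha> - \<omega> x $ \<alpha>)) \<le> C * (y - x) powr (2 * H)"
          if "0 \<le> x" "x \<le> y" "y \<le> T" for x y \<alpha>
          by (rule b3[rule_format]) (intro conjI that)
      qed
    qed
  qed
  \<comment> \<open>Lowering the exponent costs a power of \<open>T\<close>, as all lengths are at
    most \<open>T\<close>. The absolute value is taken because nothing says that \<open>C\<close> is
    nonnegative.\<close>
  define C' where "C' = \<bar>C\<bar> * T powr (2 * H - 2 * H')"
  have C'0: "0 \<le> C'" by (simp add: C'_def)
  have scale: "C * x powr e \<le> C' * x powr (e - (2 * H - 2 * H'))" if x: "0 \<le> x" "x \<le> T" for x e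
  proof -
    have "x powr e = x powr (2 * H - 2 * H') * x powr (e - (2 * H - 2 * H'))"
      by (simp add: powr_add[symmetric])
    also have "\<dots> \<le> T powr (2 * H - 2 * H') * x powr (e - (2 * H - 2 * H'))"
      using x H' by (intro mult_right_mono powr_mono2) auto
    finally have "\<bar>C\<bar> * x powr e \<le> \<bar>C\<bar> * (T powr (2 * H - 2 * H') * x powr (e - (2 * H - 2 * H')))"
      by (intro mult_left_mono) auto
    moreover have "C * x powr e \<le> \<bar>C\<bar> * x powr e" by (intro mult_right_mono) auto
    ultimately show ?thesis by (simp add: C'_def)
  qed
  \<comment> \<open>Any component will do, \<open>R\<close> being common to all;
    \<open>undefined\<close> names one.\<close>
  have sym: "R x y = R y x" if "x \<in> {0..T}" "y \<in> {0..T}" for x y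
    using covariance[OF that, of undefined] covariance[OF that(2,1), of undefined] by (simp add: mult.commute)
  have "cov_bounds s t R T H' C'"
  proof
    show "s < t" "1 / 4 < H'" "H' < 1 / 2" "0 \<le> C'" "0 \<le> s" "t \<le> T" by (fact st H' C'0)+
    show "continuous_on ({0..T} \<times> {0..T}) (\<lambda>(x, y). R x y)" by (rule R_continuous)
    show "\<And>x y. x \<in> {0..T} \<Longrightarrow> y \<in> {0..T} \<Longrightarrow> R x y = R y x" by (rule sym)
    show "R 0 y = 0" if y: "y \<in> {0..T}" for y
    proof -
      have 0: "0 \<in> {0..T}" using T_pos by simp
      have "AE \<omega> in M. \<omega> 0 $ undefined * \<omega> y $ undefined = 0" using start by eventually_elim simp
      then have "(LINT \<omega>|M. \<omega> 0 $ undefined * \<omega> y $ undefined) = (LINT \<omega>|M. 0)"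
        using coordinate_moments(1)[OF 0] coordinate_moments(1)[OF y]
        by (intro integral_cong_AE borel_measurable_times) auto
      then show ?thesis using covariance[OF 0 y, of undefined] by simp
    qed
    show "\<bar>R b d - R b c - R a d + R a c\<bar> \<le> C' * (b - a) powr (2 * H')"
      if *: "0 \<le> a" "a \<le> b" "b \<le> T" "0 \<le> c" "c \<le> d" "d \<le> T" "b - a = d - c" for a b c d
    proof -
      let ?\<alpha> = "undefined :: 'd"
      have m: "a \<in> {0..T}" "b \<in> {0..T}" "c \<in> {0..T}" "d \<in> {0..T}" using * by auto
      let ?U = "\<lambda>\<omega> :: real \<Rightarrow> real ^ 'd. \<omega> b $ ?\<alpha> - \<omega> a $ ?\<alpha>" and ?V = "\<lambda>\<omega> :: real \<Rightarrow> real ^ 'd. \<omega> d $ ?\<alpha> - \<omega> c $ ?\<alpha>"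
      have i: "integrable M (\<lambda>\<omega>. ?U \<omega> * ?V \<omega>)" "integrable M (\<lambda>\<omega>. ?U \<omega> * ?U \<omega>)" "integrable M (\<lambda>\<omega>. ?V \<omega> * ?V \<omega>)"
        by (rule increment_covariance(2)[OF m(1,2,3,4)] increment_covariance(2)[OF m(1,2,1,2)] increment_covariance(2)[OF m(3,4,3,4)])+
      have sumi: "integrable M (\<lambda>\<omega>. (?U \<omega> * ?U \<omega> + ?V \<omega> * ?V \<omega>) / 2)"
        by (intro integrable_divide_zero Bochner_Integration.integrable_add i)
      \<comment> \<open>This replaces the Cauchy-Schwarz inequality: the two increments have equal
        length and hence the same variance bound, so the arithmetic mean loses nothing.\<close>
      have amgm: "\<bar>x * y\<bar> \<le> (x * x + y * y) / 2" for x y :: real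
        using sum_squares_bound[of "\<bar>x\<bar>" "\<bar>y\<bar>"] by (simp add: abs_mult power2_eq_square)
      have "\<bar>LINT \<omega>|M. ?U \<omega> * ?V \<omega>\<bar> \<le> (LINT \<omega>|M. (?U \<omega> * ?U \<omega> + ?V \<omega> * ?V \<omega>) / 2)"
        by (rule order_trans[OF integral_abs_bound integral_mono[OF integrable_abs[OF i(1)] sumi amgm]])
      also have "\<dots> = ((LINT \<omega>|M. ?U \<omega> * ?U \<omega>) + (LINT \<omega>|M. ?V \<omega> * ?V \<omega>)) / 2"
        by (simp only: integral_divide_zero Bochner_Integration.integral_add[OF i(2,3)])
      also have "\<dots> \<le> C * (b - a) powr (2 * H)"
        using C(3)[of a b ?\<alpha>] C(3)[of c d ?\<alpha>] * by simp
      also have "\<dots> \<le> C' * (b - a) powr (2 * H')" using scale[of "b - a" "2 * H"] * by simp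
      finally show ?thesis using increment_covariance(1)[OF m, of ?\<alpha> ?\<alpha>] by simp
    qed
    show "\<And>x y. x \<in> {0..T} \<Longrightarrow> y \<in> {0<..<T} \<Longrightarrow> x \<noteq> y \<Longrightarrow> (\<lambda>v. R x v) differentiable (at y)"
      by (rule pd2_exists)
    let ?U = "{(x, y). 0 < x \<and> x < y \<and> y < T}"
    have c2: "C1_on_plane ?U R" "C1_on_plane ?U (pd2 R)" using R_C2 unfolding C2_on_plane_def by auto
    show "continuous_on ?U (\<lambda>(x, y). pd2 R x y)" using c2(1) unfolding C1_on_plane_def by blast
    show "(\<lambda>x. pd2 R x y) differentiable (at x)" if "0 < x" "x < y" "y < T" for x y
      using c2(2) that unfolding C1_on_plane_def by blast
    show "continuous_on ?U (\<lambda>(x, y). pd12 R x y)" using c2(2) unfolding C1_on_plane_def pd12_def by blast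
    obtain D where D: "\<And>x. x \<in> {0<..<T} \<Longrightarrow> ((\<lambda>v. R v v) has_vector_derivative D x) (at x)"
      "continuous_on {0<..<T} D"
      using variance_C1 unfolding C1_differentiable_on_def by blast
    have Dr: "((\<lambda>v. R v v) has_real_derivative D x) (at x)" if "x \<in> {0<..<T}" for x
      using D(1)[OF that] by (simp add: has_real_derivative_iff_has_vector_derivative)
    show "(\<lambda>v. R v v) differentiable (at y)" if "y \<in> {0<..<T}" for y
      using Dr[OF that] real_differentiable_def by blast
    show "continuous_on {0<..<T} (deriv (\<lambda>v. R v v))"
      using D(2) by (rule continuous_on_eq) (use Dr DERIV_imp_deriv in \<open>metis\<close>)
    show "\<bar>pd12 R x y\<bar> \<le> C' * (y - x) powr (2 * H' - 2)" if "0 < x" "x < y" "y < T" for x y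
      using C(1)[OF that] scale[of "y - x" "2 * H - 2"] that by simp
    show "\<bar>1 / 2 * deriv (\<lambda>v. R v v) y - pd2 R x y\<bar> \<le> C' * (y - x) powr (2 * H' - 1)"
      if "0 \<le> x" "x < y" "y < T" for x y
      using C(2)[of x y] scale[of "y - x" "2 * H - 1"] that by simp
  qed
  then show ?thesis by blast
qed

end

section \<open>Wick's formula for increments\<close>

context gaussian_setting
begin

text \<open>Each increment is split into its two ends by an additional index in \<open>bool\<close>,
  which reduces the claim to \<open>linear_gaussian\<close>.\<close>

lemma increments_gaussian:
  assumes "finite A" "\<And>i. i \<in> A \<Longrightarrow> p i \<in> {0..T}" "\<And>i. i \<in> A \<Longrightarrow> q i \<in> {0..T}"
  shows "centred_gaussian M (\<lambda>\<omega>. \<Sum>i\<in>A. a i * ((\<omega> (q i) $ \<gamma> i - \<omega> (p i) $ \<gamma> i) / c))"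
proof -
  have "centred_gaussian M (\<lambda>\<omega>. \<Sum>z\<in>A \<times> UNIV.
      (if snd z then a (fst z) / c else - a (fst z) / c) *
      \<omega> (if snd z then q (fst z) else p (fst z)) $ \<gamma> (fst z))"
    by (rule linear_gaussian) (use assms in auto)
  moreover have "(\<Sum>z\<in>A \<times> UNIV. (if snd z then a (fst z) / c else - a (fst z) / c) *
      \<omega> (if snd z then q (fst z) else p (fst z)) $ \<gamma> (fst z)) =
      (\<Sum>i\<in>A. a i * ((\<omega> (q i) $ \<gamma> i - \<omega> (p i) $ \<gamma> i) / c))" for \<omega>
    unfolding sum.cartesian_product' by (simp add: UNIV_bool right_diff_distrib diff_divide_distrib)
  ultimately show ?thesis by simp
qed

lemma increments_wick:
  fixes \<gamma> :: "nat \<Rightarrow> 'd" and c :: real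
  assumes "\<And>i. p i \<in> {0..T}" "\<And>i. q i \<in> {0..T}"
  defines "Z \<equiv> \<lambda>i \<omega>. (\<omega> (q i) $ \<gamma> i - \<omega> (p i) $ \<gamma> i) / c"
  shows "integrable M (\<lambda>\<omega>. \<Prod>i\<in>{1..n}. Z i \<omega>)"
    and "(LINT \<omega>|M. (\<Prod>i\<in>{1..n}. Z i \<omega>)) = (\<Sum>P\<in>pairings n. \<Prod>B\<in>P. (LINT \<omega>|M. (\<Prod>i\<in>B. Z i \<omega>)))"
proof -
  have g: "centred_gaussian M (\<lambda>\<omega>. \<Sum>i\<in>{1..n}. a i * Z i \<omega>)" for a
    unfolding Z_def by (rule increments_gaussian) (use assms in auto)
  show "integrable M (\<lambda>\<omega>. \<Prod>i\<in>{1..n}. Z i \<omega>)"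
    by (rule wick(1)[OF prob_space_axioms _ g]) simp
  show "(LINT \<omega>|M. (\<Prod>i\<in>{1..n}. Z i \<omega>)) = (\<Sum>P\<in>pairings n. \<Prod>B\<in>P. (LINT \<omega>|M. (\<Prod>i\<in>B. Z i \<omega>)))"
    unfolding pairings_eq by (rule wick(2)[OF prob_space_axioms _ g]) simp
qed

end

text \<open>The Kronecker deltas of the covariance matrix, collected in front: they do not depend on
  the integration variables, and what remains involves only the scalar \<open>R\<close>.\<close>

definition matching :: "(nat \<Rightarrow> 'd) \<Rightarrow> nat set set \<Rightarrow> real" where
  "matching \<gamma> P = (\<Prod>(i, j)\<in>nc_pairs P. of_bool (\<gamma> i = \<gamma> j)) * (\<Prod>k\<in>c_tops P. of_bool (\<gamma> (k - 1) = \<gamma> k))"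

lemma pd2_cov_matrix: "pd2 (cov_matrix R \<alpha> \<beta>) x y = of_bool (\<alpha> = \<beta>) * pd2 R x y"
  and pd12_cov_matrix: "pd12 (cov_matrix R \<alpha> \<beta>) x y = of_bool (\<alpha> = \<beta>) * pd12 R x y"
  and deriv_cov_matrix: "deriv (\<lambda>v. cov_matrix R \<alpha> \<beta> v v) y = of_bool (\<alpha> = \<beta>) * deriv (\<lambda>v. R v v) y"
  by (cases "\<alpha> = \<beta>"; simp add: pd12_def pd1_def pd2_def cov_matrix_def)+

text \<open>Reindexing by \<open>k = h + 1\<close> turns the lower neighbour \<open>h - 1\<close>
  into \<open>k - 2\<close>.\<close>

lemma pairing_integrand_eq:
  "pairing_integrand R \<gamma> P u = matching \<gamma> P *
     ((\<Prod>(i, j)\<in>nc_pairs P. pd12 R (u i) (u j)) *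
      (\<Prod>k\<in>c_tops P. 1 / 2 * deriv (\<lambda>v. R v v) (u k) - pd2 R (u (k - 2)) (u k)))"
proof -
  have nc: "(\<Prod>(i, j)\<in>{(i, j). {i, j} \<in> P \<and> i < j \<and> j - i > 1}. pd12 (cov_matrix R (\<gamma> i) (\<gamma> j)) (u i) (u j)) =
      (\<Prod>(i, j)\<in>nc_pairs P. of_bool (\<gamma> i = \<gamma> j)) * (\<Prod>(i, j)\<in>nc_pairs P. pd12 R (u i) (u j))"
    unfolding nc_pairs_def[symmetric] pd12_cov_matrix
    by (simp only: case_prod_unfold prod.distrib)
  have "(\<Prod>h\<in>{h. {h, Suc h} \<in> P}.
        1 / 2 * deriv (\<lambda>v. cov_matrix R (\<gamma> h) (\<gamma> (Suc h)) v v) (u (Suc h))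
        - pd2 (cov_matrix R (\<gamma> h) (\<gamma> (Suc h))) (u (h - 1)) (u (Suc h))) =
     (\<Prod>k\<in>c_tops P. of_bool (\<gamma> (k - 1) = \<gamma> k) *
        (1 / 2 * deriv (\<lambda>v. R v v) (u k) - pd2 R (u (k - 2)) (u k)))"
    unfolding c_tops_def prod.reindex[OF inj_on_subset[OF inj_Suc subset_UNIV]] comp_def
    by (rule prod.cong) (simp_all add: pd2_cov_matrix deriv_cov_matrix right_diff_distrib)
  then show ?thesis
    unfolding pairing_integrand_def nc matching_def prod.distrib by (simp only: mult.assoc mult.left_commute)
qed

lemma kept_indices_eq: "kept_indices n P = {1..n} - (\<lambda>k. k - 1) ` c_tops P"
  unfolding kept_indices_def c_tops_def image_image by simp

section \<open>Limit of the contribution of one pairing\<close>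

context cov_bounds
begin

text \<open>For \<open>k = 2\<close> the drift reads position \<open>0\<close>, where
  \<open>u(0 := s)\<close> and \<open>ext_pts\<close> agree; elsewhere the two readings of
  \<open>u\<close> differ only at \<open>n + 1\<close>, which does not occur.\<close>

lemma pairing_integral_eq:
  fixes \<gamma> :: "nat \<Rightarrow> 'd"
  assumes P: "P \<in> pairings n"
  defines "K \<equiv> kept_indices n P"
  shows "pairing_integral R n \<gamma> s t P = matching \<gamma> P *
     (LINT u|PiM K (\<lambda>_. lborel). indicator (osimplex s t n K) u *
       ((\<Prod>(i, j)\<in>nc_pairs P. pd12 R (u i) (u j)) * (\<Prod>k\<in>c_tops P. drift (ext_pts s t n u (k - 2)) (u k))))"
proof -
  interpret pair_struct n "nc_pairs P" "c_tops P" by (rule pair_struct_of_pairing[OF P])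
  have K: "K \<subseteq> {1..n}" by (auto simp: K_def kept_indices_def)
  have eq: "indicator {u \<in> K \<rightarrow>\<^sub>E {s<..<t}. strict_mono_on K u} u *\<^sub>R pairing_integrand R \<gamma> P (u(0 := s)) =
      matching \<gamma> P * (indicator (osimplex s t n K) u *
       ((\<Prod>(i, j)\<in>nc_pairs P. pd12 R (u i) (u j)) * (\<Prod>k\<in>c_tops P. drift (ext_pts s t n u (k - 2)) (u k))))"
    if u: "u \<in> space (PiM K (\<lambda>_. lborel :: real measure))" for u
  proof -
    have "u \<in> extensional K" using u by (auto simp: space_PiM PiE_def)
    from simplex_space_iff[OF K st this]
    have ind: "indicator {u \<in> K \<rightarrow>\<^sub>E {s<..<t}. strict_mono_on K u} u = (indicator (osimplex s t n K) u :: real)"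
      by (simp add: indicator_def)
    have 1: "(\<Prod>(i, j)\<in>nc_pairs P. pd12 R ((u(0 := s)) i) ((u(0 := s)) j)) = (\<Prod>(i, j)\<in>nc_pairs P. pd12 R (u i) (u j))"
    proof (rule prod.cong[OF refl])
      fix p assume p: "p \<in> nc_pairs P"
      obtain i j where ij: "p = (i, j)" by (cases p)
      have "1 \<le> i \<and> Suc i < j \<and> j \<le> n" using E_range[of i j] p unfolding ij by simp
      then show "(case p of (i, j) \<Rightarrow> pd12 R ((u(0 := s)) i) ((u(0 := s)) j)) = (case p of (i, j) \<Rightarrow> pd12 R (u i) (u j))"
        unfolding ij by simp
    qed
    have 2: "(\<Prod>k\<in>c_tops P. 1 / 2 * deriv (\<lambda>v. R v v) ((u(0 := s)) k) - pd2 R ((u(0 := s)) (k - 2)) ((u(0 := s)) k)) =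
       (\<Prod>k\<in>c_tops P. drift (ext_pts s t n u (k - 2)) (u k))"
    proof (rule prod.cong[OF refl])
      fix k assume "k \<in> c_tops P"
      from Kc_range[OF this] have k: "2 \<le> k" "k \<le> n" by simp_all
      have "k \<noteq> 0" "k - 2 \<noteq> Suc n" using k by linarith+
      then show "1 / 2 * deriv (\<lambda>v. R v v) ((u(0 := s)) k) - pd2 R ((u(0 := s)) (k - 2)) ((u(0 := s)) k) =
          drift (ext_pts s t n u (k - 2)) (u k)"
        unfolding drift_def ext_pts_def by (simp only: fun_upd_apply if_False)
    qed
    show ?thesis unfolding ind pairing_integrand_eq 1 2 by (simp only: real_scaleR_def mult.left_commute)
  qed
  show ?thesis
    unfolding pairing_integral_def set_lebesgue_integral_def K_def[symmetric]
    by (rule trans[OF Bochner_Integration.integral_cong[OF refl eq] integral_mult_right_zero])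
qed

lemma pairing_approximation:
  fixes \<gamma> :: "nat \<Rightarrow> 'd"
  assumes P: "P \<in> pairings n"
  defines "F \<equiv> \<lambda>N u. (\<Prod>(i, j)\<in>nc_pairs P. rhoN N (u i) (u j)) * (\<Prod>k\<in>c_tops P. rhoN N (u (k - 1)) (u k))"
  shows "integrable (PiM {1..n} (\<lambda>_. lborel)) (\<lambda>u. indicator (osimplex s t n {1..n}) u * F N u)"
    and "(\<lambda>N. matching \<gamma> P * (LINT u|PiM {1..n} (\<lambda>_. lborel). indicator (osimplex s t n {1..n}) u * F N u))
      \<longlonglongrightarrow> pairing_integral R n \<gamma> s t P"
proof -
  interpret pair_struct n "nc_pairs P" "c_tops P" by (rule pair_struct_of_pairing[OF P])
  interpret pair_bounds s t R T H C n "nc_pairs P" "c_tops P" ..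
  have full: "removed {} = {1..n}" by (simp add: removed_def)
  have mixed: "mixed N {} u = F N u" for u
  proof -
    have 1: "(\<Prod>(i, j)\<in>nc_pairs P. rhoN N (X u i) (X u j)) = (\<Prod>(i, j)\<in>nc_pairs P. rhoN N (u i) (u j))"
    proof (rule prod.cong[OF refl])
      fix p assume p: "p \<in> nc_pairs P"
      obtain i j where ij: "p = (i, j)" by (cases p)
      have "1 \<le> i \<and> Suc i < j \<and> j \<le> n" using E_range[of i j] p unfolding ij by simp
      then show "(case p of (i, j) \<Rightarrow> rhoN N (X u i) (X u j)) = (case p of (i, j) \<Rightarrow> rhoN N (u i) (u j))"
        unfolding ij by (simp add: ext_pts_def)
    qed
    have 2: "(\<Prod>k\<in>c_tops P. rhoN N (X u (k - 1)) (X u k)) = (\<Prod>k\<in>c_tops P. rhoN N (u (k - 1)) (u k))"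
    proof (rule prod.cong[OF refl])
      fix k assume "k \<in> c_tops P"
      from Kc_range[OF this] have k: "2 \<le> k" "k \<le> n" by simp_all
      have "k \<noteq> 0" "k \<noteq> Suc n" "k - 1 \<noteq> 0" "k - 1 \<noteq> Suc n" using k by linarith+
      then show "rhoN N (X u (k - 1)) (X u k) = rhoN N (u (k - 1)) (u k)"
        unfolding ext_pts_def by (simp only: fun_upd_apply if_False)
    qed
    show ?thesis unfolding mixed_def F_def 1[symmetric] 2[symmetric] by simp
  qed
  show "integrable (PiM {1..n} (\<lambda>_. lborel)) (\<lambda>u. indicator (osimplex s t n {1..n}) u * F N u)"
    using integrable_mixed[of "{}" N] unfolding full mixed by simp
  have K: "kept_indices n P = Q \<union> c_tops P"
  proof -
    have "{k \<in> c_tops P. k < Suc n} = c_tops P" using Kc_sub by auto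
    then have "stage (Suc n) = Q \<union> c_tops P" by (simp add: stage_def)
    then show ?thesis using removed_Kc kept_indices_eq by (simp add: removed_def)
  qed
  show "(\<lambda>N. matching \<gamma> P * (LINT u|PiM {1..n} (\<lambda>_. lborel). indicator (osimplex s t n {1..n}) u * F N u))
      \<longlonglongrightarrow> pairing_integral R n \<gamma> s t P"
    unfolding pairing_integral_eq[OF P] K F_def by (intro tendsto_mult tendsto_const pairing_limit)
qed

end

section \<open>The expected iterated integral on the grid\<close>

context gaussian_setting
begin

text \<open>At fixed times the slopes are jointly Gaussian, with covariance \<open>rhoN\<close> for
  equal components and 0 otherwise; each block of a pairing thus contributes a Kronecker delta times
  \<open>rhoN\<close>.\<close>

lemma slope_moments:
  assumes cov: "cov_bounds s t R T H' C"
  shows "integrable M (\<lambda>\<omega>. \<Prod>i\<in>{1..n}. interval.slope s t N (\<lambda>r. \<omega> r $ \<gamma> i) (x i))"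
    and "(LINT \<omega>|M. (\<Prod>i\<in>{1..n}. interval.slope s t N (\<lambda>r. \<omega> r $ \<gamma> i) (x i))) =
      (\<Sum>P\<in>pairings n. matching \<gamma> P *
        ((\<Prod>(i, j)\<in>nc_pairs P. cov_bounds.rhoN s t R N (x i) (x j)) *
         (\<Prod>k\<in>c_tops P. cov_bounds.rhoN s t R N (x (k - 1)) (x k))))"
proof -
  interpret cov_bounds s t R T H' C by fact
  let ?p = "\<lambda>i. node N (cell N (x i))" and ?q = "\<lambda>i. node N (Suc (cell N (x i)))"
  have pq: "?p i \<in> {0..T}" "?q i \<in> {0..T}" for i
    using node_bounds[of "cell N (x i)" N] node_bounds[of "Suc (cell N (x i))" N] cell_le[of N "x i"] s0 tT
    by auto
  note w = increments_wick[of ?p ?q \<gamma> "h N" n, OF pq]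
  show "integrable M (\<lambda>\<omega>. \<Prod>i\<in>{1..n}. slope N (\<lambda>r. \<omega> r $ \<gamma> i) (x i))"
    unfolding slope_def by (rule w(1))
  define c where "c B = (LINT \<omega>|M. (\<Prod>i\<in>B. slope N (\<lambda>r. \<omega> r $ \<gamma> i) (x i)))" for B
  have c2: "c {i, j} = of_bool (\<gamma> i = \<gamma> j) * rhoN N (x i) (x j)" if "i \<noteq> j" for i j
  proof -
    have "c {i, j} = (LINT \<omega>|M. (\<omega> (?q i) $ \<gamma> i - \<omega> (?p i) $ \<gamma> i) * (\<omega> (?q j) $ \<gamma> j - \<omega> (?p j) $ \<gamma> j) / (h N)\<^sup>2)"
      unfolding c_def using that by (simp add: slope_def power2_eq_square)
    also have "\<dots> = of_bool (\<gamma> i = \<gamma> j) * (R (?q i) (?q j) - R (?q i) (?p j) - R (?p i) (?q j) + R (?p i) (?p j)) / (h N)\<^sup>2"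
      by (simp only: integral_divide_zero increment_covariance(1)[OF pq(1) pq(2) pq(1) pq(2)])
    also have "\<dots> = of_bool (\<gamma> i = \<gamma> j) * rhoN N (x i) (x j)"
      unfolding rhoN_rect rect_def by simp
    finally show ?thesis .
  qed
  have "(LINT \<omega>|M. (\<Prod>i\<in>{1..n}. slope N (\<lambda>r. \<omega> r $ \<gamma> i) (x i))) = (\<Sum>P\<in>pairings n. \<Prod>B\<in>P. c B)"
    unfolding c_def slope_def by (rule w(2))
  also have "\<dots> = (\<Sum>P\<in>pairings n. matching \<gamma> P *
        ((\<Prod>(i, j)\<in>nc_pairs P. rhoN N (x i) (x j)) * (\<Prod>k\<in>c_tops P. rhoN N (x (k - 1)) (x k))))"
  proof (rule sum.cong[OF refl])
    fix P assume P: "P \<in> pairings n"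
    interpret pair_struct n "nc_pairs P" "c_tops P" by (rule pair_struct_of_pairing[OF P])
    have 1: "(\<Prod>(i, j)\<in>nc_pairs P. c {i, j}) = (\<Prod>(i, j)\<in>nc_pairs P. of_bool (\<gamma> i = \<gamma> j) * rhoN N (x i) (x j))"
    proof (rule prod.cong[OF refl])
      fix p assume p: "p \<in> nc_pairs P"
      obtain i j where ij: "p = (i, j)" by (cases p)
      have "i \<noteq> j" using E_range[of i j] p unfolding ij by simp
      then show "(case p of (i, j) \<Rightarrow> c {i, j}) = (case p of (i, j) \<Rightarrow> of_bool (\<gamma> i = \<gamma> j) * rhoN N (x i) (x j))"
        unfolding ij by (simp add: c2)
    qed
    have 2: "(\<Prod>k\<in>c_tops P. c {k - 1, k}) = (\<Prod>k\<in>c_tops P. of_bool (\<gamma> (k - 1) = \<gamma> k) * rhoN N (x (k - 1)) (x k))"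
    proof (rule prod.cong[OF refl])
      fix k assume "k \<in> c_tops P"
      from Kc_range[OF this] have "k - 1 \<noteq> k" by linarith
      then show "c {k - 1, k} = of_bool (\<gamma> (k - 1) = \<gamma> k) * rhoN N (x (k - 1)) (x k)" by (rule c2)
    qed
    show "(\<Prod>B\<in>P. c B) = matching \<gamma> P *
        ((\<Prod>(i, j)\<in>nc_pairs P. rhoN N (x i) (x j)) * (\<Prod>k\<in>c_tops P. rhoN N (x (k - 1)) (x k)))"
      unfolding prod_pairing[OF P] 1 2 matching_def
      by (simp only: case_prod_unfold prod.distrib mult.assoc mult.left_commute)
  qed
  finally show "(LINT \<omega>|M. (\<Prod>i\<in>{1..n}. slope N (\<lambda>r. \<omega> r $ \<gamma> i) (x i))) =
      (\<Sum>P\<in>pairings n. matching \<gamma> P *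
        ((\<Prod>(i, j)\<in>nc_pairs P. rhoN N (x i) (x j)) * (\<Prod>k\<in>c_tops P. rhoN N (x (k - 1)) (x k))))" .
qed

lemma iter_int_grid:
  assumes cov: "cov_bounds s t R T H' C"
  shows "iter_int (pl_interp (grid s t T N) \<omega>) \<gamma> s n t = (LINT x|PiM {1..n} (\<lambda>_. lborel).
      indicator (osimplex s t n {1..n}) x * (\<Prod>i\<in>{1..n}. interval.slope s t N (\<lambda>r. \<omega> r $ \<gamma> i) (x i)))"
proof -
  interpret cov_bounds s t R T H' C by fact
  define L where "L = (\<Sum>\<alpha>\<in>UNIV. \<Sum>k\<le>N. \<bar>(\<omega> (node N (Suc k)) $ \<alpha> - \<omega> (node N k) $ \<alpha>) / h N\<bar>)"
  let ?y = "\<lambda>\<alpha>. slope N (\<lambda>r. \<omega> r $ \<alpha>)"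
  have bd: "\<bar>?y \<alpha> x\<bar> \<le> L" for \<alpha> x
  proof -
    have "\<bar>?y \<alpha> x\<bar> \<le> (\<Sum>k\<le>N. \<bar>(\<omega> (node N (Suc k)) $ \<alpha> - \<omega> (node N k) $ \<alpha>) / h N\<bar>)" by (rule slope_bound)
    also have "\<dots> \<le> L" unfolding L_def by (rule member_le_sum) (auto intro: sum_nonneg)
    finally show ?thesis .
  qed
  have dens: "(?y \<alpha> has_integral (pl_interp (grid s t T N) \<omega> b $ \<alpha> - pl_interp (grid s t T N) \<omega> a $ \<alpha>)) {a..b}"
    if "s \<le> a" "a \<le> b" "b \<le> t" for \<alpha> a b
  proof -
    have ab: "a \<le> t" "s \<le> b" using that by linarith+
    show ?thesis
      unfolding pl_interp_grid[OF s0 tT that(1) ab(1)] pl_interp_grid[OF s0 tT ab(2) that(3)]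
      by (rule slope_has_integral[OF that])
  qed
  have "iter_int (pl_interp (grid s t T N) \<omega>) \<gamma> s n t = nested_int (\<lambda>i. ?y (\<gamma> i)) s n t"
    by (rule iter_int_eq_nested_int[OF measurable_slope bd dens less_imp_le[OF st] order_refl])
  also have "\<dots> = (LINT x|PiM {1..n} (\<lambda>_. lborel).
      indicator (osimplex s t n {1..n}) x * (\<Prod>i\<in>{1..n}. ?y (\<gamma> i) (x i)))"
    by (rule nested_int_eq_simplex[OF measurable_slope bd st])
  finally show ?thesis .
qed

text \<open>The product of slopes is a finite sum, over assignments of the variables to cells, of a
  function of time alone times a function of the path alone. Expectation and simplex integral then
  commute by linearity, with no appeal to Fubini on the path space.\<close>

lemma grid_expectation:
  assumes cov: "cov_bounds s t R T H' C"
  shows "integrable M (\<lambda>\<omega>. iter_int (pl_interp (grid s t T N) \<omega>) \<gamma> s n t)"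
    and "(LINT \<omega>|M. iter_int (pl_interp (grid s t T N) \<omega>) \<gamma> s n t) =
      (LINT x|PiM {1..n} (\<lambda>_. lborel). indicator (osimplex s t n {1..n}) x *
         (LINT \<omega>|M. (\<Prod>i\<in>{1..n}. interval.slope s t N (\<lambda>r. \<omega> r $ \<gamma> i) (x i))))"
proof -
  interpret cov_bounds s t R T H' C by fact
  define K where "K = PiE {1..n} (\<lambda>_. {..N})"
  define w where "w \<kappa> x = (\<Prod>i\<in>{1..n}. of_bool (cell N (x i) = \<kappa> i) :: real)" for \<kappa> :: "nat \<Rightarrow> nat" and x
  define D where "D \<kappa> \<omega> = (\<Prod>i\<in>{1..n}. slope N (\<lambda>r. \<omega> r $ \<gamma> i) (node N (\<kappa> i)))" for \<kappa> :: "nat \<Rightarrow> nat" and \<omega>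
  let ?L = "PiM {1..n} (\<lambda>_. lborel) :: (nat \<Rightarrow> real) measure"
  let ?ind = "\<lambda>x. indicator (osimplex s t n {1..n}) x :: real"
  have fK: "finite K" unfolding K_def by (intro finite_PiE) auto
  have cell_node: "cell N (node N k) = k" if "k \<le> N" for k
    using cell_eqI[OF that, of "node N k"] h_pos[of N] by (simp add: node_Suc)
  have expand: "(\<Prod>i\<in>{1..n}. slope N (\<lambda>r. \<omega> r $ \<gamma> i) (x i)) = (\<Sum>\<kappa>\<in>K. w \<kappa> x * D \<kappa> \<omega>)" for \<omega> x
  proof -
    have "slope N (\<lambda>r. \<omega> r $ \<gamma> i) (x i) = (\<Sum>k\<le>N. of_bool (cell N (x i) = k) * slope N (\<lambda>r. \<omega> r $ \<gamma> i) (node N k))" for i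
      unfolding slope_sum[of N _ "x i"] by (rule sum.cong) (simp_all add: slope_def cell_node)
    then have "(\<Prod>i\<in>{1..n}. slope N (\<lambda>r. \<omega> r $ \<gamma> i) (x i)) =
        (\<Prod>i\<in>{1..n}. \<Sum>k\<le>N. of_bool (cell N (x i) = k) * slope N (\<lambda>r. \<omega> r $ \<gamma> i) (node N k))"
      by (rule prod.cong[OF refl])
    also have "\<dots> = (\<Sum>\<kappa>\<in>K. \<Prod>i\<in>{1..n}. of_bool (cell N (x i) = \<kappa> i) * slope N (\<lambda>r. \<omega> r $ \<gamma> i) (node N (\<kappa> i)))"
      unfolding K_def by (rule prod_sum_PiE) auto
    finally show ?thesis unfolding w_def D_def prod.distrib .
  qed
  have Di: "integrable M (D \<kappa>)" for \<kappa> unfolding D_def by (rule slope_moments(1)[OF cov])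
  have wi: "integrable ?L (\<lambda>x. ?ind x * w \<kappa> x)" for \<kappa>
  proof (rule integrable_simplex_bounded[where C = 1])
    have "(\<lambda>x. of_bool (cell N (x i) = \<kappa> i) :: real) \<in> borel_measurable ?L" if "i \<in> {1..n}" for i
    proof -
      have "(\<lambda>v. (\<lambda>k. of_bool (k = \<kappa> i) :: real) (cell N v)) \<in> borel_measurable lborel"
        using measurable_compose[OF measurable_cell, of "\<lambda>k. of_bool (k = \<kappa> i) :: real" borel N]
        by (simp add: comp_def)
      from measurable_compose[OF measurable_component_singleton[OF that] this] show ?thesis by simp
    qed
    then show "w \<kappa> \<in> borel_measurable ?L" unfolding w_def by (rule borel_measurable_prod)
    show "\<bar>w \<kappa> x\<bar> \<le> 1" for x unfolding w_def abs_prod by (rule prod_le_1) simp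
  qed simp
  have J: "iter_int (pl_interp (grid s t T N) \<omega>) \<gamma> s n t = (\<Sum>\<kappa>\<in>K. (LINT x|?L. ?ind x * w \<kappa> x) * D \<kappa> \<omega>)" for \<omega>
  proof -
    have "?ind x * (\<Sum>\<kappa>\<in>K. w \<kappa> x * D \<kappa> \<omega>) = (\<Sum>\<kappa>\<in>K. (?ind x * w \<kappa> x) * D \<kappa> \<omega>)" for x
      by (simp only: sum_distrib_left mult.assoc)
    then show ?thesis
      unfolding iter_int_grid[OF cov] expand using wi by (simp only: integral_mult_left_zero
        Bochner_Integration.integral_sum integrable_mult_left)
  qed
  show "integrable M (\<lambda>\<omega>. iter_int (pl_interp (grid s t T N) \<omega>) \<gamma> s n t)"
    unfolding J by (intro Bochner_Integration.integrable_sum integrable_mult_right Di)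
  have E: "(LINT \<omega>|M. (\<Prod>i\<in>{1..n}. slope N (\<lambda>r. \<omega> r $ \<gamma> i) (x i))) = (\<Sum>\<kappa>\<in>K. w \<kappa> x * (LINT \<omega>|M. D \<kappa> \<omega>))" for x
    unfolding expand using Di by (simp only: integral_mult_right_zero
        Bochner_Integration.integral_sum integrable_mult_right)
  have "?ind x * (\<Sum>\<kappa>\<in>K. w \<kappa> x * (LINT \<omega>|M. D \<kappa> \<omega>)) = (\<Sum>\<kappa>\<in>K. (?ind x * w \<kappa> x) * (LINT \<omega>|M. D \<kappa> \<omega>))" for x
    by (simp only: sum_distrib_left mult.assoc)
  then have "(LINT x|?L. ?ind x * (\<Sum>\<kappa>\<in>K. w \<kappa> x * (LINT \<omega>|M. D \<kappa> \<omega>))) =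
      (\<Sum>\<kappa>\<in>K. (LINT x|?L. ?ind x * w \<kappa> x) * (LINT \<omega>|M. D \<kappa> \<omega>))"
    using wi by (simp only: integral_mult_left_zero Bochner_Integration.integral_sum integrable_mult_left)
  moreover have "(LINT \<omega>|M. iter_int (pl_interp (grid s t T N) \<omega>) \<gamma> s n t) =
      (\<Sum>\<kappa>\<in>K. (LINT x|?L. ?ind x * w \<kappa> x) * (LINT \<omega>|M. D \<kappa> \<omega>))"
    unfolding J using Di by (simp only: integral_mult_right_zero
        Bochner_Integration.integral_sum integrable_mult_right)
  ultimately show "(LINT \<omega>|M. iter_int (pl_interp (grid s t T N) \<omega>) \<gamma> s n t) =
      (LINT x|PiM {1..n} (\<lambda>_. lborel). ?ind x * (LINT \<omega>|M. (\<Prod>i\<in>{1..n}. slope N (\<lambda>r. \<omega> r $ \<gamma> i) (x i))))"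
    unfolding E by simp
qed

lemma grid_expectation_limit:
  assumes cov: "cov_bounds s t R T H' C"
  shows "(\<lambda>N. LINT \<omega>|M. iter_int (pl_interp (grid s t T N) \<omega>) \<gamma> s n t) \<longlonglongrightarrow>
    (\<Sum>P\<in>pairings n. pairing_integral R n \<gamma> s t P)"
proof -
  interpret cov_bounds s t R T H' C by fact
  define F where "F P N u = (\<Prod>(i, j)\<in>nc_pairs P. rhoN N (u i) (u j)) * (\<Prod>k\<in>c_tops P. rhoN N (u (k - 1)) (u k))"
    for P N and u :: "nat \<Rightarrow> real"
  let ?L = "PiM {1..n} (\<lambda>_. lborel) :: (nat \<Rightarrow> real) measure"
  let ?ind = "\<lambda>x. indicator (osimplex s t n {1..n}) x :: real"
  note a = pairing_approximation[of _ n, folded F_def]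
  have "(LINT \<omega>|M. iter_int (pl_interp (grid s t T N) \<omega>) \<gamma> s n t) =
      (\<Sum>P\<in>pairings n. matching \<gamma> P * (LINT u|?L. ?ind u * F P N u))" for N
  proof -
    have "?ind x * (\<Sum>P\<in>pairings n. matching \<gamma> P * F P N x) = (\<Sum>P\<in>pairings n. matching \<gamma> P * (?ind x * F P N x))" for x
      by (simp only: sum_distrib_left mult.left_commute)
    then show ?thesis
      unfolding grid_expectation(2)[OF cov] slope_moments(2)[OF cov] F_def[symmetric]
      using a(1) by (simp add: Bochner_Integration.integral_sum)
  qed
  moreover have "(\<lambda>N. \<Sum>P\<in>pairings n. matching \<gamma> P * (LINT u|?L. ?ind u * F P N u)) \<longlonglongrightarrow>
      (\<Sum>P\<in>pairings n. pairing_integral R n \<gamma> s t P)"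
    by (intro tendsto_sum a(2))
  ultimately show ?thesis by simp
qed

end

text \<open>Holds for every path: both sides are 1 for \<open>n = 0\<close>. Otherwise the Stieltjes
  integral over a point is 0, and \<open>n\<close> is a kept index with no admissible value, so each
  domain of integration is empty.\<close>

lemma degenerate_interval:
  "iter_int Y \<gamma> s n s = (\<Sum>P\<in>pairings n. pairing_integral R n \<gamma> s s P)"
proof (cases n)
  case 0
  have "pairings 0 = {{}}" by (auto simp: pairings_def partition_on_def)
  moreover have "pairing_integral R 0 \<gamma> s s {} = 1"
    by (simp add: pairing_integral_def kept_indices_def pairing_integrand_def set_lebesgue_integral_def
        PiM_empty lebesgue_integral_count_space_finite strict_mono_on_def)
  ultimately show ?thesis by (simp add: 0)
next
  case (Suc m)
  have "pairing_integral R n \<gamma> s s P = 0" if P: "P \<in> pairings n" for P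
  proof -
    have "n \<in> kept_indices n P"
      using pairing_range[OF P, of "{n, Suc n}"] Suc by (auto simp: kept_indices_def)
    then have "kept_indices n P \<rightarrow>\<^sub>E {s<..<s} = {}" by (auto simp: PiE_eq_empty_iff)
    then show ?thesis by (simp add: pairing_integral_def set_lebesgue_integral_def)
  qed
  then show ?thesis by (simp add: Suc RS_integral_eqI[OF has_RS_integral_refl])
qed

theorem corollary2p4:
  fixes M :: "(real \<Rightarrow> real ^ 'd) measure"
    and T H s t :: real
    and R :: "real \<Rightarrow> real \<Rightarrow> real"
    and n :: nat and \<gamma> :: "nat \<Rightarrow> 'd"
    and S :: "(real \<Rightarrow> real ^ 'd) \<Rightarrow> real"
  assumes "gaussian_setting M T H R"
    and "1 / 4 < H" and "H < 1"
    and "0 \<le> s" and "s \<le> t" and "t \<le> T"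
    and "is_signature M T n \<gamma> s t S"
  shows "(LINT \<omega>|M. S \<omega>) = (\<Sum>P\<in>pairings n. pairing_integral R n \<gamma> s t P)"
proof -
  interpret gaussian_setting M T H R by fact
  note grid = grid_vanishing[OF assms(4-6) T_pos]
  show ?thesis
  proof (cases "s = t")
    \<comment> \<open>\<open>cov_bounds\<close> requires \<open>s < t\<close>, so this case is
      settled path by path.\<close>
    case True
    show ?thesis
    proof (rule expectation_of_signature[OF prob_space_axioms assms(7) grid])
      show "integrable M (\<lambda>\<omega>. iter_int (pl_interp (grid s t T N) \<omega>) \<gamma> s n t)" for N
        unfolding True degenerate_interval[where R = R] by simp
      show "(\<lambda>N. LINT \<omega>|M. iter_int (pl_interp (grid s t T N) \<omega>) \<gamma> s n t) \<longlonglongrightarrow>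
          (\<Sum>P\<in>pairings n. pairing_integral R n \<gamma> s t P)"
        unfolding True degenerate_interval[where R = R] by (simp add: prob_space)
    qed
  next
    case False
    then obtain H' C where "cov_bounds s t R T H' C"
      using cov_bounds_exists[OF assms(2,4) _ assms(6)] assms(5) by auto
    note cov = this
    show ?thesis
      by (rule expectation_of_signature[OF prob_space_axioms assms(7) grid
            grid_expectation(1)[OF cov] grid_expectation_limit[OF cov]])
  qed
qed

end
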